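(* Suppose that the kernel $\kappa$ satisfies Assumption A and Assumption B (see context), and let $u$ be the solution of the hyperbolic Anderson model driven by the Lévy colored noise $X$ (see context). Then for any $t>0$ the strictly stationary process $\{u(t,x)\}_{x\in\mathbb{R}}$ is ergodic. Consequently, with $F_R(t)=\int_{-R}^{R}\big(u(t,x)-1\big)dx$, $$\frac1R F_R(t)\to 0\quad\text{a.s. and in } L^2(\Omega),\quad\text{as } R\to\infty .$$
   Context: **Noise.** $\mathbb{R}_0=\mathbb{R}\setminus\{0\}$ with distance $d(x,y)=|x^{-1}-y^{-1}|$ (so bounded sets are those bounded away from $0$). $\nu$ is a measure on $\mathbb{R}_0$ with $m_2:=\int_{\mathbb{R}_0}|z|^2\nu(dz)<\infty$. $N$ is a Poisson random measure on $\mathbf{Z}=\mathbb{R}_+\times\mathbb{R}\times\mathbb{R}_0$ with intensity $\mathfrak{m}(dt,dx,dz)=dt\,dx\,\nu(dz)$ on a complete probability space $(\Omega,\mathcal{F},\mathbb{P})$, and $\widehat N=N-\mathfrak{m}$. $\mathcal{F}_t$ is the $\sigma$-field generated by $N([0,s]\times A\times B)$, $s\le t$, $A\subset\mathbb{R}$ and $B\subset\mathbb{R}_0$ bounded Borel, and the $\mathbb{P}$-null sets. A process indexed by $\mathbb{R}_+\times\mathbb{R}$ is predictable if it is measurable with respect to the $\sigma$-field generated by the elementary processes $Y1_{(a,b]}(t)1_A(x)$, $0\le a<b$, $A$ bounded Borel, $Y$ $\mathcal{F}_a$-measurable. The Lévy white noise is $L(\varphi)=\int_{\mathbf{Z}}\varphi(t,x)z\,\widehat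 N(dt,dx,dz)$, $\varphi\in L^2(\mathbb{R}_+\times\mathbb{R})$, with $L_t(\varphi)=L(1_{[0,t]}\varphi)$. The Lévy colored noise is $X_t(\varphi)=L_t(\varphi*\kappa)$, $\varphi\in\mathcal{S}(\mathbb{R})$. **Assumption A.** $\kappa:\mathbb{R}\to[0,\infty]$ is continuous, symmetric and tempered (a measurable function $g$ is tempered if $\int|g(x)|(1+|x|^2)^{-k}dx<\infty$ for some $k>0$), and: (a) its Fourier transform in $\mathcal{S}'(\mathbb{R})$ is a tempered non-negative function $h$, with $h^2$ tempered; (b) $f=\kappa*\tilde\kappa$, $\tilde\kappa(x)=\kappa(-x)$, is a continuous, symmetric, tempered function (with Fourier transform $h^2$); (c) $\kappa(x)<\infty$ and $f(x)<\infty$ for all $x\ne0$. **Assumption B.** Either (i) $\kappa\in L^1(\mathbb{R})$; or (ii) $\kappa=R_{1,\alpha/2}$ for some $\alpha\in(0,1)$, where for $a\in(0,1)$, $R_{1,a}(x)=C_{1,a}|x|^{-(1-a)}$ is the Riesz kernel, $C_{1,a}=\pi^{-1/2}2^{-a}\Gamma(\frac{1-a}{2})/\Gamma(\frac a2)$. **Integral with respect to $X$.** $\int\int g\,dX$ is Walsh's integral with respect to the martingale measure induced by $X$; for predictable $g$ with $\mathbb{E}\int_0^T\int_{\mathbb{R}^2}|g(s,x)g(s,y)|f(x-y)\,dx\,dy\,ds<\infty$ and $t\le T$, $\int_0^t\int_{\mathbb{R}}g(s,x)X(ds,dx)=\int_0^t\int_{\mathbb{R}}\int_{\mathbb{R}_0}(g(s,\cdot)*\kappa)(x)\,z\,\widehat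 N(ds,dx,dz)$. **Equation.** The hyperbolic Anderson model is $\partial_t^2u=\partial_x^2u+u\dot X$, $t>0$, $x\in\mathbb{R}$, $u(0,x)=1$, $\partial_tu(0,x)=0$. With $G_t(x)=\frac12 1_{\{|x|<t\}}$, a (mild) solution is a predictable process $u$ satisfying $u(t,x)=1+\int_0^t\int_{\mathbb{R}}G_{t-s}(x-y)u(s,y)X(ds,dy)$. It is known that there is a unique solution $u$; it satisfies $\sup_{[0,T]\times\mathbb{R}}\mathbb{E}|u(t,x)|^2<\infty$ for all $T>0$, and $\{u(t,x)\}_{x\in\mathbb{R}}$ is strictly stationary for each $t>0$. *)

theory Defs
  imports "HOL-Probability.Probability"
begin

definition dist_R0 :: "real \<Rightarrow> real \<Rightarrow> real" where
  "dist_R0 x y = \<bar>inverse x - inverse y\<bar>"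

definition bounded_R0 :: "real set \<Rightarrow> bool" where
  "bounded_R0 B \<longleftrightarrow> (\<exists>C. \<forall>x\<in>B. \<forall>y\<in>B. dist_R0 x y \<le> C)"

definition borel_R0 :: "real measure" where
  "borel_R0 = restrict_space borel (- {0})"

text \<open>The intensity \<open>dt dx \<nu>(dz)\<close>; points of its space are the triples \<open>(t, x, z)\<close> with
  \<open>t \<ge> 0\<close> and \<open>z \<noteq> 0\<close>.\<close>

definition intensity :: "real measure \<Rightarrow> (real \<times> real \<times> real) measure" where
  "intensity \<nu> = restrict_space lborel {0..} \<Otimes>\<^sub>M (lborel \<Otimes>\<^sub>M \<nu>)"

text \<open>The Poisson probabilities are written out because \<^const>\<open>poisson_pmf\<close> is unspecified at rate
  \<open>0\<close>, which occurs for null sets \<open>A\<close>.\<close>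

definition poisson_random_measure ::
    "'w measure \<Rightarrow> 'z measure \<Rightarrow> ('w \<Rightarrow> 'z measure) \<Rightarrow> bool" where
  "poisson_random_measure M \<mu> N \<longleftrightarrow>
     (\<forall>\<omega>\<in>space M. sets (N \<omega>) = sets \<mu>) \<and>
     (\<forall>A\<in>sets \<mu>. (\<lambda>\<omega>. emeasure (N \<omega>) A) \<in> borel_measurable M) \<and>
     (\<forall>A\<in>sets \<mu>. emeasure \<mu> A < \<infinity> \<longrightarrow>
        (\<forall>k::nat. measure M {\<omega>\<in>space M. emeasure (N \<omega>) A = of_nat k}
                  = measure \<mu> A ^ k / fact k * exp (- measure \<mu> A))) \<and>
     (\<forall>A\<in>sets \<mu>. emeasure \<mu> A = \<infinity> \<longrightarrow> (AE \<omega> in M. emeasure (N \<omega>) A = \<infinity>)) \<and>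
     (\<forall>\<A>\<subseteq>sets \<mu>. finite \<A> \<and> disjoint \<A> \<longrightarrow>
        prob_space.indep_vars M (\<lambda>_. borel) (\<lambda>A \<omega>. emeasure (N \<omega>) A) \<A>)"

text \<open>For \<open>\<Phi> \<in> L\<^sup>2(\<mu>)\<close>, \<open>\<integral>\<Phi> d(N - \<mu>)\<close> is the limit in \<open>L\<^sup>2(\<Omega>)\<close> of the pathwise integrals of
  integrable simple functions converging to \<open>\<Phi>\<close> in \<open>L\<^sup>2(\<mu>)\<close>. The isometry makes the value
  unique up to null sets, so the integral is stated as a relation between \<open>\<Phi>\<close> and a random variable.\<close>

definition compensated_integral ::
    "('w \<Rightarrow> 'z measure) \<Rightarrow> 'z measure \<Rightarrow> ('z \<Rightarrow> real) \<Rightarrow> 'w \<Rightarrow> real" where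
  "compensated_integral N \<mu> \<Phi> \<omega> = (\<integral>p. \<Phi> p \<partial>N \<omega>) - (\<integral>p. \<Phi> p \<partial>\<mu>)"

definition has_compensated_integral ::
    "'w measure \<Rightarrow> ('w \<Rightarrow> 'z measure) \<Rightarrow> 'z measure \<Rightarrow> ('z \<Rightarrow> real) \<Rightarrow> ('w \<Rightarrow> real) \<Rightarrow> bool" where
  "has_compensated_integral M N \<mu> \<Phi> I \<longleftrightarrow>
     \<Phi> \<in> borel_measurable \<mu> \<and> (\<integral>\<^sup>+p. ennreal ((\<Phi> p)\<^sup>2) \<partial>\<mu>) < \<infinity> \<and>
     I \<in> borel_measurable M \<and>
     (\<exists>S. (\<forall>n::nat. simple_function \<mu> (S n) \<and> integrable \<mu> (S n)) \<and>
          (\<lambda>n. \<integral>\<^sup>+p. ennreal ((S n p - \<Phi> p)\<^sup>2) \<partial>\<mu>) \<longlonglongrightarrow> 0 \<and>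
          (\<lambda>n. \<integral>\<^sup>+\<omega>. ennreal ((compensated_integral N \<mu> (S n) \<omega> - I \<omega>)\<^sup>2) \<partial>M) \<longlonglongrightarrow> 0)"

definition noise_filtration ::
    "'w measure \<Rightarrow> ('w \<Rightarrow> (real \<times> real \<times> real) measure) \<Rightarrow> real \<Rightarrow> 'w measure" where
  "noise_filtration M N t = sigma (space M)
     ({{\<omega>\<in>space M. emeasure (N \<omega>) ({0..s} \<times> A \<times> B) \<in> C} | s A B C.
         0 \<le> s \<and> s \<le> t \<and> A \<in> sets borel \<and> bounded A \<and>
         B \<in> sets borel_R0 \<and> bounded_R0 B \<and> C \<in> sets borel}
      \<union> null_sets M)"

text \<open>A process indexed by \<open>\<real>\<^sub>+ \<times> \<real>\<close> is a function \<open>u t x \<omega>\<close>, of which only the values for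
  \<open>t \<ge> 0\<close> and \<open>\<omega> \<in> space M\<close> matter.\<close>

definition elementary_process ::
    "('w \<Rightarrow> real) \<Rightarrow> real \<Rightarrow> real \<Rightarrow> real set \<Rightarrow> real \<Rightarrow> real \<Rightarrow> 'w \<Rightarrow> real" where
  "elementary_process Y a b A t x \<omega> = Y \<omega> * indicator {a<..b} t * indicator A x"

definition elementary_data ::
    "'w measure \<Rightarrow> ('w \<Rightarrow> (real \<times> real \<times> real) measure) \<Rightarrow>
     ('w \<Rightarrow> real) \<Rightarrow> real \<Rightarrow> real \<Rightarrow> real set \<Rightarrow> bool" where
  "elementary_data M N Y a b A \<longleftrightarrow>
     0 \<le> a \<and> a < b \<and> A \<in> sets borel \<and> bounded A \<and> Y \<in> borel_measurable (noise_filtration M N a)"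

definition predictable_sigma ::
    "'w measure \<Rightarrow> ('w \<Rightarrow> (real \<times> real \<times> real) measure) \<Rightarrow> ('w \<times> real \<times> real) measure" where
  "predictable_sigma M N = sigma (space M \<times> {0..} \<times> UNIV)
     {{(\<omega>, t, x) \<in> space M \<times> {0..} \<times> UNIV. elementary_process Y a b A t x \<omega> \<in> C} | Y a b A C.
        elementary_data M N Y a b A \<and> C \<in> sets borel}"

definition predictable ::
    "'w measure \<Rightarrow> ('w \<Rightarrow> (real \<times> real \<times> real) measure) \<Rightarrow>
     (real \<Rightarrow> real \<Rightarrow> 'w \<Rightarrow> real) \<Rightarrow> bool" where
  "predictable M N g \<longleftrightarrow> (\<lambda>(\<omega>, t, x). g t x \<omega>) \<in> borel_measurable (predictable_sigma M N)"

definition tempered :: "(real \<Rightarrow> ennreal) \<Rightarrow> bool" where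
  "tempered g \<longleftrightarrow> g \<in> borel_measurable borel \<and>
     (\<exists>k>0. (\<integral>\<^sup>+x. g x * ennreal ((1 + x\<^sup>2) powr (- k)) \<partial>lborel) < \<infinity>)"

definition schwartz :: "(real \<Rightarrow> complex) \<Rightarrow> bool" where
  "schwartz \<phi> \<longleftrightarrow> (\<exists>D :: nat \<Rightarrow> real \<Rightarrow> complex. D 0 = \<phi> \<and>
     (\<forall>n x. (D n has_vector_derivative D (Suc n) x) (at x)) \<and>
     (\<forall>n k. bounded (range (\<lambda>x. x ^ k *\<^sub>R D n x))))"

definition fourier :: "(real \<Rightarrow> complex) \<Rightarrow> real \<Rightarrow> complex" where
  "fourier \<phi> \<xi> = (\<integral>x. cis (- (\<xi> * x)) * \<phi> x \<partial>lborel)"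

text \<open>The function \<open>h\<close> is the Fourier transform of the function \<open>g\<close> in \<open>\<S>'(\<real>)\<close>. Both are meant to be
  tempered and \<open>g\<close> finite almost everywhere, so that the integrals converge and \<^const>\<open>enn2real\<close> only
  alters \<open>g\<close> on a null set.\<close>

definition distributional_fourier :: "(real \<Rightarrow> ennreal) \<Rightarrow> (real \<Rightarrow> real) \<Rightarrow> bool" where
  "distributional_fourier g h \<longleftrightarrow> (\<forall>\<phi>. schwartz \<phi> \<longrightarrow>
     (\<integral>x. complex_of_real (enn2real (g x)) * fourier \<phi> x \<partial>lborel)
     = (\<integral>\<xi>. complex_of_real (h \<xi>) * \<phi> \<xi> \<partial>lborel))"

text \<open>\<open>\<kappa> * \<kappa>~\<close> with \<open>\<kappa>~(x) = \<kappa>(-x)\<close>.\<close>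

definition autoconv :: "(real \<Rightarrow> ennreal) \<Rightarrow> real \<Rightarrow> ennreal" where
  "autoconv \<kappa> x = (\<integral>\<^sup>+y. \<kappa> y * \<kappa> (- (x - y)) \<partial>lborel)"

definition assumption_A :: "(real \<Rightarrow> ennreal) \<Rightarrow> bool" where
  "assumption_A \<kappa> \<longleftrightarrow>
     continuous_on UNIV \<kappa> \<and> (\<forall>x. \<kappa> (- x) = \<kappa> x) \<and> tempered \<kappa> \<and>
     (\<exists>h. h \<in> borel_measurable borel \<and> (\<forall>\<xi>. 0 \<le> h \<xi>) \<and>
          tempered (\<lambda>\<xi>. ennreal (h \<xi>)) \<and> tempered (\<lambda>\<xi>. ennreal ((h \<xi>)\<^sup>2)) \<and>
          distributional_fourier \<kappa> h \<and>
          distributional_fourier (autoconv \<kappa>) (\<lambda>\<xi>. (h \<xi>)\<^sup>2)) \<and>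
     continuous_on UNIV (autoconv \<kappa>) \<and> (\<forall>x. autoconv \<kappa> (- x) = autoconv \<kappa> x) \<and>
     tempered (autoconv \<kappa>) \<and>
     (\<forall>x. x \<noteq> 0 \<longrightarrow> \<kappa> x < \<infinity> \<and> autoconv \<kappa> x < \<infinity>)"

definition riesz_const :: "real \<Rightarrow> real" where
  "riesz_const a = pi powr (- 1 / 2) * 2 powr (- a) * Gamma ((1 - a) / 2) / Gamma (a / 2)"

text \<open>Division in \<^typ>\<open>ennreal\<close> gives \<open>riesz_kernel a 0 = \<infinity>\<close> for \<open>0 < a < 1\<close>.\<close>

definition riesz_kernel :: "real \<Rightarrow> real \<Rightarrow> ennreal" where
  "riesz_kernel a x = ennreal (riesz_const a) / ennreal (\<bar>x\<bar> powr (1 - a))"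

definition assumption_B :: "(real \<Rightarrow> ennreal) \<Rightarrow> bool" where
  "assumption_B \<kappa> \<longleftrightarrow>
     (\<kappa> \<in> borel_measurable borel \<and> (\<integral>\<^sup>+x. \<kappa> x \<partial>lborel) < \<infinity>) \<or>
     (\<exists>\<alpha>. 0 < \<alpha> \<and> \<alpha> < 1 \<and> \<kappa> = riesz_kernel (\<alpha> / 2))"

text \<open>\<open>L(\<phi>)\<close> is determined up to null sets; an arbitrary version is chosen.\<close>

definition levy_white_noise ::
    "'w measure \<Rightarrow> real measure \<Rightarrow> ('w \<Rightarrow> (real \<times> real \<times> real) measure) \<Rightarrow>
     (real \<Rightarrow> real \<Rightarrow> real) \<Rightarrow> 'w \<Rightarrow> real" where
  "levy_white_noise M \<nu> N \<phi> =
     (SOME I. has_compensated_integral M N (intensity \<nu>) (\<lambda>(t, x, z). \<phi> t x * z) I)"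

definition convolve :: "(real \<Rightarrow> real) \<Rightarrow> (real \<Rightarrow> ennreal) \<Rightarrow> real \<Rightarrow> real" where
  "convolve \<phi> \<kappa> x = (\<integral>y. \<phi> (x - y) * enn2real (\<kappa> y) \<partial>lborel)"

text \<open>\<open>X\<^sub>t(\<phi>) = L\<^sub>t(\<phi> * \<kappa>)\<close>. Besides Schwartz functions, \<open>\<phi>\<close> may be the indicator of a bounded Borel
  set, since \<open>\<phi> * \<kappa> \<in> L\<^sup>2(\<real>)\<close> when \<open>\<kappa> * \<kappa>~\<close> is locally integrable. The values
  \<open>X\<^sub>t(A) = X\<^sub>t(1\<^sub>A)\<close> form the martingale measure induced by \<open>X\<close>.\<close>

definition levy_colored_noise ::
    "'w measure \<Rightarrow> real measure \<Rightarrow> ('w \<Rightarrow> (real \<times> real \<times> real) measure) \<Rightarrow>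
     (real \<Rightarrow> ennreal) \<Rightarrow> real \<Rightarrow> (real \<Rightarrow> real) \<Rightarrow> 'w \<Rightarrow> real" where
  "levy_colored_noise M \<nu> N \<kappa> t \<phi> =
     levy_white_noise M \<nu> N (\<lambda>s x. indicator {0..t} s * convolve \<phi> \<kappa> x)"

text \<open>A simple process is a finite sum of elementary processes with bounded \<open>Y\<close>, represented by the
  list of the data \<open>(Y, a, b, A)\<close> of its summands.\<close>

type_synonym 'w simple_data = "(('w \<Rightarrow> real) \<times> real \<times> real \<times> real set) list"

definition simple_data_ok ::
    "'w measure \<Rightarrow> ('w \<Rightarrow> (real \<times> real \<times> real) measure) \<Rightarrow> 'w simple_data \<Rightarrow> bool" where
  "simple_data_ok M N ps \<longleftrightarrow>
     (\<forall>(Y, a, b, A)\<in>set ps. elementary_data M N Y a b A \<and> bounded (Y ` space M))"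

definition simple_process :: "'w simple_data \<Rightarrow> real \<Rightarrow> real \<Rightarrow> 'w \<Rightarrow> real" where
  "simple_process ps s x \<omega> = (\<Sum>(Y, a, b, A)\<leftarrow>ps. elementary_process Y a b A s x \<omega>)"

definition simple_walsh_integral ::
    "'w measure \<Rightarrow> real measure \<Rightarrow> ('w \<Rightarrow> (real \<times> real \<times> real) measure) \<Rightarrow>
     (real \<Rightarrow> ennreal) \<Rightarrow> real \<Rightarrow> 'w simple_data \<Rightarrow> 'w \<Rightarrow> real" where
  "simple_walsh_integral M \<nu> N \<kappa> t ps \<omega> = (\<Sum>(Y, a, b, A)\<leftarrow>ps. Y \<omega> *
     (levy_colored_noise M \<nu> N \<kappa> (min t b) (indicator A) \<omega>
      - levy_colored_noise M \<nu> N \<kappa> (min t a) (indicator A) \<omega>))"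

text \<open>The square of Walsh's norm on \<open>[0,t]\<close> for the dominating measure \<open>f(x - y) dx dy ds\<close>,
  \<open>f = \<kappa> * \<kappa>~\<close>.\<close>

definition walsh_norm_sq ::
    "'w measure \<Rightarrow> (real \<Rightarrow> ennreal) \<Rightarrow> real \<Rightarrow> (real \<Rightarrow> real \<Rightarrow> 'w \<Rightarrow> real) \<Rightarrow> ennreal" where
  "walsh_norm_sq M \<kappa> t g =
     (\<integral>\<^sup>+\<omega>. (\<integral>\<^sup>+s\<in>{0..t}. (\<integral>\<^sup>+x. (\<integral>\<^sup>+y. ennreal \<bar>g s x \<omega> * g s y \<omega>\<bar> * autoconv \<kappa> (x - y)
       \<partial>lborel) \<partial>lborel) \<partial>lborel) \<partial>M)"

text \<open>\<open>I\<close> is a version of \<open>\<integral>\<^sub>0\<^sup>t\<integral> g dX\<close>. Every elementary process vanishes at time \<open>0\<close>, hence a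
  predictable process is constant there, while \<open>G (t - s) (x - y) * u s y \<omega>\<close> at \<open>s = 0\<close> depends on
  \<open>y\<close>. Predictability is therefore required of the restriction of \<open>g\<close> to \<open>(0,t]\<close>, which has the same
  integral.\<close>

definition has_walsh_integral ::
    "'w measure \<Rightarrow> real measure \<Rightarrow> ('w \<Rightarrow> (real \<times> real \<times> real) measure) \<Rightarrow>
     (real \<Rightarrow> ennreal) \<Rightarrow> real \<Rightarrow> (real \<Rightarrow> real \<Rightarrow> 'w \<Rightarrow> real) \<Rightarrow> ('w \<Rightarrow> real) \<Rightarrow> bool" where
  "has_walsh_integral M \<nu> N \<kappa> t g I \<longleftrightarrow>
     predictable M N (\<lambda>s x \<omega>. indicator {0<..t} s * g s x \<omega>) \<and>
     walsh_norm_sq M \<kappa> t g < \<infinity> \<and>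
     I \<in> borel_measurable M \<and>
     (\<exists>ps. (\<forall>n::nat. simple_data_ok M N (ps n)) \<and>
           (\<lambda>n. walsh_norm_sq M \<kappa> t (\<lambda>s x \<omega>. simple_process (ps n) s x \<omega> - g s x \<omega>)) \<longlonglongrightarrow> 0 \<and>
           (\<lambda>n. \<integral>\<^sup>+\<omega>. ennreal ((simple_walsh_integral M \<nu> N \<kappa> t (ps n) \<omega> - I \<omega>)\<^sup>2) \<partial>M)
             \<longlonglongrightarrow> 0)"

definition wave_kernel :: "real \<Rightarrow> real \<Rightarrow> real" where
  "wave_kernel t x = (if \<bar>x\<bar> < t then 1 / 2 else 0)"

definition mild_solution ::
    "'w measure \<Rightarrow> real measure \<Rightarrow> ('w \<Rightarrow> (real \<times> real \<times> real) measure) \<Rightarrow>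
     (real \<Rightarrow> ennreal) \<Rightarrow> (real \<Rightarrow> real \<Rightarrow> 'w \<Rightarrow> real) \<Rightarrow> bool" where
  "mild_solution M \<nu> N \<kappa> u \<longleftrightarrow> predictable M N u \<and>
     (\<forall>t\<ge>0. \<forall>x. has_walsh_integral M \<nu> N \<kappa> t
        (\<lambda>s y \<omega>. wave_kernel (t - s) (x - y) * u s y \<omega>) (\<lambda>\<omega>. u t x \<omega> - 1))"

definition strictly_stationary :: "'w measure \<Rightarrow> (real \<Rightarrow> 'w \<Rightarrow> real) \<Rightarrow> bool" where
  "strictly_stationary M Y \<longleftrightarrow> (\<forall>x. Y x \<in> borel_measurable M) \<and>
     (\<forall>J h. finite J \<longrightarrow>
        distr M (\<Pi>\<^sub>M x\<in>J. borel) (\<lambda>\<omega>. \<lambda>x\<in>J. Y (x + h) \<omega>)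
        = distr M (\<Pi>\<^sub>M x\<in>J. borel) (\<lambda>\<omega>. \<lambda>x\<in>J. Y x \<omega>))"

text \<open>Invariance has to be understood up to null sets: a set in the product \<open>\<sigma>\<close>-algebra depends on
  countably many coordinates only, so one that is exactly invariant under all real shifts is empty or
  the whole space, and exact invariance would make every process ergodic.\<close>

definition ergodic_process :: "'w measure \<Rightarrow> (real \<Rightarrow> 'w \<Rightarrow> real) \<Rightarrow> bool" where
  "ergodic_process M Y \<longleftrightarrow> strictly_stationary M Y \<and>
     (\<forall>A\<in>sets (\<Pi>\<^sub>M x\<in>(UNIV::real set). (borel :: real measure)).
        (\<forall>h. AE \<omega> in M. (\<lambda>x. Y (x + h) \<omega>) \<in> A \<longleftrightarrow> (\<lambda>x. Y x \<omega>) \<in> A) \<longrightarrow>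
        measure M {\<omega>\<in>space M. (\<lambda>x. Y x \<omega>) \<in> A} \<in> {0, 1})"

definition tendsto_L2 ::
    "'w measure \<Rightarrow> ('i \<Rightarrow> 'w \<Rightarrow> real) \<Rightarrow> ('w \<Rightarrow> real) \<Rightarrow> 'i filter \<Rightarrow> bool" where
  "tendsto_L2 M Z L F \<longleftrightarrow>
     (\<forall>\<^sub>F i in F. Z i \<in> borel_measurable M \<and> integrable M (\<lambda>\<omega>. (Z i \<omega>)\<^sup>2)) \<and>
     L \<in> borel_measurable M \<and> integrable M (\<lambda>\<omega>. (L \<omega>)\<^sup>2) \<and>
     ((\<lambda>i. \<integral>\<omega>. (Z i \<omega> - L \<omega>)\<^sup>2 \<partial>M) \<longlongrightarrow> 0) F"

definition spatial_integral :: "(real \<Rightarrow> real \<Rightarrow> 'w \<Rightarrow> real) \<Rightarrow> real \<Rightarrow> real \<Rightarrow> 'w \<Rightarrow> real" where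
  "spatial_integral u t R \<omega> = (LINT x:{-R..R}|lborel. u t x \<omega> - 1)"

end

theory Submission
  imports Defs
begin

text \<open>Up to null sets \<open>u t x\<close> is a function \<open>y x\<close> of the counts \<open>N([0,s] \<times> A \<times> B)\<close>, \<open>s \<le> t\<close>. Because mild
  solutions are unique, \<open>u t (x + h)\<close> is the same function of the counts of the noise shifted by \<open>h\<close>,
  which has the same law. This gives stationarity, and the counts of bounded boxes become independent
  of those shifted far away, so the shift is mixing on the noise and hence on \<open>u t\<close>.

  For the averages, \<open>\<Sum>j\<in>{-n..<n}. (u t (\<theta> + j) - 1)\<close> is a Walsh integral of \<open>u\<close> against a bounded
  kernel supported in an interval of length \<open>O(n)\<close>, so its second moment is at most a constant times
  \<open>n\<close> times the integral of \<open>\<kappa> * \<kappa>~\<close> over an interval of length \<open>O(n)\<close>, which Assumption B bounds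
  by \<open>n powr b\<close> with \<open>b < 1\<close>. Averaging over \<open>\<theta>\<close> yields \<open>E|F\<^sub>R|\<^sup>2 = O(R powr (1 + b))\<close>, whence the
  convergence in \<open>L\<^sup>2\<close>, and almost surely along a polynomial sequence; between its members the
  oscillation is controlled by \<open>\<integral>|u t x - 1| dx\<close>.\<close>

section \<open>Counts of a Poisson random measure\<close>

text \<open>The probability space carries no shift, so no measure-preserving map is at hand to which
  an ergodic theorem could be applied. The substitute is to evaluate one fixed functional of the
  counts on translated noises that live on the same space. Two obstacles shape this. Stochastic
  integrals are arbitrarily chosen versions and the filtration contains the null sets, so
  factorizations hold only almost surely, and it is the common law of the counts that carries such
  identities from one noise to another. A mild solution comes with no moment bound; the finite Walsh
  norm in its own equation provides one on backward cones, which is enough for uniqueness, and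
  stationarity then spreads it over the line. The spatial integral is never written as a stochastic
  integral. Finite lattice sums are Walsh integrals by linearity alone, and averaging over \<theta>
  replaces a stochastic Fubini theorem. The exponent \<open>b\<close> is \<open>0\<close> for an
  integrable kernel and \<open>\<alpha>\<close> for the Riesz kernel, by scaling.\<close>

definition cnt :: "('w \<Rightarrow> 'z measure) \<Rightarrow> 'z set set \<Rightarrow> 'w \<Rightarrow> 'z set \<Rightarrow> ennreal" where
  "cnt N I \<omega> = (\<lambda>A\<in>I. emeasure (N \<omega>) A)"

abbreviation cnt_space :: "'z set set \<Rightarrow> ('z set \<Rightarrow> ennreal) measure" where
  "cnt_space I \<equiv> \<Pi>\<^sub>M A\<in>I. borel"

lemma cnt_mem_prod_emb:
  assumes "J \<subseteq> I"
  shows "cnt N I \<omega> \<in> prod_emb I (\<lambda>_. borel) J (Pi\<^sub>E J X) \<longleftrightarrow> (\<forall>A\<in>J. emeasure (N \<omega>) A \<in> X A)"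
proof -
  have "restrict (cnt N I \<omega>) J = (\<lambda>A\<in>J. emeasure (N \<omega>) A)"
    using assms by (auto simp: cnt_def fun_eq_iff)
  moreover have "cnt N I \<omega> \<in> extensional I" by (simp add: cnt_def)
  ultimately show ?thesis by (auto simp: prod_emb_def space_PiM PiE_iff)
qed

text \<open>The atoms of the finite algebra generated by \<open>J\<close>. A Poisson random measure
  is specified through independence over disjoint sets only; cutting overlapping sets into atoms
  turns their counts into sums of independent counts.\<close>

definition atom_of :: "'z set \<Rightarrow> 'z set set \<Rightarrow> 'z \<Rightarrow> 'z set" where
  "atom_of S J x = {y\<in>S. \<forall>A\<in>J. y \<in> A \<longleftrightarrow> x \<in> A}"

definition atoms_of :: "'z set \<Rightarrow> 'z set set \<Rightarrow> 'z set set" where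
  "atoms_of S J = atom_of S J ` S"

lemma finite_atoms_of: "finite J \<Longrightarrow> finite (atoms_of S J)"
proof -
  assume J: "finite J"
  have "atoms_of S J \<subseteq> (\<lambda>K. {y\<in>S. \<forall>A\<in>J. y \<in> A \<longleftrightarrow> A \<in> K}) ` Pow J"
  proof
    fix a assume "a \<in> atoms_of S J"
    then obtain x where "a = atom_of S J x" by (auto simp: atoms_of_def)
    then have "a = {y\<in>S. \<forall>A\<in>J. y \<in> A \<longleftrightarrow> A \<in> {A\<in>J. x \<in> A}}"
      by (auto simp: atom_of_def)
    then show "a \<in> (\<lambda>K. {y\<in>S. \<forall>A\<in>J. y \<in> A \<longleftrightarrow> A \<in> K}) ` Pow J" by blast
  qed
  then show ?thesis using J by (meson finite_Pow_iff finite_imageI finite_subset)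
qed

lemma disjoint_atoms_of: "disjoint (atoms_of S J)"
  by (auto simp: disjoint_def atoms_of_def atom_of_def)

lemma atoms_of_nonempty: "{} \<notin> atoms_of S J"
  by (auto simp: atoms_of_def atom_of_def)

lemma Union_atoms_of: "A \<in> J \<Longrightarrow> A \<subseteq> S \<Longrightarrow> \<Union>{a\<in>atoms_of S J. a \<subseteq> A} = A"
proof (intro equalityI subsetI)
  fix x assume *: "A \<in> J" "A \<subseteq> S" "x \<in> A"
  have "x \<in> atom_of S J x" "atom_of S J x \<subseteq> A" "atom_of S J x \<in> atoms_of S J"
    using * by (auto simp: atom_of_def atoms_of_def)
  then show "x \<in> \<Union>{a\<in>atoms_of S J. a \<subseteq> A}" by blast
qed auto

lemma sets_atoms_of:
  assumes "finite J" "J \<subseteq> sets M"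
  shows "atoms_of (space M) J \<subseteq> sets M"
proof
  fix a assume "a \<in> atoms_of (space M) J"
  then obtain x where a: "a = {y\<in>space M. \<forall>A\<in>J. y \<in> A \<longleftrightarrow> x \<in> A}"
    by (auto simp: atoms_of_def atom_of_def)
  have "{y\<in>space M. \<forall>A\<in>J. y \<in> A \<longleftrightarrow> x \<in> A} \<in> sets M"
  proof (rule sets.sets_Collect_finite_All[OF _ \<open>finite J\<close>])
    fix A assume "A \<in> J"
    then have "A \<in> sets M" using assms by auto
    then show "{y\<in>space M. y \<in> A \<longleftrightarrow> x \<in> A} \<in> sets M"
      by (cases "x \<in> A") (auto simp: sets.sets_Collect_neg sets.Int_space_eq1 Collect_conj_eq)
  qed
  then show "a \<in> sets M" using a by simp
qed

lemma emeasure_atoms_of: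
  assumes "finite J" "J \<subseteq> sets \<mu>" "A \<in> J" "sets Q = sets \<mu>"
  shows "emeasure Q A = (\<Sum>a\<in>{a\<in>atoms_of (space \<mu>) J. a \<subseteq> A}. emeasure Q a)"
proof -
  let ?K = "{a\<in>atoms_of (space \<mu>) J. a \<subseteq> A}"
  have "?K \<subseteq> sets Q" using sets_atoms_of[OF assms(1,2)] assms(4) by auto
  moreover have "disjoint_family_on (\<lambda>x. x) ?K"
    using disjoint_atoms_of[of "space \<mu>" J] by (auto simp: disjoint_family_on_def disjoint_def)
  moreover have "finite ?K" using finite_atoms_of[OF assms(1)] by auto
  ultimately have "(\<Sum>a\<in>?K. emeasure Q a) = emeasure Q (\<Union>a\<in>?K. a)"
    by (intro sum_emeasure) auto
  also have "(\<Union>a\<in>?K. a) = A"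
    using Union_atoms_of[of A J "space \<mu>"] assms sets.sets_into_space[of A \<mu>] by auto
  finally show ?thesis by simp
qed

section \<open>Poisson moments and independence over disjoint regions\<close>

locale prm = prob_space M for M :: "'w measure" +
  fixes \<mu> :: "'z measure" and N :: "'w \<Rightarrow> 'z measure"
  assumes prm: "poisson_random_measure M \<mu> N"
begin

lemma sets_N: "\<omega> \<in> space M \<Longrightarrow> sets (N \<omega>) = sets \<mu>"
  and measurable_N[measurable (raw)]: "A \<in> sets \<mu> \<Longrightarrow> (\<lambda>\<omega>. emeasure (N \<omega>) A) \<in> borel_measurable M"
  using prm by (auto simp: poisson_random_measure_def)

lemma space_N: "\<omega> \<in> space M \<Longrightarrow> space (N \<omega>) = space \<mu>"
  using sets_N by (rule sets_eq_imp_space_eq)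

text \<open>Since \<open>0 ^ 0 = 1\<close>, for a null set this is the point mass at
  \<open>0\<close>.\<close>

definition pois :: "'z set \<Rightarrow> nat \<Rightarrow> real" where
  "pois A k = measure \<mu> A ^ k / fact k * exp (- measure \<mu> A)"

lemma pois_nonneg: "0 \<le> pois A k"
  by (simp add: pois_def)

lemma prob_N: "A \<in> sets \<mu> \<Longrightarrow> emeasure \<mu> A < \<infinity> \<Longrightarrow>
    measure M {\<omega>\<in>space M. emeasure (N \<omega>) A = of_nat k} = pois A k"
  using prm by (auto simp: poisson_random_measure_def pois_def)

lemma N_infinite: "A \<in> sets \<mu> \<Longrightarrow> emeasure \<mu> A = \<infinity> \<Longrightarrow> AE \<omega> in M. emeasure (N \<omega>) A = \<infinity>"
  using prm by (auto simp: poisson_random_measure_def)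

text \<open>Factorial moments are the convenient ones: the factors \<open>k\<close> and
  \<open>k (k - 1)\<close> cancel against the factorial, so each series is the first one with its
  index shifted by one or two.\<close>

lemma pois_sums: "pois A sums 1"
  and pois_sums1: "(\<lambda>k. real k * pois A k) sums measure \<mu> A"
  and pois_sums2: "(\<lambda>k. real k * (real k - 1) * pois A k) sums (measure \<mu> A)\<^sup>2"
proof -
  let ?l = "measure \<mu> A"
  have "(\<lambda>n. ?l ^ n / fact n) sums exp ?l"
    using exp_converges[of ?l] by (simp add: divide_inverse mult.commute)
  from sums_mult2[OF this, of "exp (- ?l)"] show 0: "pois A sums 1"
    by (simp add: exp_add[symmetric] pois_def[abs_def])
  have "(\<lambda>k. real (Suc k) * pois A (Suc k)) = (\<lambda>k. ?l * pois A k)"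
    by (auto simp: pois_def fun_eq_iff field_simps simp del: of_nat_Suc)
  with sums_mult[OF 0, of ?l] have "(\<lambda>k. real (Suc k) * pois A (Suc k)) sums ?l" by simp
  then show "(\<lambda>k. real k * pois A k) sums ?l" by (subst (asm) sums_Suc_iff) simp
  have "(\<lambda>k. real (Suc (Suc k)) * (real (Suc (Suc k)) - 1) * pois A (Suc (Suc k))) = (\<lambda>k. ?l\<^sup>2 * pois A k)"
  proof
    fix k
    have a: "fact (Suc (Suc k)) = real (Suc (Suc k)) * (real (Suc k) * fact k)" by simp
    have b: "real (Suc (Suc k)) - 1 = real (Suc k)" by simp
    have "x * y * (z / (x * (y * f)) * e) = z / f * e" if "x \<noteq> 0" "y \<noteq> 0" for x y z f e :: real
      using that by simp
    from this[of "real (Suc (Suc k))" "real (Suc k)"]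
    show "real (Suc (Suc k)) * (real (Suc (Suc k)) - 1) * pois A (Suc (Suc k)) = ?l\<^sup>2 * pois A k"
      unfolding pois_def a b by (simp add: power2_eq_square del: of_nat_Suc)
  qed
  with sums_mult[OF 0, of "?l\<^sup>2"]
  have "(\<lambda>k. real (Suc (Suc k)) * (real (Suc (Suc k)) - 1) * pois A (Suc (Suc k))) sums ?l\<^sup>2" by simp
  then show "(\<lambda>k. real k * (real k - 1) * pois A k) sums ?l\<^sup>2"
    by (subst (asm) sums_Suc_iff, subst (asm) sums_Suc_iff) simp
qed

text \<open>The definition prescribes probabilities at natural numbers and says nothing about single
  paths. These probabilities already add up to one, so all other values, including infinity, form a
  null event.\<close>

lemma AE_N_nat:
  assumes A: "A \<in> sets \<mu>" "emeasure \<mu> A < \<infinity>"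
  shows "AE \<omega> in M. \<exists>k::nat. emeasure (N \<omega>) A = of_nat k"
proof -
  let ?E = "\<lambda>k::nat. {\<omega>\<in>space M. emeasure (N \<omega>) A = of_nat k}"
  have m: "\<And>k. ?E k \<in> sets M" using A by measurable
  have "(\<lambda>k. measure M (?E k)) sums measure M (\<Union>k. ?E k)"
    using m by (intro finite_measure_UNION) (auto simp: disjoint_family_on_def)
  then have "measure M (\<Union>k. ?E k) = 1"
    using pois_sums[of A] sums_unique2 by (simp add: prob_N[OF A])
  then have "AE \<omega> in M. \<omega> \<in> (\<Union>k. ?E k)" using m by (intro prob_eq_1[THEN iffD1]) auto
  then show ?thesis by eventually_elim auto
qed

lemma nn_integral_N:
  assumes A: "A \<in> sets \<mu>" "emeasure \<mu> A < \<infinity>" and f[measurable]: "f \<in> borel_measurable borel"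
  shows "(\<integral>\<^sup>+\<omega>. f (emeasure (N \<omega>) A) \<partial>M) = (\<Sum>k. f (of_nat k) * ennreal (pois A k))"
proof -
  let ?E = "\<lambda>k::nat. {\<omega>\<in>space M. emeasure (N \<omega>) A = of_nat k}"
  have m[measurable]: "\<And>k. ?E k \<in> sets M" using A by measurable
  have "(\<integral>\<^sup>+\<omega>. f (emeasure (N \<omega>) A) \<partial>M) = (\<integral>\<^sup>+\<omega>. (\<Sum>k. f (of_nat k) * indicator (?E k) \<omega>) \<partial>M)"
  proof (rule nn_integral_cong_AE, use AE_N_nat[OF A] AE_space in eventually_elim)
    fix \<omega> assume elim: "\<exists>k::nat. emeasure (N \<omega>) A = of_nat k" "\<omega> \<in> space M"
    then obtain k :: nat where k: "emeasure (N \<omega>) A = of_nat k" by auto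
    have "(\<lambda>j. f (of_nat j) * indicator (?E j) \<omega>) = (\<lambda>j. if j = k then f (of_nat k) else 0)"
      using elim k by (auto simp: fun_eq_iff)
    then show "f (emeasure (N \<omega>) A) = (\<Sum>k. f (of_nat k) * indicator (?E k) \<omega>)"
      using k suminf_finite[of "{k}" "\<lambda>j. if j = k then f (of_nat k) else 0"] by simp
  qed
  also have "\<dots> = (\<Sum>k. \<integral>\<^sup>+\<omega>. f (of_nat k) * indicator (?E k) \<omega> \<partial>M)"
    by (intro nn_integral_suminf) measurable
  also have "\<dots> = (\<Sum>k. f (of_nat k) * ennreal (pois A k))"
    using prob_N[OF A] m by (simp add: nn_integral_cmult_indicator emeasure_eq_measure)
  finally show ?thesis .
qed

definition Ntil :: "'z set \<Rightarrow> 'w \<Rightarrow> real" where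
  "Ntil A \<omega> = measure (N \<omega>) A - measure \<mu> A"

lemma measurable_measure_N[measurable (raw)]: "A \<in> sets \<mu> \<Longrightarrow> (\<lambda>\<omega>. measure (N \<omega>) A) \<in> borel_measurable M"
  unfolding measure_def by (intro measurable_compose[OF measurable_N]) auto

lemma measurable_Ntil[measurable (raw)]: "A \<in> sets \<mu> \<Longrightarrow> Ntil A \<in> borel_measurable M"
  unfolding Ntil_def[abs_def] by (intro borel_measurable_diff measurable_measure_N) auto

lemma
  assumes A: "A \<in> sets \<mu>" "emeasure \<mu> A < \<infinity>"
  shows integrable_N: "integrable M (\<lambda>\<omega>. measure (N \<omega>) A)"
    and integral_N: "(\<integral>\<omega>. measure (N \<omega>) A \<partial>M) = measure \<mu> A"
    and integrable_N2: "integrable M (\<lambda>\<omega>. (measure (N \<omega>) A)\<^sup>2)"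
    and integral_N2: "(\<integral>\<omega>. (measure (N \<omega>) A)\<^sup>2 \<partial>M) = (measure \<mu> A)\<^sup>2 + measure \<mu> A"
proof -
  have [measurable]: "A \<in> sets \<mu>" by fact
  have "(\<integral>\<^sup>+\<omega>. ennreal (measure (N \<omega>) A) \<partial>M) = (\<Sum>k. ennreal (real k * pois A k))"
    using nn_integral_N[OF A, of "\<lambda>x. ennreal (enn2real x)"]
    by (simp add: measure_def pois_nonneg ennreal_mult)
  also have "\<dots> = ennreal (measure \<mu> A)"
    using pois_sums1[of A] by (intro suminf_ennreal_eq) (auto simp: pois_nonneg)
  finally have *: "(\<integral>\<^sup>+\<omega>. ennreal (measure (N \<omega>) A) \<partial>M) = ennreal (measure \<mu> A)" .
  have "has_bochner_integral M (\<lambda>\<omega>. measure (N \<omega>) A) (measure \<mu> A)"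
    by (rule has_bochner_integral_nn_integral) (use * in auto)
  then show "integrable M (\<lambda>\<omega>. measure (N \<omega>) A)" "(\<integral>\<omega>. measure (N \<omega>) A \<partial>M) = measure \<mu> A"
    by (auto simp: has_bochner_integral_iff)
  have "(\<integral>\<^sup>+\<omega>. ennreal ((measure (N \<omega>) A)\<^sup>2) \<partial>M) = (\<Sum>k. ennreal ((real k)\<^sup>2 * pois A k))"
    using nn_integral_N[OF A, of "\<lambda>x. ennreal ((enn2real x)\<^sup>2)"]
    by (simp add: measure_def pois_nonneg ennreal_mult)
  also have "\<dots> = ennreal ((measure \<mu> A)\<^sup>2 + measure \<mu> A)"
  proof (intro suminf_ennreal_eq)
    show "(\<lambda>k. (real k)\<^sup>2 * pois A k) sums ((measure \<mu> A)\<^sup>2 + measure \<mu> A)"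
      using sums_add[OF pois_sums2[of A] pois_sums1[of A]]
      by (simp add: algebra_simps power2_eq_square)
  qed (auto simp: pois_nonneg)
  finally have *: "(\<integral>\<^sup>+\<omega>. ennreal ((measure (N \<omega>) A)\<^sup>2) \<partial>M) = ennreal ((measure \<mu> A)\<^sup>2 + measure \<mu> A)" .
  have "has_bochner_integral M (\<lambda>\<omega>. (measure (N \<omega>) A)\<^sup>2) ((measure \<mu> A)\<^sup>2 + measure \<mu> A)"
    by (rule has_bochner_integral_nn_integral) (use * in auto)
  then show "integrable M (\<lambda>\<omega>. (measure (N \<omega>) A)\<^sup>2)"
      "(\<integral>\<omega>. (measure (N \<omega>) A)\<^sup>2 \<partial>M) = (measure \<mu> A)\<^sup>2 + measure \<mu> A"
    by (auto simp: has_bochner_integral_iff)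
qed

lemma
  assumes A: "A \<in> sets \<mu>" "emeasure \<mu> A < \<infinity>"
  shows integrable_Ntil: "integrable M (Ntil A)"
    and integral_Ntil: "(\<integral>\<omega>. Ntil A \<omega> \<partial>M) = 0"
    and integrable_Ntil2: "integrable M (\<lambda>\<omega>. (Ntil A \<omega>)\<^sup>2)"
    and integral_Ntil2: "(\<integral>\<omega>. (Ntil A \<omega>)\<^sup>2 \<partial>M) = measure \<mu> A"
proof -
  note 1 = integrable_N[OF A] integral_N[OF A] integrable_N2[OF A] integral_N2[OF A]
  show "integrable M (Ntil A)" "(\<integral>\<omega>. Ntil A \<omega> \<partial>M) = 0"
    using 1 by (simp_all add: Ntil_def[abs_def] prob_space)
  have *: "(Ntil A \<omega>)\<^sup>2 = (measure (N \<omega>) A)\<^sup>2 - 2 * measure \<mu> A * measure (N \<omega>) A + (measure \<mu> A)\<^sup>2" for \<omega>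
    by (simp add: Ntil_def power2_eq_square algebra_simps)
  show "integrable M (\<lambda>\<omega>. (Ntil A \<omega>)\<^sup>2)" unfolding * using 1 by auto
  show "(\<integral>\<omega>. (Ntil A \<omega>)\<^sup>2 \<partial>M) = measure \<mu> A"
    unfolding * using 1 by (simp add: prob_space) (simp add: power2_eq_square)
qed

lemma measurable_cnt[measurable]: "I \<subseteq> sets \<mu> \<Longrightarrow> cnt N I \<in> measurable M (cnt_space I)"
  unfolding cnt_def[abs_def] by (intro measurable_restrict) auto

text \<open>Independence passes from finite disjoint families to two arbitrary families that only
  avoid each other: a cylinder event over finitely many sets is an event about the counts of their
  common atoms, and no atom serves both families. A pi-system argument then reaches the generated
  \<sigma>-algebras.\<close>

lemma indep_cnt:
  assumes I: "I1 \<subseteq> sets \<mu>" "I2 \<subseteq> sets \<mu>" and disj: "\<And>A B. A \<in> I1 \<Longrightarrow> B \<in> I2 \<Longrightarrow> A \<inter> B = {}"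
  shows "indep_var (cnt_space I1) (cnt N I1) (cnt_space I2) (cnt N I2)"
proof -
  \<comment> \<open>Preimages of the generators of the product \<sigma>-algebra. The side condition
    on empty \<open>J\<close> is the one of \<open>prod_algebra\<close>, from which stability under
    intersection is inherited.\<close>
  define G where "G = (\<lambda>I. {cnt N I -` (prod_emb I (\<lambda>_. borel) J (Pi\<^sub>E J X)) \<inter> space M | J X.
      finite J \<and> (J \<noteq> {} \<or> I = {}) \<and> J \<subseteq> I \<and> (\<forall>i\<in>J. X i \<in> sets (borel :: ennreal measure))})"
  have G_prob: "prob (a \<inter> b) = prob a * prob b" if a: "a \<in> G I1" and b: "b \<in> G I2" for a b
  proof -
    obtain J1 X1 where a: "a = cnt N I1 -` (prod_emb I1 (\<lambda>_. borel) J1 (Pi\<^sub>E J1 X1)) \<inter> space M"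
      and J1: "finite J1" "J1 \<subseteq> I1" "\<And>i. i \<in> J1 \<Longrightarrow> X1 i \<in> sets (borel :: ennreal measure)"
      using a by (auto simp: G_def)
    obtain J2 X2 where b: "b = cnt N I2 -` (prod_emb I2 (\<lambda>_. borel) J2 (Pi\<^sub>E J2 X2)) \<inter> space M"
      and J2: "finite J2" "J2 \<subseteq> I2" "\<And>i. i \<in> J2 \<Longrightarrow> X2 i \<in> sets (borel :: ennreal measure)"
      using b by (auto simp: G_def)
    define J where "J = J1 \<union> J2"
    have J: "finite J" "J \<subseteq> sets \<mu>" using J1 J2 I by (auto simp: J_def)
    define T where "T = atoms_of (space \<mu>) J"
    define T1 where "T1 = {a\<in>T. \<exists>A\<in>J1. a \<subseteq> A}"
    define T2 where "T2 = {a\<in>T. \<exists>A\<in>J2. a \<subseteq> A}"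
    have T: "finite T" "T \<subseteq> sets \<mu>" "disjoint T" "{} \<notin> T"
      using J finite_atoms_of[of J] sets_atoms_of[of J \<mu>] disjoint_atoms_of[of "space \<mu>" J]
        atoms_of_nonempty[of "space \<mu>" J] by (auto simp: T_def)
    \<comment> \<open>A set below both \<open>A\<close> and \<open>B\<close> lies in their empty
      intersection, and the empty set is no atom.\<close>
    have T12: "T1 \<inter> T2 = {}"
    proof (rule ccontr)
      assume "T1 \<inter> T2 \<noteq> {}"
      then obtain a A B where "a \<in> T" "A \<in> J1" "a \<subseteq> A" "B \<in> J2" "a \<subseteq> B"
        by (auto simp: T1_def T2_def)
      then have "A \<inter> B = {}" using disj[of A B] J1(2) J2(2) by blast
      then have "a = {}" using \<open>a \<subseteq> A\<close> \<open>a \<subseteq> B\<close> by blast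
      then show False using T(4) \<open>a \<in> T\<close> by blast
    qed
    have iv: "indep_vars (\<lambda>_. borel) (\<lambda>A \<omega>. emeasure (N \<omega>) A) T"
      using prm T by (auto simp: poisson_random_measure_def)
    have iv2: "indep_var (cnt_space T1) (cnt N T1) (cnt_space T2) (cnt N T2)"
      unfolding cnt_def[abs_def] using indep_var_restrict[OF iv T12] by (auto simp: T1_def T2_def)
    define C1 where "C1 = {c\<in>space (cnt_space T1). \<forall>A\<in>J1. (\<Sum>a\<in>{a\<in>T. a \<subseteq> A}. c a) \<in> X1 A}"
    define C2 where "C2 = {c\<in>space (cnt_space T2). \<forall>A\<in>J2. (\<Sum>a\<in>{a\<in>T. a \<subseteq> A}. c a) \<in> X2 A}"
    have C1: "C1 \<in> sets (cnt_space T1)"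
      unfolding C1_def
    proof (rule sets.sets_Collect_finite_All[OF _ \<open>finite J1\<close>])
      fix A assume "A \<in> J1"
      then have "(\<lambda>c. \<Sum>a\<in>{a\<in>T. a \<subseteq> A}. c a) \<in> borel_measurable (cnt_space T1)"
        by (intro borel_measurable_sum measurable_component_singleton) (auto simp: T1_def)
      from measurable_sets[OF this J1(3)[OF \<open>A \<in> J1\<close>]]
      show "{c\<in>space (cnt_space T1). (\<Sum>a\<in>{a\<in>T. a \<subseteq> A}. c a) \<in> X1 A} \<in> sets (cnt_space T1)"
        by (simp add: vimage_def Int_def conj_commute)
    qed
    have C2: "C2 \<in> sets (cnt_space T2)"
      unfolding C2_def
    proof (rule sets.sets_Collect_finite_All[OF _ \<open>finite J2\<close>])
      fix A assume "A \<in> J2"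
      then have "(\<lambda>c. \<Sum>a\<in>{a\<in>T. a \<subseteq> A}. c a) \<in> borel_measurable (cnt_space T2)"
        by (intro borel_measurable_sum measurable_component_singleton) (auto simp: T2_def)
      from measurable_sets[OF this J2(3)[OF \<open>A \<in> J2\<close>]]
      show "{c\<in>space (cnt_space T2). (\<Sum>a\<in>{a\<in>T. a \<subseteq> A}. c a) \<in> X2 A} \<in> sets (cnt_space T2)"
        by (simp add: vimage_def Int_def conj_commute)
    qed
    have sum_eq: "(\<Sum>a\<in>{a\<in>T. a \<subseteq> A}. cnt N T' \<omega> a) = emeasure (N \<omega>) A"
      if "A \<in> J" "\<omega> \<in> space M" "{a\<in>T. a \<subseteq> A} \<subseteq> T'" for A \<omega> T'
    proof -
      have "(\<Sum>a\<in>{a\<in>T. a \<subseteq> A}. cnt N T' \<omega> a) = (\<Sum>a\<in>{a\<in>T. a \<subseteq> A}. emeasure (N \<omega>) a)"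
        using that by (intro sum.cong) (auto simp: cnt_def)
      then show ?thesis
        using emeasure_atoms_of[OF J that(1) sets_N[OF that(2)]] by (simp add: T_def)
    qed
    have a': "a = cnt N T1 -` C1 \<inter> space M"
    proof -
      have "\<omega> \<in> a \<longleftrightarrow> cnt N T1 \<omega> \<in> C1" if w: "\<omega> \<in> space M" for \<omega>
      proof -
        have "\<omega> \<in> a \<longleftrightarrow> (\<forall>A\<in>J1. emeasure (N \<omega>) A \<in> X1 A)"
          unfolding a using w by (simp add: cnt_mem_prod_emb[OF J1(2)])
        also have "\<dots> \<longleftrightarrow> (\<forall>A\<in>J1. (\<Sum>a\<in>{a\<in>T. a \<subseteq> A}. cnt N T1 \<omega> a) \<in> X1 A)"
          using w by (intro ball_cong refl, subst sum_eq) (auto simp: J_def T1_def)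
        also have "\<dots> \<longleftrightarrow> cnt N T1 \<omega> \<in> C1"
          by (auto simp: C1_def cnt_def space_PiM)
        finally show ?thesis .
      qed
      then show ?thesis by (auto simp: a)
    qed
    have b': "b = cnt N T2 -` C2 \<inter> space M"
    proof -
      have "\<omega> \<in> b \<longleftrightarrow> cnt N T2 \<omega> \<in> C2" if w: "\<omega> \<in> space M" for \<omega>
      proof -
        have "\<omega> \<in> b \<longleftrightarrow> (\<forall>A\<in>J2. emeasure (N \<omega>) A \<in> X2 A)"
          unfolding b using w by (simp add: cnt_mem_prod_emb[OF J2(2)])
        also have "\<dots> \<longleftrightarrow> (\<forall>A\<in>J2. (\<Sum>a\<in>{a\<in>T. a \<subseteq> A}. cnt N T2 \<omega> a) \<in> X2 A)"
          using w by (intro ball_cong refl, subst sum_eq) (auto simp: J_def T2_def)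
        also have "\<dots> \<longleftrightarrow> cnt N T2 \<omega> \<in> C2"
          by (auto simp: C2_def cnt_def space_PiM)
        finally show ?thesis .
      qed
      then show ?thesis by (auto simp: b)
    qed
    have "a \<inter> b = (\<lambda>x. (cnt N T1 x, cnt N T2 x)) -` (C1 \<times> C2) \<inter> space M"
      unfolding a' b' by auto
    then show ?thesis using indep_varD[OF iv2 C1 C2] unfolding a' b' by simp
  qed
  have G_sets: "G I \<subseteq> events" if "I \<subseteq> sets \<mu>" for I
    using that by (auto simp: G_def intro!: measurable_sets[OF measurable_cnt] sets_PiM_I_finite sets_PiM_I)
  have G_D: "\<exists>A. a = cnt N I -` A \<inter> space M \<and> A \<in> prod_algebra I (\<lambda>_. borel)" if a: "a \<in> G I" for a I
  proof -
    obtain J X where J: "a = cnt N I -` (prod_emb I (\<lambda>_. borel) J (Pi\<^sub>E J X)) \<inter> space M"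
        "finite J" "J \<noteq> {} \<or> I = {}" "J \<subseteq> I" "\<forall>i\<in>J. X i \<in> sets (borel :: ennreal measure)"
      using a unfolding G_def by blast
    have "prod_emb I (\<lambda>_. borel) J (Pi\<^sub>E J X) \<in> prod_algebra I (\<lambda>_. borel :: ennreal measure)"
      by (rule prod_algebraI) (use J in auto)
    then show ?thesis using J(1) by blast
  qed
  have G_stable: "Int_stable (G I)" if "I \<subseteq> sets \<mu>" for I
  proof (rule Int_stableI)
    fix a b assume "a \<in> G I" "b \<in> G I"
    then obtain A B where ab: "a = cnt N I -` A \<inter> space M" "b = cnt N I -` B \<inter> space M"
      and AB: "A \<in> prod_algebra I (\<lambda>_. borel)" "B \<in> prod_algebra I (\<lambda>_. borel)"
      using G_D by meson
    have "A \<inter> B \<in> prod_algebra I (\<lambda>_. borel)" using AB Int_stable_prod_algebra by (auto simp: Int_stable_def)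
    then obtain J X where J: "A \<inter> B = prod_emb I (\<lambda>_. borel) J (Pi\<^sub>E J X)" "finite J" "J \<noteq> {} \<or> I = {}" "J \<subseteq> I"
        "\<And>i. i \<in> J \<Longrightarrow> X i \<in> sets (borel::ennreal measure)"
      by (elim prod_algebraE) auto
    moreover have "a \<inter> b = cnt N I -` (A \<inter> B) \<inter> space M" using ab by auto
    ultimately show "a \<inter> b \<in> G I" unfolding G_def by blast
  qed
  have G_sigma: "{cnt N I -` A \<inter> space M | A. A \<in> sets (cnt_space I)} \<subseteq> sigma_sets (space M) (G I)" if I: "I \<subseteq> sets \<mu>" for I
  proof -
    have m: "cnt N I \<in> measurable (sigma (space M) (G I)) (cnt_space I)"
    proof (rule measurable_sigma_sets[OF sets_PiM prod_algebra_sets_into_space])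
      show "cnt N I \<in> space (sigma (space M) (G I)) \<rightarrow> (\<Pi>\<^sub>E i\<in>I. space borel)"
        by (auto simp: cnt_def)
      fix A assume "A \<in> prod_algebra I (\<lambda>_. borel :: ennreal measure)"
      then have "cnt N I -` A \<inter> space M \<in> G I"
        unfolding G_def by (elim prod_algebraE) blast
      then show "cnt N I -` A \<inter> space (sigma (space M) (G I)) \<in> sets (sigma (space M) (G I))"
        using G_sets[OF I] sets.sets_into_space by (subst sets_measure_of) (auto simp: space_measure_of_conv)
    qed
    show ?thesis
    proof safe
      fix A assume "A \<in> sets (cnt_space I)"
      from measurable_sets[OF m this] show "cnt N I -` A \<inter> space M \<in> sigma_sets (space M) (G I)"
        using G_sets[OF I] sets.sets_into_space
        by (subst (asm) sets_measure_of) (auto simp: space_measure_of_conv)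
    qed
  qed
  have ind: "indep_set (sigma_sets (space M) (G I1)) (sigma_sets (space M) (G I2))"
    using G_prob G_sets I G_stable
    by (intro indep_set_sigma_sets) (auto simp: indep_sets2_eq)
  have G_sigma': "sigma_sets (space M) {cnt N I -` A \<inter> space M | A. A \<in> sets (cnt_space I)} \<subseteq> sigma_sets (space M) (G I)" if I: "I \<subseteq> sets \<mu>" for I
    by (rule sigma_sets_mono) (use G_sigma[OF I] in auto)
  show ?thesis
    unfolding indep_var_eq indep_sets2_eq
  proof (intro conjI ballI measurable_cnt I)
    note s = G_sigma'[OF I(1)] G_sigma'[OF I(2)] ind[unfolded indep_sets2_eq]
    show "sigma_sets (space M) {cnt N I1 -` A \<inter> space M | A. A \<in> sets (cnt_space I1)} \<subseteq> events"
      "sigma_sets (space M) {cnt N I2 -` A \<inter> space M | A. A \<in> sets (cnt_space I2)} \<subseteq> events"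
      using s by blast+
    fix a b
    assume "a \<in> sigma_sets (space M) {cnt N I1 -` A \<inter> space M | A. A \<in> sets (cnt_space I1)}"
      "b \<in> sigma_sets (space M) {cnt N I2 -` A \<inter> space M | A. A \<in> sets (cnt_space I2)}"
    then show "prob (a \<inter> b) = prob a * prob b" using s by (meson subsetD)
  qed
qed

lemma emeasure_distr_N:
  assumes [measurable]: "A \<in> sets \<mu>" "B \<in> sets borel"
  shows "emeasure (distr M borel (\<lambda>\<omega>. emeasure (N \<omega>) A)) B = (\<integral>\<^sup>+\<omega>. indicator B (emeasure (N \<omega>) A) \<partial>M)"
  by (simp add: nn_integral_distr flip: nn_integral_indicator)

text \<open>Reduces the probability of a cylinder to the joint law of the counts of finitely many
  disjoint sets, the only joint laws that are prescribed.\<close>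

lemma emeasure_distr_prod_emb:
  assumes I: "I \<subseteq> sets \<mu>" and J: "finite J" "J \<subseteq> I"
    and X: "\<And>i. i \<in> J \<Longrightarrow> X i \<in> sets (borel::ennreal measure)"
  shows "emeasure (distr M (cnt_space I) (cnt N I)) (prod_emb I (\<lambda>_. borel) J (Pi\<^sub>E J X))
    = emeasure (distr M (cnt_space (atoms_of (space \<mu>) J)) (cnt N (atoms_of (space \<mu>) J)))
       {c\<in>space (cnt_space (atoms_of (space \<mu>) J)). \<forall>A\<in>J. (\<Sum>a\<in>{a\<in>atoms_of (space \<mu>) J. a \<subseteq> A}. c a) \<in> X A}"
proof -
  let ?T = "atoms_of (space \<mu>) J"
  define C where "C = {c\<in>space (cnt_space ?T). \<forall>A\<in>J. (\<Sum>a\<in>{a\<in>?T. a \<subseteq> A}. c a) \<in> X A}"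
  have J': "J \<subseteq> sets \<mu>" using J I by auto
  have T: "?T \<subseteq> sets \<mu>" using sets_atoms_of[OF J(1) J'] .
  have C: "C \<in> sets (cnt_space ?T)"
    unfolding C_def
  proof (rule sets.sets_Collect_finite_All[OF _ \<open>finite J\<close>])
    fix A assume "A \<in> J"
    then have "(\<lambda>c. \<Sum>a\<in>{a\<in>?T. a \<subseteq> A}. c a) \<in> borel_measurable (cnt_space ?T)"
      by (intro borel_measurable_sum measurable_component_singleton) auto
    from measurable_sets[OF this X[OF \<open>A \<in> J\<close>]]
    show "{c\<in>space (cnt_space ?T). (\<Sum>a\<in>{a\<in>?T. a \<subseteq> A}. c a) \<in> X A} \<in> sets (cnt_space ?T)"
      by (simp add: vimage_def Int_def conj_commute)
  qed
  have "cnt N I \<omega> \<in> prod_emb I (\<lambda>_. borel) J (Pi\<^sub>E J X) \<longleftrightarrow> cnt N ?T \<omega> \<in> C" if w: "\<omega> \<in> space M" for \<omega>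
  proof -
    have "cnt N I \<omega> \<in> prod_emb I (\<lambda>_. borel) J (Pi\<^sub>E J X) \<longleftrightarrow> (\<forall>A\<in>J. emeasure (N \<omega>) A \<in> X A)"
      by (rule cnt_mem_prod_emb[OF J(2)])
    also have "\<dots> \<longleftrightarrow> (\<forall>A\<in>J. (\<Sum>a\<in>{a\<in>?T. a \<subseteq> A}. cnt N ?T \<omega> a) \<in> X A)"
    proof (intro ball_cong refl)
      fix A assume "A \<in> J"
      then have "emeasure (N \<omega>) A = (\<Sum>a\<in>{a\<in>?T. a \<subseteq> A}. cnt N ?T \<omega> a)"
        using emeasure_atoms_of[OF J(1) J' _ sets_N[OF w]] by (simp add: cnt_def)
      then show "emeasure (N \<omega>) A \<in> X A \<longleftrightarrow> (\<Sum>a\<in>{a\<in>?T. a \<subseteq> A}. cnt N ?T \<omega> a) \<in> X A" by simp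
    qed
    also have "\<dots> \<longleftrightarrow> cnt N ?T \<omega> \<in> C"
      by (auto simp: C_def cnt_def space_PiM)
    finally show ?thesis .
  qed
  then have "cnt N I -` (prod_emb I (\<lambda>_. borel) J (Pi\<^sub>E J X)) \<inter> space M = cnt N ?T -` C \<inter> space M" by auto
  then show ?thesis
    unfolding C_def[symmetric]
    using C T I J X measurable_cnt by (subst (1 2) emeasure_distr) (auto intro!: sets_PiM_I)
qed

end

text \<open>The intensity determines the joint law of all counts: single counts are Poisson or
  almost surely infinite, disjoint counts have a product law, finitely many sets reduce to atoms,
  and cylinders determine the law of an infinite family. The two noises may live on different
  spaces.\<close>

lemma distr_cnt_eq:
  assumes "prm M1 \<mu> N1" "prm M2 \<mu> N2" "I \<subseteq> sets \<mu>"
  shows "distr M1 (cnt_space I) (cnt N1 I) = distr M2 (cnt_space I) (cnt N2 I)"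
proof -
  interpret N1: prm M1 \<mu> N1 by fact
  interpret N2: prm M2 \<mu> N2 by fact
  have single: "distr M1 borel (\<lambda>\<omega>. emeasure (N1 \<omega>) A) = distr M2 borel (\<lambda>\<omega>. emeasure (N2 \<omega>) A)"
    if A[measurable]: "A \<in> sets \<mu>" for A
  proof (rule measure_eqI)
    fix B assume "B \<in> sets (distr M1 borel (\<lambda>\<omega>. emeasure (N1 \<omega>) A))"
    then have B[measurable]: "B \<in> sets borel" by simp
    show "emeasure (distr M1 borel (\<lambda>\<omega>. emeasure (N1 \<omega>) A)) B = emeasure (distr M2 borel (\<lambda>\<omega>. emeasure (N2 \<omega>) A)) B"
    proof (cases "emeasure \<mu> A < \<infinity>")
      case True
      have "(\<integral>\<^sup>+\<omega>. indicator B (emeasure (N1 \<omega>) A) \<partial>M1) = (\<Sum>k. indicator B (of_nat k) * ennreal (N1.pois A k))"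
        by (rule N1.nn_integral_N[OF A True]) auto
      moreover have "(\<integral>\<^sup>+\<omega>. indicator B (emeasure (N2 \<omega>) A) \<partial>M2) = (\<Sum>k. indicator B (of_nat k) * ennreal (N2.pois A k))"
        by (rule N2.nn_integral_N[OF A True]) auto
      ultimately show ?thesis
        by (simp add: N1.emeasure_distr_N N2.emeasure_distr_N N1.pois_def N2.pois_def)
    next
      case False
      then have i: "emeasure \<mu> A = \<infinity>" using less_top[of "emeasure \<mu> A"] by auto
      have "(\<integral>\<^sup>+\<omega>. indicator B (emeasure (N1 \<omega>) A) \<partial>M1) = (\<integral>\<^sup>+\<omega>. indicator B (\<infinity>::ennreal) \<partial>M1)"
        using N1.N_infinite[OF A i] by (intro nn_integral_cong_AE) auto
      moreover have "(\<integral>\<^sup>+\<omega>. indicator B (emeasure (N2 \<omega>) A) \<partial>M2) = (\<integral>\<^sup>+\<omega>. indicator B (\<infinity>::ennreal) \<partial>M2)"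
        using N2.N_infinite[OF A i] by (intro nn_integral_cong_AE) auto
      ultimately show ?thesis
        by (simp add: N1.emeasure_distr_N N2.emeasure_distr_N N1.emeasure_space_1 N2.emeasure_space_1)
    qed
  qed simp
  have dis: "distr M1 (cnt_space T) (cnt N1 T) = distr M2 (cnt_space T) (cnt N2 T)"
    if T: "finite T" "T \<subseteq> sets \<mu>" "disjoint T" for T
  proof (cases "T = {}")
    \<comment> \<open>The characterization of independence by product laws requires a nonempty index
      set; over the empty set both laws are the point mass at the same function.\<close>
    case True
    show ?thesis
    proof (rule measure_eqI)
      fix A assume A: "A \<in> sets (distr M1 (cnt_space T) (cnt N1 T))"
      have "cnt N1 T = (\<lambda>_ _. undefined)" "cnt N2 T = (\<lambda>_ _. undefined)"
        using True by (simp_all add: cnt_def restrict_def fun_eq_iff)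
      then have "cnt N1 T -` A \<inter> space M1 = (if (\<lambda>_. undefined) \<in> A then space M1 else {})"
          "cnt N2 T -` A \<inter> space M2 = (if (\<lambda>_. undefined) \<in> A then space M2 else {})" by auto
      then show "emeasure (distr M1 (cnt_space T) (cnt N1 T)) A = emeasure (distr M2 (cnt_space T) (cnt N2 T)) A"
        using A T N1.measurable_cnt[of T] N2.measurable_cnt[of T] N1.emeasure_space_1 N2.emeasure_space_1
        by (simp add: emeasure_distr)
    qed simp
  next
    case False
    have 1: "N1.indep_vars (\<lambda>_. borel) (\<lambda>A \<omega>. emeasure (N1 \<omega>) A) T"
      using N1.prm T by (auto simp: poisson_random_measure_def)
    have 2: "N2.indep_vars (\<lambda>_. borel) (\<lambda>A \<omega>. emeasure (N2 \<omega>) A) T"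
      using N2.prm T by (auto simp: poisson_random_measure_def)
    have "distr M1 (cnt_space T) (\<lambda>\<omega>. \<lambda>A\<in>T. emeasure (N1 \<omega>) A) = (\<Pi>\<^sub>M A\<in>T. distr M1 borel (\<lambda>\<omega>. emeasure (N1 \<omega>) A))"
      by (rule N1.indep_vars_iff_distr_eq_PiM'[THEN iffD1, OF False _ 1]) (use T in auto)
    also have "\<dots> = (\<Pi>\<^sub>M A\<in>T. distr M2 borel (\<lambda>\<omega>. emeasure (N2 \<omega>) A))"
      using T by (intro PiM_cong refl single) auto
    also have "\<dots> = distr M2 (cnt_space T) (\<lambda>\<omega>. \<lambda>A\<in>T. emeasure (N2 \<omega>) A)"
      by (rule N2.indep_vars_iff_distr_eq_PiM'[THEN iffD1, OF False _ 2, symmetric]) (use T in auto)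
    finally have ?thesis unfolding cnt_def[abs_def] .
    then show ?thesis .
  qed
  show ?thesis
  proof (rule measure_eqI_PiM_infinite[where I=I and M="\<lambda>_. borel"])
    show "finite_measure (distr M1 (cnt_space I) (cnt N1 I))"
      using N1.prob_space_distr[OF N1.measurable_cnt[OF assms(3)]]
      by (simp add: prob_space_def)
    fix X J assume J: "finite J" "J \<subseteq> I" and X: "\<And>i. i \<in> J \<Longrightarrow> X i \<in> sets (borel::ennreal measure)"
    let ?T = "atoms_of (space \<mu>) J"
    have J': "J \<subseteq> sets \<mu>" using J assms(3) by auto
    have T: "finite ?T" "?T \<subseteq> sets \<mu>" "disjoint ?T"
      using J finite_atoms_of[of J] sets_atoms_of[of J \<mu>] disjoint_atoms_of[of "space \<mu>" J] J' by auto
    show "emeasure (distr M1 (cnt_space I) (cnt N1 I)) (prod_emb I (\<lambda>_. borel) J (Pi\<^sub>E J X)) =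
        emeasure (distr M2 (cnt_space I) (cnt N2 I)) (prod_emb I (\<lambda>_. borel) J (Pi\<^sub>E J X))"
      by (simp only: N1.emeasure_distr_prod_emb[OF assms(3) J X] N2.emeasure_distr_prod_emb[OF assms(3) J X] dis[OF T])
  qed (simp_all only: sets_distr)
qed

section \<open>Convergence in mean square\<close>

text \<open>The squared \<open>L2\<close> norm with values in \<open>ennreal\<close>: it makes sense
  before integrability is known, and convergence in mean square is convergence of these values to
  \<open>0\<close>.\<close>

definition nsq :: "'a measure \<Rightarrow> ('a \<Rightarrow> real) \<Rightarrow> ennreal" where
  "nsq M f = (\<integral>\<^sup>+x. ennreal ((f x)\<^sup>2) \<partial>M)"

lemma nsq_cong_AE: "AE x in M. f x = g x \<Longrightarrow> nsq M f = nsq M g"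
  unfolding nsq_def by (rule nn_integral_cong_AE) auto

lemma nsq_minus: "nsq M (\<lambda>x. f x - g x) = nsq M (\<lambda>x. g x - f x)"
  unfolding nsq_def by (simp add: power2_commute)

text \<open>This quasi-triangle inequality takes the place of the Minkowski inequality. Its factors
  \<open>2\<close> only affect constants.\<close>

lemma ennreal_square_add_le: "ennreal ((a + b)\<^sup>2) \<le> 2 * ennreal (a\<^sup>2) + 2 * ennreal (b\<^sup>2)"
proof -
  have "(a + b)\<^sup>2 \<le> 2 * a\<^sup>2 + 2 * b\<^sup>2"
    using sum_squares_bound[of a b] by (simp add: power2_sum)
  then have "ennreal ((a + b)\<^sup>2) \<le> ennreal (2 * a\<^sup>2 + 2 * b\<^sup>2)" by (rule ennreal_leI)
  also have "\<dots> = 2 * ennreal (a\<^sup>2) + 2 * ennreal (b\<^sup>2)" by (simp add: ennreal_mult')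
  finally show ?thesis .
qed

lemma nsq_add_le:
  assumes [measurable]: "f \<in> borel_measurable M" "g \<in> borel_measurable M"
  shows "nsq M (\<lambda>x. f x + g x) \<le> 2 * nsq M f + 2 * nsq M g"
proof -
  have "nsq M (\<lambda>x. f x + g x) \<le> (\<integral>\<^sup>+x. 2 * ennreal ((f x)\<^sup>2) + 2 * ennreal ((g x)\<^sup>2) \<partial>M)"
    unfolding nsq_def by (intro nn_integral_mono ennreal_square_add_le)
  also have "\<dots> = 2 * nsq M f + 2 * nsq M g"
    unfolding nsq_def by (simp add: nn_integral_add nn_integral_cmult)
  finally show ?thesis .
qed

lemma nsq_uminus: "nsq M (\<lambda>x. - f x) = nsq M f"
  by (simp add: nsq_def)

lemma nsq_diff_le:
  assumes [measurable]: "f \<in> borel_measurable M" "g \<in> borel_measurable M"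
  shows "nsq M (\<lambda>x. f x - g x) \<le> 2 * nsq M f + 2 * nsq M g"
  using nsq_add_le[of f M "\<lambda>x. - g x"] by (simp add: nsq_uminus)

lemma nsq_triangle:
  assumes [measurable]: "f \<in> borel_measurable M" "g \<in> borel_measurable M" "h \<in> borel_measurable M"
  shows "nsq M (\<lambda>x. f x - g x) \<le> 2 * nsq M (\<lambda>x. f x - h x) + 2 * nsq M (\<lambda>x. g x - h x)"
  using nsq_diff_le[of "\<lambda>x. f x - h x" M "\<lambda>x. g x - h x"] by simp

lemma nsq_cmult: "nsq M (\<lambda>x. c * f x) = ennreal (c\<^sup>2) * nsq M f" if "f \<in> borel_measurable M"
  using that by (simp add: nsq_def power_mult_distrib ennreal_mult nn_integral_cmult)

lemma nsq_0_iff: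
  assumes [measurable]: "f \<in> borel_measurable M"
  shows "nsq M f = 0 \<longleftrightarrow> (AE x in M. f x = 0)"
  unfolding nsq_def by (subst nn_integral_0_iff_AE) auto

lemma
  assumes [measurable]: "f \<in> borel_measurable M" and fin: "nsq M f < \<infinity>"
  shows integrable_square: "integrable M (\<lambda>x. (f x)\<^sup>2)"
    and nsq_eq_integral: "nsq M f = ennreal (\<integral>x. (f x)\<^sup>2 \<partial>M)"
proof -
  show 1: "integrable M (\<lambda>x. (f x)\<^sup>2)"
    using fin by (intro integrableI_nonneg) (auto simp: nsq_def)
  show "nsq M f = ennreal (\<integral>x. (f x)\<^sup>2 \<partial>M)"
    unfolding nsq_def using 1 by (intro nn_integral_eq_integral) auto
qed

lemma integrable_square_nsq:
  "integrable M (\<lambda>x. (f x)\<^sup>2) \<Longrightarrow> nsq M f = ennreal (\<integral>x. (f x)\<^sup>2 \<partial>M)"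
  unfolding nsq_def by (intro nn_integral_eq_integral) auto

lemma nsq_distr:
  assumes [measurable]: "T \<in> measurable M P" "f \<in> borel_measurable P"
  shows "nsq (distr M P T) f = nsq M (\<lambda>x. f (T x))"
  unfolding nsq_def by (simp add: nn_integral_distr)

lemma L2_unique:
  assumes [measurable]: "\<And>n. X n \<in> borel_measurable M" "f \<in> borel_measurable M" "g \<in> borel_measurable M"
    and f: "(\<lambda>n. nsq M (\<lambda>x. X n x - f x)) \<longlonglongrightarrow> 0" and g: "(\<lambda>n. nsq M (\<lambda>x. X n x - g x)) \<longlonglongrightarrow> 0"
  shows "AE x in M. f x = g x"
proof -
  have "nsq M (\<lambda>x. f x - g x) \<le> 2 * nsq M (\<lambda>x. X n x - f x) + 2 * nsq M (\<lambda>x. X n x - g x)" for n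
    using nsq_triangle[of f M g "X n"] by (simp add: nsq_minus[of M _ "X n"])
  moreover have "(\<lambda>n. 2 * nsq M (\<lambda>x. X n x - f x) + 2 * nsq M (\<lambda>x. X n x - g x)) \<longlonglongrightarrow> 2 * 0 + 2 * 0"
    by (intro tendsto_add ennreal_tendsto_cmult f g) auto
  ultimately have "nsq M (\<lambda>x. f x - g x) \<le> 0"
    by (intro LIMSEQ_le_const) auto
  then have "nsq M (\<lambda>x. f x - g x) = 0" by simp
  then have "AE x in M. f x - g x = 0" by (subst (asm) nsq_0_iff) auto
  then show ?thesis by eventually_elim simp
qed

text \<open>The Riesz-Fischer argument. The Cauchy condition is given with explicit errors
  \<open>e\<close>, which is the form that the quasi-triangle inequality produces when a limit in
  another space is already known.\<close>

lemma L2_complete: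
  assumes X[measurable]: "\<And>n. X n \<in> borel_measurable M"
    and cauchy: "\<And>m n. nsq M (\<lambda>x. X m x - X n x) \<le> e m + e n" and e: "e \<longlonglongrightarrow> 0"
  shows "\<exists>f\<in>borel_measurable M. (\<lambda>n. nsq M (\<lambda>x. X n x - f x)) \<longlonglongrightarrow> 0"
proof -
  \<comment> \<open>With errors below \<open>4 ^ -k\<close> the squared increments, weighted by
    \<open>2 ^ k\<close>, still have summable integrals. Almost surely the increments are then
    bounded by a multiple of \<open>2 ^ (-k/2)\<close>, hence summable. The indices
    \<open>r k\<close> may repeat or decrease; only \<open>e (r k)\<close> tending to
    \<open>0\<close> matters.\<close>
  have "\<forall>k. \<exists>n. e n \<le> ennreal ((1/4)^k)"
  proof
    fix k
    have "eventually (\<lambda>n. e n < ennreal ((1/4)^k)) sequentially"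
      using e by (rule order_tendstoD) (simp add: zero_less_power)
    then show "\<exists>n. e n \<le> ennreal ((1/4)^k)"
      by (auto simp: eventually_sequentially intro: less_imp_le)
  qed
  then obtain r where r: "\<And>k. e (r k) \<le> ennreal ((1/4)^k)" by metis
  define Y where "Y k = X (r k)" for k
  have [measurable]: "\<And>k. Y k \<in> borel_measurable M" by (simp add: Y_def)
  \<comment> \<open>\<open>lim\<close> has some value also where the sequence diverges and is
    measurable there too, so the exceptional set needs no separate treatment.\<close>
  define f where "f x = lim (\<lambda>k. Y k x)" for x
  have f[measurable]: "f \<in> borel_measurable M"
    unfolding f_def[abs_def] by measurable
  have er: "(\<lambda>k. e (r k)) \<longlonglongrightarrow> 0"
  proof (rule tendsto_sandwich[OF _ _ tendsto_const])
    show "(\<lambda>k. ennreal ((1/4)^k)) \<longlonglongrightarrow> 0"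
      using tendsto_ennrealI[OF LIMSEQ_realpow_zero[of "1/4"]] by simp
  qed (use r in auto)
  have "(\<integral>\<^sup>+x. (\<Sum>k. ennreal (2^k) * ennreal ((Y (Suc k) x - Y k x)\<^sup>2)) \<partial>M)
      = (\<Sum>k. ennreal (2^k) * nsq M (\<lambda>x. Y (Suc k) x - Y k x))"
    unfolding nsq_def by (subst nn_integral_suminf) (auto simp: nn_integral_cmult)
  also have "\<dots> \<le> (\<Sum>k. ennreal (2 * (1/2)^k))"
  proof (intro suminf_le summableI)
    fix k
    have "nsq M (\<lambda>x. Y (Suc k) x - Y k x) \<le> e (r (Suc k)) + e (r k)"
      unfolding Y_def by (rule cauchy)
    also have "\<dots> \<le> ennreal ((1/4)^Suc k) + ennreal ((1/4)^k)"
      by (intro add_mono r)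
    also have "\<dots> = ennreal ((1/4)^Suc k + (1/4)^k)" by (rule ennreal_plus[symmetric]) auto
    also have "\<dots> \<le> ennreal (2 * (1/4)^k)" by (intro ennreal_leI) simp
    finally have "ennreal (2^k) * nsq M (\<lambda>x. Y (Suc k) x - Y k x) \<le> ennreal (2^k) * ennreal (2 * (1/4)^k)"
      by (rule mult_left_mono) simp
    also have "\<dots> = ennreal (2^k * (2 * (1/4)^k))" by (simp add: ennreal_mult')
    also have "2^k * (2 * (1/4)^k) = 2 * (1/2::real)^k"
      by (simp add: power_divide field_simps flip: power_mult_distrib)
    finally show "ennreal (2^k) * nsq M (\<lambda>x. Y (Suc k) x - Y k x) \<le> ennreal (2 * (1/2)^k)" .
  qed
  also have "\<dots> = ennreal (\<Sum>k. 2 * (1/2)^k)"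
    by (intro suminf_ennreal2 summable_mult) auto
  also have "\<dots> < \<infinity>" by simp
  finally have "(\<integral>\<^sup>+x. (\<Sum>k. ennreal (2^k) * ennreal ((Y (Suc k) x - Y k x)\<^sup>2)) \<partial>M) \<noteq> \<infinity>" by simp
  then have "AE x in M. (\<Sum>k. ennreal (2^k) * ennreal ((Y (Suc k) x - Y k x)\<^sup>2)) \<noteq> \<infinity>"
    by (intro nn_integral_PInf_AE) auto
  then have conv: "AE x in M. (\<lambda>k. Y k x) \<longlonglongrightarrow> f x"
  proof eventually_elim
    case (elim x)
    then obtain C where C: "(\<Sum>k. ennreal (2^k) * ennreal ((Y (Suc k) x - Y k x)\<^sup>2)) = ennreal C" "0 \<le> C"
      by (cases "(\<Sum>k. ennreal (2^k) * ennreal ((Y (Suc k) x - Y k x)\<^sup>2))") auto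
    have b: "\<bar>Y (Suc k) x - Y k x\<bar> \<le> sqrt C * (sqrt (1/2))^k" for k
    proof -
      have "ennreal (2^k * (Y (Suc k) x - Y k x)\<^sup>2) \<le> ennreal C"
        unfolding C(1)[symmetric]
        using sum_le_suminf[OF summableI, of "{k}" "\<lambda>k. ennreal (2^k) * ennreal ((Y (Suc k) x - Y k x)\<^sup>2)"]
        by (simp add: ennreal_mult')
      then have "2^k * (Y (Suc k) x - Y k x)\<^sup>2 \<le> C" using C(2) by simp
      then have "(Y (Suc k) x - Y k x)\<^sup>2 \<le> C * (1/2)^k" by (simp add: field_simps)
      then have "sqrt ((Y (Suc k) x - Y k x)\<^sup>2) \<le> sqrt (C * (1/2)^k)" by (rule real_sqrt_le_mono)
      then show ?thesis unfolding real_sqrt_abs by (simp add: real_sqrt_mult real_sqrt_power)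
    qed
    have "summable (\<lambda>k. sqrt C * (sqrt (1/2))^k)"
      by (intro summable_mult summable_geometric) auto
    then have "summable (\<lambda>k. Y (Suc k) x - Y k x)"
      by (rule summable_comparison_test'[where N=0]) (use b in auto)
    then have "convergent (\<lambda>n. \<Sum>k<n. Y (Suc k) x - Y k x)" by (simp add: summable_iff_convergent)
    then have "convergent (\<lambda>n. Y n x - Y 0 x)" by (simp only: sum_lessThan_telescope[of "\<lambda>k. Y k x"])
    then obtain l where "(\<lambda>n. Y n x - Y 0 x) \<longlonglongrightarrow> l" by (auto simp: convergent_def)
    from tendsto_add[OF this tendsto_const[of "Y 0 x"]] have "convergent (\<lambda>n. Y n x)"
      by (auto simp: convergent_def)
    then show ?case by (simp add: f_def convergent_LIMSEQ_iff)
  qed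
  \<comment> \<open>Fatou's lemma along the subsequence: the limit inherits the Cauchy estimate, and
    the error of the subsequence disappears.\<close>
  have le: "nsq M (\<lambda>x. X n x - f x) \<le> e n" for n
  proof -
    have "nsq M (\<lambda>x. X n x - f x) = (\<integral>\<^sup>+x. liminf (\<lambda>k. ennreal ((X n x - Y k x)\<^sup>2)) \<partial>M)"
      unfolding nsq_def
    proof (intro nn_integral_cong_AE, use conv in eventually_elim)
      fix x assume "(\<lambda>k. Y k x) \<longlonglongrightarrow> f x"
      then have "(\<lambda>k. ennreal ((X n x - Y k x)\<^sup>2)) \<longlonglongrightarrow> ennreal ((X n x - f x)\<^sup>2)"
        by (intro tendsto_intros)
      then show "ennreal ((X n x - f x)\<^sup>2) = liminf (\<lambda>k. ennreal ((X n x - Y k x)\<^sup>2))"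
        using lim_imp_Liminf[OF sequentially_bot] by metis
    qed
    also have "\<dots> \<le> liminf (\<lambda>k. \<integral>\<^sup>+x. ennreal ((X n x - Y k x)\<^sup>2) \<partial>M)"
      by (rule nn_integral_liminf) auto
    also have "\<dots> \<le> liminf (\<lambda>k. e n + e (r k))"
      using cauchy[of n] by (intro Liminf_mono always_eventually allI) (simp add: nsq_def Y_def)
    also have "(\<lambda>k. e n + e (r k)) \<longlonglongrightarrow> e n + 0"
      by (intro tendsto_add tendsto_const er)
    then have "liminf (\<lambda>k. e n + e (r k)) = e n"
      using lim_imp_Liminf[OF sequentially_bot] by fastforce
    finally show ?thesis .
  qed
  have "(\<lambda>n. nsq M (\<lambda>x. X n x - f x)) \<longlonglongrightarrow> 0"
    by (rule tendsto_sandwich[OF _ _ tendsto_const e]) (use le in auto)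
  then show ?thesis using f by auto
qed

text \<open>The standard approximation satisfies
  \<open>\<bar>S n\<bar> \<le> 2 * \<bar>\<Phi>\<bar>\<close>, so the squared errors are dominated
  by \<open>9 = (2 + 1)^2\<close> times the square of \<open>\<Phi>\<close>. Integrability of
  \<open>S n\<close> on a possibly infinite measure space has to be shown as well.\<close>

lemma L2_simple_approx:
  fixes \<Phi> :: "'a \<Rightarrow> real"
  assumes [measurable]: "\<Phi> \<in> borel_measurable \<mu>" and fin: "nsq \<mu> \<Phi> < \<infinity>"
  shows "\<exists>S. (\<forall>n::nat. simple_function \<mu> (S n) \<and> integrable \<mu> (S n)) \<and>
    (\<lambda>n. nsq \<mu> (\<lambda>x. S n x - \<Phi> x)) \<longlonglongrightarrow> 0"
proof -
  obtain S where S: "\<And>n. simple_function \<mu> (S n)" "\<And>x. x \<in> space \<mu> \<Longrightarrow> (\<lambda>n. S n x) \<longlonglongrightarrow> \<Phi> x"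
    "\<And>n x. x \<in> space \<mu> \<Longrightarrow> \<bar>S n x\<bar> \<le> 2 * \<bar>\<Phi> x\<bar>"
  proof -
    obtain F where "\<forall>i. simple_function \<mu> (F i)" "\<forall>x\<in>space \<mu>. (\<lambda>i. F i x) \<longlonglongrightarrow> \<Phi> x"
      "\<forall>i. \<forall>x\<in>space \<mu>. \<bar>F i x\<bar> \<le> 2 * \<bar>\<Phi> x\<bar>"
      using borel_measurable_implies_sequence_metric[of \<Phi> \<mu> 0] by auto
    then show ?thesis using that[of F] by blast
  qed
  have [measurable]: "S n \<in> borel_measurable \<mu>" for n
    using S(1) by (rule borel_measurable_simple_function)
  have "integrable \<mu> (S n)" for n
  proof -
    have "finite (S n ` space \<mu>)" using S(1) by (auto simp: simple_function_def)
    have "S n ` space \<mu> - {0} = {} \<or> S n ` space \<mu> - {0} \<noteq> {}" by auto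
    \<comment> \<open>\<open>c\<close> is the smallest nonzero absolute value taken. Where
      \<open>S n\<close> is nonzero, \<open>c * \<bar>S n\<bar>\<close> is at most the square of
      \<open>S n\<close>, which trades square integrability for integrability.\<close>
    obtain c where c: "c > 0" "\<And>y. y \<in> S n ` space \<mu> \<Longrightarrow> y \<noteq> 0 \<Longrightarrow> c \<le> \<bar>y\<bar>"
    proof (cases "S n ` space \<mu> - {0} = {}")
      case True then show ?thesis using that[of 1] by auto
    next
      case False
      let ?F = "abs ` (S n ` space \<mu> - {0})"
      have "finite ?F" "?F \<noteq> {}" using False \<open>finite (S n ` space \<mu>)\<close> by auto
      then show ?thesis using that[of "Min ?F"] by (auto simp: Min_gr_iff)
    qed
    have "ennreal (norm (S n x)) \<le> ennreal (4 / c) * ennreal ((\<Phi> x)\<^sup>2)" if x: "x \<in> space \<mu>" for x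
    proof (cases "S n x = 0")
      case False
      then have "c \<le> \<bar>S n x\<bar>" using c x by auto
      then have "c * \<bar>S n x\<bar> \<le> \<bar>S n x\<bar> * \<bar>S n x\<bar>" by (intro mult_right_mono) auto
      also have "\<dots> \<le> (2 * \<bar>\<Phi> x\<bar>) * (2 * \<bar>\<Phi> x\<bar>)" using S(3)[OF x, of n] by (intro mult_mono) auto
      also have "\<dots> = 4 * (\<Phi> x)\<^sup>2" by (simp add: power2_eq_square abs_mult[symmetric])
      finally have "\<bar>S n x\<bar> \<le> 4 / c * (\<Phi> x)\<^sup>2" using c(1) by (simp add: field_simps)
      then have "ennreal \<bar>S n x\<bar> \<le> ennreal (4 / c * (\<Phi> x)\<^sup>2)" by (rule ennreal_leI)
      then show ?thesis using c(1) by (subst ennreal_mult'[symmetric]) auto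
    qed simp
    then have "(\<integral>\<^sup>+x. ennreal (norm (S n x)) \<partial>\<mu>) \<le> (\<integral>\<^sup>+x. ennreal (4 / c) * ennreal ((\<Phi> x)\<^sup>2) \<partial>\<mu>)"
      by (intro nn_integral_mono) auto
    also have "\<dots> < \<infinity>"
      using fin by (simp add: nn_integral_cmult nsq_def ennreal_mult_less_top)
    finally show ?thesis by (intro integrableI_bounded) auto
  qed
  moreover have "(\<lambda>n. nsq \<mu> (\<lambda>x. S n x - \<Phi> x)) \<longlonglongrightarrow> (\<integral>\<^sup>+x. 0 \<partial>\<mu>)"
    unfolding nsq_def
  proof (rule nn_integral_dominated_convergence[where w="\<lambda>x. 9 * ennreal ((\<Phi> x)\<^sup>2)"])
    show "AE x in \<mu>. ennreal ((S n x - \<Phi> x)\<^sup>2) \<le> 9 * ennreal ((\<Phi> x)\<^sup>2)" for n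
    proof (rule AE_I2)
      fix x assume "x \<in> space \<mu>"
      from S(3)[OF this, of n] have "\<bar>S n x - \<Phi> x\<bar> \<le> 3 * \<bar>\<Phi> x\<bar>" by linarith
      then have "\<bar>S n x - \<Phi> x\<bar>\<^sup>2 \<le> (3 * \<bar>\<Phi> x\<bar>)\<^sup>2" by (rule power_mono) simp
      then have "(S n x - \<Phi> x)\<^sup>2 \<le> 9 * (\<Phi> x)\<^sup>2" by (simp add: power_mult_distrib)
      then have "ennreal ((S n x - \<Phi> x)\<^sup>2) \<le> ennreal (9 * (\<Phi> x)\<^sup>2)" by (rule ennreal_leI)
      then show "ennreal ((S n x - \<Phi> x)\<^sup>2) \<le> 9 * ennreal ((\<Phi> x)\<^sup>2)" by (simp add: ennreal_mult')
    qed
    show "(\<integral>\<^sup>+x. 9 * ennreal ((\<Phi> x)\<^sup>2) \<partial>\<mu>) < \<infinity>"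
      using fin by (simp add: nn_integral_cmult nsq_def ennreal_mult_less_top)
    show "AE x in \<mu>. (\<lambda>n. ennreal ((S n x - \<Phi> x)\<^sup>2)) \<longlonglongrightarrow> 0"
    proof (rule AE_I2)
      fix x assume "x \<in> space \<mu>"
      then have "(\<lambda>n. ennreal ((S n x - \<Phi> x)\<^sup>2)) \<longlonglongrightarrow> ennreal ((\<Phi> x - \<Phi> x)\<^sup>2)"
        by (intro tendsto_intros S)
      then show "(\<lambda>n. ennreal ((S n x - \<Phi> x)\<^sup>2)) \<longlonglongrightarrow> 0" by simp
    qed
  qed auto
  ultimately show ?thesis using S(1) by auto
qed

lemma ennreal_square_tendsto_0D:
  fixes x :: "'i \<Rightarrow> ennreal"
  assumes "((\<lambda>n. (x n)\<^sup>2) \<longlongrightarrow> 0) F"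
  shows "(x \<longlongrightarrow> 0) F"
proof (rule order_tendstoI)
  fix a :: ennreal assume "0 < a"
  then have "0 < a\<^sup>2" by (simp add: power2_eq_square ennreal_zero_less_mult_iff)
  with assms have "\<forall>\<^sub>F n in F. (x n)\<^sup>2 < a\<^sup>2" by (rule order_tendstoD)
  then show "\<forall>\<^sub>F n in F. x n < a"
    by eventually_elim (meson linorder_not_le power_mono zero_le)
qed auto

lemma nn_integral_mult_le_nsq:
  assumes [measurable]: "f \<in> borel_measurable M" "g \<in> borel_measurable M"
  shows "(\<integral>\<^sup>+x. ennreal \<bar>f x * g x\<bar> \<partial>M)\<^sup>2 \<le> nsq M f * nsq M g"
  using Cauchy_Schwarz_nn_integral[of "\<lambda>x. ennreal \<bar>f x\<bar>" M "\<lambda>x. ennreal \<bar>g x\<bar>"]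
  by (simp add: nsq_def abs_mult ennreal_mult ennreal_power)

lemma integrable_mult_L2:
  assumes [measurable]: "f \<in> borel_measurable M" "g \<in> borel_measurable M"
    and "nsq M f < \<infinity>" "nsq M g < \<infinity>"
  shows "integrable M (\<lambda>x. f x * g x)"
proof -
  have "(\<integral>\<^sup>+x. ennreal \<bar>f x * g x\<bar> \<partial>M)\<^sup>2 < \<infinity>"
    using nn_integral_mult_le_nsq[of f M g] assms(3,4)
    by (auto simp: ennreal_mult_less_top intro: le_less_trans)
  then have "(\<integral>\<^sup>+x. ennreal \<bar>f x * g x\<bar> \<partial>M) < \<infinity>" by (simp add: power_less_top_ennreal)
  then show ?thesis by (intro integrableI_bounded) auto
qed

lemma integrable_bounded_mult:
  fixes Z f :: "'a \<Rightarrow> real"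
  assumes [measurable]: "Z \<in> borel_measurable M" and "integrable M f"
    and "\<And>x. x \<in> space M \<Longrightarrow> \<bar>Z x\<bar> \<le> C"
  shows "integrable M (\<lambda>x. Z x * f x)"
proof (rule Bochner_Integration.integrable_bound)
  show "integrable M (\<lambda>x. C * f x)" using assms by simp
  show "(\<lambda>x. Z x * f x) \<in> borel_measurable M" using assms by measurable
  show "AE x in M. norm (Z x * f x) \<le> norm (C * f x)"
    using assms(3) by (intro AE_I2) (auto simp: abs_mult intro!: mult_right_mono order_trans[OF assms(3)])
qed

text \<open>The difference of the products is
  \<open>(A - a) (B - b) + a (B - b) + b (A - a)\<close>, and each term is handled by the
  Cauchy-Schwarz inequality. The bounded weight \<open>Z\<close> will carry the past of the
  noise.\<close>

lemma L2_mult_tendsto: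
  fixes A B :: "nat \<Rightarrow> 'a \<Rightarrow> real"
  assumes [measurable]: "\<And>n. A n \<in> borel_measurable M" "a \<in> borel_measurable M"
      "\<And>n. B n \<in> borel_measurable M" "b \<in> borel_measurable M" "Z \<in> borel_measurable M"
    and Z: "\<And>x. x \<in> space M \<Longrightarrow> \<bar>Z x\<bar> \<le> C"
    and a: "nsq M a < \<infinity>" and b: "nsq M b < \<infinity>"
    and An: "\<And>n. nsq M (A n) < \<infinity>" and Bn: "\<And>n. nsq M (B n) < \<infinity>"
    and A: "(\<lambda>n. nsq M (\<lambda>x. A n x - a x)) \<longlonglongrightarrow> 0" and B: "(\<lambda>n. nsq M (\<lambda>x. B n x - b x)) \<longlonglongrightarrow> 0"
  shows "(\<lambda>n. \<integral>x. Z x * (A n x * B n x) \<partial>M) \<longlonglongrightarrow> (\<integral>x. Z x * (a x * b x) \<partial>M)"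
proof (rule tendsto_L1_int)
  show "integrable M (\<lambda>x. Z x * (A n x * B n x))" for n
    using Z An Bn by (intro integrable_bounded_mult integrable_mult_L2) auto
  show "integrable M (\<lambda>x. Z x * (a x * b x))"
    using Z a b by (intro integrable_bounded_mult integrable_mult_L2) auto
  let ?I = "\<lambda>f g. \<integral>\<^sup>+x. ennreal \<bar>f x * g x\<bar> \<partial>M"
  have t: "(\<lambda>n. ?I (f n) (g n)) \<longlonglongrightarrow> 0"
    if "\<And>n. f n \<in> borel_measurable M" "\<And>n. g n \<in> borel_measurable M" "(\<lambda>n. nsq M (f n) * nsq M (g n)) \<longlonglongrightarrow> 0" for f g
    by (rule ennreal_square_tendsto_0D, rule tendsto_sandwich[OF _ _ tendsto_const that(3)])
       (use nn_integral_mult_le_nsq[OF that(1,2)] in auto)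
  have t1: "(\<lambda>n. ?I (\<lambda>x. A n x - a x) (\<lambda>x. B n x - b x)) \<longlonglongrightarrow> 0"
  proof (rule t)
    show "(\<lambda>n. nsq M (\<lambda>x. A n x - a x) * nsq M (\<lambda>x. B n x - b x)) \<longlonglongrightarrow> 0"
      using tendsto_mult_ennreal[OF A B] by simp
  qed auto
  have t2: "(\<lambda>n. ?I a (\<lambda>x. B n x - b x)) \<longlonglongrightarrow> 0"
  proof (rule t)
    show "(\<lambda>n. nsq M a * nsq M (\<lambda>x. B n x - b x)) \<longlonglongrightarrow> 0"
      using ennreal_tendsto_cmult[OF _ B, of "nsq M a"] a by simp
  qed auto
  have t3: "(\<lambda>n. ?I b (\<lambda>x. A n x - a x)) \<longlonglongrightarrow> 0"
  proof (rule t)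
    show "(\<lambda>n. nsq M b * nsq M (\<lambda>x. A n x - a x)) \<longlonglongrightarrow> 0"
      using ennreal_tendsto_cmult[OF _ A, of "nsq M b"] b by simp
  qed auto
  let ?S = "\<lambda>n. ?I (\<lambda>x. A n x - a x) (\<lambda>x. B n x - b x) + ?I a (\<lambda>x. B n x - b x) + ?I b (\<lambda>x. A n x - a x)"
  have "(\<lambda>n. ennreal \<bar>C\<bar> * ?S n) \<longlonglongrightarrow> ennreal \<bar>C\<bar> * (0 + 0 + 0)"
    by (intro ennreal_tendsto_cmult tendsto_add t1 t2 t3) simp
  then have S: "(\<lambda>n. ennreal \<bar>C\<bar> * ?S n) \<longlonglongrightarrow> 0" by simp
  show "(\<lambda>n. \<integral>\<^sup>+x. ennreal (norm (Z x * (A n x * B n x) - Z x * (a x * b x))) \<partial>M) \<longlonglongrightarrow> 0"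
  proof (rule tendsto_sandwich[OF _ _ tendsto_const S])
    show "\<forall>\<^sub>F n in sequentially. (\<integral>\<^sup>+x. ennreal (norm (Z x * (A n x * B n x) - Z x * (a x * b x))) \<partial>M) \<le> ennreal \<bar>C\<bar> * ?S n"
    proof (intro always_eventually allI)
      fix n
      have "(\<integral>\<^sup>+x. ennreal (norm (Z x * (A n x * B n x) - Z x * (a x * b x))) \<partial>M)
        \<le> (\<integral>\<^sup>+x. ennreal \<bar>C\<bar> * (ennreal \<bar>(A n x - a x) * (B n x - b x)\<bar> + ennreal \<bar>a x * (B n x - b x)\<bar> + ennreal \<bar>b x * (A n x - a x)\<bar>) \<partial>M)"
      proof (rule nn_integral_mono)
        fix x assume x: "x \<in> space M"
        let ?u = "(A n x - a x) * (B n x - b x)" and ?v = "a x * (B n x - b x)" and ?w = "b x * (A n x - a x)"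
        have "Z x * (A n x * B n x) - Z x * (a x * b x) = Z x * (?u + ?v + ?w)" by (simp add: algebra_simps)
        then have "norm (Z x * (A n x * B n x) - Z x * (a x * b x)) = \<bar>Z x\<bar> * \<bar>?u + ?v + ?w\<bar>"
          by (simp only: real_norm_def abs_mult)
        also have "\<dots> \<le> \<bar>C\<bar> * (\<bar>?u\<bar> + \<bar>?v\<bar> + \<bar>?w\<bar>)"
          using Z[OF x] by (intro mult_mono) auto
        finally have "ennreal (norm (Z x * (A n x * B n x) - Z x * (a x * b x))) \<le> ennreal (\<bar>C\<bar> * (\<bar>?u\<bar> + \<bar>?v\<bar> + \<bar>?w\<bar>))"
          by (rule ennreal_leI)
        then show "ennreal (norm (Z x * (A n x * B n x) - Z x * (a x * b x))) \<le> ennreal \<bar>C\<bar> * (ennreal \<bar>?u\<bar> + ennreal \<bar>?v\<bar> + ennreal \<bar>?w\<bar>)"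
          by (simp add: ennreal_mult)
      qed
      also have "\<dots> = ennreal \<bar>C\<bar> * ?S n"
        by (simp add: nn_integral_cmult nn_integral_add)
      finally show "(\<integral>\<^sup>+x. ennreal (norm (Z x * (A n x * B n x) - Z x * (a x * b x))) \<partial>M) \<le> ennreal \<bar>C\<bar> * ?S n" .
    qed
  qed simp
qed

section \<open>Compensated integrals\<close>

definition sets_off :: "'z measure \<Rightarrow> ('z \<Rightarrow> real) \<Rightarrow> real \<Rightarrow> 'z set" where
  "sets_off \<mu> S y = S -` {y} \<inter> space \<mu>"

definition nonzero_values :: "'z measure \<Rightarrow> ('z \<Rightarrow> real) \<Rightarrow> real set" where
  "nonzero_values \<mu> S = S ` space \<mu> - {0}"

lemma
  assumes S: "simple_function \<mu> S" "integrable \<mu> S"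
  shows finite_nonzero_values: "finite (nonzero_values \<mu> S)"
    and sets_sets_off: "sets_off \<mu> S y \<in> sets \<mu>"
    and finite_sets_off: "y \<noteq> 0 \<Longrightarrow> emeasure \<mu> (sets_off \<mu> S y) < \<infinity>"
proof -
  show "finite (nonzero_values \<mu> S)" using S by (auto simp: nonzero_values_def simple_function_def)
  show m[measurable]: "sets_off \<mu> S y \<in> sets \<mu>"
    using borel_measurable_simple_function[OF S(1)] unfolding sets_off_def by measurable
  assume y: "y \<noteq> 0"
  have "ennreal \<bar>y\<bar> * emeasure \<mu> (sets_off \<mu> S y) = (\<integral>\<^sup>+x. ennreal \<bar>y\<bar> * indicator (sets_off \<mu> S y) x \<partial>\<mu>)"
    by (simp add: nn_integral_cmult_indicator)
  also have "\<dots> \<le> (\<integral>\<^sup>+x. ennreal (norm (S x)) \<partial>\<mu>)"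
    by (intro nn_integral_mono) (auto simp: sets_off_def indicator_def)
  also have "\<dots> < \<infinity>" using S(2) by (simp add: integrable_iff_bounded)
  finally show "emeasure \<mu> (sets_off \<mu> S y) < \<infinity>"
    using y by (auto simp: ennreal_mult_less_top)
qed

lemma simple_expansion:
  assumes S: "finite (nonzero_values \<mu> S)" and x: "x \<in> space \<mu>"
  shows "S x = (\<Sum>y\<in>nonzero_values \<mu> S. y * indicator (sets_off \<mu> S y) x)"
proof (cases "S x = 0")
  case True
  then show ?thesis by (auto simp: sets_off_def nonzero_values_def intro!: sum.neutral[symmetric])
next
  case False
  then have "S x \<in> nonzero_values \<mu> S" using x by (auto simp: nonzero_values_def)
  have "(\<Sum>y\<in>nonzero_values \<mu> S. y * indicator (sets_off \<mu> S y) x) = (\<Sum>y\<in>{S x}. y * indicator (sets_off \<mu> S y) x)"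
    using S \<open>S x \<in> nonzero_values \<mu> S\<close>
    by (intro sum.mono_neutral_right) (auto simp: sets_off_def)
  then show ?thesis using x by (simp add: sets_off_def)
qed

lemma has_integral_simple:
  assumes S: "finite (nonzero_values \<mu> S)" and Q: "sets Q = sets \<mu>"
    and D: "\<And>y. y \<in> nonzero_values \<mu> S \<Longrightarrow> sets_off \<mu> S y \<in> sets Q \<and> emeasure Q (sets_off \<mu> S y) < \<infinity>"
  shows "has_bochner_integral Q S (\<Sum>y\<in>nonzero_values \<mu> S. y * measure Q (sets_off \<mu> S y))"
proof -
  have "has_bochner_integral Q (\<lambda>x. \<Sum>y\<in>nonzero_values \<mu> S. y * indicator (sets_off \<mu> S y) x)
      (\<Sum>y\<in>nonzero_values \<mu> S. y * measure Q (sets_off \<mu> S y))"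
    using D by (intro has_bochner_integral_sum has_bochner_integral_mult_right has_bochner_integral_real_indicator) auto
  moreover have "space Q = space \<mu>" using Q by (rule sets_eq_imp_space_eq)
  ultimately show ?thesis
    using simple_expansion[OF S] by (subst has_bochner_integral_cong[OF refl _ refl]) auto
qed

text \<open>The compensated integral of a simple function, read off from the counts. It agrees with
  the pathwise integral only almost surely: on a null event a level set may have infinite count,
  which \<open>enn2real\<close> sends to \<open>0\<close>.\<close>

definition comp_fun :: "'z measure \<Rightarrow> ('z \<Rightarrow> real) \<Rightarrow> ('z set \<Rightarrow> ennreal) \<Rightarrow> real" where
  "comp_fun \<mu> S c = (\<Sum>y\<in>nonzero_values \<mu> S. y * (enn2real (c (sets_off \<mu> S y)) - measure \<mu> (sets_off \<mu> S y)))"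

lemma measurable_comp_fun:
  assumes "simple_function \<mu> S" "integrable \<mu> S"
  shows "comp_fun \<mu> S \<in> borel_measurable (cnt_space (sets \<mu>))"
  unfolding comp_fun_def[abs_def]
  using sets_sets_off[OF assms]
  by (intro borel_measurable_sum borel_measurable_times borel_measurable_diff borel_measurable_const
      measurable_compose[OF measurable_component_singleton]) auto

section \<open>Isometry and covariances of compensated integrals\<close>

context prm
begin

text \<open>The product rule in the form in which it is used: the factors are functions of counts in
  separate regions only up to null sets.\<close>

lemma indep_integral:
  fixes f :: "_ \<Rightarrow> real" and g :: "_ \<Rightarrow> real"
  assumes I: "Ia \<subseteq> sets \<mu>" "Ib \<subseteq> sets \<mu>" and disj: "\<And>A B. A \<in> Ia \<Longrightarrow> B \<in> Ib \<Longrightarrow> A \<inter> B = {}"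
    and f: "f \<in> borel_measurable (cnt_space Ia)" and g: "g \<in> borel_measurable (cnt_space Ib)"
    and X: "AE \<omega> in M. X \<omega> = f (cnt N Ia \<omega>)" "integrable M X"
    and Y: "AE \<omega> in M. Y \<omega> = g (cnt N Ib \<omega>)" "integrable M Y"
  shows "integrable M (\<lambda>\<omega>. X \<omega> * Y \<omega>)" "(\<integral>\<omega>. X \<omega> * Y \<omega> \<partial>M) = (\<integral>\<omega>. X \<omega> \<partial>M) * (\<integral>\<omega>. Y \<omega> \<partial>M)"
proof -
  let ?X = "f \<circ> cnt N Ia" and ?Y = "g \<circ> cnt N Ib"
  have ind: "indep_var borel ?X borel ?Y"
    by (rule indep_var_compose[OF indep_cnt[OF I disj] f g])
  have Xm: "?X \<in> borel_measurable M" by (rule measurable_comp[OF measurable_cnt[OF I(1)] f])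
  have Ym: "?Y \<in> borel_measurable M" by (rule measurable_comp[OF measurable_cnt[OF I(2)] g])
  have XAE: "AE \<omega> in M. X \<omega> = ?X \<omega>" and YAE: "AE \<omega> in M. Y \<omega> = ?Y \<omega>" using X Y by auto
  have Xi: "integrable M ?X" using integrable_cong_AE_imp[OF X(2) Xm] XAE by (auto simp: eq_commute)
  have Yi: "integrable M ?Y" using integrable_cong_AE_imp[OF Y(2) Ym] YAE by (auto simp: eq_commute)
  have XY: "AE \<omega> in M. ?X \<omega> * ?Y \<omega> = X \<omega> * Y \<omega>" using XAE YAE by eventually_elim simp
  have m: "(\<lambda>\<omega>. X \<omega> * Y \<omega>) \<in> borel_measurable M" using X(2) Y(2) by measurable
  show "integrable M (\<lambda>\<omega>. X \<omega> * Y \<omega>)"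
    by (rule integrable_cong_AE_imp[OF indep_var_integrable[OF ind Xi Yi] m XY])
  have "(\<integral>\<omega>. X \<omega> * Y \<omega> \<partial>M) = (\<integral>\<omega>. ?X \<omega> * ?Y \<omega> \<partial>M)"
    using XY m Xm Ym by (intro integral_cong_AE) (auto simp: comp_def)
  also have "\<dots> = (\<integral>\<omega>. ?X \<omega> \<partial>M) * (\<integral>\<omega>. ?Y \<omega> \<partial>M)"
    by (rule indep_var_lebesgue_integral[OF ind Xi Yi])
  also have "\<dots> = (\<integral>\<omega>. X \<omega> \<partial>M) * (\<integral>\<omega>. Y \<omega> \<partial>M)"
    using XAE YAE X(2) Y(2) Xm Ym by (intro arg_cong2[where f="(*)"] integral_cong_AE) (auto simp: comp_def)
  finally show "(\<integral>\<omega>. X \<omega> * Y \<omega> \<partial>M) = (\<integral>\<omega>. X \<omega> \<partial>M) * (\<integral>\<omega>. Y \<omega> \<partial>M)" .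
qed

lemma Ntil_cnt: "A \<in> I \<Longrightarrow> Ntil A \<omega> = enn2real (cnt N I \<omega> A) - measure \<mu> A"
  by (simp add: Ntil_def cnt_def measure_def)

lemma AE_Ntil_cnt: "A \<in> I \<Longrightarrow> AE \<omega> in M. Ntil A \<omega> = enn2real (cnt N I \<omega> A) - measure \<mu> A"
  by (simp add: Ntil_cnt)

lemma measurable_Ntil_cnt: "A \<in> I \<Longrightarrow> (\<lambda>c. enn2real (c A) - measure \<mu> A) \<in> borel_measurable (cnt_space I)"
  by (intro borel_measurable_diff borel_measurable_const measurable_compose[OF measurable_component_singleton]) auto

lemma nsq_Ntil: "A \<in> sets \<mu> \<Longrightarrow> emeasure \<mu> A < \<infinity> \<Longrightarrow> nsq M (Ntil A) < \<infinity>"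
  using integrable_square_nsq[OF integrable_Ntil2[of A]] by simp

lemma integrable_Ntil_mult:
  assumes "D \<in> sets \<mu>" "emeasure \<mu> D < \<infinity>" "E \<in> sets \<mu>" "emeasure \<mu> E < \<infinity>"
  shows "integrable M (\<lambda>\<omega>. Ntil D \<omega> * Ntil E \<omega>)"
  using assms by (intro integrable_mult_L2 nsq_Ntil measurable_Ntil) auto

text \<open>Almost surely only: \<open>measure\<close> is \<open>0\<close> on a set of infinite
  count, where additivity breaks down.\<close>

lemma Ntil_Un:
  assumes D: "D \<in> sets \<mu>" "emeasure \<mu> D < \<infinity>" "E \<in> sets \<mu>" "emeasure \<mu> E < \<infinity>" "D \<inter> E = {}"
  shows "AE \<omega> in M. Ntil (D \<union> E) \<omega> = Ntil D \<omega> + Ntil E \<omega>"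
  using AE_N_nat[OF D(1,2)] AE_N_nat[OF D(3,4)] AE_space
proof eventually_elim
  case (elim \<omega>)
  then have "measure (N \<omega>) (D \<union> E) = measure (N \<omega>) D + measure (N \<omega>) E"
    using D sets_N by (intro measure_Union) auto
  moreover have "measure \<mu> (D \<union> E) = measure \<mu> D + measure \<mu> E"
    using D by (intro measure_Union) auto
  ultimately show ?case by (simp add: Ntil_def)
qed

lemma integral_Ntil_disjoint:
  assumes D: "D \<in> sets \<mu>" "emeasure \<mu> D < \<infinity>" "E \<in> sets \<mu>" "emeasure \<mu> E < \<infinity>" "D \<inter> E = {}"
  shows "(\<integral>\<omega>. Ntil D \<omega> * Ntil E \<omega> \<partial>M) = 0"
proof -
  have "(\<integral>\<omega>. Ntil D \<omega> * Ntil E \<omega> \<partial>M) = (\<integral>\<omega>. Ntil D \<omega> \<partial>M) * (\<integral>\<omega>. Ntil E \<omega> \<partial>M)"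
    by (rule indep_integral(2)[where Ia="{D}" and Ib="{E}" and f="\<lambda>c. enn2real (c D) - measure \<mu> D" and g="\<lambda>c. enn2real (c E) - measure \<mu> E"])
       (use D in \<open>auto intro!: measurable_Ntil_cnt integrable_Ntil AE_Ntil_cnt\<close>)
  then show ?thesis using D by (simp add: integral_Ntil)
qed

text \<open>Both sets are cut along their intersection. The pieces are disjoint, so all mixed terms
  are products of centered independent variables and vanish; what remains is the variance of the
  common part.\<close>

lemma integral_Ntil_mult:
  assumes D: "D \<in> sets \<mu>" "emeasure \<mu> D < \<infinity>" "E \<in> sets \<mu>" "emeasure \<mu> E < \<infinity>"
  shows "(\<integral>\<omega>. Ntil D \<omega> * Ntil E \<omega> \<partial>M) = measure \<mu> (D \<inter> E)"
proof -
  let ?P = "D \<inter> E" and ?D = "D - E" and ?E = "E - D"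
  have fin: "?P \<in> sets \<mu>" "?D \<in> sets \<mu>" "?E \<in> sets \<mu>"
    "emeasure \<mu> ?P < \<infinity>" "emeasure \<mu> ?D < \<infinity>" "emeasure \<mu> ?E < \<infinity>"
    using D by (auto intro: le_less_trans[OF emeasure_mono])
  have 1: "AE \<omega> in M. Ntil (?P \<union> ?D) \<omega> = Ntil ?P \<omega> + Ntil ?D \<omega>"
    by (rule Ntil_Un) (use fin in auto)
  have 2: "AE \<omega> in M. Ntil (?P \<union> ?E) \<omega> = Ntil ?P \<omega> + Ntil ?E \<omega>"
    by (rule Ntil_Un) (use fin in auto)
  have e: "?P \<union> ?D = D" "?P \<union> ?E = E" by auto
  have "(\<integral>\<omega>. Ntil D \<omega> * Ntil E \<omega> \<partial>M) = (\<integral>\<omega>. (Ntil ?P \<omega>)\<^sup>2 + Ntil ?P \<omega> * Ntil ?E \<omega> + Ntil ?D \<omega> * Ntil ?P \<omega> + Ntil ?D \<omega> * Ntil ?E \<omega> \<partial>M)"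
  proof (intro integral_cong_AE)
    show "AE \<omega> in M. Ntil D \<omega> * Ntil E \<omega> = (Ntil ?P \<omega>)\<^sup>2 + Ntil ?P \<omega> * Ntil ?E \<omega> + Ntil ?D \<omega> * Ntil ?P \<omega> + Ntil ?D \<omega> * Ntil ?E \<omega>"
      using 1 2 unfolding e by eventually_elim (simp add: power2_eq_square algebra_simps)
  qed (use D fin in \<open>auto intro!: borel_measurable_add borel_measurable_times borel_measurable_power measurable_Ntil\<close>)
  also have "\<dots> = measure \<mu> ?P"
  proof -
    have d: "(D \<inter> E) \<inter> (E - D) = {}" "(D - E) \<inter> (D \<inter> E) = {}" "(D - E) \<inter> (E - D) = {}" by auto
    show ?thesis using fin integral_Ntil2[OF fin(1,4)] integrable_Ntil2[OF fin(1,4)]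
      integrable_Ntil_mult[OF fin(1,4) fin(3,6)] integrable_Ntil_mult[OF fin(2,5) fin(1,4)] integrable_Ntil_mult[OF fin(2,5) fin(3,6)]
      integral_Ntil_disjoint[OF fin(1,4) fin(3,6) d(1)] integral_Ntil_disjoint[OF fin(2,5) fin(1,4) d(2)] integral_Ntil_disjoint[OF fin(2,5) fin(3,6) d(3)]
    by auto
  qed
  finally show ?thesis .
qed

text \<open>The martingale property as a covariance formula. \<open>D\<close> is cut along the past
  region \<open>R\<close>: together with \<open>Z\<close> the inner part is independent of the
  centered count of \<open>E\<close>, and contributes nothing; \<open>Z\<close> is independent of
  the product formed from the outer part and \<open>E\<close>. No condition ties \<open>D\<close> to
  \<open>R\<close>, which is what overlapping time intervals require later.\<close>

lemma integral_past_Ntil_mult: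
  assumes R: "R \<in> sets \<mu>" and I: "I \<subseteq> sets \<mu>" "\<And>A. A \<in> I \<Longrightarrow> A \<subseteq> R"
    and z: "z \<in> borel_measurable (cnt_space I)" and Z: "AE \<omega> in M. Z \<omega> = z (cnt N I \<omega>)"
    and Zm[measurable]: "Z \<in> borel_measurable M" and Zb: "\<And>\<omega>. \<omega> \<in> space M \<Longrightarrow> \<bar>Z \<omega>\<bar> \<le> C"
    and D: "D \<in> sets \<mu>" "emeasure \<mu> D < \<infinity>" and E: "E \<in> sets \<mu>" "emeasure \<mu> E < \<infinity>" "E \<inter> R = {}"
  shows "(\<integral>\<omega>. Z \<omega> * (Ntil D \<omega> * Ntil E \<omega>) \<partial>M) = (\<integral>\<omega>. Z \<omega> \<partial>M) * measure \<mu> (D \<inter> E)"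
proof -
  let ?P = "D \<inter> R" and ?F = "D - R"
  have fin: "?P \<in> sets \<mu>" "?F \<in> sets \<mu>" "emeasure \<mu> ?P < \<infinity>" "emeasure \<mu> ?F < \<infinity>"
    using D R by (auto intro: le_less_trans[OF emeasure_mono])
  have 1: "AE \<omega> in M. Ntil (?P \<union> ?F) \<omega> = Ntil ?P \<omega> + Ntil ?F \<omega>"
    by (rule Ntil_Un) (use fin in auto)
  have e: "?P \<union> ?F = D" by auto
  have ZPi: "integrable M (\<lambda>\<omega>. Z \<omega> * Ntil ?P \<omega>)"
    using fin Zb by (intro integrable_bounded_mult integrable_Ntil) auto
  have Zi: "integrable M Z"
    using integrable_bounded_mult[OF Zm, of "\<lambda>_. 1" C] Zb by simp
  have IP: "insert ?P I \<subseteq> sets \<mu>" using I fin by auto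
  have E1: "{E} \<subseteq> sets \<mu>" "{?F, E} \<subseteq> sets \<mu>" using E fin by auto
  have disj1: "A \<inter> B = {}" if "A \<in> insert ?P I" "B \<in> {E}" for A B using that I E by auto
  have disj2: "A \<inter> B = {}" if "A \<in> I" "B \<in> {?F, E}" for A B using that I E by auto
  have f1: "(\<lambda>c. z (restrict c I) * (enn2real (c ?P) - measure \<mu> ?P)) \<in> borel_measurable (cnt_space (insert ?P I))"
    by (intro borel_measurable_times measurable_Ntil_cnt measurable_compose[OF measurable_restrict_subset z]) auto
  have f2: "(\<lambda>c. (enn2real (c ?F) - measure \<mu> ?F) * (enn2real (c E) - measure \<mu> E)) \<in> borel_measurable (cnt_space {?F, E})"
    by (intro borel_measurable_times measurable_Ntil_cnt) auto
  have X1: "AE \<omega> in M. Z \<omega> * Ntil ?P \<omega> = z (restrict (cnt N (insert ?P I) \<omega>) I) * (enn2real (cnt N (insert ?P I) \<omega> ?P) - measure \<mu> ?P)"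
    using Z
  proof eventually_elim
    case (elim \<omega>)
    have "restrict (cnt N (insert ?P I) \<omega>) I = cnt N I \<omega>" by (auto simp: cnt_def fun_eq_iff)
    then show ?case using elim by (simp add: Ntil_cnt[of ?P "insert ?P I"])
  qed
  have X2: "AE \<omega> in M. Ntil ?F \<omega> * Ntil E \<omega> = (enn2real (cnt N {?F, E} \<omega> ?F) - measure \<mu> ?F) * (enn2real (cnt N {?F, E} \<omega> E) - measure \<mu> E)"
    by (simp add: Ntil_cnt[of ?F "{?F,E}"] Ntil_cnt[of E "{?F,E}"])
  have E2: "AE \<omega> in M. Ntil E \<omega> = enn2real (cnt N {E} \<omega> E) - measure \<mu> E"
    by (rule AE_Ntil_cnt) simp
  have E3: "(\<lambda>c. enn2real (c E) - measure \<mu> E) \<in> borel_measurable (cnt_space {E})"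
    by (rule measurable_Ntil_cnt) simp
  note PE = indep_integral[OF IP E1(1) disj1 f1 E3 X1 ZPi E2 integrable_Ntil[OF E(1,2)]]
  note FE = indep_integral[OF I(1) E1(2) disj2 z f2 Z Zi X2 integrable_Ntil_mult[OF fin(2,4) E(1,2)]]
  have "(\<integral>\<omega>. Z \<omega> * (Ntil D \<omega> * Ntil E \<omega>) \<partial>M) = (\<integral>\<omega>. (Z \<omega> * Ntil ?P \<omega>) * Ntil E \<omega> + Z \<omega> * (Ntil ?F \<omega> * Ntil E \<omega>) \<partial>M)"
  proof (intro integral_cong_AE)
    show "AE \<omega> in M. Z \<omega> * (Ntil D \<omega> * Ntil E \<omega>) = (Z \<omega> * Ntil ?P \<omega>) * Ntil E \<omega> + Z \<omega> * (Ntil ?F \<omega> * Ntil E \<omega>)"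
      using 1 unfolding e by eventually_elim (simp add: algebra_simps)
  qed (use D E fin in \<open>auto intro!: borel_measurable_add borel_measurable_times measurable_Ntil\<close>)
  also have "\<dots> = (\<integral>\<omega>. Z \<omega> \<partial>M) * measure \<mu> (?F \<inter> E)"
    using PE FE E fin by (simp add: integral_Ntil integral_Ntil_mult)
  also have "?F \<inter> E = D \<inter> E" using E by auto
  finally show ?thesis .
qed

lemma comp_simple:
  assumes S: "simple_function \<mu> S" "integrable \<mu> S"
  shows "AE \<omega> in M. integrable (N \<omega>) S \<and>
    compensated_integral N \<mu> S \<omega> = (\<Sum>y\<in>nonzero_values \<mu> S. y * Ntil (sets_off \<mu> S y) \<omega>)"
proof -
  have D: "sets_off \<mu> S y \<in> sets \<mu> \<and> emeasure \<mu> (sets_off \<mu> S y) < \<infinity>" if "y \<in> nonzero_values \<mu> S" for y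
    using that sets_sets_off[OF S] finite_sets_off[OF S] by (auto simp: nonzero_values_def)
  note fin = finite_nonzero_values[OF S]
  have "AE \<omega> in M. \<forall>y\<in>nonzero_values \<mu> S. emeasure (N \<omega>) (sets_off \<mu> S y) < \<infinity>"
  proof (intro AE_finite_allI fin)
    fix y assume "y \<in> nonzero_values \<mu> S"
    from AE_N_nat[of "sets_off \<mu> S y"] D[OF this]
    have "AE \<omega> in M. \<exists>k::nat. emeasure (N \<omega>) (sets_off \<mu> S y) = of_nat k" by auto
    then show "AE \<omega> in M. emeasure (N \<omega>) (sets_off \<mu> S y) < \<infinity>" by eventually_elim (auto simp: ennreal_of_nat_eq_real_of_nat)
  qed
  then show ?thesis
    using AE_space
  proof eventually_elim
    case (elim \<omega>)
    have 1: "has_bochner_integral (N \<omega>) S (\<Sum>y\<in>nonzero_values \<mu> S. y * measure (N \<omega>) (sets_off \<mu> S y))"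
      using elim sets_N D by (intro has_integral_simple[OF fin]) auto
    have 2: "has_bochner_integral \<mu> S (\<Sum>y\<in>nonzero_values \<mu> S. y * measure \<mu> (sets_off \<mu> S y))"
      using D by (intro has_integral_simple[OF fin]) auto
    show ?case
      using 1 2 by (auto simp: has_bochner_integral_iff compensated_integral_def Ntil_def sum_subtractf algebra_simps)
  qed
qed

lemma comp_simple_cnt:
  assumes S: "simple_function \<mu> S" "integrable \<mu> S"
  shows "AE \<omega> in M. compensated_integral N \<mu> S \<omega> = comp_fun \<mu> S (cnt N (sets \<mu>) \<omega>)"
  using comp_simple[OF S]
  by eventually_elim (use sets_sets_off[OF S] in \<open>simp add: comp_fun_def Ntil_cnt[of _ "sets \<mu>"]\<close>)

lemma comp_fun_cnt:
  assumes S: "simple_function \<mu> S" "integrable \<mu> S"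
  shows "comp_fun \<mu> S (cnt N (sets \<mu>) \<omega>) = (\<Sum>y\<in>nonzero_values \<mu> S. y * Ntil (sets_off \<mu> S y) \<omega>)"
  using sets_sets_off[OF S] by (simp add: comp_fun_def Ntil_cnt[of _ "sets \<mu>"])

lemma measurable_comp_fun_cnt[measurable]:
  assumes S: "simple_function \<mu> S" "integrable \<mu> S"
  shows "(\<lambda>\<omega>. comp_fun \<mu> S (cnt N (sets \<mu>) \<omega>)) \<in> borel_measurable M"
  by (rule measurable_compose[OF measurable_cnt measurable_comp_fun[OF S]]) auto

lemma integral_past_comp_fun_mult:
  assumes R: "R \<in> sets \<mu>" and I: "I \<subseteq> sets \<mu>" "\<And>A. A \<in> I \<Longrightarrow> A \<subseteq> R"
    and z: "z \<in> borel_measurable (cnt_space I)" and Z: "AE \<omega> in M. Z \<omega> = z (cnt N I \<omega>)"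
    and Zm[measurable]: "Z \<in> borel_measurable M" and Zb: "\<And>\<omega>. \<omega> \<in> space M \<Longrightarrow> \<bar>Z \<omega>\<bar> \<le> C"
    and S: "simple_function \<mu> S" "integrable \<mu> S" and T: "simple_function \<mu> T" "integrable \<mu> T"
    and TR: "\<And>p. p \<in> R \<Longrightarrow> T p = 0"
  shows "(\<integral>\<omega>. Z \<omega> * (comp_fun \<mu> S (cnt N (sets \<mu>) \<omega>) * comp_fun \<mu> T (cnt N (sets \<mu>) \<omega>)) \<partial>M) = (\<integral>\<omega>. Z \<omega> \<partial>M) * (\<integral>p. S p * T p \<partial>\<mu>)"
proof -
  let ?V = "nonzero_values \<mu> S" and ?W = "nonzero_values \<mu> T"
  let ?D = "sets_off \<mu> S" and ?E = "sets_off \<mu> T"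
  have D: "?D y \<in> sets \<mu>" "emeasure \<mu> (?D y) < \<infinity>" if "y \<in> ?V" for y
    using that sets_sets_off[OF S] finite_sets_off[OF S] by (auto simp: nonzero_values_def)
  have E: "?E y \<in> sets \<mu>" "emeasure \<mu> (?E y) < \<infinity>" "?E y \<inter> R = {}" if "y \<in> ?W" for y
    using that sets_sets_off[OF T] finite_sets_off[OF T] TR by (auto simp: nonzero_values_def sets_off_def)
  note fin = finite_nonzero_values[OF S] finite_nonzero_values[OF T]
  have int: "integrable M (\<lambda>\<omega>. Z \<omega> * (Ntil (?D y) \<omega> * Ntil (?E y') \<omega>))" if "y \<in> ?V" "y' \<in> ?W" for y y'
    using Zb D[OF that(1)] E[OF that(2)] by (intro integrable_bounded_mult integrable_Ntil_mult) auto
  have "(\<integral>\<omega>. Z \<omega> * (comp_fun \<mu> S (cnt N (sets \<mu>) \<omega>) * comp_fun \<mu> T (cnt N (sets \<mu>) \<omega>)) \<partial>M)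
      = (\<integral>\<omega>. (\<Sum>y\<in>?V. \<Sum>y'\<in>?W. (y * y') * (Z \<omega> * (Ntil (?D y) \<omega> * Ntil (?E y') \<omega>))) \<partial>M)"
  proof (intro Bochner_Integration.integral_cong refl)
    fix \<omega>
    have "comp_fun \<mu> S (cnt N (sets \<mu>) \<omega>) * comp_fun \<mu> T (cnt N (sets \<mu>) \<omega>)
      = (\<Sum>y\<in>?V. \<Sum>y'\<in>?W. (y * y') * (Ntil (?D y) \<omega> * Ntil (?E y') \<omega>))"
      unfolding comp_fun_cnt[OF S] comp_fun_cnt[OF T] sum_product by (intro sum.cong refl) simp
    then show "Z \<omega> * (comp_fun \<mu> S (cnt N (sets \<mu>) \<omega>) * comp_fun \<mu> T (cnt N (sets \<mu>) \<omega>))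
      = (\<Sum>y\<in>?V. \<Sum>y'\<in>?W. (y * y') * (Z \<omega> * (Ntil (?D y) \<omega> * Ntil (?E y') \<omega>)))"
      by (simp add: sum_distrib_left mult.left_commute)
  qed
  also have "\<dots> = (\<Sum>y\<in>?V. \<Sum>y'\<in>?W. (y * y') * (\<integral>\<omega>. Z \<omega> * (Ntil (?D y) \<omega> * Ntil (?E y') \<omega>) \<partial>M))"
  proof (rule has_bochner_integral_integral_eq)
    show "has_bochner_integral M (\<lambda>\<omega>. \<Sum>y\<in>?V. \<Sum>y'\<in>?W. (y * y') * (Z \<omega> * (Ntil (?D y) \<omega> * Ntil (?E y') \<omega>)))
      (\<Sum>y\<in>?V. \<Sum>y'\<in>?W. (y * y') * (\<integral>\<omega>. Z \<omega> * (Ntil (?D y) \<omega> * Ntil (?E y') \<omega>) \<partial>M))"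
      by (intro has_bochner_integral_sum has_bochner_integral_mult_right has_bochner_integral_integrable int)
  qed
  also have "\<dots> = (\<Sum>y\<in>?V. \<Sum>y'\<in>?W. (y * y') * ((\<integral>\<omega>. Z \<omega> \<partial>M) * measure \<mu> (?D y \<inter> ?E y')))"
    using D E by (intro sum.cong refl arg_cong2[where f="(*)"] integral_past_Ntil_mult[OF R I z Z Zm Zb]) auto
  also have "\<dots> = (\<integral>\<omega>. Z \<omega> \<partial>M) * (\<Sum>y\<in>?V. \<Sum>y'\<in>?W. (y * y') * measure \<mu> (?D y \<inter> ?E y'))"
    by (simp add: sum_distrib_left algebra_simps)
  also have "(\<Sum>y\<in>?V. \<Sum>y'\<in>?W. (y * y') * measure \<mu> (?D y \<inter> ?E y')) = (\<integral>p. (\<Sum>y\<in>?V. \<Sum>y'\<in>?W. (y * y') * indicator (?D y \<inter> ?E y') p) \<partial>\<mu>)"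
  proof -
    have "has_bochner_integral \<mu> (\<lambda>p. \<Sum>y\<in>?V. \<Sum>y'\<in>?W. (y * y') * indicator (?D y \<inter> ?E y') p)
      (\<Sum>y\<in>?V. \<Sum>y'\<in>?W. (y * y') * measure \<mu> (?D y \<inter> ?E y'))"
    proof (intro has_bochner_integral_sum has_bochner_integral_mult_right has_bochner_integral_real_indicator)
      fix y y' assume "y \<in> ?V" "y' \<in> ?W"
      note * = D[OF this(1)] E[OF this(2)]
      then show "?D y \<inter> ?E y' \<in> sets \<mu>" by auto
      have "emeasure \<mu> (?D y \<inter> ?E y') \<le> emeasure \<mu> (?D y)" using * by (intro emeasure_mono) auto
      then show "emeasure \<mu> (?D y \<inter> ?E y') < \<infinity>" using * by (auto intro: le_less_trans)
    qed
    then show ?thesis by (simp add: has_bochner_integral_iff)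
  qed
  also have "\<dots> = (\<integral>p. S p * T p \<partial>\<mu>)"
  proof (intro Bochner_Integration.integral_cong refl)
    fix p assume p: "p \<in> space \<mu>"
    show "(\<Sum>y\<in>?V. \<Sum>y'\<in>?W. (y * y') * indicator (?D y \<inter> ?E y') p) = S p * T p"
      unfolding simple_expansion[OF fin(1) p, of ] simple_expansion[OF fin(2) p]
      by (simp add: sum_product indicator_inter_arith algebra_simps)
  qed
  finally show ?thesis .
qed

lemma integrable_simple_square:
  assumes S: "simple_function \<mu> S" "integrable \<mu> S"
  shows "nsq \<mu> S < \<infinity>"
proof -
  have "finite (S ` space \<mu>)" using S by (auto simp: simple_function_def)
  then have "finite (abs ` S ` space \<mu>)" by simp
  then obtain C where C: "\<And>p. p \<in> space \<mu> \<Longrightarrow> \<bar>S p\<bar> \<le> C"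
    by (meson Max_ge imageI)
  have "integrable \<mu> (\<lambda>p. S p * S p)"
    using C S by (intro integrable_bounded_mult) auto
  then show ?thesis by (simp add: integrable_square_nsq power2_eq_square)
qed

lemma nsq_comp_fun:
  assumes S: "simple_function \<mu> S" "integrable \<mu> S"
  shows "nsq M (\<lambda>\<omega>. comp_fun \<mu> S (cnt N (sets \<mu>) \<omega>)) = nsq \<mu> S"
proof -
  let ?X = "\<lambda>\<omega>. comp_fun \<mu> S (cnt N (sets \<mu>) \<omega>)"
  have D: "sets_off \<mu> S y \<in> sets \<mu>" "emeasure \<mu> (sets_off \<mu> S y) < \<infinity>" if "y \<in> nonzero_values \<mu> S" for y
    using that sets_sets_off[OF S] finite_sets_off[OF S] by (auto simp: nonzero_values_def)
  have "integrable M (\<lambda>\<omega>. \<Sum>y\<in>nonzero_values \<mu> S. \<Sum>y'\<in>nonzero_values \<mu> S. (y * y') * (Ntil (sets_off \<mu> S y) \<omega> * Ntil (sets_off \<mu> S y') \<omega>))"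
    using D by (intro Bochner_Integration.integrable_sum integrable_mult_right integrable_Ntil_mult) auto
  also have "(\<lambda>\<omega>. \<Sum>y\<in>nonzero_values \<mu> S. \<Sum>y'\<in>nonzero_values \<mu> S. (y * y') * (Ntil (sets_off \<mu> S y) \<omega> * Ntil (sets_off \<mu> S y') \<omega>)) = (\<lambda>\<omega>. (?X \<omega>)\<^sup>2)"
    by (simp add: fun_eq_iff comp_fun_cnt[OF S] power2_eq_square sum_product algebra_simps)
  finally have i: "integrable M (\<lambda>\<omega>. (?X \<omega>)\<^sup>2)" .
  \<comment> \<open>With empty past and weight \<open>1\<close> the covariance formula becomes the
    isometry.\<close>
  have "(\<integral>\<omega>. 1 * (?X \<omega> * ?X \<omega>) \<partial>M) = (\<integral>\<omega>. 1 \<partial>M) * (\<integral>p. S p * S p \<partial>\<mu>)"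
    by (rule integral_past_comp_fun_mult[where R="{}" and I="{}" and z="\<lambda>_. 1" and C=1]) (use S in auto)
  then have "(\<integral>\<omega>. (?X \<omega>)\<^sup>2 \<partial>M) = (\<integral>p. (S p)\<^sup>2 \<partial>\<mu>)"
    by (simp add: power2_eq_square prob_space)
  moreover have "integrable \<mu> (\<lambda>p. (S p)\<^sup>2)"
    using integrable_square[OF _ integrable_simple_square[OF S]] S by auto
  ultimately show ?thesis using i by (simp add: integrable_square_nsq)
qed

text \<open>Level sets do not behave linearly, so linearity is borrowed from the pathwise integrals,
  with which \<open>comp_fun\<close> agrees almost surely.\<close>

lemma comp_fun_diff:
  assumes S: "simple_function \<mu> S" "integrable \<mu> S" and T: "simple_function \<mu> T" "integrable \<mu> T"
  shows "AE \<omega> in M. comp_fun \<mu> (\<lambda>p. S p - T p) (cnt N (sets \<mu>) \<omega>) = comp_fun \<mu> S (cnt N (sets \<mu>) \<omega>) - comp_fun \<mu> T (cnt N (sets \<mu>) \<omega>)"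
proof -
  have ST: "simple_function \<mu> (\<lambda>p. S p - T p)" "integrable \<mu> (\<lambda>p. S p - T p)"
    using S T by auto
  show ?thesis
    using comp_simple_cnt[OF ST] comp_simple_cnt[OF S] comp_simple_cnt[OF T] comp_simple[OF S] comp_simple[OF T]
  proof eventually_elim
    case (elim \<omega>)
    have "compensated_integral N \<mu> (\<lambda>p. S p - T p) \<omega> = compensated_integral N \<mu> S \<omega> - compensated_integral N \<mu> T \<omega>"
      using elim S T by (simp add: compensated_integral_def)
    then show ?case using elim by simp
  qed
qed

lemma nsq_comp_fun_diff:
  assumes S: "simple_function \<mu> S" "integrable \<mu> S" and T: "simple_function \<mu> T" "integrable \<mu> T"
  shows "nsq M (\<lambda>\<omega>. comp_fun \<mu> S (cnt N (sets \<mu>) \<omega>) - comp_fun \<mu> T (cnt N (sets \<mu>) \<omega>)) = nsq \<mu> (\<lambda>p. S p - T p)"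
proof -
  have ST: "simple_function \<mu> (\<lambda>p. S p - T p)" "integrable \<mu> (\<lambda>p. S p - T p)"
    using S T by auto
  show ?thesis
    using nsq_cong_AE[OF comp_fun_diff[OF S T]] nsq_comp_fun[OF ST] by simp
qed

text \<open>Replaces the pathwise integrals of the definition by functions of finitely many counts,
  whose measurability in \<open>\<omega>\<close> is immediate.\<close>

lemma has_compensated_integral_iff:
  "has_compensated_integral M N \<mu> \<Phi> X \<longleftrightarrow>
     \<Phi> \<in> borel_measurable \<mu> \<and> nsq \<mu> \<Phi> < \<infinity> \<and> X \<in> borel_measurable M \<and>
     (\<exists>S. (\<forall>n::nat. simple_function \<mu> (S n) \<and> integrable \<mu> (S n)) \<and>
          (\<lambda>n. nsq \<mu> (\<lambda>p. S n p - \<Phi> p)) \<longlonglongrightarrow> 0 \<and>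
          (\<lambda>n. nsq M (\<lambda>\<omega>. comp_fun \<mu> (S n) (cnt N (sets \<mu>) \<omega>) - X \<omega>)) \<longlonglongrightarrow> 0)"
proof -
  have "nsq M (\<lambda>\<omega>. compensated_integral N \<mu> S \<omega> - X \<omega>) = nsq M (\<lambda>\<omega>. comp_fun \<mu> S (cnt N (sets \<mu>) \<omega>) - X \<omega>)"
    if "simple_function \<mu> S" "integrable \<mu> S" for S
    by (rule nsq_cong_AE) (use comp_simple_cnt[OF that] in eventually_elim, simp)
  then show ?thesis
    unfolding has_compensated_integral_def nsq_def[symmetric]
    by (auto simp: nsq_def[symmetric] cong: conj_cong)
qed

lemma has_compensated_integralE:
  assumes "has_compensated_integral M N \<mu> \<Phi> X"
  obtains S where "\<And>n. simple_function \<mu> (S n)" "\<And>n. integrable \<mu> (S n)"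
    "(\<lambda>n. nsq \<mu> (\<lambda>p. S n p - \<Phi> p)) \<longlonglongrightarrow> 0"
    "(\<lambda>n. nsq M (\<lambda>\<omega>. comp_fun \<mu> (S n) (cnt N (sets \<mu>) \<omega>) - X \<omega>)) \<longlonglongrightarrow> 0"
  using assms unfolding has_compensated_integral_iff by blast

lemma has_compensated_integralD:
  assumes "has_compensated_integral M N \<mu> \<Phi> X"
  shows "\<Phi> \<in> borel_measurable \<mu>" "nsq \<mu> \<Phi> < \<infinity>" "X \<in> borel_measurable M"
  using assms unfolding has_compensated_integral_iff by auto

text \<open>The integral does not depend on the approximating sequence: two sequences with the same
  limit are close in \<open>L2\<close> of the intensity, so by the isometry their integrals are
  close in \<open>L2\<close> of the probability space.\<close>

lemma nsq_L2_limit: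
  assumes X: "has_compensated_integral M N \<mu> \<Phi> X"
    and T: "\<And>n. simple_function \<mu> (T n)" "\<And>n. integrable \<mu> (T n)"
      "(\<lambda>n. nsq \<mu> (\<lambda>p. T n p - \<Phi> p)) \<longlonglongrightarrow> 0"
  shows "(\<lambda>n. nsq M (\<lambda>\<omega>. comp_fun \<mu> (T n) (cnt N (sets \<mu>) \<omega>) - X \<omega>)) \<longlonglongrightarrow> 0"
proof -
  obtain S where S: "\<And>n. simple_function \<mu> (S n)" "\<And>n. integrable \<mu> (S n)"
    "(\<lambda>n. nsq \<mu> (\<lambda>p. S n p - \<Phi> p)) \<longlonglongrightarrow> 0"
    "(\<lambda>n. nsq M (\<lambda>\<omega>. comp_fun \<mu> (S n) (cnt N (sets \<mu>) \<omega>) - X \<omega>)) \<longlonglongrightarrow> 0"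
    using X by (elim has_compensated_integralE) blast
  note [measurable] = has_compensated_integralD[OF X]
  have [measurable]: "S n \<in> borel_measurable \<mu>" "T n \<in> borel_measurable \<mu>" for n
    using S T by (auto intro: borel_measurable_simple_function)
  have le: "nsq M (\<lambda>\<omega>. comp_fun \<mu> (T n) (cnt N (sets \<mu>) \<omega>) - X \<omega>)
     \<le> 2 * (2 * nsq \<mu> (\<lambda>p. T n p - \<Phi> p) + 2 * nsq \<mu> (\<lambda>p. S n p - \<Phi> p)) + 2 * nsq M (\<lambda>\<omega>. comp_fun \<mu> (S n) (cnt N (sets \<mu>) \<omega>) - X \<omega>)" for n
  proof -
    have [measurable]: "(\<lambda>\<omega>. comp_fun \<mu> (T n) (cnt N (sets \<mu>) \<omega>)) \<in> borel_measurable M"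
      "(\<lambda>\<omega>. comp_fun \<mu> (S n) (cnt N (sets \<mu>) \<omega>)) \<in> borel_measurable M"
      using S T by (auto intro: measurable_comp_fun_cnt)
    have "nsq M (\<lambda>\<omega>. comp_fun \<mu> (T n) (cnt N (sets \<mu>) \<omega>) - X \<omega>)
      \<le> 2 * nsq M (\<lambda>\<omega>. comp_fun \<mu> (T n) (cnt N (sets \<mu>) \<omega>) - comp_fun \<mu> (S n) (cnt N (sets \<mu>) \<omega>)) + 2 * nsq M (\<lambda>\<omega>. X \<omega> - comp_fun \<mu> (S n) (cnt N (sets \<mu>) \<omega>))"
      by (rule nsq_triangle) measurable
    moreover have "nsq M (\<lambda>\<omega>. comp_fun \<mu> (T n) (cnt N (sets \<mu>) \<omega>) - comp_fun \<mu> (S n) (cnt N (sets \<mu>) \<omega>)) = nsq \<mu> (\<lambda>p. T n p - S n p)"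
      using S T by (intro nsq_comp_fun_diff) auto
    moreover have "nsq \<mu> (\<lambda>p. T n p - S n p) \<le> 2 * nsq \<mu> (\<lambda>p. T n p - \<Phi> p) + 2 * nsq \<mu> (\<lambda>p. S n p - \<Phi> p)"
      by (rule nsq_triangle) measurable
    moreover have "a \<le> 2 * e + 2 * c" if "a \<le> 2 * b + 2 * c" "b = d" "d \<le> e" for a b c d e :: ennreal
      using that by (meson add_right_mono mult_left_mono order_trans zero_le)
    ultimately show ?thesis
      unfolding nsq_minus[of M X] by blast
  qed
  have "(\<lambda>n. 2 * (2 * nsq \<mu> (\<lambda>p. T n p - \<Phi> p) + 2 * nsq \<mu> (\<lambda>p. S n p - \<Phi> p)) + 2 * nsq M (\<lambda>\<omega>. comp_fun \<mu> (S n) (cnt N (sets \<mu>) \<omega>) - X \<omega>))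
     \<longlonglongrightarrow> 2 * (2 * 0 + 2 * 0) + 2 * 0"
    by (intro tendsto_add ennreal_tendsto_cmult S T) auto
  then have lim: "(\<lambda>n. 2 * (2 * nsq \<mu> (\<lambda>p. T n p - \<Phi> p) + 2 * nsq \<mu> (\<lambda>p. S n p - \<Phi> p)) + 2 * nsq M (\<lambda>\<omega>. comp_fun \<mu> (S n) (cnt N (sets \<mu>) \<omega>) - X \<omega>)) \<longlonglongrightarrow> 0"
    by simp
  show ?thesis
    by (rule tendsto_sandwich[OF _ _ tendsto_const lim]) (use le in auto)
qed

lemma compensated_integral_unique:
  assumes X: "has_compensated_integral M N \<mu> \<Phi> X" and Y: "has_compensated_integral M N \<mu> \<Phi> Y"
  shows "AE \<omega> in M. X \<omega> = Y \<omega>"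
proof -
  obtain S where S: "\<And>n. simple_function \<mu> (S n)" "\<And>n. integrable \<mu> (S n)"
    "(\<lambda>n. nsq \<mu> (\<lambda>p. S n p - \<Phi> p)) \<longlonglongrightarrow> 0"
    "(\<lambda>n. nsq M (\<lambda>\<omega>. comp_fun \<mu> (S n) (cnt N (sets \<mu>) \<omega>) - X \<omega>)) \<longlonglongrightarrow> 0"
    using X by (elim has_compensated_integralE) blast
  show ?thesis
    using has_compensated_integralD[OF X] has_compensated_integralD[OF Y] S nsq_L2_limit[OF Y S(1-3)]
    by (intro L2_unique[of "\<lambda>n \<omega>. comp_fun \<mu> (S n) (cnt N (sets \<mu>) \<omega>)"]) auto
qed

lemma has_compensated_integral_diff:
  assumes X: "has_compensated_integral M N \<mu> \<Phi> X" and Y: "has_compensated_integral M N \<mu> \<Psi> Y"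
  shows "has_compensated_integral M N \<mu> (\<lambda>p. \<Phi> p - \<Psi> p) (\<lambda>\<omega>. X \<omega> - Y \<omega>)"
proof -
  obtain S where S: "\<And>n. simple_function \<mu> (S n)" "\<And>n. integrable \<mu> (S n)"
    "(\<lambda>n. nsq \<mu> (\<lambda>p. S n p - \<Phi> p)) \<longlonglongrightarrow> 0"
    "(\<lambda>n. nsq M (\<lambda>\<omega>. comp_fun \<mu> (S n) (cnt N (sets \<mu>) \<omega>) - X \<omega>)) \<longlonglongrightarrow> 0"
    using X by (elim has_compensated_integralE) blast
  obtain T where T: "\<And>n. simple_function \<mu> (T n)" "\<And>n. integrable \<mu> (T n)"
    "(\<lambda>n. nsq \<mu> (\<lambda>p. T n p - \<Psi> p)) \<longlonglongrightarrow> 0"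
    "(\<lambda>n. nsq M (\<lambda>\<omega>. comp_fun \<mu> (T n) (cnt N (sets \<mu>) \<omega>) - Y \<omega>)) \<longlonglongrightarrow> 0"
    using Y by (elim has_compensated_integralE) blast
  note [measurable] = has_compensated_integralD[OF X] has_compensated_integralD[OF Y]
  have [measurable]: "S n \<in> borel_measurable \<mu>" "T n \<in> borel_measurable \<mu>" for n
    using S T by (auto intro: borel_measurable_simple_function)
  have [measurable]: "(\<lambda>\<omega>. comp_fun \<mu> (T n) (cnt N (sets \<mu>) \<omega>)) \<in> borel_measurable M"
      "(\<lambda>\<omega>. comp_fun \<mu> (S n) (cnt N (sets \<mu>) \<omega>)) \<in> borel_measurable M" for n
      using S T by (auto intro: measurable_comp_fun_cnt)
  have lim0: "(\<lambda>n. 2 * f n + 2 * g n) \<longlonglongrightarrow> 0" if "f \<longlonglongrightarrow> 0" "g \<longlonglongrightarrow> 0" for f g :: "nat \<Rightarrow> ennreal"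
  proof -
    have "(\<lambda>n. 2 * f n + 2 * g n) \<longlonglongrightarrow> 2 * 0 + 2 * 0"
      by (intro tendsto_add ennreal_tendsto_cmult that) auto
    then show ?thesis by simp
  qed
  show ?thesis
    unfolding has_compensated_integral_iff
  proof (intro conjI exI[of _ "\<lambda>n p. S n p - T n p"] allI)
    show "nsq \<mu> (\<lambda>p. \<Phi> p - \<Psi> p) < \<infinity>"
      using nsq_diff_le[of \<Phi> \<mu> \<Psi>] has_compensated_integralD[OF X] has_compensated_integralD[OF Y]
      by (auto intro!: le_less_trans[OF nsq_diff_le] simp: ennreal_mult_less_top)
    show "(\<lambda>n. nsq \<mu> (\<lambda>p. S n p - T n p - (\<Phi> p - \<Psi> p))) \<longlonglongrightarrow> 0"
    proof (rule tendsto_sandwich[OF _ _ tendsto_const lim0[OF S(3) T(3)]])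
      show "\<forall>\<^sub>F n in sequentially. nsq \<mu> (\<lambda>p. S n p - T n p - (\<Phi> p - \<Psi> p)) \<le> 2 * nsq \<mu> (\<lambda>p. S n p - \<Phi> p) + 2 * nsq \<mu> (\<lambda>p. T n p - \<Psi> p)"
        using nsq_diff_le[of "\<lambda>p. S _ p - \<Phi> p" \<mu> "\<lambda>p. T _ p - \<Psi> p"]
        by (intro always_eventually allI) (simp add: algebra_simps)
    qed simp
    have eq: "nsq M (\<lambda>\<omega>. comp_fun \<mu> (\<lambda>p. S n p - T n p) (cnt N (sets \<mu>) \<omega>) - (X \<omega> - Y \<omega>)) =
      nsq M (\<lambda>\<omega>. (comp_fun \<mu> (S n) (cnt N (sets \<mu>) \<omega>) - X \<omega>) - (comp_fun \<mu> (T n) (cnt N (sets \<mu>) \<omega>) - Y \<omega>))" for n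
      by (rule nsq_cong_AE) (use comp_fun_diff[OF S(1,2) T(1,2)] in eventually_elim, simp)
    show "(\<lambda>n. nsq M (\<lambda>\<omega>. comp_fun \<mu> (\<lambda>p. S n p - T n p) (cnt N (sets \<mu>) \<omega>) - (X \<omega> - Y \<omega>))) \<longlonglongrightarrow> 0"
      unfolding eq
      by (rule tendsto_sandwich[OF _ _ tendsto_const lim0[OF S(4) T(4)]])
         (auto intro!: always_eventually nsq_diff_le)
    show "simple_function \<mu> (\<lambda>p. S n p - T n p)" "integrable \<mu> (\<lambda>p. S n p - T n p)" for n
      using S T by auto
  qed measurable
qed

lemma nsq_has_compensated_integral:
  assumes X: "has_compensated_integral M N \<mu> \<Phi> X"
  shows "nsq M X < \<infinity>"
proof -
  obtain U where U: "\<And>n. simple_function \<mu> (U n)" "\<And>n. integrable \<mu> (U n)"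
    "(\<lambda>n. nsq M (\<lambda>\<omega>. comp_fun \<mu> (U n) (cnt N (sets \<mu>) \<omega>) - X \<omega>)) \<longlonglongrightarrow> 0"
    using X by (elim has_compensated_integralE) blast
  have "\<forall>\<^sub>F n in sequentially. nsq M (\<lambda>\<omega>. comp_fun \<mu> (U n) (cnt N (sets \<mu>) \<omega>) - X \<omega>) < 1"
    using U(3) by (rule order_tendstoD) simp
  then obtain n where n: "nsq M (\<lambda>\<omega>. comp_fun \<mu> (U n) (cnt N (sets \<mu>) \<omega>) - X \<omega>) < 1"
    by (auto simp: eventually_sequentially)
  have m: "(\<lambda>\<omega>. comp_fun \<mu> (U n) (cnt N (sets \<mu>) \<omega>)) \<in> borel_measurable M" "X \<in> borel_measurable M"
    using U has_compensated_integralD[OF X] by auto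
  have "nsq M X = nsq M (\<lambda>\<omega>. comp_fun \<mu> (U n) (cnt N (sets \<mu>) \<omega>) - (comp_fun \<mu> (U n) (cnt N (sets \<mu>) \<omega>) - X \<omega>))" by simp
  also have "\<dots> \<le> 2 * nsq M (\<lambda>\<omega>. comp_fun \<mu> (U n) (cnt N (sets \<mu>) \<omega>)) + 2 * nsq M (\<lambda>\<omega>. comp_fun \<mu> (U n) (cnt N (sets \<mu>) \<omega>) - X \<omega>)"
    by (rule nsq_diff_le) (use m in measurable)
  also have "\<dots> < \<infinity>"
    using n U integrable_simple_square[OF U(1,2), of n]
    by (auto simp: nsq_comp_fun ennreal_mult_less_top intro: less_trans)
  finally show ?thesis .
qed

text \<open>Passage to the limit in the covariance formula for simple integrands;
  \<open>\<Phi>\<close> may charge the past as well as the future, \<open>\<Psi>\<close> only the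
  complement of \<open>R\<close>.\<close>

lemma integral_past_compensated_mult:
  assumes R: "R \<in> sets \<mu>" and I: "I \<subseteq> sets \<mu>" "\<And>A. A \<in> I \<Longrightarrow> A \<subseteq> R"
    and z: "z \<in> borel_measurable (cnt_space I)" and Z: "AE \<omega> in M. Z \<omega> = z (cnt N I \<omega>)"
    and Zm[measurable]: "Z \<in> borel_measurable M" and Zb: "\<And>\<omega>. \<omega> \<in> space M \<Longrightarrow> \<bar>Z \<omega>\<bar> \<le> C"
    and X: "has_compensated_integral M N \<mu> \<Phi> X" and Y: "has_compensated_integral M N \<mu> \<Psi> Y"
    and \<Psi>R: "\<And>p. p \<in> R \<Longrightarrow> \<Psi> p = 0"
  shows "(\<integral>\<omega>. Z \<omega> * (X \<omega> * Y \<omega>) \<partial>M) = (\<integral>\<omega>. Z \<omega> \<partial>M) * (\<integral>p. \<Phi> p * \<Psi> p \<partial>\<mu>)"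
proof -
  obtain S where S: "\<And>n. simple_function \<mu> (S n)" "\<And>n. integrable \<mu> (S n)"
    "(\<lambda>n. nsq \<mu> (\<lambda>p. S n p - \<Phi> p)) \<longlonglongrightarrow> 0"
    "(\<lambda>n. nsq M (\<lambda>\<omega>. comp_fun \<mu> (S n) (cnt N (sets \<mu>) \<omega>) - X \<omega>)) \<longlonglongrightarrow> 0"
    using X by (elim has_compensated_integralE) blast
  obtain T' where T': "\<And>n. simple_function \<mu> (T' n)" "\<And>n. integrable \<mu> (T' n)"
    "(\<lambda>n. nsq \<mu> (\<lambda>p. T' n p - \<Psi> p)) \<longlonglongrightarrow> 0"
    using Y by (elim has_compensated_integralE) blast
  \<comment> \<open>The given approximants of \<open>\<Psi>\<close> may charge the past. Cutting
    them off on \<open>R\<close> restores the support condition and only decreases the error,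
    because \<open>\<Psi>\<close> vanishes there.\<close>
  define T where "T n p = indicator (space \<mu> - R) p * T' n p" for n p
  note XD[measurable] = has_compensated_integralD[OF X] and YD[measurable] = has_compensated_integralD[OF Y]
  have T: "simple_function \<mu> (T n)" "integrable \<mu> (T n)" for n
  proof -
    show "simple_function \<mu> (T n)"
      unfolding T_def[abs_def] using T' R by (intro simple_function_mult simple_function_indicator) auto
    show "integrable \<mu> (T n)"
      unfolding T_def[abs_def] using T' R by (intro integrable_real_mult_indicator[unfolded mult.commute[of _ "indicator _ _"]]) auto
  qed
  have TR: "T n p = 0" if "p \<in> R" for n p using that by (simp add: T_def)
  have Tlim: "(\<lambda>n. nsq \<mu> (\<lambda>p. T n p - \<Psi> p)) \<longlonglongrightarrow> 0"
  proof (rule tendsto_sandwich[OF _ _ tendsto_const T'(3)])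
    show "\<forall>\<^sub>F n in sequentially. nsq \<mu> (\<lambda>p. T n p - \<Psi> p) \<le> nsq \<mu> (\<lambda>p. T' n p - \<Psi> p)"
      unfolding nsq_def
      by (intro always_eventually allI nn_integral_mono) (auto simp: T_def indicator_def \<Psi>R)
  qed simp
  have Tlim2: "(\<lambda>n. nsq M (\<lambda>\<omega>. comp_fun \<mu> (T n) (cnt N (sets \<mu>) \<omega>) - Y \<omega>)) \<longlonglongrightarrow> 0"
    by (rule nsq_L2_limit[OF Y T Tlim])
  have [measurable]: "(\<lambda>\<omega>. comp_fun \<mu> (T n) (cnt N (sets \<mu>) \<omega>)) \<in> borel_measurable M"
      "(\<lambda>\<omega>. comp_fun \<mu> (S n) (cnt N (sets \<mu>) \<omega>)) \<in> borel_measurable M" for n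
      using S T by (auto intro: measurable_comp_fun_cnt)
  have 1: "(\<lambda>n. \<integral>\<omega>. Z \<omega> * (comp_fun \<mu> (S n) (cnt N (sets \<mu>) \<omega>) * comp_fun \<mu> (T n) (cnt N (sets \<mu>) \<omega>)) \<partial>M) \<longlonglongrightarrow> (\<integral>\<omega>. Z \<omega> * (X \<omega> * Y \<omega>) \<partial>M)"
    using S T Zb nsq_has_compensated_integral[OF X] nsq_has_compensated_integral[OF Y] integrable_simple_square
    by (intro L2_mult_tendsto[where C=C] Tlim2) (auto simp: nsq_comp_fun)
  have 2: "(\<lambda>n. \<integral>p. 1 * (S n p * T n p) \<partial>\<mu>) \<longlonglongrightarrow> (\<integral>p. 1 * (\<Phi> p * \<Psi> p) \<partial>\<mu>)"
    using S T XD YD integrable_simple_square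
    by (intro L2_mult_tendsto[where C=1] Tlim) (auto intro: borel_measurable_simple_function)
  have 3: "(\<integral>\<omega>. Z \<omega> * (comp_fun \<mu> (S n) (cnt N (sets \<mu>) \<omega>) * comp_fun \<mu> (T n) (cnt N (sets \<mu>) \<omega>)) \<partial>M) = (\<integral>\<omega>. Z \<omega> \<partial>M) * (\<integral>p. 1 * (S n p * T n p) \<partial>\<mu>)" for n
    using integral_past_comp_fun_mult[OF R I z Z Zm Zb S(1,2) T TR] by simp
  have 4: "(\<lambda>n. (\<integral>\<omega>. Z \<omega> \<partial>M) * (\<integral>p. 1 * (S n p * T n p) \<partial>\<mu>)) \<longlonglongrightarrow> (\<integral>\<omega>. Z \<omega> \<partial>M) * (\<integral>p. 1 * (\<Phi> p * \<Psi> p) \<partial>\<mu>)"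
    by (intro tendsto_mult tendsto_const 2)
  show ?thesis using LIMSEQ_unique[OF 1[unfolded 3] 4] by simp
qed

end

text \<open>A version of the compensated integral is one and the same function of the counts for all
  Poisson random measures with the given intensity.\<close>

lemma compensated_integral_exists:
  fixes \<mu> :: "'z measure"
  assumes prm0: "prm M \<mu> N0" and \<Phi>[measurable]: "\<Phi> \<in> borel_measurable \<mu>" and fin: "nsq \<mu> \<Phi> < \<infinity>"
  shows "\<exists>L\<in>borel_measurable (cnt_space (sets \<mu>)). \<forall>N. prm M \<mu> N \<longrightarrow>
    has_compensated_integral M N \<mu> \<Phi> (\<lambda>\<omega>. L (cnt N (sets \<mu>) \<omega>))"
proof -
  interpret N0: prm M \<mu> N0 by fact
  let ?C = "cnt_space (sets \<mu>)"
  obtain S where S: "\<And>n::nat. simple_function \<mu> (S n)" "\<And>n. integrable \<mu> (S n)"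
    "(\<lambda>n. nsq \<mu> (\<lambda>x. S n x - \<Phi> x)) \<longlonglongrightarrow> 0"
    using L2_simple_approx[OF \<Phi> fin] by auto
  have [measurable]: "S n \<in> borel_measurable \<mu>" for n
    using S by (auto intro: borel_measurable_simple_function)
  have [measurable]: "comp_fun \<mu> (S n) \<in> borel_measurable ?C" for n
    by (rule measurable_comp_fun[OF S(1,2)])
  \<comment> \<open>Completeness is applied on the space of counts with its law. That law is fixed
    by the intensity, so the limit fits every noise at once.\<close>
  let ?P = "distr M ?C (cnt N0 (sets \<mu>))"
  have cauchy: "nsq ?P (\<lambda>c. comp_fun \<mu> (S m) c - comp_fun \<mu> (S n) c) \<le> 2 * nsq \<mu> (\<lambda>x. S m x - \<Phi> x) + 2 * nsq \<mu> (\<lambda>x. S n x - \<Phi> x)" for m n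
    using nsq_triangle[of "S m" \<mu> "S n" \<Phi>] N0.nsq_comp_fun_diff[OF S(1,2) S(1,2), of m n]
    by (subst nsq_distr) auto
  have "(\<lambda>n. 2 * nsq \<mu> (\<lambda>x. S n x - \<Phi> x)) \<longlonglongrightarrow> 2 * 0"
    by (intro ennreal_tendsto_cmult S) simp
  then have "\<exists>L\<in>borel_measurable ?P. (\<lambda>n. nsq ?P (\<lambda>c. comp_fun \<mu> (S n) c - L c)) \<longlonglongrightarrow> 0"
    using cauchy by (intro L2_complete[where e="\<lambda>n. 2 * nsq \<mu> (\<lambda>x. S n x - \<Phi> x)"]) auto
  then obtain L where L[measurable]: "L \<in> borel_measurable ?C"
    and lim: "(\<lambda>n. nsq ?P (\<lambda>c. comp_fun \<mu> (S n) c - L c)) \<longlonglongrightarrow> 0" by auto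
  show ?thesis
  proof (intro bexI[of _ L] allI impI L)
    fix N assume "prm M \<mu> N"
    then interpret prm M \<mu> N .
    have [measurable]: "cnt N (sets \<mu>) \<in> measurable M ?C" by (rule measurable_cnt) auto
    have "?P = distr M ?C (cnt N (sets \<mu>))"
      by (rule distr_cnt_eq[OF prm0 \<open>prm M \<mu> N\<close>]) auto
    then have "nsq ?P (\<lambda>c. comp_fun \<mu> (S n) c - L c) = nsq M (\<lambda>\<omega>. comp_fun \<mu> (S n) (cnt N (sets \<mu>) \<omega>) - L (cnt N (sets \<mu>) \<omega>))" for n
      by (simp add: nsq_distr)
    then show "has_compensated_integral M N \<mu> \<Phi> (\<lambda>\<omega>. L (cnt N (sets \<mu>) \<omega>))"
      unfolding has_compensated_integral_iff using lim S fin by (auto intro!: exI[of _ S])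
  qed
qed

section \<open>The spatial kernel\<close>

lemma nn_integral_shift: "f \<in> borel_measurable borel \<Longrightarrow> (\<integral>\<^sup>+x. f (x + c) \<partial>lborel) = (\<integral>\<^sup>+x. f x \<partial>lborel)" for c :: real
  using nn_integral_real_affine[of f 1 c] by (simp add: add.commute)

lemma nn_integral_reflect: "f \<in> borel_measurable borel \<Longrightarrow> (\<integral>\<^sup>+x. f (c - x) \<partial>lborel) = (\<integral>\<^sup>+x. f x \<partial>lborel)" for c :: real
  using nn_integral_real_affine[of f "-1" c] by simp

text \<open>The weight in the definition of \<open>tempered\<close> is bounded below on a compact
  interval, with the explicit constant \<open>(1 + r^2) powr k\<close>.\<close>

lemma tempered_locally_integrable:
  assumes "tempered g"
  shows "(\<integral>\<^sup>+x. g x * indicator {-r..r} x \<partial>lborel) < \<infinity>"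
proof -
  obtain k where k: "k > 0" "(\<integral>\<^sup>+x. g x * ennreal ((1 + x\<^sup>2) powr (- k)) \<partial>lborel) < \<infinity>"
    and g[measurable]: "g \<in> borel_measurable borel"
    using assms unfolding tempered_def by auto
  let ?c = "(1 + r\<^sup>2) powr k"
  have "(\<integral>\<^sup>+x. g x * indicator {-r..r} x \<partial>lborel) \<le> (\<integral>\<^sup>+x. ennreal ?c * (g x * ennreal ((1 + x\<^sup>2) powr (- k))) \<partial>lborel)"
  proof (rule nn_integral_mono)
    fix x :: real
    show "g x * indicator {-r..r} x \<le> ennreal ?c * (g x * ennreal ((1 + x\<^sup>2) powr (- k)))"
    proof (cases "x \<in> {-r..r}")
      case True
      then have "x\<^sup>2 \<le> r\<^sup>2" by (auto simp: abs_le_square_iff[symmetric])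
      then have "(1 + x\<^sup>2) powr k \<le> ?c" using k(1) by (intro powr_mono2) auto
      moreover have "0 < 1 + x\<^sup>2" by (simp add: add_pos_nonneg)
      then have "0 < (1 + x\<^sup>2) powr k" by simp
      ultimately have "1 \<le> ?c * (1 + x\<^sup>2) powr (- k)"
        unfolding powr_minus divide_inverse[symmetric] by (simp add: le_divide_eq)
      then have "ennreal 1 \<le> ennreal (?c * (1 + x\<^sup>2) powr (- k))" by (rule ennreal_leI)
      then have "g x * 1 \<le> g x * (ennreal ?c * ennreal ((1 + x\<^sup>2) powr (- k)))"
        by (intro mult_left_mono) (auto simp: ennreal_mult)
      then show ?thesis using True by (simp add: mult.left_commute)
    qed simp
  qed
  also have "\<dots> < \<infinity>" using k(2) by (simp add: nn_integral_cmult ennreal_mult_less_top)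
  finally show ?thesis .
qed

text \<open>Local integrability of \<open>\<kappa>\<close> makes the convolution with the indicator
  of a bounded set converge, and that of \<open>autoconv \<kappa>\<close> puts this convolution into
  \<open>L2\<close>.\<close>

locale kernel =
  fixes \<kappa> :: "real \<Rightarrow> ennreal"
  assumes measurable_kernel[measurable]: "\<kappa> \<in> borel_measurable borel"
    and kernel_loc: "\<And>r. (\<integral>\<^sup>+x. \<kappa> x * indicator {-r..r} x \<partial>lborel) < \<infinity>"
    and autoconv_loc: "\<And>r. (\<integral>\<^sup>+x. autoconv \<kappa> x * indicator {-r..r} x \<partial>lborel) < \<infinity>"
begin

lemma measurable_autoconv[measurable]: "autoconv \<kappa> \<in> borel_measurable borel"
  unfolding autoconv_def[abs_def] by measurable

text \<open>The convolution \<open>\<bar>h\<bar> * \<kappa>\<close>, always defined as a nonnegative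
  extended number. \<open>energy\<close> below is the integrand of Walsh's norm at fixed time and
  sample point.\<close>

definition cv :: "(real \<Rightarrow> real) \<Rightarrow> real \<Rightarrow> ennreal" where
  "cv h x = (\<integral>\<^sup>+y. ennreal \<bar>h y\<bar> * \<kappa> (x - y) \<partial>lborel)"

definition energy :: "(real \<Rightarrow> real) \<Rightarrow> ennreal" where
  "energy h = (\<integral>\<^sup>+x. \<integral>\<^sup>+y. ennreal \<bar>h x * h y\<bar> * autoconv \<kappa> (x - y) \<partial>lborel \<partial>lborel)"

definition autoconv_mass :: "real \<Rightarrow> ennreal" where
  "autoconv_mass r = (\<integral>\<^sup>+x. autoconv \<kappa> x * indicator {-r..r} x \<partial>lborel)"

lemma autoconv_mass_finite: "autoconv_mass r < \<infinity>"
  unfolding autoconv_mass_def by (rule autoconv_loc)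

lemma autoconv_mass_mono: "r \<le> r' \<Longrightarrow> autoconv_mass r \<le> autoconv_mass r'"
  unfolding autoconv_mass_def by (intro nn_integral_mono mult_left_mono) (auto simp: indicator_def)

lemma measurable_cv[measurable]:
  assumes [measurable]: "h \<in> borel_measurable borel"
  shows "cv h \<in> borel_measurable borel"
  unfolding cv_def[abs_def] by measurable

text \<open>Tonelli and a translation recognize \<open>autoconv \<kappa> (y - y')\<close> in the
  square of a convolution. Being a squared \<open>L2\<close> norm of \<open>cv h\<close>, the energy
  obeys a quasi-triangle inequality, which its double integral does not show.\<close>

lemma energy_cv:
  assumes [measurable]: "h \<in> borel_measurable borel"
  shows "energy h = (\<integral>\<^sup>+x. (cv h x)\<^sup>2 \<partial>lborel)"
proof -
  have sq: "(cv h x)\<^sup>2 = (\<integral>\<^sup>+y. \<integral>\<^sup>+y'. ennreal \<bar>h y * h y'\<bar> * (\<kappa> (x - y) * \<kappa> (x - y')) \<partial>lborel \<partial>lborel)" for x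
  proof -
    have "(cv h x)\<^sup>2 = (\<integral>\<^sup>+y. (ennreal \<bar>h y\<bar> * \<kappa> (x - y)) * cv h x \<partial>lborel)"
      by (subst nn_integral_multc) (auto simp: cv_def power2_eq_square)
    also have "\<dots> = (\<integral>\<^sup>+y. \<integral>\<^sup>+y'. (ennreal \<bar>h y\<bar> * \<kappa> (x - y)) * (ennreal \<bar>h y'\<bar> * \<kappa> (x - y')) \<partial>lborel \<partial>lborel)"
      by (subst nn_integral_cmult) (auto simp: cv_def)
    also have "\<dots> = (\<integral>\<^sup>+y. \<integral>\<^sup>+y'. ennreal \<bar>h y * h y'\<bar> * (\<kappa> (x - y) * \<kappa> (x - y')) \<partial>lborel \<partial>lborel)"
      by (simp add: abs_mult ennreal_mult mult_ac)
    finally show ?thesis .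
  qed
  have "(\<integral>\<^sup>+x. (cv h x)\<^sup>2 \<partial>lborel) = (\<integral>\<^sup>+y. \<integral>\<^sup>+x. \<integral>\<^sup>+y'. ennreal \<bar>h y * h y'\<bar> * (\<kappa> (x - y) * \<kappa> (x - y')) \<partial>lborel \<partial>lborel \<partial>lborel)"
    unfolding sq by (rule lborel_pair.Fubini') measurable
  also have "\<dots> = (\<integral>\<^sup>+y. \<integral>\<^sup>+y'. \<integral>\<^sup>+x. ennreal \<bar>h y * h y'\<bar> * (\<kappa> (x - y) * \<kappa> (x - y')) \<partial>lborel \<partial>lborel \<partial>lborel)"
    by (intro nn_integral_cong lborel_pair.Fubini') measurable
  also have "\<dots> = (\<integral>\<^sup>+y. \<integral>\<^sup>+y'. ennreal \<bar>h y * h y'\<bar> * autoconv \<kappa> (y - y') \<partial>lborel \<partial>lborel)"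
  proof (intro nn_integral_cong)
    fix y y' :: real
    have "(\<integral>\<^sup>+x. \<kappa> (x - y) * \<kappa> (x - y') \<partial>lborel) = (\<integral>\<^sup>+x. \<kappa> ((x + y') - y) * \<kappa> ((x + y') - y') \<partial>lborel)"
      by (rule nn_integral_shift[symmetric]) measurable
    also have "\<dots> = autoconv \<kappa> (y - y')"
      unfolding autoconv_def by (intro nn_integral_cong) (simp add: mult.commute algebra_simps)
    finally show "(\<integral>\<^sup>+x. ennreal \<bar>h y * h y'\<bar> * (\<kappa> (x - y) * \<kappa> (x - y')) \<partial>lborel) = ennreal \<bar>h y * h y'\<bar> * autoconv \<kappa> (y - y')"
      by (subst nn_integral_cmult) auto
  qed
  finally show ?thesis unfolding energy_def by simp
qed

lemma energy_mono:
  assumes "\<And>x. \<bar>h x\<bar> \<le> \<bar>g x\<bar>"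
  shows "energy h \<le> energy g"
  unfolding energy_def using assms
  by (intro nn_integral_mono mult_right_mono ennreal_leI) (auto simp: abs_mult intro!: mult_mono)

lemma cv_add_le:
  assumes [measurable]: "h \<in> borel_measurable borel" "g \<in> borel_measurable borel"
  shows "cv (\<lambda>x. h x + g x) x \<le> cv h x + cv g x"
proof -
  have "cv (\<lambda>x. h x + g x) x \<le> (\<integral>\<^sup>+y. ennreal \<bar>h y\<bar> * \<kappa> (x - y) + ennreal \<bar>g y\<bar> * \<kappa> (x - y) \<partial>lborel)"
    unfolding cv_def
    by (intro nn_integral_mono)
       (auto simp: distrib_right[symmetric] ennreal_plus[symmetric] simp del: ennreal_plus intro!: mult_right_mono ennreal_leI)
  then show ?thesis by (simp add: nn_integral_add cv_def)
qed

lemma ennreal_power2_add_le: "((a::ennreal) + b)\<^sup>2 \<le> 2 * a\<^sup>2 + 2 * b\<^sup>2"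
proof (cases "a = \<infinity> \<or> b = \<infinity>")
  case True
  then show ?thesis by (auto simp: power2_eq_square ennreal_mult_top)
next
  case False
  then obtain x y where xy: "a = ennreal x" "b = ennreal y" "0 \<le> x" "0 \<le> y"
    by (cases a; cases b) auto
  then have "(a + b)\<^sup>2 = ennreal ((x + y)\<^sup>2)"
    by (simp add: ennreal_power[symmetric])
  also have "\<dots> \<le> 2 * ennreal (x\<^sup>2) + 2 * ennreal (y\<^sup>2)" by (rule ennreal_square_add_le)
  finally show ?thesis using xy by (simp add: ennreal_power)
qed

lemma energy_add_le:
  assumes [measurable]: "h \<in> borel_measurable borel" "g \<in> borel_measurable borel"
  shows "energy (\<lambda>x. h x + g x) \<le> 2 * energy h + 2 * energy g"
proof -
  have "energy (\<lambda>x. h x + g x) = (\<integral>\<^sup>+x. (cv (\<lambda>x. h x + g x) x)\<^sup>2 \<partial>lborel)"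
    by (rule energy_cv) measurable
  also have "\<dots> \<le> (\<integral>\<^sup>+x. 2 * (cv h x)\<^sup>2 + 2 * (cv g x)\<^sup>2 \<partial>lborel)"
    by (intro nn_integral_mono order_trans[OF power_mono ennreal_power2_add_le] cv_add_le) auto
  also have "\<dots> = 2 * energy h + 2 * energy g"
    by (simp add: nn_integral_add nn_integral_cmult energy_cv)
  finally show ?thesis .
qed

lemma energy_cmult: "energy (\<lambda>x. c * h x) = ennreal (c\<^sup>2) * energy h" if [measurable]: "h \<in> borel_measurable borel"
proof -
  have "ennreal \<bar>c * h x * (c * h y)\<bar> = ennreal (c\<^sup>2) * ennreal \<bar>h x * h y\<bar>" for x y
  proof -
    have "c * h x * (c * h y) = c\<^sup>2 * (h x * h y)" by (simp add: power2_eq_square)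
    then have "\<bar>c * h x * (c * h y)\<bar> = c\<^sup>2 * \<bar>h x * h y\<bar>" by (simp only: abs_mult abs_power2)
    then show ?thesis by (simp add: ennreal_mult)
  qed
  then have "energy (\<lambda>x. c * h x) = (\<integral>\<^sup>+x. ennreal (c\<^sup>2) * (\<integral>\<^sup>+y. ennreal \<bar>h x * h y\<bar> * autoconv \<kappa> (x - y) \<partial>lborel) \<partial>lborel)"
    unfolding energy_def by (simp add: mult.assoc nn_integral_cmult)
  then show ?thesis unfolding energy_def by (simp add: nn_integral_cmult)
qed

lemma autoconv_mass_shift:
  "(\<integral>\<^sup>+y. autoconv \<kappa> (x - y) * indicator {-r..r} (x - y) \<partial>lborel) = autoconv_mass r"
  "(\<integral>\<^sup>+x. autoconv \<kappa> (x - y) * indicator {-r..r} (x - y) \<partial>lborel) = autoconv_mass r"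
  using nn_integral_reflect[of "\<lambda>z. autoconv \<kappa> z * indicator {-r..r} z" x]
    nn_integral_shift[of "\<lambda>z. autoconv \<kappa> z * indicator {-r..r} z" "-y"]
  by (simp_all add: autoconv_mass_def)

text \<open>A Schur test: \<open>\<bar>h x * h y\<bar>\<close> is at most half the sum of the
  squares, and two points of the support differ by at most \<open>2 * r\<close>, so
  \<open>autoconv \<kappa>\<close> may be cut off there. Each half then integrates to half of the
  bound.\<close>

lemma energy_local_le:
  assumes [measurable]: "h \<in> borel_measurable borel" and h: "\<And>x. r < \<bar>x - c\<bar> \<Longrightarrow> h x = 0"
  shows "energy h \<le> autoconv_mass (2 * r) * (\<integral>\<^sup>+x. ennreal ((h x)\<^sup>2) \<partial>lborel)"
proof -
  let ?g = "\<lambda>x y. autoconv \<kappa> (x - y) * indicator {- (2 * r)..2 * r} (x - y)"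
  have "energy h \<le> (\<integral>\<^sup>+x. \<integral>\<^sup>+y. ennreal ((h x)\<^sup>2 / 2) * ?g x y + ennreal ((h y)\<^sup>2 / 2) * ?g x y \<partial>lborel \<partial>lborel)"
    unfolding energy_def
  proof (intro nn_integral_mono)
    fix x y :: real
    show "ennreal \<bar>h x * h y\<bar> * autoconv \<kappa> (x - y) \<le> ennreal ((h x)\<^sup>2 / 2) * ?g x y + ennreal ((h y)\<^sup>2 / 2) * ?g x y"
    proof (cases "h x * h y = 0")
      case False
      then have "\<bar>x - c\<bar> \<le> r" "\<bar>y - c\<bar> \<le> r" using h[of x] h[of y] by (auto simp: not_le[symmetric])
      then have ind: "indicator {- (2 * r)..2 * r} (x - y) = (1::ennreal)" by (auto simp: indicator_def)
      have "2 * \<bar>h x\<bar> * \<bar>h y\<bar> \<le> \<bar>h x\<bar>\<^sup>2 + \<bar>h y\<bar>\<^sup>2" by (rule sum_squares_bound)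
      then have "\<bar>h x * h y\<bar> \<le> (h x)\<^sup>2 / 2 + (h y)\<^sup>2 / 2" by (simp add: abs_mult)
      then have "ennreal \<bar>h x * h y\<bar> \<le> ennreal ((h x)\<^sup>2 / 2 + (h y)\<^sup>2 / 2)" by (rule ennreal_leI)
      also have "\<dots> = ennreal ((h x)\<^sup>2 / 2) + ennreal ((h y)\<^sup>2 / 2)" by (rule ennreal_plus) auto
      finally have "ennreal \<bar>h x * h y\<bar> * autoconv \<kappa> (x - y) \<le> (ennreal ((h x)\<^sup>2 / 2) + ennreal ((h y)\<^sup>2 / 2)) * autoconv \<kappa> (x - y)"
        by (rule mult_right_mono) simp
      then show ?thesis unfolding ind by (simp add: distrib_right)
    qed (simp only: abs_zero ennreal_0 mult_zero_left zero_le)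
  qed
  also have "\<dots> = (\<integral>\<^sup>+x. \<integral>\<^sup>+y. ennreal ((h x)\<^sup>2 / 2) * ?g x y \<partial>lborel \<partial>lborel) + (\<integral>\<^sup>+x. \<integral>\<^sup>+y. ennreal ((h y)\<^sup>2 / 2) * ?g x y \<partial>lborel \<partial>lborel)"
    by (simp add: nn_integral_add)
  also have "(\<integral>\<^sup>+x. \<integral>\<^sup>+y. ennreal ((h y)\<^sup>2 / 2) * ?g x y \<partial>lborel \<partial>lborel) = (\<integral>\<^sup>+y. \<integral>\<^sup>+x. ennreal ((h y)\<^sup>2 / 2) * ?g x y \<partial>lborel \<partial>lborel)"
    by (rule lborel_pair.Fubini') measurable
  also have "\<dots> = (\<integral>\<^sup>+x. ennreal ((h x)\<^sup>2 / 2) \<partial>lborel) * autoconv_mass (2 * r)"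
    by (simp add: nn_integral_cmult nn_integral_multc autoconv_mass_shift)
  also have "(\<integral>\<^sup>+x. \<integral>\<^sup>+y. ennreal ((h x)\<^sup>2 / 2) * ?g x y \<partial>lborel \<partial>lborel) = (\<integral>\<^sup>+x. ennreal ((h x)\<^sup>2 / 2) \<partial>lborel) * autoconv_mass (2 * r)"
    by (simp add: nn_integral_cmult nn_integral_multc autoconv_mass_shift)
  also have "(\<integral>\<^sup>+x. ennreal ((h x)\<^sup>2 / 2) \<partial>lborel) * autoconv_mass (2 * r) + (\<integral>\<^sup>+x. ennreal ((h x)\<^sup>2 / 2) \<partial>lborel) * autoconv_mass (2 * r)
      = (\<integral>\<^sup>+x. ennreal ((h x)\<^sup>2 / 2) + ennreal ((h x)\<^sup>2 / 2) \<partial>lborel) * autoconv_mass (2 * r)"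
    by (simp add: distrib_right nn_integral_add)
  also have "(\<lambda>x. ennreal ((h x)\<^sup>2 / 2) + ennreal ((h x)\<^sup>2 / 2)) = (\<lambda>x. ennreal ((h x)\<^sup>2))"
    by (simp add: fun_eq_iff ennreal_plus[symmetric] del: ennreal_plus)
  finally show ?thesis by (simp add: mult.commute)
qed

lemma measurable_convolve[measurable]:
  assumes [measurable]: "\<phi> \<in> borel_measurable borel"
  shows "convolve \<phi> \<kappa> \<in> borel_measurable borel"
  unfolding convolve_def[abs_def] by measurable

lemma integrable_convolve_indicator:
  assumes [measurable]: "A \<in> sets borel" and A: "bounded A"
  shows "integrable lborel (\<lambda>y. indicator A (x - y) * enn2real (\<kappa> y) :: real)"
proof (rule integrableI_bounded)
  obtain r where r: "\<And>a. a \<in> A \<Longrightarrow> \<bar>a\<bar> \<le> r" using A by (auto simp: bounded_iff)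
  have "(\<integral>\<^sup>+y. ennreal (norm (indicator A (x - y) * enn2real (\<kappa> y) :: real)) \<partial>lborel)
    \<le> (\<integral>\<^sup>+y. \<kappa> y * indicator {-(\<bar>x\<bar> + r)..\<bar>x\<bar> + r} y \<partial>lborel)"
  proof (rule nn_integral_mono)
    fix y
    have "y \<in> {-(\<bar>x\<bar> + r)..\<bar>x\<bar> + r}" if "x - y \<in> A" using r[OF that] by auto
    then show "ennreal (norm (indicator A (x - y) * enn2real (\<kappa> y) :: real)) \<le> \<kappa> y * indicator {-(\<bar>x\<bar> + r)..\<bar>x\<bar> + r} y"
      by (cases "\<kappa> y") (auto simp: indicator_def)
  qed
  also have "\<dots> < \<infinity>" by (rule kernel_loc)
  finally show "(\<integral>\<^sup>+y. ennreal (norm (indicator A (x - y) * enn2real (\<kappa> y) :: real)) \<partial>lborel) < \<infinity>" .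
qed measurable

text \<open>\<open>enn2real\<close> sends an infinite kernel value to \<open>0\<close>, and
  \<open>cv\<close> moves the absolute value inside, so this is an inequality. It points in the
  direction required: stochastic integrals are to be bounded by Walsh's norm.\<close>

lemma convolve_sum_le_cv:
  assumes I: "finite I" and A: "\<And>i. i \<in> I \<Longrightarrow> A i \<in> sets borel \<and> bounded (A i)"
  shows "ennreal \<bar>\<Sum>i\<in>I. c i * convolve (indicator (A i)) \<kappa> x\<bar> \<le> cv (\<lambda>y. \<Sum>i\<in>I. c i * indicator (A i) y) x"
proof -
  let ?g = "\<lambda>y. \<Sum>i\<in>I. c i * indicator (A i) y"
  have [measurable]: "?g \<in> borel_measurable borel"
    using A by (intro borel_measurable_sum borel_measurable_times borel_measurable_indicator) auto
  have "has_bochner_integral lborel (\<lambda>y. \<Sum>i\<in>I. c i * (indicator (A i) (x - y) * enn2real (\<kappa> y))) (\<Sum>i\<in>I. c i * convolve (indicator (A i)) \<kappa> x)"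
    unfolding convolve_def using A
    by (intro has_bochner_integral_sum has_bochner_integral_mult_right has_bochner_integral_integrable integrable_convolve_indicator) auto
  then have int: "integrable lborel (\<lambda>y. ?g (x - y) * enn2real (\<kappa> y))"
    and eq: "(\<Sum>i\<in>I. c i * convolve (indicator (A i)) \<kappa> x) = (\<integral>y. ?g (x - y) * enn2real (\<kappa> y) \<partial>lborel)"
    by (simp_all add: has_bochner_integral_iff sum_distrib_right mult.assoc)
  have "ennreal \<bar>\<integral>y. ?g (x - y) * enn2real (\<kappa> y) \<partial>lborel\<bar> \<le> (\<integral>\<^sup>+y. ennreal (norm (?g (x - y) * enn2real (\<kappa> y))) \<partial>lborel)"
    using integral_norm_bound_ennreal[OF int] by simp
  also have "\<dots> \<le> (\<integral>\<^sup>+y. ennreal \<bar>?g (x - y)\<bar> * \<kappa> y \<partial>lborel)"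
  proof (rule nn_integral_mono)
    fix y
    have "ennreal (enn2real (\<kappa> y)) \<le> \<kappa> y" by (cases "\<kappa> y") auto
    then show "ennreal (norm (?g (x - y) * enn2real (\<kappa> y))) \<le> ennreal \<bar>?g (x - y)\<bar> * \<kappa> y"
      by (auto simp: abs_mult ennreal_mult intro!: mult_left_mono)
  qed
  also have "\<dots> = (\<integral>\<^sup>+y. ennreal \<bar>?g (x - (x - y))\<bar> * \<kappa> (x - y) \<partial>lborel)"
    by (rule nn_integral_reflect[symmetric]) measurable
  also have "\<dots> = cv ?g x" by (simp add: cv_def)
  finally show ?thesis unfolding eq .
qed

lemma nsq_convolve_indicator:
  assumes [measurable]: "A \<in> sets borel" and A: "bounded A"
  shows "nsq lborel (convolve (indicator A) \<kappa>) < \<infinity>"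
proof -
  obtain r where r: "\<And>a. a \<in> A \<Longrightarrow> \<bar>a\<bar> \<le> r" using A by (auto simp: bounded_iff)
  have "nsq lborel (convolve (indicator A) \<kappa>) \<le> (\<integral>\<^sup>+x. (cv (indicator A) x)\<^sup>2 \<partial>lborel)"
    unfolding nsq_def
  proof (rule nn_integral_mono)
    fix x
    have "ennreal \<bar>convolve (indicator A) \<kappa> x\<bar> \<le> cv (indicator A) x"
      using convolve_sum_le_cv[of "{()}" "\<lambda>_. A" "\<lambda>_. 1" x] A by simp
    then have "(ennreal \<bar>convolve (indicator A) \<kappa> x\<bar>)\<^sup>2 \<le> (cv (indicator A) x)\<^sup>2" by (rule power_mono) simp
    then show "ennreal ((convolve (indicator A) \<kappa> x)\<^sup>2) \<le> (cv (indicator A) x)\<^sup>2" by (simp add: ennreal_power)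
  qed
  also have "\<dots> = energy (indicator A)" by (simp add: energy_cv)
  also have "\<dots> \<le> autoconv_mass (2 * r) * (\<integral>\<^sup>+x. ennreal ((indicator A x)\<^sup>2) \<partial>lborel)"
    using r by (intro energy_local_le[where c=0]) (auto simp: indicator_def not_le[symmetric])
  also have "(\<integral>\<^sup>+x. ennreal ((indicator A x)\<^sup>2) \<partial>lborel) = emeasure lborel A"
  proof -
    have "(\<lambda>x. ennreal ((indicator A x)\<^sup>2)) = indicator A" by (auto simp: fun_eq_iff indicator_def)
    then show ?thesis by simp
  qed
  also have "autoconv_mass (2 * r) * emeasure lborel A < \<infinity>"
    using A autoconv_mass_finite[of "2*r"] emeasure_bounded_finite[of A] by (auto simp: ennreal_mult_less_top)
  finally show ?thesis .
qed

end

lemma kernel_assumption_A: "assumption_A \<kappa> \<Longrightarrow> kernel \<kappa>"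
proof
  assume A: "assumption_A \<kappa>"
  then show "\<kappa> \<in> borel_measurable borel" by (auto simp: assumption_A_def tempered_def)
  show "(\<integral>\<^sup>+x. \<kappa> x * indicator {-r..r} x \<partial>lborel) < \<infinity>" for r
    using A by (intro tempered_locally_integrable) (auto simp: assumption_A_def)
  show "(\<integral>\<^sup>+x. autoconv \<kappa> x * indicator {-r..r} x \<partial>lborel) < \<infinity>" for r
    using A by (intro tempered_locally_integrable) (auto simp: assumption_A_def)
qed

lemma riesz_kernel_scale:
  assumes a: "0 < a" "a < 1" and l: "0 < l" and x: "x \<noteq> 0"
  shows "riesz_kernel a (l * x) = ennreal (l powr (a - 1)) * riesz_kernel a x"
proof -
  have C: "0 \<le> riesz_const a"
    using a by (auto simp: riesz_const_def intro!: mult_nonneg_nonneg divide_nonneg_nonneg less_imp_le[OF Gamma_real_pos])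
  have "riesz_const a / \<bar>l * x\<bar> powr (1 - a) = l powr (a - 1) * (riesz_const a / \<bar>x\<bar> powr (1 - a))"
    using l x powr_minus[of l "1 - a"] by (simp add: abs_mult powr_mult divide_inverse)
  then show ?thesis
    using C l x unfolding riesz_kernel_def
    by (simp add: divide_ennreal ennreal_mult[symmetric])
qed

text \<open>Only this consequence of Assumption B enters the law of large numbers.\<close>

lemma autoconv_mass_growth:
  assumes A: "assumption_A \<kappa>" and B: "assumption_B \<kappa>"
  shows "\<exists>C b. 0 \<le> b \<and> b < 1 \<and> 0 \<le> C \<and> (\<forall>r\<ge>1. kernel.autoconv_mass \<kappa> r \<le> ennreal (C * r powr b))"
proof -
  interpret kernel \<kappa> by (rule kernel_assumption_A[OF A])
  show ?thesis
    using B unfolding assumption_B_def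
  proof (elim disjE conjE exE)
    \<comment> \<open>In the integrable case Tonelli gives total mass
      \<open>(\<integral>\<kappa>)^2\<close> to \<open>autoconv \<kappa>\<close>; the mass on
      \<open>[-r, r]\<close> stays bounded and \<open>b = 0\<close> works.\<close>
    assume fin: "(\<integral>\<^sup>+x. \<kappa> x \<partial>lborel) < \<infinity>"
    have "(\<integral>\<^sup>+x. autoconv \<kappa> x \<partial>lborel) = (\<integral>\<^sup>+y. \<integral>\<^sup>+x. \<kappa> y * \<kappa> (y - x) \<partial>lborel \<partial>lborel)"
      unfolding autoconv_def by (subst lborel_pair.Fubini') auto
    also have "\<dots> = (\<integral>\<^sup>+y. \<kappa> y * (\<integral>\<^sup>+x. \<kappa> x \<partial>lborel) \<partial>lborel)"
      by (simp add: nn_integral_cmult nn_integral_reflect)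
    also have "\<dots> = (\<integral>\<^sup>+x. \<kappa> x \<partial>lborel) * (\<integral>\<^sup>+x. \<kappa> x \<partial>lborel)"
      by (simp add: nn_integral_multc)
    also have "\<dots> < \<infinity>" using fin by (simp add: ennreal_mult_less_top)
    finally obtain C where C: "(\<integral>\<^sup>+x. autoconv \<kappa> x \<partial>lborel) = ennreal C" "0 \<le> C"
      by (cases "\<integral>\<^sup>+x. autoconv \<kappa> x \<partial>lborel") auto
    have "autoconv_mass r \<le> ennreal (C * r powr 0)" if "1 \<le> r" for r
    proof -
      have "autoconv_mass r \<le> (\<integral>\<^sup>+x. autoconv \<kappa> x \<partial>lborel)"
        unfolding autoconv_mass_def by (intro nn_integral_mono) (auto simp: indicator_def)
      then show ?thesis using that C by simp
    qed
    then show ?thesis using C(2) by (intro exI[of _ C] exI[of _ 0]) auto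
  next
    fix \<alpha> :: real assume \<alpha>: "0 < \<alpha>" "\<alpha> < 1" and \<kappa>: "\<kappa> = riesz_kernel (\<alpha> / 2)"
    \<comment> \<open>The Riesz kernel is homogeneous of degree \<open>\<alpha>/2 - 1\<close>, so
      its autoconvolution has degree \<open>2 (\<alpha>/2 - 1) + 1 = \<alpha> - 1\<close>, and the
      mass on \<open>[-r, r]\<close> is \<open>r powr \<alpha>\<close> times the mass on
      \<open>[-1, 1]\<close>. This is where \<open>b = \<alpha> < 1\<close> comes from.\<close>
    have sc: "autoconv \<kappa> (l * x) = ennreal (l powr (\<alpha> - 1)) * autoconv \<kappa> x" if l: "0 < l" for l x
    proof -
      have "autoconv \<kappa> (l * x) = ennreal \<bar>l\<bar> * (\<integral>\<^sup>+y. \<kappa> (0 + l * y) * \<kappa> (- (l * x - (0 + l * y))) \<partial>lborel)"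
        unfolding autoconv_def using l by (subst nn_integral_real_affine[where c=l and t=0]) auto
      also have "\<dots> = ennreal l * (\<integral>\<^sup>+y. ennreal (l powr (\<alpha> - 2)) * (\<kappa> y * \<kappa> (- (x - y))) \<partial>lborel)"
      proof (intro arg_cong2[where f="(*)"] nn_integral_cong_AE)
        \<comment> \<open>The scaling rule is stated away from the singularity; the two points where
          an argument vanishes form a null set.\<close>
        have "AE y in lborel. y \<noteq> (0::real) \<and> y \<noteq> x"
          using AE_lborel_singleton[of "0::real"] AE_lborel_singleton[of x] by eventually_elim simp
        then show "AE y in lborel. \<kappa> (0 + l * y) * \<kappa> (- (l * x - (0 + l * y))) = ennreal (l powr (\<alpha> - 2)) * (\<kappa> y * \<kappa> (- (x - y)))"
        proof eventually_elim
          case (elim y)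
          have 1: "\<kappa> (l * y) = ennreal (l powr (\<alpha> / 2 - 1)) * \<kappa> y"
            unfolding \<kappa> using \<alpha> l elim by (intro riesz_kernel_scale) auto
          have 2: "\<kappa> (l * (y - x)) = ennreal (l powr (\<alpha> / 2 - 1)) * \<kappa> (y - x)"
            unfolding \<kappa> using \<alpha> l elim by (intro riesz_kernel_scale) auto
          have "l powr (\<alpha> / 2 - 1) * l powr (\<alpha> / 2 - 1) = l powr (\<alpha> - 2)"
            by (simp add: powr_add[symmetric])
          then have 3: "ennreal (l powr (\<alpha> / 2 - 1)) * ennreal (l powr (\<alpha> / 2 - 1)) = ennreal (l powr (\<alpha> - 2))"
            by (simp add: ennreal_mult[symmetric])
          have "- (l * x - (0 + l * y)) = l * (y - x)" by (simp add: algebra_simps)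
          then have "\<kappa> (0 + l * y) * \<kappa> (- (l * x - (0 + l * y))) = (ennreal (l powr (\<alpha> / 2 - 1)) * \<kappa> y) * (ennreal (l powr (\<alpha> / 2 - 1)) * \<kappa> (y - x))"
            using 1 2 by simp
          also have "\<dots> = (ennreal (l powr (\<alpha> / 2 - 1)) * ennreal (l powr (\<alpha> / 2 - 1))) * (\<kappa> y * \<kappa> (y - x))"
            by (simp only: mult_ac)
          finally show ?case unfolding 3 by simp
        qed
      qed (use l in auto)
      also have "\<dots> = ennreal l * ennreal (l powr (\<alpha> - 2)) * autoconv \<kappa> x"
        unfolding autoconv_def by (simp add: nn_integral_cmult mult.assoc)
      also have "ennreal l * ennreal (l powr (\<alpha> - 2)) = ennreal (l powr (\<alpha> - 1))"
        using l powr_add[of l 1 "\<alpha> - 2"] by (simp add: ennreal_mult[symmetric])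
      finally show ?thesis .
    qed
    obtain C where C: "autoconv_mass 1 = ennreal C" "0 \<le> C"
      using autoconv_mass_finite[of 1] by (cases "autoconv_mass 1") auto
    have "autoconv_mass r \<le> ennreal (C * r powr \<alpha>)" if r: "1 \<le> r" for r
    proof -
      have "autoconv_mass r = ennreal \<bar>r\<bar> * (\<integral>\<^sup>+x. autoconv \<kappa> (0 + r * x) * indicator {-r..r} (0 + r * x) \<partial>lborel)"
        unfolding autoconv_mass_def using r by (intro nn_integral_real_affine) auto
      also have "\<dots> = ennreal r * (\<integral>\<^sup>+x. ennreal (r powr (\<alpha> - 1)) * (autoconv \<kappa> x * indicator {-1..1} x) \<partial>lborel)"
      proof (rule arg_cong2[where f="(*)"], use r in simp, rule nn_integral_cong)
        fix x
        have "r * x \<in> {-r..r} \<longleftrightarrow> x \<in> {-1..1}"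
          using r mult_le_cancel_left_pos[of r x 1] mult_le_cancel_left_pos[of r "-1" x] by auto
        then show "autoconv \<kappa> (0 + r * x) * indicator {-r..r} (0 + r * x) = ennreal (r powr (\<alpha> - 1)) * (autoconv \<kappa> x * indicator {-1..1} x)"
          using sc[of r x] r by (auto simp: indicator_def)
      qed
      also have "\<dots> = (ennreal r * ennreal (r powr (\<alpha> - 1))) * autoconv_mass 1"
        unfolding autoconv_mass_def by (simp add: nn_integral_cmult mult.assoc)
      also have "ennreal r * ennreal (r powr (\<alpha> - 1)) = ennreal (r powr \<alpha>)"
        using r powr_add[of r 1 "\<alpha> - 1"] by (simp add: ennreal_mult[symmetric])
      also have "ennreal (r powr \<alpha>) * autoconv_mass 1 = ennreal (C * r powr \<alpha>)"
        using C by (simp add: ennreal_mult[symmetric] mult.commute)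
      finally show ?thesis by simp
    qed
    then show ?thesis using \<alpha> C(2) by (intro exI[of _ C] exI[of _ \<alpha>]) auto
  qed
qed

section \<open>Factoring through the counts up to null sets\<close>

text \<open>\<open>neg\<close> is a \<open>\<sigma>\<close>-ideal of exceptional sets: for random variables the null sets, for
  processes the sets of triples \<open>(\<omega>, t, x)\<close> whose \<open>\<omega>\<close> run through a null set.\<close>

lemma factorization_AE:
  fixes f :: "'a \<Rightarrow> real"
  assumes A: "space Am = X" "sets Am = sigma_sets X G" and T: "\<And>x. x \<in> X \<Longrightarrow> T x \<in> space B"
    and neg0: "neg {}" and neg_UN: "\<And>S :: nat \<Rightarrow> 'a set. (\<And>n. neg (S n)) \<Longrightarrow> neg (\<Union>n. S n)"
    and neg_mono: "\<And>S S'. neg S \<Longrightarrow> S' \<subseteq> S \<Longrightarrow> neg S'"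
    and gen: "\<And>g. g \<in> G \<Longrightarrow> \<exists>b\<in>sets B. neg {x\<in>X. (x \<in> g) \<noteq> (T x \<in> b)}"
    and f: "f \<in> borel_measurable Am"
  shows "\<exists>h\<in>borel_measurable B. neg {x\<in>X. f x \<noteq> h (T x)}"
proof -
  have step: "\<exists>b\<in>sets B. neg {x\<in>X. (x \<in> g) \<noteq> (T x \<in> b)}" if "g \<in> sigma_sets X G" for g
    using that
  proof induction
    case (Basic g) then show ?case by (rule gen)
  next
    case Empty show ?case by (rule bexI[of _ "{}"]) (auto simp: neg0)
  next
    case (Compl g)
    then obtain b where b: "b \<in> sets B" "neg {x\<in>X. (x \<in> g) \<noteq> (T x \<in> b)}" by auto
    show ?case
      by (rule bexI[of _ "space B - b"], rule neg_mono[OF b(2)]) (use T b in auto)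
  next
    case (Union a)
    then have "\<forall>n. \<exists>b\<in>sets B. neg {x\<in>X. (x \<in> a n) \<noteq> (T x \<in> b)}" by auto
    then obtain b where b: "\<And>n. b n \<in> sets B" "\<And>n. neg {x\<in>X. (x \<in> a n) \<noteq> (T x \<in> b n)}" by metis
    have "neg (\<Union>n. {x\<in>X. (x \<in> a n) \<noteq> (T x \<in> b n)})" using b(2) by (rule neg_UN)
    then have "neg {x\<in>X. (x \<in> (\<Union>n. a n)) \<noteq> (T x \<in> (\<Union>n. b n))}" by (rule neg_mono) blast
    then show ?case using b(1) by (intro bexI[of _ "\<Union>n. b n"]) auto
  qed
  have "\<forall>q::rat. \<exists>b\<in>sets B. neg {x\<in>X. (x \<in> {x\<in>space Am. f x < of_rat q}) \<noteq> (T x \<in> b)}"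
  proof
    fix q :: rat
    have "{x\<in>space Am. f x < of_rat q} \<in> sets Am" using f by measurable
    then show "\<exists>b\<in>sets B. neg {x\<in>X. (x \<in> {x\<in>space Am. f x < of_rat q}) \<noteq> (T x \<in> b)}"
      by (intro step) (simp add: A)
  qed
  from choice[OF this[unfolded Bex_def]]
  obtain b where b: "\<And>q::rat. b q \<in> sets B" "\<And>q. neg {x\<in>X. (x \<in> {x\<in>space Am. f x < of_rat q}) \<noteq> (T x \<in> b q)}"
    by blast
  note [measurable] = b(1)
  \<comment> \<open>A real number is the infimum of the rationals above it, so \<open>f\<close> is
    recovered from countably many sublevel sets. The infimum is taken in \<open>ereal\<close>, where
    it exists also at points that meet none of the sets \<open>b q\<close>.\<close>
  define e where "e y = (INF q. if y \<in> b q then ereal (of_rat q) else \<infinity>)" for y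
  have [measurable]: "e \<in> borel_measurable B" unfolding e_def[abs_def] by measurable
  let ?S = "\<lambda>n. {x\<in>X. (x \<in> {x\<in>space Am. f x < of_rat (from_nat n)}) \<noteq> (T x \<in> b (from_nat n))}"
  have "neg (\<Union>n. ?S n)" using b(2) by (rule neg_UN)
  then have "neg {x\<in>X. f x \<noteq> real_of_ereal (e (T x))}"
  proof (rule neg_mono, intro subsetI)
    fix x assume x: "x \<in> {x\<in>X. f x \<noteq> real_of_ereal (e (T x))}"
    show "x \<in> (\<Union>n. ?S n)"
    proof (rule ccontr)
      assume n: "x \<notin> (\<Union>n. ?S n)"
      have iff: "T x \<in> b q \<longleftrightarrow> f x < of_rat q" for q :: rat
      proof -
        have "x \<notin> ?S (to_nat q)" using n by blast
        then show ?thesis using x A by auto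
      qed
      have "e (T x) = ereal (f x)"
      proof (rule antisym)
        show "ereal (f x) \<le> e (T x)"
          unfolding e_def by (intro INF_greatest) (auto simp: iff)
        show "e (T x) \<le> ereal (f x)"
        proof (rule ccontr)
          assume "\<not> e (T x) \<le> ereal (f x)"
          then obtain z where z: "ereal (f x) < ereal z" "ereal z < e (T x)"
            using ereal_dense2[of "ereal (f x)" "e (T x)"] by (auto simp: not_le)
          then obtain q where q: "f x < of_rat q" "of_rat q < z" using of_rat_dense[of "f x" z] by auto
          have "e (T x) \<le> (if T x \<in> b q then ereal (of_rat q) else \<infinity>)"
            unfolding e_def by (rule INF_lower) simp
          also have "\<dots> = ereal (of_rat q)" using q(1) by (simp add: iff)
          also have "\<dots> < ereal z" using q(2) by simp
          finally show False using z(2) by simp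
        qed
      qed
      then show False using x by simp
    qed
  qed
  then show ?thesis by (intro bexI[of _ "\<lambda>y. real_of_ereal (e y)"]) auto
qed

section \<open>Boxes generating the filtration, and the intensity measure\<close>

definition boxes :: "real \<Rightarrow> (real \<times> real \<times> real) set set" where
  "boxes a = {{0..s} \<times> A \<times> B | s A B. 0 \<le> s \<and> s \<le> a \<and> A \<in> sets borel \<and> bounded A \<and>
     B \<in> sets borel_R0 \<and> bounded_R0 B}"

text \<open>One region containing all boxes up to time \<open>a\<close>. An integrand that lives on
  times after \<open>a\<close> vanishes on it, which matches the hypothesis of the covariance
  formula.\<close>

definition past :: "real \<Rightarrow> (real \<times> real \<times> real) set" where
  "past a = {0..a} \<times> UNIV \<times> (- {0})"

lemma boxes_mono: "a \<le> b \<Longrightarrow> boxes a \<subseteq> boxes b"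
  unfolding boxes_def by force

lemma boxes_past: "A \<in> boxes a \<Longrightarrow> A \<subseteq> past a"
  by (auto simp: boxes_def past_def borel_R0_def sets_restrict_space)

lemma noise_filtration_space[simp]: "space (noise_filtration M N a) = space M"
  by (simp add: noise_filtration_def space_measure_of_conv)

locale levy_measure =
  fixes \<nu> :: "real measure"
  assumes sets_\<nu>: "sets \<nu> = sets borel_R0"
    and second_moment_finite: "(\<integral>\<^sup>+z. ennreal (\<bar>z\<bar>\<^sup>2) \<partial>\<nu>) < \<infinity>"
begin

definition m2 :: real where "m2 = (\<integral>z. z\<^sup>2 \<partial>\<nu>)"

lemma space_\<nu>: "space \<nu> = - {0}"
  using sets_eq_imp_space_eq[OF sets_\<nu>] by (simp add: borel_R0_def space_restrict_space)

lemma measurable_\<nu>[measurable]: "(\<lambda>z. z) \<in> measurable \<nu> borel"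
proof -
  have "(\<lambda>z. z) \<in> measurable borel_R0 borel" unfolding borel_R0_def by (rule measurable_restrict_space1) simp
  then show ?thesis using measurable_cong_sets[OF sets_\<nu> refl] by blast
qed

lemma nsq_\<nu>: "nsq \<nu> (\<lambda>z. z) < \<infinity>"
  using second_moment_finite by (simp add: nsq_def)

lemma m2_nonneg: "0 \<le> m2"
  by (simp add: m2_def)

text \<open>A Chebyshev bound: the integrable function \<open>z^2\<close> is positive off
  \<open>0\<close>, so the sets where it is at least \<open>1/(n+1)\<close> have finite mass and
  exhaust the space.\<close>

lemma sigma_finite_\<nu>: "sigma_finite_measure \<nu>"
proof
  let ?A = "\<lambda>n::nat. {z\<in>space \<nu>. 1 / real (Suc n) \<le> z\<^sup>2}"
  have m: "?A n \<in> sets \<nu>" for n by measurable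
  have "emeasure \<nu> (?A n) \<noteq> \<infinity>" for n
  proof -
    have "emeasure \<nu> (?A n) = (\<integral>\<^sup>+z. indicator (?A n) z \<partial>\<nu>)" using m by simp
    also have "\<dots> \<le> (\<integral>\<^sup>+z. ennreal (real (Suc n)) * ennreal (z\<^sup>2) \<partial>\<nu>)"
    proof (rule nn_integral_mono)
      fix z assume "z \<in> space \<nu>"
      show "indicator (?A n) z \<le> ennreal (real (Suc n)) * ennreal (z\<^sup>2)"
      proof (cases "z \<in> ?A n")
        case True
        then have "1 \<le> real (Suc n) * z\<^sup>2" by (simp add: field_simps del: of_nat_Suc)
        then have "ennreal 1 \<le> ennreal (real (Suc n) * z\<^sup>2)" by (rule ennreal_leI)
        then show ?thesis using True by (simp add: ennreal_mult del: of_nat_Suc)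
      qed simp
    qed
    also have "\<dots> < \<infinity>"
      using nsq_\<nu> by (subst nn_integral_cmult) (auto simp: nsq_def ennreal_mult_less_top simp del: of_nat_Suc)
    finally show ?thesis by simp
  qed
  moreover have "\<Union> (range ?A) = space \<nu>"
  proof safe
    fix z assume z: "z \<in> space \<nu>"
    then have "0 < z\<^sup>2" by (simp add: space_\<nu>)
    then obtain n where "inverse (real (Suc n)) < z\<^sup>2" using reals_Archimedean by blast
    then have "z \<in> ?A n" using z by (simp add: inverse_eq_divide del: of_nat_Suc)
    then show "z \<in> \<Union> (range ?A)" by blast
  qed
  ultimately show "\<exists>A. countable A \<and> A \<subseteq> sets \<nu> \<and> \<Union> A = space \<nu> \<and> (\<forall>a\<in>A. emeasure \<nu> a \<noteq> \<infinity>)"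
    using m by (intro exI[of _ "range ?A"]) auto
qed

sublocale \<nu>: sigma_finite_measure \<nu> by (rule sigma_finite_\<nu>)

sublocale time: sigma_finite_measure "restrict_space lborel {0::real..}"
  by (rule sigma_finite_measure_restrict_space) (auto intro: sigma_finite_lborel)

sublocale xz: pair_sigma_finite "lborel :: real measure" \<nu> ..


lemma sigma_finite_xz: "sigma_finite_measure (lborel \<Otimes>\<^sub>M \<nu>)"
  by (rule sigma_finite_pair_measure[OF sigma_finite_lborel sigma_finite_\<nu>])

sublocale txz: pair_sigma_finite "restrict_space lborel {0::real..}" "lborel \<Otimes>\<^sub>M \<nu>"
  by (intro pair_sigma_finite.intro sigma_finite_xz time.sigma_finite_measure_axioms)

lemma space_intensity: "space (intensity \<nu>) = {0..} \<times> UNIV \<times> (- {0})"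
  by (simp add: intensity_def space_pair_measure space_restrict_space space_\<nu>)

lemma measurable_intensity_fst[measurable]: "fst \<in> borel_measurable (intensity \<nu>)"
  and measurable_intensity_snd[measurable]: "snd \<in> measurable (intensity \<nu>) (lborel \<Otimes>\<^sub>M \<nu>)"
proof -
  have "fst \<in> measurable (intensity \<nu>) (restrict_space lborel {0..})" unfolding intensity_def by simp
  from measurable_compose[OF this measurable_restrict_space1[OF measurable_ident_sets[OF sets_lborel]]]
  show "fst \<in> borel_measurable (intensity \<nu>)" by simp
  show "snd \<in> measurable (intensity \<nu>) (lborel \<Otimes>\<^sub>M \<nu>)" unfolding intensity_def by simp
qed

lemma measurable_intensity_x[measurable]: "(\<lambda>p. fst (snd p)) \<in> borel_measurable (intensity \<nu>)"
  and measurable_intensity_z[measurable]: "(\<lambda>p. snd (snd p)) \<in> borel_measurable (intensity \<nu>)"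
proof -
  have "fst \<in> borel_measurable (lborel \<Otimes>\<^sub>M \<nu>)" using measurable_fst[of "lborel::real measure" \<nu>] by simp
  from measurable_compose[OF measurable_intensity_snd this] show "(\<lambda>p. fst (snd p)) \<in> borel_measurable (intensity \<nu>)" .
  have "snd \<in> borel_measurable (lborel \<Otimes>\<^sub>M \<nu>)" using measurable_compose[OF measurable_snd measurable_\<nu>] by simp
  from measurable_compose[OF measurable_intensity_snd this] show "(\<lambda>p. snd (snd p)) \<in> borel_measurable (intensity \<nu>)" .
qed

lemma sets_intensity_box:
  assumes "T \<in> sets borel" "A \<in> sets borel" "B \<in> sets borel_R0" "T \<subseteq> {0..}"
  shows "T \<times> A \<times> B \<in> sets (intensity \<nu>)"
  unfolding intensity_def using assms sets_\<nu>
  by (intro pair_measureI) (auto simp: sets_restrict_space_iff)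

lemma boxes_sets: "boxes a \<subseteq> sets (intensity \<nu>)"
  by (auto simp: boxes_def intro!: sets_intensity_box)

lemma past_sets: "past a \<in> sets (intensity \<nu>)"
  unfolding past_def by (intro sets_intensity_box) (auto simp: borel_R0_def sets_restrict_space_iff)

definition tensor :: "real set \<Rightarrow> (real \<Rightarrow> real) \<Rightarrow> real \<times> real \<times> real \<Rightarrow> real" where
  "tensor J \<psi> = (\<lambda>(s, x, z). indicator J s * \<psi> x * z)"

lemma measurable_tensor[measurable]:
  assumes [measurable]: "J \<in> sets borel" "\<psi> \<in> borel_measurable borel"
  shows "tensor J \<psi> \<in> borel_measurable (intensity \<nu>)"
  unfolding tensor_def split_beta' by measurable

lemma nsq_tensor:
  assumes [measurable]: "J \<in> sets borel" "\<psi> \<in> borel_measurable borel"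
    and J: "emeasure lborel J < \<infinity>" and \<psi>: "nsq lborel \<psi> < \<infinity>"
  shows "nsq (intensity \<nu>) (tensor J \<psi>) < \<infinity>"
proof -
  have m[measurable]: "(\<lambda>q. ennreal ((\<psi> (fst q) * snd q)\<^sup>2)) \<in> borel_measurable (lborel \<Otimes>\<^sub>M \<nu>)"
    using measurable_compose[OF measurable_snd measurable_\<nu>, of "lborel::real measure"] by measurable
  have "nsq (intensity \<nu>) (tensor J \<psi>) = (\<integral>\<^sup>+s. \<integral>\<^sup>+q. ennreal ((tensor J \<psi> (s, q))\<^sup>2) \<partial>(lborel \<Otimes>\<^sub>M \<nu>) \<partial>restrict_space lborel {0..})"
    unfolding nsq_def intensity_def
  proof (rule sigma_finite_measure.nn_integral_fst[OF sigma_finite_xz, symmetric])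
    have t: "tensor J \<psi> \<in> borel_measurable (restrict_space lborel {0..} \<Otimes>\<^sub>M (lborel \<Otimes>\<^sub>M \<nu>))"
      using measurable_tensor[OF assms(1,2)] unfolding intensity_def .
    show "(\<lambda>p. ennreal ((tensor J \<psi> p)\<^sup>2)) \<in> borel_measurable (restrict_space lborel {0..} \<Otimes>\<^sub>M (lborel \<Otimes>\<^sub>M \<nu>))"
      by (rule measurable_compose[OF t]) measurable
  qed
  also have "\<dots> = (\<integral>\<^sup>+s. indicator J s * (\<integral>\<^sup>+q. ennreal ((\<psi> (fst q) * snd q)\<^sup>2) \<partial>(lborel \<Otimes>\<^sub>M \<nu>)) \<partial>restrict_space lborel {0..})"
    by (intro nn_integral_cong, subst nn_integral_cmult[symmetric])
       (auto intro!: nn_integral_cong simp: tensor_def indicator_def split_beta' m)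
  also have "\<dots> \<le> (\<integral>\<^sup>+s. indicator J s * (\<integral>\<^sup>+q. ennreal ((\<psi> (fst q) * snd q)\<^sup>2) \<partial>(lborel \<Otimes>\<^sub>M \<nu>)) \<partial>lborel)"
    by (subst nn_integral_restrict_space) (auto intro!: nn_integral_mono simp: indicator_def)
  also have "\<dots> = emeasure lborel J * (\<integral>\<^sup>+q. ennreal ((\<psi> (fst q) * snd q)\<^sup>2) \<partial>(lborel \<Otimes>\<^sub>M \<nu>))"
    by (subst nn_integral_multc) auto
  also have "(\<integral>\<^sup>+q. ennreal ((\<psi> (fst q) * snd q)\<^sup>2) \<partial>(lborel \<Otimes>\<^sub>M \<nu>)) = (\<integral>\<^sup>+x. \<integral>\<^sup>+z. ennreal ((\<psi> x * z)\<^sup>2) \<partial>\<nu> \<partial>lborel)"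
    using \<nu>.nn_integral_fst[OF m] by simp
  also have "\<dots> = nsq lborel \<psi> * nsq \<nu> (\<lambda>z. z)"
    by (simp add: nsq_def power_mult_distrib ennreal_mult nn_integral_cmult nn_integral_multc)
  finally show ?thesis
    using J \<psi> nsq_\<nu> by (auto simp: ennreal_mult_less_top intro: le_less_trans)
qed

text \<open>For product integrands the covariance splits into time overlap, spatial inner product
  and second moment of the jumps. The set \<open>{0..}\<close> enters because the time measure lives
  on the half line.\<close>

lemma integral_tensor:
  assumes [measurable]: "J \<in> sets borel" "\<psi> \<in> borel_measurable borel" "J' \<in> sets borel" "\<psi>' \<in> borel_measurable borel"
    and J: "emeasure lborel J < \<infinity>" "emeasure lborel J' < \<infinity>" and \<psi>: "nsq lborel \<psi> < \<infinity>" "nsq lborel \<psi>' < \<infinity>"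
  shows "(\<integral>p. tensor J \<psi> p * tensor J' \<psi>' p \<partial>intensity \<nu>) = measure lborel (J \<inter> J' \<inter> {0..}) * (\<integral>x. \<psi> x * \<psi>' x \<partial>lborel) * m2"
proof -
  have int: "integrable (intensity \<nu>) (\<lambda>p. tensor J \<psi> p * tensor J' \<psi>' p)"
    using J \<psi> by (intro integrable_mult_L2 nsq_tensor) auto
  have mz: "snd \<in> borel_measurable (lborel \<Otimes>\<^sub>M \<nu>)" using measurable_compose[OF measurable_snd measurable_\<nu>, of "lborel::real measure"] by simp
  have sqint: "integrable (lborel \<Otimes>\<^sub>M \<nu>) (\<lambda>q. (\<psi> (fst q) * snd q) * (\<psi>' (fst q) * snd q))"
  proof (rule integrable_mult_L2)
    have *: "(\<lambda>q. \<phi> (fst q) * snd q) \<in> borel_measurable (lborel \<Otimes>\<^sub>M \<nu>) \<and> nsq (lborel \<Otimes>\<^sub>M \<nu>) (\<lambda>q. \<phi> (fst q) * snd q) < \<infinity>"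
      if [measurable]: "\<phi> \<in> borel_measurable borel" and \<phi>: "nsq lborel \<phi> < \<infinity>" for \<phi>
    proof
      note [measurable] = mz
      show m: "(\<lambda>q. \<phi> (fst q) * snd q) \<in> borel_measurable (lborel \<Otimes>\<^sub>M \<nu>)" by measurable
      have "nsq (lborel \<Otimes>\<^sub>M \<nu>) (\<lambda>q. \<phi> (fst q) * snd q) = (\<integral>\<^sup>+x. \<integral>\<^sup>+z. ennreal ((\<phi> x * z)\<^sup>2) \<partial>\<nu> \<partial>lborel)"
        unfolding nsq_def by (subst \<nu>.nn_integral_fst[symmetric]) (use m in auto)
      also have "\<dots> = nsq lborel \<phi> * nsq \<nu> (\<lambda>z. z)"
        by (simp add: nsq_def power_mult_distrib ennreal_mult nn_integral_cmult nn_integral_multc)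
      also have "\<dots> < \<infinity>" using \<phi> nsq_\<nu> by (simp add: ennreal_mult_less_top)
      finally show "nsq (lborel \<Otimes>\<^sub>M \<nu>) (\<lambda>q. \<phi> (fst q) * snd q) < \<infinity>" .
    qed
    show "(\<lambda>q. \<psi> (fst q) * snd q) \<in> borel_measurable (lborel \<Otimes>\<^sub>M \<nu>)" "nsq (lborel \<Otimes>\<^sub>M \<nu>) (\<lambda>q. \<psi> (fst q) * snd q) < \<infinity>"
      "(\<lambda>q. \<psi>' (fst q) * snd q) \<in> borel_measurable (lborel \<Otimes>\<^sub>M \<nu>)" "nsq (lborel \<Otimes>\<^sub>M \<nu>) (\<lambda>q. \<psi>' (fst q) * snd q) < \<infinity>"
      using *[of \<psi>] *[of \<psi>'] \<psi> by auto
  qed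
  have in2: "(\<integral>q. (\<psi> (fst q) * snd q) * (\<psi>' (fst q) * snd q) \<partial>(lborel \<Otimes>\<^sub>M \<nu>)) = (\<integral>x. \<psi> x * \<psi>' x \<partial>lborel) * m2"
  proof -
    have "(\<integral>q. (\<psi> (fst q) * snd q) * (\<psi>' (fst q) * snd q) \<partial>(lborel \<Otimes>\<^sub>M \<nu>)) = (\<integral>x. \<integral>z. (\<psi> x * \<psi>' x) * z\<^sup>2 \<partial>\<nu> \<partial>lborel)"
      using xz.integral_fst'[OF sqint] by (simp add: power2_eq_square mult_ac)
    then show ?thesis by (simp add: m2_def)
  qed
  have "(\<integral>p. tensor J \<psi> p * tensor J' \<psi>' p \<partial>intensity \<nu>) = (\<integral>s. \<integral>q. tensor J \<psi> (s, q) * tensor J' \<psi>' (s, q) \<partial>(lborel \<Otimes>\<^sub>M \<nu>) \<partial>restrict_space lborel {0..})"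
    using txz.integral_fst'[OF int[unfolded intensity_def]] by (simp add: intensity_def)
  also have "\<dots> = (\<integral>s. (indicator J s * indicator J' s) * ((\<integral>x. \<psi> x * \<psi>' x \<partial>lborel) * m2) \<partial>restrict_space lborel {0..})"
  proof (intro Bochner_Integration.integral_cong refl)
    fix s :: real
    have "(\<integral>q. tensor J \<psi> (s, q) * tensor J' \<psi>' (s, q) \<partial>(lborel \<Otimes>\<^sub>M \<nu>)) = (\<integral>q. (indicator J s * indicator J' s) * ((\<psi> (fst q) * snd q) * (\<psi>' (fst q) * snd q)) \<partial>(lborel \<Otimes>\<^sub>M \<nu>))"
      by (intro Bochner_Integration.integral_cong refl) (simp add: tensor_def split_beta' mult_ac)
    then show "(\<integral>q. tensor J \<psi> (s, q) * tensor J' \<psi>' (s, q) \<partial>(lborel \<Otimes>\<^sub>M \<nu>)) = (indicator J s * indicator J' s) * ((\<integral>x. \<psi> x * \<psi>' x \<partial>lborel) * m2)"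
      by (simp add: in2)
  qed
  also have "\<dots> = (\<integral>s. indicator (J \<inter> J' \<inter> {0..}) s * ((\<integral>x. \<psi> x * \<psi>' x \<partial>lborel) * m2) \<partial>lborel)"
  proof -
    have *: "indicator {0..} s *\<^sub>R ((indicator J s * indicator J' s) * c) = indicator (J \<inter> J' \<inter> {0..}) s * c" for s c :: real
      by (auto simp: indicator_def)
    show ?thesis by (subst integral_restrict_space) (auto simp only: * sets_lborel space_lborel Int_UNIV_right assms borel_closed closed_real_atLeast)
  qed
  also have "\<dots> = measure lborel (J \<inter> J' \<inter> {0..}) * ((\<integral>x. \<psi> x * \<psi>' x \<partial>lborel) * m2)"
    by simp
  finally show ?thesis by simp
qed

end

section \<open>The colored noise and its simple stochastic integrals\<close>

locale levy_noise = levy_measure \<nu> + kernel \<kappa> + prm M "intensity \<nu>" N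
  for M :: "'w measure" and \<nu> N \<kappa>
begin

lemma noise_filtration_sets: "sets (noise_filtration M N a) = sigma_sets (space M)
     ({{\<omega>\<in>space M. emeasure (N \<omega>) ({0..s} \<times> A \<times> B) \<in> C} | s A B C.
         0 \<le> s \<and> s \<le> a \<and> A \<in> sets borel \<and> bounded A \<and>
         B \<in> sets borel_R0 \<and> bounded_R0 B \<and> C \<in> sets borel} \<union> null_sets M)"
  unfolding noise_filtration_def
  by (intro sets_measure_of) (auto dest: sets.sets_into_space null_setsD2)

lemma noise_filtration_generator:
  "{{\<omega>\<in>space M. emeasure (N \<omega>) ({0..s} \<times> A \<times> B) \<in> C} | s A B C.
         0 \<le> s \<and> s \<le> a \<and> A \<in> sets borel \<and> bounded A \<and>
         B \<in> sets borel_R0 \<and> bounded_R0 B \<and> C \<in> sets borel} \<union> null_sets M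
   = {{\<omega>\<in>space M. emeasure (N \<omega>) D \<in> C} | D C. D \<in> boxes a \<and> C \<in> sets borel} \<union> null_sets M"
  unfolding boxes_def by blast

lemma noise_filtration_mono:
  assumes "a \<le> b" "Y \<in> borel_measurable (noise_filtration M N a)"
  shows "Y \<in> borel_measurable (noise_filtration M N b)"
proof -
  have "sets (noise_filtration M N a) \<subseteq> sets (noise_filtration M N b)"
    unfolding noise_filtration_sets noise_filtration_generator
    by (rule sigma_sets_mono') (use boxes_mono[OF assms(1)] in blast)
  then show ?thesis using assms(2) by (auto simp: measurable_def)
qed

lemma noise_filtration_le:
  assumes "Y \<in> borel_measurable (noise_filtration M N a)"
  shows "Y \<in> borel_measurable M"
proof -
  have "sets (noise_filtration M N a) \<subseteq> sets M"
    unfolding noise_filtration_sets noise_filtration_generator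
  proof (rule sets.sigma_sets_subset, safe)
    fix D C assume "D \<in> boxes a" "C \<in> sets (borel::ennreal measure)"
    then show "{\<omega>\<in>space M. emeasure (N \<omega>) D \<in> C} \<in> sets M"
      using measurable_sets[OF measurable_N[of D]] boxes_sets[of a] by (auto simp: vimage_def Int_def conj_commute)
  qed auto
  then show ?thesis using assms by (auto simp: measurable_def)
qed

lemma measurable_noise_filtration_cnt:
  assumes "y \<in> borel_measurable (cnt_space (boxes a))"
  shows "(\<lambda>\<omega>. y (cnt N (boxes a) \<omega>)) \<in> borel_measurable (noise_filtration M N a)"
proof -
  have "cnt N (boxes a) \<in> measurable (noise_filtration M N a) (cnt_space (boxes a))"
    unfolding cnt_def[abs_def]
  proof (rule measurable_restrict, rule measurableI)
    fix D C assume D: "D \<in> boxes a" "C \<in> sets (borel::ennreal measure)"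
    then have "{\<omega>\<in>space M. emeasure (N \<omega>) D \<in> C} \<in> sets (noise_filtration M N a)"
      unfolding noise_filtration_sets noise_filtration_generator by blast
    then show "(\<lambda>\<omega>. emeasure (N \<omega>) D) -` C \<inter> space (noise_filtration M N a) \<in> sets (noise_filtration M N a)"
      by (simp add: vimage_def Int_def conj_commute)
  qed simp
  from measurable_compose[OF this assms] show ?thesis .
qed

text \<open>The null sets put into the filtration are what limits the factorization to almost every
  sample point. They generate the ideal of exceptional sets.\<close>

lemma noise_filtration_factor:
  fixes Y :: "'w \<Rightarrow> real"
  assumes "Y \<in> borel_measurable (noise_filtration M N a)"
  shows "\<exists>y\<in>borel_measurable (cnt_space (boxes a)). AE \<omega> in M. Y \<omega> = y (cnt N (boxes a) \<omega>)"
proof -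
  let ?neg = "\<lambda>S. \<exists>Z\<in>null_sets M. S \<subseteq> Z"
  have "\<exists>y\<in>borel_measurable (cnt_space (boxes a)). ?neg {\<omega>\<in>space M. Y \<omega> \<noteq> y (cnt N (boxes a) \<omega>)}"
  proof (rule factorization_AE[where Am="noise_filtration M N a" and neg="?neg" and f=Y
      and G="{{\<omega>\<in>space M. emeasure (N \<omega>) D \<in> C} | D C. D \<in> boxes a \<and> C \<in> sets borel} \<union> null_sets M"])
    show "Y \<in> borel_measurable (noise_filtration M N a)" by fact
    show "sets (noise_filtration M N a) = sigma_sets (space M)
      ({{\<omega>\<in>space M. emeasure (N \<omega>) D \<in> C} | D C. D \<in> boxes a \<and> C \<in> sets borel} \<union> null_sets M)"
      unfolding noise_filtration_sets noise_filtration_generator ..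
    show "cnt N (boxes a) \<omega> \<in> space (cnt_space (boxes a))" for \<omega>
      by (simp add: cnt_def space_PiM)
    show "?neg {}" by auto
    show "?neg (\<Union>n. S n)" if S: "\<And>n. ?neg (S n)" for S :: "nat \<Rightarrow> 'w set"
    proof -
      obtain Z where Z: "\<And>n. Z n \<in> null_sets M" "\<And>n. S n \<subseteq> Z n" using S by metis
      then show ?thesis by (intro bexI[of _ "\<Union>n. Z n"]) auto
    qed
    show "?neg S'" if "?neg S" "S' \<subseteq> S" for S S' using that by blast
    fix g assume "g \<in> {{\<omega>\<in>space M. emeasure (N \<omega>) D \<in> C} | D C. D \<in> boxes a \<and> C \<in> sets borel} \<union> null_sets M"
    then show "\<exists>b\<in>sets (cnt_space (boxes a)). ?neg {x\<in>space M. (x \<in> g) \<noteq> (cnt N (boxes a) x \<in> b)}"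
    proof safe
      fix D C assume D: "D \<in> boxes a" "C \<in> sets (borel::ennreal measure)"
      let ?b = "{c\<in>space (cnt_space (boxes a)). c D \<in> C}"
      have "?b \<in> sets (cnt_space (boxes a))"
        using measurable_sets[OF measurable_component_singleton[OF D(1)] D(2)]
        by (simp add: vimage_def Int_def conj_commute)
      note b = this
      have "{x\<in>space M. (x \<in> {\<omega>\<in>space M. emeasure (N \<omega>) D \<in> C}) \<noteq> (cnt N (boxes a) x \<in> ?b)} = {}"
        using D by (auto simp: cnt_def space_PiM)
      then have "?neg {x\<in>space M. (x \<in> {\<omega>\<in>space M. emeasure (N \<omega>) D \<in> C}) \<noteq> (cnt N (boxes a) x \<in> ?b)}"
        by (intro bexI[of _ "{}"]) (simp_all only: empty_subsetI null_sets.empty_sets)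
      then show "\<exists>b\<in>sets (cnt_space (boxes a)). ?neg {x\<in>space M. (x \<in> {\<omega>\<in>space M. emeasure (N \<omega>) D \<in> C}) \<noteq> (cnt N (boxes a) x \<in> b)}"
        by (rule bexI[OF _ b])
    next
      \<comment> \<open>A null generator is matched with the empty set of counts; the discrepancy is
        the null set itself.\<close>
      assume "g \<in> null_sets M"
      then show "\<exists>b\<in>sets (cnt_space (boxes a)). ?neg {x\<in>space M. (x \<in> g) \<noteq> (cnt N (boxes a) x \<in> b)}"
        by (intro bexI[of _ "{}"] bexI[of _ g]) auto
    qed
  qed simp
  then obtain y Z where y: "y \<in> borel_measurable (cnt_space (boxes a))" "Z \<in> null_sets M"
    "{\<omega>\<in>space M. Y \<omega> \<noteq> y (cnt N (boxes a) \<omega>)} \<subseteq> Z" by blast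
  then show ?thesis by (intro bexI[of _ y] AE_I') auto
qed

abbreviation X :: "real \<Rightarrow> real set \<Rightarrow> 'w \<Rightarrow> real" where
  "X t A \<equiv> levy_colored_noise M \<nu> N \<kappa> t (indicator A)"

text \<open>The convolution of the indicator with \<open>\<kappa>\<close> is in \<open>L2\<close>,
  so the integral exists, and the version picked by the choice operator is a genuine one.\<close>

lemma has_compensated_integral_X:
  assumes [measurable]: "A \<in> sets borel" and A: "bounded A"
  shows "has_compensated_integral M N (intensity \<nu>) (tensor {0..t} (convolve (indicator A) \<kappa>)) (X t A)"
proof -
  have "prm M (intensity \<nu>) N" ..
  moreover have "nsq (intensity \<nu>) (tensor {0..t} (convolve (indicator A) \<kappa>)) < \<infinity>"
    using A by (intro nsq_tensor nsq_convolve_indicator) (auto simp: emeasure_lborel_Icc_eq)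
  ultimately obtain L where "has_compensated_integral M N (intensity \<nu>) (tensor {0..t} (convolve (indicator A) \<kappa>)) (\<lambda>\<omega>. L (cnt N (sets (intensity \<nu>)) \<omega>))"
    using compensated_integral_exists[of M "intensity \<nu>" N "tensor {0..t} (convolve (indicator A) \<kappa>)"] by auto
  then show ?thesis
    unfolding levy_colored_noise_def levy_white_noise_def tensor_def
    by (rule someI[of "has_compensated_integral M N (intensity \<nu>) (\<lambda>(s, x, z). indicator {0..t} s * convolve (indicator A) \<kappa> x * z)"])
qed

lemma has_compensated_integral_X_diff:
  assumes A: "A \<in> sets borel" "bounded A" and ab: "0 \<le> a" "a \<le> b"
  shows "has_compensated_integral M N (intensity \<nu>) (tensor {a<..b} (convolve (indicator A) \<kappa>)) (\<lambda>\<omega>. X b A \<omega> - X a A \<omega>)"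
proof -
  have "tensor {0..b} \<psi> p - tensor {0..a} \<psi> p = tensor {a<..b} \<psi> p" for \<psi> p
    using ab by (cases p) (auto simp: tensor_def indicator_def)
  then show ?thesis
    using has_compensated_integral_diff[OF has_compensated_integral_X[OF A, of b] has_compensated_integral_X[OF A, of a]]
    by simp
qed

lemma nsq_X_diff:
  assumes A: "A \<in> sets borel" "bounded A" and ab: "0 \<le> a" "a \<le> b"
  shows "nsq M (\<lambda>\<omega>. X b A \<omega> - X a A \<omega>) < \<infinity>" "(\<lambda>\<omega>. X b A \<omega> - X a A \<omega>) \<in> borel_measurable M"
  using nsq_has_compensated_integral[OF has_compensated_integral_X_diff[OF assms]]
    has_compensated_integralD(3)[OF has_compensated_integral_X_diff[OF assms]] by auto

abbreviation gram :: "real set \<Rightarrow> real set \<Rightarrow> real" where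
  "gram A B \<equiv> (\<integral>x. convolve (indicator A) \<kappa> x * convolve (indicator B) \<kappa> x \<partial>lborel)"

text \<open>Since \<open>a \<le> a'\<close>, the product \<open>Y Y'\<close> is determined by the
  noise up to \<open>a'\<close>, and the second increment by the noise after \<open>a'\<close>. The
  first increment may straddle \<open>a'\<close>; the covariance formula allows this.\<close>

lemma elementary_covariance_aux:
  assumes 1: "elementary_data M N Y a b A" "bounded (Y ` space M)"
    and 2: "elementary_data M N Y' a' b' A'" "bounded (Y' ` space M)"
    and t: "0 \<le> t" and le: "a \<le> a'"
  shows "(\<integral>\<omega>. (Y \<omega> * (X (min t b) A \<omega> - X (min t a) A \<omega>)) * (Y' \<omega> * (X (min t b') A' \<omega> - X (min t a') A' \<omega>)) \<partial>M)
    = (\<integral>\<omega>. Y \<omega> * Y' \<omega> \<partial>M) * measure lborel ({a<..b} \<inter> {a'<..b'} \<inter> {0..t}) * gram A A' * m2"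
proof -
  note d = 1[unfolded elementary_data_def] 2[unfolded elementary_data_def]
  let ?D = "\<lambda>\<omega>. X (min t b) A \<omega> - X (min t a) A \<omega>" and ?D' = "\<lambda>\<omega>. X (min t b') A' \<omega> - X (min t a') A' \<omega>"
  have D: "has_compensated_integral M N (intensity \<nu>) (tensor {min t a<..min t b} (convolve (indicator A) \<kappa>)) ?D"
    using d t by (intro has_compensated_integral_X_diff) auto
  have D': "has_compensated_integral M N (intensity \<nu>) (tensor {min t a'<..min t b'} (convolve (indicator A') \<kappa>)) ?D'"
    using d t by (intro has_compensated_integral_X_diff) auto
  let ?Z = "\<lambda>\<omega>. Y \<omega> * Y' \<omega>"
  have Zf: "?Z \<in> borel_measurable (noise_filtration M N a')"
  proof (rule borel_measurable_times)
    show "Y \<in> borel_measurable (noise_filtration M N a')" using d noise_filtration_mono[OF le] by blast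
    show "Y' \<in> borel_measurable (noise_filtration M N a')" using d by blast
  qed
  obtain z where z: "z \<in> borel_measurable (cnt_space (boxes a'))" "AE \<omega> in M. ?Z \<omega> = z (cnt N (boxes a') \<omega>)"
    using noise_filtration_factor[OF Zf] by auto
  obtain c where c: "\<And>\<omega>. \<omega> \<in> space M \<Longrightarrow> \<bar>Y \<omega>\<bar> \<le> c" using 1(2) by (auto simp: bounded_iff)
  obtain c' where c': "\<And>\<omega>. \<omega> \<in> space M \<Longrightarrow> \<bar>Y' \<omega>\<bar> \<le> c'" using 2(2) by (auto simp: bounded_iff)
  have Zb: "\<bar>?Z \<omega>\<bar> \<le> \<bar>c\<bar> * \<bar>c'\<bar>" if "\<omega> \<in> space M" for \<omega>
    using c[OF that] c'[OF that] by (auto simp: abs_mult intro!: mult_mono)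
  have "(\<integral>\<omega>. ?Z \<omega> * (?D \<omega> * ?D' \<omega>) \<partial>M) = (\<integral>\<omega>. ?Z \<omega> \<partial>M) *
      (\<integral>p. tensor {min t a<..min t b} (convolve (indicator A) \<kappa>) p * tensor {min t a'<..min t b'} (convolve (indicator A') \<kappa>) p \<partial>intensity \<nu>)"
  proof (rule integral_past_compensated_mult[OF past_sets boxes_sets boxes_past z noise_filtration_le[OF Zf] Zb D D'])
    fix p assume "p \<in> past a'"
    then show "tensor {min t a'<..min t b'} (convolve (indicator A') \<kappa>) p = 0"
      by (cases p) (auto simp: past_def tensor_def indicator_def min_def split: if_splits)
  qed
  also have "(\<integral>p. tensor {min t a<..min t b} (convolve (indicator A) \<kappa>) p * tensor {min t a'<..min t b'} (convolve (indicator A') \<kappa>) p \<partial>intensity \<nu>)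
    = measure lborel ({min t a<..min t b} \<inter> {min t a'<..min t b'} \<inter> {0..}) * gram A A' * m2"
    using d t by (intro integral_tensor nsq_convolve_indicator) (auto intro!: measurable_convolve)
  also have "{min t a<..min t b} \<inter> {min t a'<..min t b'} \<inter> {0..} = {a<..b} \<inter> {a'<..b'} \<inter> {0..t}"
    using t by (auto simp: min_def split: if_splits)
  finally show ?thesis by (simp add: mult_ac)
qed

lemma elementary_covariance:
  assumes 1: "elementary_data M N Y a b A" "bounded (Y ` space M)"
    and 2: "elementary_data M N Y' a' b' A'" "bounded (Y' ` space M)"
    and t: "0 \<le> t"
  shows "(\<integral>\<omega>. (Y \<omega> * (X (min t b) A \<omega> - X (min t a) A \<omega>)) * (Y' \<omega> * (X (min t b') A' \<omega> - X (min t a') A' \<omega>)) \<partial>M)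
    = (\<integral>\<omega>. Y \<omega> * Y' \<omega> \<partial>M) * measure lborel ({a<..b} \<inter> {a'<..b'} \<inter> {0..t}) * gram A A' * m2"
proof (cases "a \<le> a'")
  case True then show ?thesis by (rule elementary_covariance_aux[OF 1 2 t])
next
  case False
  then have "a' \<le> a" by simp
  from elementary_covariance_aux[OF 2 1 t this] show ?thesis
    by (simp add: mult.commute Int_commute Int_left_commute Int_assoc)
qed

text \<open>By the covariances, the second moment is \<open>m2\<close> times the expected time
  integral of a quadratic form in the coefficients. For a fixed sample point and time that form is
  the squared \<open>L2\<close> norm of the process convolved with \<open>\<kappa>\<close>, which
  the energy dominates. An inequality is the most that can hold, as Walsh's norm contains absolute
  values.\<close>

lemma simple_walsh_le:
  assumes ok: "simple_data_ok M N ps" and t: "0 \<le> t"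
  shows "nsq M (simple_walsh_integral M \<nu> N \<kappa> t ps) \<le> ennreal m2 * walsh_norm_sq M \<kappa> t (simple_process ps)"
    and "simple_walsh_integral M \<nu> N \<kappa> t ps \<in> borel_measurable M"
    and "nsq M (simple_walsh_integral M \<nu> N \<kappa> t ps) < \<infinity>"
proof -
  let ?n = "length ps"
  define Y where "Y i = fst (ps ! i)" for i
  define a where "a i = fst (snd (ps ! i))" for i
  define b where "b i = fst (snd (snd (ps ! i)))" for i
  define A where "A i = snd (snd (snd (ps ! i)))" for i
  have ps: "ps ! i = (Y i, a i, b i, A i)" for i by (simp add: Y_def a_def b_def A_def)
  have ok': "elementary_data M N (Y i) (a i) (b i) (A i)" "bounded (Y i ` space M)" if "i < ?n" for i
    using ok nth_mem[OF that] ps[of i] unfolding simple_data_ok_def by fastforce+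
  then have A[measurable]: "i < ?n \<Longrightarrow> A i \<in> sets borel" and Ab: "i < ?n \<Longrightarrow> bounded (A i)"
      and ab: "i < ?n \<Longrightarrow> 0 \<le> a i" "i < ?n \<Longrightarrow> a i < b i" for i
    by (auto simp: elementary_data_def)
  have Ym: "Y i \<in> borel_measurable M" if "i < ?n" for i
    using ok'[OF that] by (auto simp: elementary_data_def intro: noise_filtration_le)
  obtain c where c: "\<And>i \<omega>. i < ?n \<Longrightarrow> \<omega> \<in> space M \<Longrightarrow> \<bar>Y i \<omega>\<bar> \<le> c i"
  proof -
    have "\<forall>i. \<exists>c. i < ?n \<longrightarrow> (\<forall>\<omega>\<in>space M. \<bar>Y i \<omega>\<bar> \<le> c)"
    proof
      fix i show "\<exists>c. i < ?n \<longrightarrow> (\<forall>\<omega>\<in>space M. \<bar>Y i \<omega>\<bar> \<le> c)"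
        using ok'(2)[of i] by (cases "i < ?n") (auto simp: bounded_iff)
    qed
    then show ?thesis using that by metis
  qed
  define D where "D i \<omega> = X (min t (b i)) (A i) \<omega> - X (min t (a i)) (A i) \<omega>" for i \<omega>
  have D: "nsq M (D i) < \<infinity>" "D i \<in> borel_measurable M" if "i < ?n" for i
    using nsq_X_diff[of "A i" "min t (a i)" "min t (b i)"] A[OF that] Ab[OF that] ab[OF that] t
    unfolding D_def[abs_def] by auto
  have I_eq: "simple_walsh_integral M \<nu> N \<kappa> t ps = (\<lambda>\<omega>. \<Sum>i<?n. Y i \<omega> * D i \<omega>)"
    by (simp add: fun_eq_iff simple_walsh_integral_def sum_list_sum_nth ps D_def atLeast0LessThan)
  have S_eq: "simple_process ps s x \<omega> = (\<Sum>i<?n. (Y i \<omega> * indicator {a i<..b i} s) * indicator (A i) x)" for s x \<omega>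
    by (simp add: simple_process_def elementary_process_def sum_list_sum_nth ps atLeast0LessThan)
  show "simple_walsh_integral M \<nu> N \<kappa> t ps \<in> borel_measurable M"
    unfolding I_eq using Ym D by (intro borel_measurable_sum borel_measurable_times) auto
  define \<psi> where "\<psi> i = convolve (indicator (A i)) \<kappa>" for i
  have \<psi>: "\<psi> i \<in> borel_measurable borel" "nsq lborel (\<psi> i) < \<infinity>" if "i < ?n" for i
    using A[OF that] nsq_convolve_indicator[OF A[OF that] Ab[OF that]] unfolding \<psi>_def by (auto intro!: measurable_convolve)
  define G where "G i j = (\<integral>x. \<psi> i x * \<psi> j x \<partial>lborel)" for i j
  define l where "l i j = measure lborel ({a i<..b i} \<inter> {a j<..b j} \<inter> {0..t})" for i j
  have YDi: "integrable M (\<lambda>\<omega>. (Y i \<omega> * D i \<omega>) * (Y j \<omega> * D j \<omega>))" if ij: "i < ?n" "j < ?n" for i j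
  proof -
    have "integrable M (\<lambda>\<omega>. (Y i \<omega> * Y j \<omega>) * (D i \<omega> * D j \<omega>))"
    proof (rule integrable_bounded_mult)
      show "(\<lambda>\<omega>. Y i \<omega> * Y j \<omega>) \<in> borel_measurable M" using Ym ij by auto
      show "integrable M (\<lambda>\<omega>. D i \<omega> * D j \<omega>)" using D ij by (intro integrable_mult_L2) auto
      show "\<bar>Y i \<omega> * Y j \<omega>\<bar> \<le> \<bar>c i\<bar> * \<bar>c j\<bar>" if "\<omega> \<in> space M" for \<omega>
        using c[OF ij(1) that] c[OF ij(2) that] by (auto simp: abs_mult intro!: mult_mono)
    qed
    then show ?thesis by (simp add: mult_ac)
  qed
  have YYi: "integrable M (\<lambda>\<omega>. Y i \<omega> * Y j \<omega>)" if ij: "i < ?n" "j < ?n" for i j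
  proof (rule integrable_const_bound[where B="\<bar>c i\<bar> * \<bar>c j\<bar>"])
    show "AE \<omega> in M. norm (Y i \<omega> * Y j \<omega>) \<le> \<bar>c i\<bar> * \<bar>c j\<bar>"
    proof (rule AE_I2)
      fix \<omega> assume "\<omega> \<in> space M"
      from c[OF ij(1) this] c[OF ij(2) this] show "norm (Y i \<omega> * Y j \<omega>) \<le> \<bar>c i\<bar> * \<bar>c j\<bar>"
        by (auto simp: abs_mult intro!: mult_mono)
    qed
    show "(\<lambda>\<omega>. Y i \<omega> * Y j \<omega>) \<in> borel_measurable M" using Ym ij by auto
  qed
  have sq: "(\<Sum>i<?n. f i)\<^sup>2 = (\<Sum>i<?n. \<Sum>j<?n. f i * f j)" for f :: "nat \<Rightarrow> real"
    by (simp add: power2_eq_square sum_product)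
  have hb: "has_bochner_integral M (\<lambda>\<omega>. (\<Sum>i<?n. Y i \<omega> * D i \<omega>)\<^sup>2) (\<Sum>i<?n. \<Sum>j<?n. (\<integral>\<omega>. (Y i \<omega> * D i \<omega>) * (Y j \<omega> * D j \<omega>) \<partial>M))"
    unfolding sq using YDi by (intro has_bochner_integral_sum has_bochner_integral_integrable) auto
  have "(\<Sum>i<?n. \<Sum>j<?n. (\<integral>\<omega>. (Y i \<omega> * D i \<omega>) * (Y j \<omega> * D j \<omega>) \<partial>M)) = (\<Sum>i<?n. \<Sum>j<?n. (\<integral>\<omega>. Y i \<omega> * Y j \<omega> \<partial>M) * l i j * G i j * m2)"
    unfolding D_def l_def G_def \<psi>_def using ok' t by (intro sum.cong refl elementary_covariance) auto
  also have "\<dots> = m2 * (\<Sum>i<?n. \<Sum>j<?n. (\<integral>\<omega>. Y i \<omega> * Y j \<omega> \<partial>M) * l i j * G i j)"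
    by (simp add: sum_distrib_left mult_ac)
  finally have "has_bochner_integral M (\<lambda>\<omega>. (\<Sum>i<?n. Y i \<omega> * D i \<omega>)\<^sup>2) (m2 * (\<Sum>i<?n. \<Sum>j<?n. (\<integral>\<omega>. Y i \<omega> * Y j \<omega> \<partial>M) * l i j * G i j))"
    using hb by simp
  then have nI: "nsq M (simple_walsh_integral M \<nu> N \<kappa> t ps) = ennreal (m2 * (\<Sum>i<?n. \<Sum>j<?n. (\<integral>\<omega>. Y i \<omega> * Y j \<omega> \<partial>M) * l i j * G i j))"
    unfolding I_eq by (subst integrable_square_nsq) (auto simp: has_bochner_integral_iff)
  show "nsq M (simple_walsh_integral M \<nu> N \<kappa> t ps) < \<infinity>" unfolding nI by simp
  have \<psi>i: "integrable lborel (\<lambda>x. \<psi> i x * \<psi> j x)" if "i < ?n" "j < ?n" for i j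
    using \<psi> that by (intro integrable_mult_L2) auto
  \<comment> \<open>The Gram matrix of the convolved indicators represents a squared norm; this also
    yields the nonnegativity that permits passing to \<open>ennreal\<close>.\<close>
  have quad: "has_bochner_integral lborel (\<lambda>x. (\<Sum>i<?n. d i * \<psi> i x)\<^sup>2) (\<Sum>i<?n. \<Sum>j<?n. (d i * d j) * G i j)" for d
  proof -
    have "has_bochner_integral lborel (\<lambda>x. \<Sum>i<?n. \<Sum>j<?n. (d i * d j) * (\<psi> i x * \<psi> j x)) (\<Sum>i<?n. \<Sum>j<?n. (d i * d j) * G i j)"
      unfolding G_def using \<psi>i by (intro has_bochner_integral_sum has_bochner_integral_mult_right has_bochner_integral_integrable) auto
    then show ?thesis unfolding sq by (simp add: mult_ac)
  qed
  have quad_nonneg: "0 \<le> (\<Sum>i<?n. \<Sum>j<?n. (d i * d j) * G i j)" for d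
    using quad[of d] has_bochner_integral_integral_eq[OF quad[of d]] Bochner_Integration.integral_nonneg[of lborel "\<lambda>x. (\<Sum>i<?n. d i * \<psi> i x)\<^sup>2"] by simp
  \<comment> \<open>This is where absolute values enter: the norm of the signed convolution is
    bounded by that of \<open>cv\<close>.\<close>
  have energy_ge: "ennreal (\<Sum>i<?n. \<Sum>j<?n. (d i * d j) * G i j) \<le> energy (\<lambda>x. \<Sum>i<?n. d i * indicator (A i) x)" for d
  proof -
    have m: "(\<lambda>x. \<Sum>i<?n. d i * indicator (A i) x) \<in> borel_measurable borel"
      using A by (intro borel_measurable_sum borel_measurable_times borel_measurable_indicator) auto
    have "ennreal (\<Sum>i<?n. \<Sum>j<?n. (d i * d j) * G i j) = nsq lborel (\<lambda>x. \<Sum>i<?n. d i * \<psi> i x)"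
      using quad[of d] by (subst integrable_square_nsq) (auto simp: has_bochner_integral_iff)
    also have "\<dots> \<le> (\<integral>\<^sup>+x. (cv (\<lambda>x. \<Sum>i<?n. d i * indicator (A i) x) x)\<^sup>2 \<partial>lborel)"
      unfolding nsq_def
    proof (rule nn_integral_mono)
      fix x
      have "ennreal \<bar>\<Sum>i<?n. d i * \<psi> i x\<bar> \<le> cv (\<lambda>x. \<Sum>i<?n. d i * indicator (A i) x) x"
        unfolding \<psi>_def using A Ab by (intro convolve_sum_le_cv) auto
      then have "(ennreal \<bar>\<Sum>i<?n. d i * \<psi> i x\<bar>)\<^sup>2 \<le> (cv (\<lambda>x. \<Sum>i<?n. d i * indicator (A i) x) x)\<^sup>2" by (rule power_mono) simp
      then show "ennreal ((\<Sum>i<?n. d i * \<psi> i x)\<^sup>2) \<le> (cv (\<lambda>x. \<Sum>i<?n. d i * indicator (A i) x) x)\<^sup>2"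
        by (simp add: ennreal_power)
    qed
    also have "\<dots> = energy (\<lambda>x. \<Sum>i<?n. d i * indicator (A i) x)" by (rule energy_cv[OF m, symmetric])
    finally show ?thesis .
  qed
  \<comment> \<open>The overlap lengths \<open>l i j\<close> are time integrals of products of
    indicators, so the sum over pairs is the time integral of the quadratic form with coefficients
    \<open>Y i\<close> switched on during \<open>(a i, b i]\<close>.\<close>
  have time: "has_bochner_integral lborel (\<lambda>s. (\<Sum>i<?n. \<Sum>j<?n. ((Y i \<omega> * indicator {a i<..b i} s) * (Y j \<omega> * indicator {a j<..b j} s)) * G i j) * indicator {0..t} s)
      (\<Sum>i<?n. \<Sum>j<?n. (Y i \<omega> * Y j \<omega>) * l i j * G i j)" for \<omega>
  proof -
    have "has_bochner_integral lborel (\<lambda>s. \<Sum>i<?n. \<Sum>j<?n. (Y i \<omega> * Y j \<omega> * G i j) * indicator ({a i<..b i} \<inter> {a j<..b j} \<inter> {0..t}) s)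
      (\<Sum>i<?n. \<Sum>j<?n. (Y i \<omega> * Y j \<omega> * G i j) * l i j)"
      unfolding l_def
    proof (intro has_bochner_integral_sum has_bochner_integral_mult_right has_bochner_integral_real_indicator)
      fix i j
      have "emeasure lborel ({a i<..b i} \<inter> {a j<..b j} \<inter> {0..t}) \<le> emeasure lborel {0..t}" by (rule emeasure_mono) auto
      also have "\<dots> < \<infinity>" by (simp add: emeasure_lborel_Icc_eq)
      finally show "emeasure lborel ({a i<..b i} \<inter> {a j<..b j} \<inter> {0..t}) < \<infinity>" .
    qed auto
    also have "(\<lambda>s. \<Sum>i<?n. \<Sum>j<?n. (Y i \<omega> * Y j \<omega> * G i j) * indicator ({a i<..b i} \<inter> {a j<..b j} \<inter> {0..t}) s)
      = (\<lambda>s. (\<Sum>i<?n. \<Sum>j<?n. ((Y i \<omega> * indicator {a i<..b i} s) * (Y j \<omega> * indicator {a j<..b j} s)) * G i j) * indicator {0..t} s)"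
      unfolding sum_distrib_right by (intro ext sum.cong refl) (auto simp: indicator_def)
    also have "(\<Sum>i<?n. \<Sum>j<?n. (Y i \<omega> * Y j \<omega> * G i j) * l i j) = (\<Sum>i<?n. \<Sum>j<?n. (Y i \<omega> * Y j \<omega>) * l i j * G i j)"
      by (intro sum.cong refl) simp
    finally show ?thesis .
  qed
  have "ennreal (\<Sum>i<?n. \<Sum>j<?n. (\<integral>\<omega>. Y i \<omega> * Y j \<omega> \<partial>M) * l i j * G i j) \<le> walsh_norm_sq M \<kappa> t (simple_process ps)"
  proof -
    have YY: "has_bochner_integral M (\<lambda>\<omega>. \<Sum>i<?n. \<Sum>j<?n. (Y i \<omega> * Y j \<omega>) * l i j * G i j) (\<Sum>i<?n. \<Sum>j<?n. (\<integral>\<omega>. Y i \<omega> * Y j \<omega> \<partial>M) * l i j * G i j)"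
      using YYi by (intro has_bochner_integral_sum has_bochner_integral_mult_left has_bochner_integral_integrable) auto
    have "ennreal (\<Sum>i<?n. \<Sum>j<?n. (\<integral>\<omega>. Y i \<omega> * Y j \<omega> \<partial>M) * l i j * G i j) \<le> (\<integral>\<^sup>+\<omega>. ennreal (\<Sum>i<?n. \<Sum>j<?n. (Y i \<omega> * Y j \<omega>) * l i j * G i j) \<partial>M)"
    proof -
      have "0 \<le> (\<Sum>i<?n. \<Sum>j<?n. (Y i \<omega> * Y j \<omega>) * l i j * G i j)" for \<omega>
        using has_bochner_integral_integral_eq[OF time[of \<omega>]] quad_nonneg
        by (subst has_bochner_integral_integral_eq[OF time[of \<omega>], symmetric]) (intro Bochner_Integration.integral_nonneg mult_nonneg_nonneg, auto)
      then show ?thesis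
        using YY by (subst nn_integral_eq_integral) (auto simp: has_bochner_integral_iff)
    qed
    also have "\<dots> \<le> walsh_norm_sq M \<kappa> t (simple_process ps)"
      unfolding walsh_norm_sq_def
    proof (rule nn_integral_mono)
      fix \<omega> assume "\<omega> \<in> space M"
      have "ennreal (\<Sum>i<?n. \<Sum>j<?n. (Y i \<omega> * Y j \<omega>) * l i j * G i j)
        = (\<integral>\<^sup>+s. ennreal ((\<Sum>i<?n. \<Sum>j<?n. ((Y i \<omega> * indicator {a i<..b i} s) * (Y j \<omega> * indicator {a j<..b j} s)) * G i j) * indicator {0..t} s) \<partial>lborel)"
        using time[of \<omega>] quad_nonneg
        by (subst nn_integral_eq_integral) (auto simp: has_bochner_integral_iff intro!: AE_I2 mult_nonneg_nonneg)
      also have "\<dots> \<le> (\<integral>\<^sup>+s. energy (\<lambda>x. simple_process ps s x \<omega>) * indicator {0..t} s \<partial>lborel)"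
      proof (rule nn_integral_mono)
        fix s
        have "ennreal (\<Sum>i<?n. \<Sum>j<?n. ((Y i \<omega> * indicator {a i<..b i} s) * (Y j \<omega> * indicator {a j<..b j} s)) * G i j) \<le> energy (\<lambda>x. simple_process ps s x \<omega>)"
          unfolding S_eq by (rule energy_ge)
        then show "ennreal ((\<Sum>i<?n. \<Sum>j<?n. ((Y i \<omega> * indicator {a i<..b i} s) * (Y j \<omega> * indicator {a j<..b j} s)) * G i j) * indicator {0..t} s)
          \<le> energy (\<lambda>x. simple_process ps s x \<omega>) * indicator {0..t} s"
          by (auto simp: indicator_def)
      qed
      finally show "ennreal (\<Sum>i<?n. \<Sum>j<?n. (Y i \<omega> * Y j \<omega>) * l i j * G i j) \<le> (\<integral>\<^sup>+s\<in>{0..t}. (\<integral>\<^sup>+x. (\<integral>\<^sup>+y. ennreal \<bar>simple_process ps s x \<omega> * simple_process ps s y \<omega>\<bar> * autoconv \<kappa> (x - y) \<partial>lborel) \<partial>lborel) \<partial>lborel)"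
        by (simp add: energy_def)
    qed
    finally show ?thesis .
  qed
  then have "ennreal m2 * ennreal (\<Sum>i<?n. \<Sum>j<?n. (\<integral>\<omega>. Y i \<omega> * Y j \<omega> \<partial>M) * l i j * G i j) \<le> ennreal m2 * walsh_norm_sq M \<kappa> t (simple_process ps)"
    by (rule mult_left_mono) simp
  then show "nsq M (simple_walsh_integral M \<nu> N \<kappa> t ps) \<le> ennreal m2 * walsh_norm_sq M \<kappa> t (simple_process ps)"
    unfolding nI using m2_nonneg by (simp add: ennreal_mult')
qed

end

section \<open>Walsh integrals\<close>

text \<open>The measurability that Tonelli's theorem asks for. It refers to \<open>M\<close> and not
  to the noise, so processes predictable for different noises can be compared in it.\<close>

definition jointly :: "'w measure \<Rightarrow> (real \<Rightarrow> real \<Rightarrow> 'w \<Rightarrow> real) \<Rightarrow> bool" where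
  "jointly M g \<longleftrightarrow> (\<lambda>(\<omega>, s, x). g s x \<omega>) \<in> borel_measurable (M \<Otimes>\<^sub>M (borel \<Otimes>\<^sub>M borel))"

lemma jointlyD:
  assumes "jointly M g" and [measurable]: "f1 \<in> measurable P M" "f2 \<in> borel_measurable P" "f3 \<in> borel_measurable P"
  shows "(\<lambda>p. g (f2 p) (f3 p) (f1 p)) \<in> borel_measurable P"
proof -
  have "(\<lambda>p. (f1 p, f2 p, f3 p)) \<in> measurable P (M \<Otimes>\<^sub>M (borel \<Otimes>\<^sub>M borel))" by measurable
  from measurable_compose[OF this assms(1)[unfolded jointly_def]] show ?thesis by simp
qed

lemma jointly_iff:
  "jointly M g \<longleftrightarrow> (\<lambda>p. g (fst (snd p)) (snd (snd p)) (fst p)) \<in> borel_measurable (M \<Otimes>\<^sub>M (borel \<Otimes>\<^sub>M borel))"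
  unfolding jointly_def split_beta' ..

lemmas jointlyI = jointly_iff[THEN iffD2]

lemma jointly_add: "jointly M g \<Longrightarrow> jointly M h \<Longrightarrow> jointly M (\<lambda>s x \<omega>. g s x \<omega> + h s x \<omega>)"
  and jointly_diff: "jointly M g \<Longrightarrow> jointly M h \<Longrightarrow> jointly M (\<lambda>s x \<omega>. g s x \<omega> - h s x \<omega>)"
  and jointly_mult: "jointly M g \<Longrightarrow> jointly M h \<Longrightarrow> jointly M (\<lambda>s x \<omega>. g s x \<omega> * h s x \<omega>)"
  unfolding jointly_iff
  by (rule borel_measurable_add borel_measurable_diff borel_measurable_times; assumption)+

lemma jointly_section: "jointly M g \<Longrightarrow> \<omega> \<in> space M \<Longrightarrow> (\<lambda>x. g s x \<omega>) \<in> borel_measurable borel"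
  by (rule jointlyD[where ?f1.0="\<lambda>_. \<omega>" and ?f2.0="\<lambda>_. s" and ?f3.0="\<lambda>x. x"])
    (assumption | rule measurable_const measurable_ident | simp)+

lemma jointly_section': "jointly M g \<Longrightarrow> (\<lambda>\<omega>. g s x \<omega>) \<in> borel_measurable M"
  by (rule jointlyD[where ?f1.0="\<lambda>\<omega>. \<omega>" and ?f2.0="\<lambda>_. s" and ?f3.0="\<lambda>_. x"])
    (assumption | rule measurable_const measurable_ident | simp)+

section \<open>Measurability and quasi-norm properties of Walsh's norm\<close>

context kernel
begin

lemma measurable_energy_jointly:
  assumes g: "jointly M g" and [measurable]: "f1 \<in> measurable P M" "f2 \<in> borel_measurable P"
  shows "(\<lambda>p. energy (\<lambda>x. g (f2 p) x (f1 p))) \<in> borel_measurable P"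
proof -
  have [measurable]: "(\<lambda>q. g (f2 (fst (fst q))) (snd q) (f1 (fst (fst q)))) \<in> borel_measurable ((P \<Otimes>\<^sub>M borel) \<Otimes>\<^sub>M borel)"
    "(\<lambda>q. g (f2 (fst (fst q))) (snd (fst q)) (f1 (fst (fst q)))) \<in> borel_measurable ((P \<Otimes>\<^sub>M borel) \<Otimes>\<^sub>M borel)"
    by (rule jointlyD[OF g, where ?f1.0="\<lambda>q. f1 (fst (fst q))" and ?f2.0="\<lambda>q. f2 (fst (fst q))" and ?f3.0="\<lambda>q. snd q"], measurable)
       (rule jointlyD[OF g, where ?f1.0="\<lambda>q. f1 (fst (fst q))" and ?f2.0="\<lambda>q. f2 (fst (fst q))" and ?f3.0="\<lambda>q. snd (fst q)"], measurable)
  have 1: "(\<lambda>q. ennreal \<bar>g (f2 (fst (fst q))) (snd (fst q)) (f1 (fst (fst q))) * g (f2 (fst (fst q))) (snd q) (f1 (fst (fst q)))\<bar> * autoconv \<kappa> (snd (fst q) - snd q))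
      \<in> borel_measurable ((P \<Otimes>\<^sub>M borel) \<Otimes>\<^sub>M lborel)" by measurable
  have 2: "(\<lambda>q. \<integral>\<^sup>+y. ennreal \<bar>g (f2 (fst q)) (snd q) (f1 (fst q)) * g (f2 (fst q)) y (f1 (fst q))\<bar> * autoconv \<kappa> (snd q - y) \<partial>lborel)
      \<in> borel_measurable (P \<Otimes>\<^sub>M lborel)"
    using lborel.borel_measurable_nn_integral_fst[OF 1] by simp
  show ?thesis
    unfolding energy_def using lborel.borel_measurable_nn_integral_fst[OF 2] by simp
qed

lemma walsh_norm_energy:
  "walsh_norm_sq M \<kappa> t g = (\<integral>\<^sup>+\<omega>. \<integral>\<^sup>+s. energy (\<lambda>x. g s x \<omega>) * indicator {0..t} s \<partial>lborel \<partial>M)"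
  by (simp add: walsh_norm_sq_def energy_def)

text \<open>Time \<open>0\<close> is Lebesgue null, so agreement on \<open>(0,t]\<close> suffices.
  The exceptional null event must not depend on \<open>s\<close> and \<open>x\<close>, because the
  norm integrates over them first.\<close>

lemma walsh_norm_cong:
  assumes "AE \<omega> in M. \<forall>s\<in>{0<..t}. \<forall>x. g s x \<omega> = h s x \<omega>"
  shows "walsh_norm_sq M \<kappa> t g = walsh_norm_sq M \<kappa> t h"
  unfolding walsh_norm_energy
proof (intro nn_integral_cong_AE, use assms in eventually_elim)
  fix \<omega> assume eq: "\<forall>s\<in>{0<..t}. \<forall>x. g s x \<omega> = h s x \<omega>"
  show "(\<integral>\<^sup>+s. energy (\<lambda>x. g s x \<omega>) * indicator {0..t} s \<partial>lborel) = (\<integral>\<^sup>+s. energy (\<lambda>x. h s x \<omega>) * indicator {0..t} s \<partial>lborel)"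
  proof (intro nn_integral_cong_AE)
    have "AE s in lborel. s \<noteq> (0::real)" by (rule AE_lborel_singleton)
    then show "AE s in lborel. energy (\<lambda>x. g s x \<omega>) * indicator {0..t} s = energy (\<lambda>x. h s x \<omega>) * indicator {0..t} s"
      by eventually_elim (use eq in \<open>auto simp: indicator_def\<close>)
  qed
qed

lemma walsh_norm_indicator:
  "walsh_norm_sq M \<kappa> t g = walsh_norm_sq M \<kappa> t (\<lambda>s x \<omega>. indicator {0<..t} s * g s x \<omega>)"
  by (rule walsh_norm_cong) (auto simp: indicator_def)

lemma walsh_norm_mono:
  assumes "\<And>s x \<omega>. \<omega> \<in> space M \<Longrightarrow> 0 \<le> s \<Longrightarrow> s \<le> t \<Longrightarrow> \<bar>g s x \<omega>\<bar> \<le> \<bar>h s x \<omega>\<bar>" "t \<le> t'"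
  shows "walsh_norm_sq M \<kappa> t g \<le> walsh_norm_sq M \<kappa> t' h"
  unfolding walsh_norm_energy
  using assms(1,2) by (intro nn_integral_mono) (auto simp: indicator_def intro!: energy_mono)

lemma measurable_inner_energy:
  assumes g: "jointly M g"
  shows "(\<lambda>\<omega>. \<integral>\<^sup>+s. energy (\<lambda>x. g s x \<omega>) * indicator {0..t} s \<partial>lborel) \<in> borel_measurable M"
proof -
  have "(\<lambda>q. energy (\<lambda>x. g (snd q) x (fst q)) * indicator {0..t} (snd q)) \<in> borel_measurable (M \<Otimes>\<^sub>M lborel)"
    by (intro borel_measurable_times_ennreal measurable_energy_jointly[OF g]) measurable
  from lborel.borel_measurable_nn_integral_fst[OF this] show ?thesis by simp
qed

lemma walsh_norm_add_le:
  assumes g: "jointly M g" and h: "jointly M h"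
  shows "walsh_norm_sq M \<kappa> t (\<lambda>s x \<omega>. g s x \<omega> + h s x \<omega>) \<le> 2 * walsh_norm_sq M \<kappa> t g + 2 * walsh_norm_sq M \<kappa> t h"
proof -
  have "walsh_norm_sq M \<kappa> t (\<lambda>s x \<omega>. g s x \<omega> + h s x \<omega>)
    \<le> (\<integral>\<^sup>+\<omega>. 2 * (\<integral>\<^sup>+s. energy (\<lambda>x. g s x \<omega>) * indicator {0..t} s \<partial>lborel) + 2 * (\<integral>\<^sup>+s. energy (\<lambda>x. h s x \<omega>) * indicator {0..t} s \<partial>lborel) \<partial>M)"
    unfolding walsh_norm_energy
  proof (rule nn_integral_mono)
    fix \<omega> assume \<omega>: "\<omega> \<in> space M"
    have m: "(\<lambda>s. energy (\<lambda>x. f s x \<omega>)) \<in> borel_measurable borel" if "jointly M f" for f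
      using measurable_energy_jointly[OF that, of "\<lambda>_. \<omega>" borel "\<lambda>s. s"] \<omega> by simp
    note [measurable] = m[OF g] m[OF h]
    have "(\<integral>\<^sup>+s. energy (\<lambda>x. g s x \<omega> + h s x \<omega>) * indicator {0..t} s \<partial>lborel)
      \<le> (\<integral>\<^sup>+s. 2 * (energy (\<lambda>x. g s x \<omega>) * indicator {0..t} s) + 2 * (energy (\<lambda>x. h s x \<omega>) * indicator {0..t} s) \<partial>lborel)"
      using energy_add_le[OF jointly_section[OF g \<omega>] jointly_section[OF h \<omega>]]
      by (intro nn_integral_mono) (auto simp: indicator_def)
    also have "\<dots> = 2 * (\<integral>\<^sup>+s. energy (\<lambda>x. g s x \<omega>) * indicator {0..t} s \<partial>lborel) + 2 * (\<integral>\<^sup>+s. energy (\<lambda>x. h s x \<omega>) * indicator {0..t} s \<partial>lborel)"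
      by (simp add: nn_integral_add nn_integral_cmult)
    finally show "(\<integral>\<^sup>+s. energy (\<lambda>x. g s x \<omega> + h s x \<omega>) * indicator {0..t} s \<partial>lborel)
      \<le> 2 * (\<integral>\<^sup>+s. energy (\<lambda>x. g s x \<omega>) * indicator {0..t} s \<partial>lborel) + 2 * (\<integral>\<^sup>+s. energy (\<lambda>x. h s x \<omega>) * indicator {0..t} s \<partial>lborel)" .
  qed
  also have "\<dots> = 2 * walsh_norm_sq M \<kappa> t g + 2 * walsh_norm_sq M \<kappa> t h"
    unfolding walsh_norm_energy using measurable_inner_energy[OF g] measurable_inner_energy[OF h]
    by (simp add: nn_integral_add nn_integral_cmult)
  finally show ?thesis .
qed

lemma walsh_norm_cmult:
  assumes g: "jointly M g"
  shows "walsh_norm_sq M \<kappa> t (\<lambda>s x \<omega>. c * g s x \<omega>) = ennreal (c\<^sup>2) * walsh_norm_sq M \<kappa> t g"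
proof -
  have "walsh_norm_sq M \<kappa> t (\<lambda>s x \<omega>. c * g s x \<omega>) = (\<integral>\<^sup>+\<omega>. ennreal (c\<^sup>2) * (\<integral>\<^sup>+s. energy (\<lambda>x. g s x \<omega>) * indicator {0..t} s \<partial>lborel) \<partial>M)"
    unfolding walsh_norm_energy
  proof (intro nn_integral_cong)
    fix \<omega> assume \<omega>: "\<omega> \<in> space M"
    have [measurable]: "(\<lambda>s. energy (\<lambda>x. g s x \<omega>)) \<in> borel_measurable borel"
      using measurable_energy_jointly[OF g, of "\<lambda>_. \<omega>" borel "\<lambda>s. s"] \<omega> by simp
    show "(\<integral>\<^sup>+s. energy (\<lambda>x. c * g s x \<omega>) * indicator {0..t} s \<partial>lborel) = ennreal (c\<^sup>2) * (\<integral>\<^sup>+s. energy (\<lambda>x. g s x \<omega>) * indicator {0..t} s \<partial>lborel)"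
      by (simp add: energy_cmult[OF jointly_section[OF g \<omega>]] mult.assoc nn_integral_cmult)
  qed
  also have "\<dots> = ennreal (c\<^sup>2) * walsh_norm_sq M \<kappa> t g"
    unfolding walsh_norm_energy using measurable_inner_energy[OF g] by (simp add: nn_integral_cmult)
  finally show ?thesis .
qed

end

section \<open>Predictable processes and the extended integral\<close>

context levy_noise
begin

lemma predictable_sigma_generator_subset:
  "{{(\<omega>, t, x) \<in> space M \<times> {0..} \<times> UNIV. elementary_process Y a b A t x \<omega> \<in> C} | Y a b A C.
        elementary_data M N Y a b A \<and> C \<in> sets borel} \<subseteq> Pow (space M \<times> {0..} \<times> UNIV)"
  by blast

lemma predictable_sigma_space: "space (predictable_sigma M N) = space M \<times> {0..} \<times> UNIV"
  unfolding predictable_sigma_def by (rule space_measure_of[OF predictable_sigma_generator_subset])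

text \<open>The predictable \<sigma>-algebra is coarser than the trace of the product
  \<sigma>-algebra, its generators being products of measurable functions. Negative times lie
  outside its space, whence the extension by zero.\<close>

lemma predictable_jointly:
  assumes "predictable M N g"
  shows "jointly M (\<lambda>s x \<omega>. indicator {0..} s * g s x \<omega>)"
proof -
  let ?Q = "M \<Otimes>\<^sub>M (borel \<Otimes>\<^sub>M borel) :: ('w \<times> real \<times> real) measure"
  let ?S = "space M \<times> {0..} \<times> (UNIV :: real set)"
  have S: "?S \<inter> space ?Q \<in> sets ?Q"
  proof -
    have "?S \<in> sets ?Q" by (intro pair_measureI) auto
    moreover have "?S \<subseteq> space ?Q" by (auto simp: space_pair_measure)
    ultimately show ?thesis by (simp add: Int_absorb2)
  qed
  have "(\<lambda>p. p) \<in> measurable (restrict_space ?Q ?S) (predictable_sigma M N)"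
    unfolding predictable_sigma_def
  proof (rule measurable_measure_of[OF predictable_sigma_generator_subset])
    show "(\<lambda>p. p) \<in> space (restrict_space ?Q ?S) \<rightarrow> ?S" by (auto simp: space_restrict_space)
    fix E assume "E \<in> {{(\<omega>, t, x) \<in> ?S. elementary_process Y a b A t x \<omega> \<in> C} | Y a b A C.
        elementary_data M N Y a b A \<and> C \<in> sets borel}"
    then obtain Y a b A C where E: "E = {(\<omega>, t, x) \<in> ?S. elementary_process Y a b A t x \<omega> \<in> C}"
      and d: "elementary_data M N Y a b A" and C: "C \<in> sets borel" by blast
    from d have [measurable]: "Y \<in> borel_measurable M" "A \<in> sets borel"
      by (auto simp: elementary_data_def intro: noise_filtration_le)
    have "(\<lambda>p. Y (fst p) * indicator {a<..b} (fst (snd p)) * indicator A (snd (snd p))) \<in> borel_measurable ?Q" by measurable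
    from measurable_sets[OF measurable_restrict_space1[OF this] C]
    have "(\<lambda>p. Y (fst p) * indicator {a<..b} (fst (snd p)) * indicator A (snd (snd p))) -` C \<inter> space (restrict_space ?Q ?S) \<in> sets (restrict_space ?Q ?S)" .
    also have "(\<lambda>p. Y (fst p) * indicator {a<..b} (fst (snd p)) * indicator A (snd (snd p))) -` C \<inter> space (restrict_space ?Q ?S)
       = (\<lambda>p. p) -` E \<inter> space (restrict_space ?Q ?S)"
      by (auto simp: E space_restrict_space elementary_process_def space_pair_measure)
    finally show "(\<lambda>p. p) -` E \<inter> space (restrict_space ?Q ?S) \<in> sets (restrict_space ?Q ?S)" .
  qed
  from measurable_compose[OF this assms[unfolded predictable_def]]
  have "(\<lambda>(\<omega>, t, x). g t x \<omega>) \<in> borel_measurable (restrict_space ?Q ?S)" .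
  then have m: "(\<lambda>p. indicator ?S p *\<^sub>R (case p of (\<omega>, t, x) \<Rightarrow> g t x \<omega>)) \<in> borel_measurable ?Q"
    using borel_measurable_restrict_space_iff[OF S] by blast
  show ?thesis
    unfolding jointly_def
    by (rule measurable_cong[THEN iffD1, OF _ m]) (auto simp: space_pair_measure indicator_def)
qed

lemma predictable_add: "predictable M N g \<Longrightarrow> predictable M N h \<Longrightarrow> predictable M N (\<lambda>s x \<omega>. g s x \<omega> + h s x \<omega>)"
  and predictable_diff: "predictable M N g \<Longrightarrow> predictable M N h \<Longrightarrow> predictable M N (\<lambda>s x \<omega>. g s x \<omega> - h s x \<omega>)"
  and predictable_cmult: "predictable M N g \<Longrightarrow> predictable M N (\<lambda>s x \<omega>. c * g s x \<omega>)"
  and predictable_mult: "predictable M N g \<Longrightarrow> predictable M N h \<Longrightarrow> predictable M N (\<lambda>s x \<omega>. g s x \<omega> * h s x \<omega>)"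
  unfolding predictable_def split_beta'
  by (rule borel_measurable_add borel_measurable_diff borel_measurable_times[OF borel_measurable_const]
      borel_measurable_times; assumption)+

lemma predictable_elementary:
  assumes "elementary_data M N Y a b A"
  shows "predictable M N (elementary_process Y a b A)"
  unfolding predictable_def
proof (rule measurableI)
  fix C :: "real set" assume C: "C \<in> sets borel"
  have "{(\<omega>, t, x) \<in> space M \<times> {0..} \<times> UNIV. elementary_process Y a b A t x \<omega> \<in> C} \<in> sets (predictable_sigma M N)"
    unfolding predictable_sigma_def
    by (subst sets_measure_of[OF predictable_sigma_generator_subset]) (use assms C in blast)
  moreover have "(\<lambda>(\<omega>, t, x). elementary_process Y a b A t x \<omega>) -` C \<inter> space (predictable_sigma M N)
     = {(\<omega>, t, x) \<in> space M \<times> {0..} \<times> UNIV. elementary_process Y a b A t x \<omega> \<in> C}"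
    unfolding predictable_sigma_space by auto
  ultimately show "(\<lambda>(\<omega>, t, x). elementary_process Y a b A t x \<omega>) -` C \<inter> space (predictable_sigma M N) \<in> sets (predictable_sigma M N)"
    by simp
qed simp

lemma jointly_simple_process:
  assumes "simple_data_ok M N ps"
  shows "jointly M (simple_process ps)"
  using assms
proof (induction ps)
  case Nil
  show ?case by (simp add: simple_process_def jointly_def split_beta')
next
  case (Cons p ps)
  obtain Y a b A where p: "p = (Y, a, b, A)" by (cases p)
  have d: "elementary_data M N Y a b A" and ps: "simple_data_ok M N ps"
    using Cons.prems by (auto simp: simple_data_ok_def p)
  from d have [measurable]: "Y \<in> borel_measurable M" "A \<in> sets borel"
    by (auto simp: elementary_data_def intro: noise_filtration_le)
  have "jointly M (elementary_process Y a b A)"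
    unfolding elementary_process_def[abs_def] by (rule jointlyI) measurable
  from jointly_add[OF this Cons.IH[OF ps]] show ?case
    by (simp add: simple_process_def p)
qed

lemma has_walsh_integralD:
  assumes "has_walsh_integral M \<nu> N \<kappa> t g I"
  shows "predictable M N (\<lambda>s x \<omega>. indicator {0<..t} s * g s x \<omega>)"
    "jointly M (\<lambda>s x \<omega>. indicator {0<..t} s * g s x \<omega>)"
    "walsh_norm_sq M \<kappa> t g < \<infinity>" "I \<in> borel_measurable M"
proof -
  show p: "predictable M N (\<lambda>s x \<omega>. indicator {0<..t} s * g s x \<omega>)"
    "walsh_norm_sq M \<kappa> t g < \<infinity>" "I \<in> borel_measurable M"
    using assms by (auto simp: has_walsh_integral_def)
  have "(\<lambda>s x \<omega>. indicator {0..} s * (indicator {0<..t} s * g s x \<omega>)) = (\<lambda>s x \<omega>. indicator {0<..t} s * g s x \<omega>)"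
    by (auto simp: fun_eq_iff indicator_def)
  with predictable_jointly[OF p(1)] show "jointly M (\<lambda>s x \<omega>. indicator {0<..t} s * g s x \<omega>)" by simp
qed

lemma walsh_norm_add_le':
  assumes "jointly M (\<lambda>s x \<omega>. indicator {0<..t} s * g s x \<omega>)" "jointly M (\<lambda>s x \<omega>. indicator {0<..t} s * h s x \<omega>)"
  shows "walsh_norm_sq M \<kappa> t (\<lambda>s x \<omega>. g s x \<omega> + h s x \<omega>) \<le> 2 * walsh_norm_sq M \<kappa> t g + 2 * walsh_norm_sq M \<kappa> t h"
  using walsh_norm_add_le[OF assms, of t]
  unfolding distrib_left[symmetric] walsh_norm_indicator[symmetric] .

lemma jointly_indicator:
  assumes "jointly M g" and [measurable]: "J \<in> sets borel"
  shows "jointly M (\<lambda>s x \<omega>. indicator J s * g s x \<omega>)"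
proof (rule jointlyI)
  have [measurable]: "(\<lambda>p. g (fst (snd p)) (snd (snd p)) (fst p)) \<in> borel_measurable (M \<Otimes>\<^sub>M (borel \<Otimes>\<^sub>M borel))"
    using assms(1) unfolding jointly_iff .
  show "(\<lambda>p. indicator J (fst (snd p)) * g (fst (snd p)) (snd (snd p)) (fst p)) \<in> borel_measurable (M \<Otimes>\<^sub>M (borel \<Otimes>\<^sub>M borel))"
    by measurable
qed

lemma tendsto_0_combine:
  fixes f g :: "nat \<Rightarrow> ennreal"
  assumes "f \<longlonglongrightarrow> 0" "g \<longlonglongrightarrow> 0" "\<And>n. h n \<le> 2 * f n + 2 * g n"
  shows "h \<longlonglongrightarrow> 0"
proof -
  have "(\<lambda>n. 2 * f n + 2 * g n) \<longlonglongrightarrow> 2 * 0 + 2 * 0"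
    by (intro tendsto_add ennreal_tendsto_cmult assms) auto
  then have lim: "(\<lambda>n. 2 * f n + 2 * g n) \<longlonglongrightarrow> 0" by simp
  show ?thesis by (rule tendsto_sandwich[OF _ _ tendsto_const lim]) (use assms(3) in auto)
qed

text \<open>The bound for simple processes survives the limit. The constant \<open>4\<close> is the
  square of the quasi-triangle factor \<open>2\<close>: one factor for replacing \<open>I\<close> by
  simple integrals, one for replacing simple processes by \<open>g\<close>.\<close>

lemma walsh_integral_le:
  assumes w: "has_walsh_integral M \<nu> N \<kappa> t g I" and t: "0 \<le> t"
  shows "nsq M I \<le> ennreal (4 * m2) * walsh_norm_sq M \<kappa> t g"
proof -
  note wD = has_walsh_integralD[OF w]
  obtain ps where ps: "\<And>n::nat. simple_data_ok M N (ps n)"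
    "(\<lambda>n. walsh_norm_sq M \<kappa> t (\<lambda>s x \<omega>. simple_process (ps n) s x \<omega> - g s x \<omega>)) \<longlonglongrightarrow> 0"
    "(\<lambda>n. nsq M (\<lambda>\<omega>. simple_walsh_integral M \<nu> N \<kappa> t (ps n) \<omega> - I \<omega>)) \<longlonglongrightarrow> 0"
    using w unfolding has_walsh_integral_def nsq_def by blast
  let ?d = "\<lambda>n. walsh_norm_sq M \<kappa> t (\<lambda>s x \<omega>. simple_process (ps n) s x \<omega> - g s x \<omega>)"
  let ?e = "\<lambda>n. nsq M (\<lambda>\<omega>. simple_walsh_integral M \<nu> N \<kappa> t (ps n) \<omega> - I \<omega>)"
  have le: "nsq M I \<le> 2 * ?e n + 2 * (ennreal m2 * (2 * ?d n + 2 * walsh_norm_sq M \<kappa> t g))" for n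
  proof -
    have jd: "jointly M (\<lambda>s x \<omega>. indicator {0<..t} s * (simple_process (ps n) s x \<omega> - g s x \<omega>))"
      unfolding right_diff_distrib
      by (intro jointly_diff jointly_indicator jointly_simple_process ps wD) simp
    have "walsh_norm_sq M \<kappa> t (simple_process (ps n)) = walsh_norm_sq M \<kappa> t (\<lambda>s x \<omega>. (simple_process (ps n) s x \<omega> - g s x \<omega>) + g s x \<omega>)" by simp
    also have "\<dots> \<le> 2 * ?d n + 2 * walsh_norm_sq M \<kappa> t g"
      by (rule walsh_norm_add_le'[OF jd wD(2)])
    finally have 1: "walsh_norm_sq M \<kappa> t (simple_process (ps n)) \<le> 2 * ?d n + 2 * walsh_norm_sq M \<kappa> t g" .
    have "nsq M I = nsq M (\<lambda>\<omega>. simple_walsh_integral M \<nu> N \<kappa> t (ps n) \<omega> - (simple_walsh_integral M \<nu> N \<kappa> t (ps n) \<omega> - I \<omega>))" by simp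
    also have "\<dots> \<le> 2 * nsq M (simple_walsh_integral M \<nu> N \<kappa> t (ps n)) + 2 * ?e n"
      using simple_walsh_le(2)[OF ps(1) t] wD(4) by (intro nsq_diff_le) auto
    also have "nsq M (simple_walsh_integral M \<nu> N \<kappa> t (ps n)) \<le> ennreal m2 * (2 * ?d n + 2 * walsh_norm_sq M \<kappa> t g)"
      using simple_walsh_le(1)[OF ps(1) t] 1 by (rule order_trans[OF _ mult_left_mono]) simp
    finally show ?thesis by (simp add: add.commute mult_left_mono add_left_mono)
  qed
  have "(\<lambda>n. 2 * ?e n + 2 * (ennreal m2 * (2 * ?d n + 2 * walsh_norm_sq M \<kappa> t g)))
      \<longlonglongrightarrow> 2 * 0 + 2 * (ennreal m2 * (2 * 0 + 2 * walsh_norm_sq M \<kappa> t g))"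
    by (intro tendsto_add ennreal_tendsto_cmult ps tendsto_const) auto
  from LIMSEQ_le_const[OF this] le
  have "nsq M I \<le> 2 * 0 + 2 * (ennreal m2 * (2 * 0 + 2 * walsh_norm_sq M \<kappa> t g))" by blast
  also have "\<dots> = ennreal (4 * m2) * walsh_norm_sq M \<kappa> t g"
  proof -
    have "ennreal (4 * m2) = 4 * ennreal m2" by (simp add: ennreal_mult')
    then show ?thesis by (simp add: mult_ac)
  qed
  finally show ?thesis .
qed

lemma has_walsh_integral_0: "has_walsh_integral M \<nu> N \<kappa> t (\<lambda>_ _ _. 0) (\<lambda>_. 0)"
  unfolding has_walsh_integral_def
  by (auto simp: predictable_def walsh_norm_sq_def simple_data_ok_def simple_process_def simple_walsh_integral_def
      split_beta' intro!: exI[of _ "\<lambda>_. []"])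

lemma simple_process_append: "simple_process (ps @ qs) s x \<omega> = simple_process ps s x \<omega> + simple_process qs s x \<omega>"
  by (simp add: simple_process_def)

lemma simple_walsh_integral_append:
  "simple_walsh_integral M \<nu> N \<kappa> t (ps @ qs) \<omega> = simple_walsh_integral M \<nu> N \<kappa> t ps \<omega> + simple_walsh_integral M \<nu> N \<kappa> t qs \<omega>"
  by (simp add: simple_walsh_integral_def)

definition scale_data :: "real \<Rightarrow> 'w simple_data \<Rightarrow> 'w simple_data" where
  "scale_data c ps = map (\<lambda>(Y, a, b, A). (\<lambda>\<omega>. c * Y \<omega>, a, b, A)) ps"

lemma scale_data_ok: "simple_data_ok M N ps \<Longrightarrow> simple_data_ok M N (scale_data c ps)"
proof -
  assume "simple_data_ok M N ps"
  moreover have "bounded ((\<lambda>\<omega>. c * Y \<omega>) ` space M)" if "bounded (Y ` space M)" for Y :: "'w \<Rightarrow> real"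
    using bounded_scaling[OF that, of c] by (simp add: image_image)
  ultimately show ?thesis
    by (auto simp: simple_data_ok_def scale_data_def elementary_data_def)
qed

lemma simple_process_scale: "simple_process (scale_data c ps) s x \<omega> = c * simple_process ps s x \<omega>"
  by (induction ps) (auto simp: simple_process_def scale_data_def elementary_process_def algebra_simps)

lemma simple_walsh_integral_scale:
  "simple_walsh_integral M \<nu> N \<kappa> t (scale_data c ps) \<omega> = c * simple_walsh_integral M \<nu> N \<kappa> t ps \<omega>"
  by (induction ps) (auto simp: simple_walsh_integral_def scale_data_def algebra_simps)

text \<open>Concatenating the lists of data adds both the simple processes and their integrals,
  without a common refinement of the time intervals.\<close>

lemma has_walsh_integral_add:
  assumes g: "has_walsh_integral M \<nu> N \<kappa> t g I" and h: "has_walsh_integral M \<nu> N \<kappa> t h J" and t: "0 \<le> t"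
  shows "has_walsh_integral M \<nu> N \<kappa> t (\<lambda>s x \<omega>. g s x \<omega> + h s x \<omega>) (\<lambda>\<omega>. I \<omega> + J \<omega>)"
proof -
  note gD = has_walsh_integralD[OF g] and hD = has_walsh_integralD[OF h]
  obtain ps where ps: "\<And>n::nat. simple_data_ok M N (ps n)"
    "(\<lambda>n. walsh_norm_sq M \<kappa> t (\<lambda>s x \<omega>. simple_process (ps n) s x \<omega> - g s x \<omega>)) \<longlonglongrightarrow> 0"
    "(\<lambda>n. nsq M (\<lambda>\<omega>. simple_walsh_integral M \<nu> N \<kappa> t (ps n) \<omega> - I \<omega>)) \<longlonglongrightarrow> 0"
    using g unfolding has_walsh_integral_def nsq_def by blast
  obtain qs where qs: "\<And>n::nat. simple_data_ok M N (qs n)"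
    "(\<lambda>n. walsh_norm_sq M \<kappa> t (\<lambda>s x \<omega>. simple_process (qs n) s x \<omega> - h s x \<omega>)) \<longlonglongrightarrow> 0"
    "(\<lambda>n. nsq M (\<lambda>\<omega>. simple_walsh_integral M \<nu> N \<kappa> t (qs n) \<omega> - J \<omega>)) \<longlonglongrightarrow> 0"
    using h unfolding has_walsh_integral_def nsq_def by blast
  show ?thesis
    unfolding has_walsh_integral_def nsq_def[symmetric]
  proof (intro conjI exI[of _ "\<lambda>n. ps n @ qs n"] allI)
    show "predictable M N (\<lambda>s x \<omega>. indicator {0<..t} s * (g s x \<omega> + h s x \<omega>))"
      unfolding distrib_left by (rule predictable_add[OF gD(1) hD(1)])
    show "walsh_norm_sq M \<kappa> t (\<lambda>s x \<omega>. g s x \<omega> + h s x \<omega>) < \<infinity>"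
      using gD(3) hD(3) by (intro le_less_trans[OF walsh_norm_add_le'[OF gD(2) hD(2)]]) (simp add: ennreal_mult_less_top)
    show "(\<lambda>\<omega>. I \<omega> + J \<omega>) \<in> borel_measurable M" using gD(4) hD(4) by simp
    show "simple_data_ok M N (ps n @ qs n)" for n
      using ps(1)[of n] qs(1)[of n] by (auto simp: simple_data_ok_def)
    show "(\<lambda>n. walsh_norm_sq M \<kappa> t (\<lambda>s x \<omega>. simple_process (ps n @ qs n) s x \<omega> - (g s x \<omega> + h s x \<omega>))) \<longlonglongrightarrow> 0"
    proof (rule tendsto_0_combine[OF ps(2) qs(2)])
      fix n
      have "jointly M (\<lambda>s x \<omega>. indicator {0<..t} s * (simple_process (ps n) s x \<omega> - g s x \<omega>))"
        "jointly M (\<lambda>s x \<omega>. indicator {0<..t} s * (simple_process (qs n) s x \<omega> - h s x \<omega>))"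
        unfolding right_diff_distrib
        by (intro jointly_diff jointly_indicator jointly_simple_process ps qs gD hD; simp)+
      from walsh_norm_add_le'[OF this]
      show "walsh_norm_sq M \<kappa> t (\<lambda>s x \<omega>. simple_process (ps n @ qs n) s x \<omega> - (g s x \<omega> + h s x \<omega>))
        \<le> 2 * walsh_norm_sq M \<kappa> t (\<lambda>s x \<omega>. simple_process (ps n) s x \<omega> - g s x \<omega>) + 2 * walsh_norm_sq M \<kappa> t (\<lambda>s x \<omega>. simple_process (qs n) s x \<omega> - h s x \<omega>)"
        by (simp add: simple_process_append algebra_simps)
    qed
    show "(\<lambda>n. nsq M (\<lambda>\<omega>. simple_walsh_integral M \<nu> N \<kappa> t (ps n @ qs n) \<omega> - (I \<omega> + J \<omega>))) \<longlonglongrightarrow> 0"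
    proof (rule tendsto_0_combine[OF ps(3) qs(3)])
      fix n
      have "nsq M (\<lambda>\<omega>. (simple_walsh_integral M \<nu> N \<kappa> t (ps n) \<omega> - I \<omega>) + (simple_walsh_integral M \<nu> N \<kappa> t (qs n) \<omega> - J \<omega>))
        \<le> 2 * nsq M (\<lambda>\<omega>. simple_walsh_integral M \<nu> N \<kappa> t (ps n) \<omega> - I \<omega>) + 2 * nsq M (\<lambda>\<omega>. simple_walsh_integral M \<nu> N \<kappa> t (qs n) \<omega> - J \<omega>)"
        using simple_walsh_le(2)[OF ps(1) t] simple_walsh_le(2)[OF qs(1) t] gD(4) hD(4) by (intro nsq_add_le) auto
      then show "nsq M (\<lambda>\<omega>. simple_walsh_integral M \<nu> N \<kappa> t (ps n @ qs n) \<omega> - (I \<omega> + J \<omega>))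
        \<le> 2 * nsq M (\<lambda>\<omega>. simple_walsh_integral M \<nu> N \<kappa> t (ps n) \<omega> - I \<omega>) + 2 * nsq M (\<lambda>\<omega>. simple_walsh_integral M \<nu> N \<kappa> t (qs n) \<omega> - J \<omega>)"
        by (simp add: simple_walsh_integral_append algebra_simps)
    qed
  qed
qed

lemma has_walsh_integral_cmult:
  assumes g: "has_walsh_integral M \<nu> N \<kappa> t g I" and t: "0 \<le> t"
  shows "has_walsh_integral M \<nu> N \<kappa> t (\<lambda>s x \<omega>. c * g s x \<omega>) (\<lambda>\<omega>. c * I \<omega>)"
proof -
  note gD = has_walsh_integralD[OF g]
  obtain ps where ps: "\<And>n::nat. simple_data_ok M N (ps n)"
    "(\<lambda>n. walsh_norm_sq M \<kappa> t (\<lambda>s x \<omega>. simple_process (ps n) s x \<omega> - g s x \<omega>)) \<longlonglongrightarrow> 0"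
    "(\<lambda>n. nsq M (\<lambda>\<omega>. simple_walsh_integral M \<nu> N \<kappa> t (ps n) \<omega> - I \<omega>)) \<longlonglongrightarrow> 0"
    using g unfolding has_walsh_integral_def nsq_def by blast
  have norm: "walsh_norm_sq M \<kappa> t (\<lambda>s x \<omega>. c * f s x \<omega>) = ennreal (c\<^sup>2) * walsh_norm_sq M \<kappa> t f"
    if "jointly M (\<lambda>s x \<omega>. indicator {0<..t} s * f s x \<omega>)" for f
    using walsh_norm_cmult[OF that, of t c] walsh_norm_indicator[of M t f] walsh_norm_indicator[of M t "\<lambda>s x \<omega>. c * f s x \<omega>"]
    by (simp add: mult.left_commute)
  show ?thesis
    unfolding has_walsh_integral_def nsq_def[symmetric]
  proof (intro conjI exI[of _ "\<lambda>n. scale_data c (ps n)"] allI)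
    show "predictable M N (\<lambda>s x \<omega>. indicator {0<..t} s * (c * g s x \<omega>))"
      using predictable_cmult[OF gD(1), of c] by (simp add: mult.left_commute)
    show "walsh_norm_sq M \<kappa> t (\<lambda>s x \<omega>. c * g s x \<omega>) < \<infinity>"
      using gD(3) by (simp add: norm[OF gD(2)] ennreal_mult_less_top)
    show "(\<lambda>\<omega>. c * I \<omega>) \<in> borel_measurable M" using gD(4) by simp
    show "simple_data_ok M N (scale_data c (ps n))" for n by (rule scale_data_ok[OF ps(1)])
    have j: "jointly M (\<lambda>s x \<omega>. indicator {0<..t} s * (simple_process (ps n) s x \<omega> - g s x \<omega>))" for n
      unfolding right_diff_distrib by (intro jointly_diff jointly_indicator jointly_simple_process ps gD) simp
    show "(\<lambda>n. walsh_norm_sq M \<kappa> t (\<lambda>s x \<omega>. simple_process (scale_data c (ps n)) s x \<omega> - c * g s x \<omega>)) \<longlonglongrightarrow> 0"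
      unfolding simple_process_scale right_diff_distrib[symmetric] norm[OF j]
      using ennreal_tendsto_cmult[OF _ ps(2), of "ennreal (c\<^sup>2)"] by simp
    have "nsq M (\<lambda>\<omega>. c * (simple_walsh_integral M \<nu> N \<kappa> t (ps n) \<omega> - I \<omega>)) = ennreal (c\<^sup>2) * nsq M (\<lambda>\<omega>. simple_walsh_integral M \<nu> N \<kappa> t (ps n) \<omega> - I \<omega>)" for n
      using simple_walsh_le(2)[OF ps(1) t] gD(4) by (intro nsq_cmult) auto
    then show "(\<lambda>n. nsq M (\<lambda>\<omega>. simple_walsh_integral M \<nu> N \<kappa> t (scale_data c (ps n)) \<omega> - c * I \<omega>)) \<longlonglongrightarrow> 0"
      unfolding simple_walsh_integral_scale right_diff_distrib[symmetric]
      using ennreal_tendsto_cmult[OF _ ps(3), of "ennreal (c\<^sup>2)"] by simp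
  qed
qed

lemma has_walsh_integral_diff:
  assumes g: "has_walsh_integral M \<nu> N \<kappa> t g I" and h: "has_walsh_integral M \<nu> N \<kappa> t h J" and t: "0 \<le> t"
  shows "has_walsh_integral M \<nu> N \<kappa> t (\<lambda>s x \<omega>. g s x \<omega> - h s x \<omega>) (\<lambda>\<omega>. I \<omega> - J \<omega>)"
  using has_walsh_integral_add[OF g has_walsh_integral_cmult[OF h t, of "-1"] t] by simp

lemma has_walsh_integral_sum:
  assumes "finite K" "\<And>k. k \<in> K \<Longrightarrow> has_walsh_integral M \<nu> N \<kappa> t (g k) (I k)" "0 \<le> t"
  shows "has_walsh_integral M \<nu> N \<kappa> t (\<lambda>s x \<omega>. \<Sum>k\<in>K. g k s x \<omega>) (\<lambda>\<omega>. \<Sum>k\<in>K. I k \<omega>)"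
  using assms(1,2)
proof (induction K)
  case empty
  then show ?case by (simp add: has_walsh_integral_0)
next
  case (insert k K)
  then show ?case using has_walsh_integral_add[of t "g k" "I k" "\<lambda>s x \<omega>. \<Sum>k\<in>K. g k s x \<omega>" "\<lambda>\<omega>. \<Sum>k\<in>K. I k \<omega>"] assms(3)
    by simp
qed

section \<open>Uniqueness of mild solutions\<close>

text \<open>For a deterministic kernel of bounded support, the Schur test at each time and sample
  point followed by Tonelli bounds the norm by second moments of \<open>w\<close> at single points.
  Those are what uniqueness and the growth estimate control.\<close>

lemma walsh_norm_nsq_le:
  assumes w: "jointly M (\<lambda>s x \<omega>. indicator {0..} s * w s x \<omega>)"
    and k: "(\<lambda>(s, y). k s y) \<in> borel_measurable (borel \<Otimes>\<^sub>M borel)"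
    and supp: "\<And>s y. 0 \<le> s \<Longrightarrow> s \<le> t \<Longrightarrow> r < \<bar>y - c\<bar> \<Longrightarrow> k s y = 0"
  shows "walsh_norm_sq M \<kappa> t (\<lambda>s y \<omega>. k s y * w s y \<omega>)
    \<le> autoconv_mass (2 * r) * (\<integral>\<^sup>+s. (\<integral>\<^sup>+y. ennreal ((k s y)\<^sup>2) * nsq M (w s y) \<partial>lborel) * indicator {0..t} s \<partial>lborel)"
proof -
  \<comment> \<open>Joint measurability is available only after cutting off negative times, which
    the integral over \<open>[0,t]\<close> does not see.\<close>
  let ?W = "\<lambda>s y \<omega>. indicator {0..} s * w s y \<omega>"
  have km[measurable]: "(\<lambda>p. k (f p) (g p)) \<in> borel_measurable P" if [measurable]: "f \<in> borel_measurable P" "g \<in> borel_measurable P" for f g and P :: "'p measure"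
  proof -
    have "(\<lambda>p. (f p, g p)) \<in> measurable P (borel \<Otimes>\<^sub>M borel)" by measurable
    from measurable_compose[OF this k] show ?thesis by simp
  qed
  have jk: "jointly M (\<lambda>s y \<omega>. k s y)" unfolding jointly_def split_beta' by (intro km) measurable
  have j: "jointly M (\<lambda>s y \<omega>. k s y * ?W s y \<omega>)" by (rule jointly_mult[OF jk w])
  have m1: "(\<lambda>q. ennreal ((k (snd (fst q)) (snd q) * ?W (snd (fst q)) (snd q) (fst (fst q)))\<^sup>2) * indicator {0..t} (snd (fst q))) \<in> borel_measurable ((M \<Otimes>\<^sub>M lborel) \<Otimes>\<^sub>M lborel)"
  proof -
    have [measurable]: "(\<lambda>q. k (snd (fst q)) (snd q) * ?W (snd (fst q)) (snd q) (fst (fst q))) \<in> borel_measurable ((M \<Otimes>\<^sub>M lborel) \<Otimes>\<^sub>M lborel)"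
      by (rule jointlyD[OF j, where ?f1.0="\<lambda>q. fst (fst q)" and ?f2.0="\<lambda>q. snd (fst q)" and ?f3.0="\<lambda>q. snd q"]) measurable
    show ?thesis by measurable
  qed
  have "walsh_norm_sq M \<kappa> t (\<lambda>s y \<omega>. k s y * w s y \<omega>) \<le> (\<integral>\<^sup>+\<omega>. \<integral>\<^sup>+s. autoconv_mass (2 * r) * (\<integral>\<^sup>+y. ennreal ((k s y * ?W s y \<omega>)\<^sup>2) * indicator {0..t} s \<partial>lborel) \<partial>lborel \<partial>M)"
    unfolding walsh_norm_energy
  proof (intro nn_integral_mono)
    fix \<omega> s assume \<omega>: "\<omega> \<in> space M"
    show "energy (\<lambda>x. k s x * w s x \<omega>) * indicator {0..t} s \<le> autoconv_mass (2 * r) * (\<integral>\<^sup>+y. ennreal ((k s y * ?W s y \<omega>)\<^sup>2) * indicator {0..t} s \<partial>lborel)"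
    proof (cases "s \<in> {0..t}")
      case True
      then have e: "(\<lambda>x. k s x * w s x \<omega>) = (\<lambda>x. k s x * ?W s x \<omega>)" by simp
      have "energy (\<lambda>x. k s x * ?W s x \<omega>) \<le> autoconv_mass (2 * r) * (\<integral>\<^sup>+y. ennreal ((k s y * ?W s y \<omega>)\<^sup>2) \<partial>lborel)"
      proof (rule energy_local_le[where c=c])
        show "(\<lambda>x. k s x * ?W s x \<omega>) \<in> borel_measurable borel" by (rule jointly_section[OF j \<omega>])
        show "k s x * ?W s x \<omega> = 0" if "r < \<bar>x - c\<bar>" for x using supp[of s x] that True by simp
      qed
      then show ?thesis unfolding e using True by simp
    qed simp
  qed
  also have "\<dots> = autoconv_mass (2 * r) * (\<integral>\<^sup>+\<omega>. \<integral>\<^sup>+s. (\<integral>\<^sup>+y. ennreal ((k s y * ?W s y \<omega>)\<^sup>2) * indicator {0..t} s \<partial>lborel) \<partial>lborel \<partial>M)"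
  proof -
    have m2: "(\<lambda>q. \<integral>\<^sup>+y. ennreal ((k (snd q) y * ?W (snd q) y (fst q))\<^sup>2) * indicator {0..t} (snd q) \<partial>lborel) \<in> borel_measurable (M \<Otimes>\<^sub>M lborel)"
      using lborel.borel_measurable_nn_integral_fst[OF m1] by simp
    have m3: "(\<lambda>\<omega>. \<integral>\<^sup>+s. \<integral>\<^sup>+y. ennreal ((k s y * ?W s y \<omega>)\<^sup>2) * indicator {0..t} s \<partial>lborel \<partial>lborel) \<in> borel_measurable M"
      using lborel.borel_measurable_nn_integral_fst[OF m2] by simp
    have m4: "(\<lambda>s. \<integral>\<^sup>+y. ennreal ((k s y * ?W s y \<omega>)\<^sup>2) * indicator {0..t} s \<partial>lborel) \<in> borel_measurable lborel" if "\<omega> \<in> space M" for \<omega>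
      using measurable_compose[OF measurable_Pair1'[OF that] m2] by simp
    have "(\<integral>\<^sup>+\<omega>. \<integral>\<^sup>+s. autoconv_mass (2 * r) * (\<integral>\<^sup>+y. ennreal ((k s y * ?W s y \<omega>)\<^sup>2) * indicator {0..t} s \<partial>lborel) \<partial>lborel \<partial>M)
      = (\<integral>\<^sup>+\<omega>. autoconv_mass (2 * r) * (\<integral>\<^sup>+s. (\<integral>\<^sup>+y. ennreal ((k s y * ?W s y \<omega>)\<^sup>2) * indicator {0..t} s \<partial>lborel) \<partial>lborel) \<partial>M)"
      by (intro nn_integral_cong nn_integral_cmult m4)
    then show ?thesis using m3 by (simp add: nn_integral_cmult)
  qed
  also have "(\<integral>\<^sup>+\<omega>. \<integral>\<^sup>+s. (\<integral>\<^sup>+y. ennreal ((k s y * ?W s y \<omega>)\<^sup>2) * indicator {0..t} s \<partial>lborel) \<partial>lborel \<partial>M)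
    = (\<integral>\<^sup>+s. \<integral>\<^sup>+\<omega>. (\<integral>\<^sup>+y. ennreal ((k s y * ?W s y \<omega>)\<^sup>2) * indicator {0..t} s \<partial>lborel) \<partial>M \<partial>lborel)"
  proof -
    interpret P: pair_sigma_finite lborel M ..
    have "(\<lambda>q. \<integral>\<^sup>+y. ennreal ((k (fst q) y * ?W (fst q) y (snd q))\<^sup>2) * indicator {0..t} (fst q) \<partial>lborel) \<in> borel_measurable (lborel \<Otimes>\<^sub>M M)"
    proof -
      have "(\<lambda>q. ennreal ((k (fst (fst q)) (snd q) * ?W (fst (fst q)) (snd q) (snd (fst q)))\<^sup>2) * indicator {0..t} (fst (fst q))) \<in> borel_measurable ((lborel \<Otimes>\<^sub>M M) \<Otimes>\<^sub>M lborel)"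
      proof -
        have [measurable]: "(\<lambda>q. k (fst (fst q)) (snd q) * ?W (fst (fst q)) (snd q) (snd (fst q))) \<in> borel_measurable ((lborel \<Otimes>\<^sub>M M) \<Otimes>\<^sub>M lborel)"
          by (rule jointlyD[OF j, where ?f1.0="\<lambda>q. snd (fst q)" and ?f2.0="\<lambda>q. fst (fst q)" and ?f3.0="\<lambda>q. snd q"]) measurable
        show ?thesis by measurable
      qed
      from lborel.borel_measurable_nn_integral_fst[OF this] show ?thesis by simp
    qed
    then show ?thesis by (intro P.Fubini') (simp add: split_beta')
  qed
  also have "\<dots> = (\<integral>\<^sup>+s. \<integral>\<^sup>+y. (\<integral>\<^sup>+\<omega>. ennreal ((k s y * ?W s y \<omega>)\<^sup>2) * indicator {0..t} s \<partial>M) \<partial>lborel \<partial>lborel)"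
  proof (intro nn_integral_cong)
    fix s :: real
    interpret P: pair_sigma_finite lborel M ..
    have [measurable]: "(\<lambda>q. k s (fst q) * ?W s (fst q) (snd q)) \<in> borel_measurable (lborel \<Otimes>\<^sub>M M)"
      by (rule jointlyD[OF j, where ?f1.0="\<lambda>q. snd q" and ?f2.0="\<lambda>q. s" and ?f3.0="\<lambda>q. fst q"]) measurable
    have "(\<lambda>(y, \<omega>). ennreal ((k s y * ?W s y \<omega>)\<^sup>2) * indicator {0..t} s) \<in> borel_measurable (lborel \<Otimes>\<^sub>M M)"
      unfolding split_beta' by measurable
    then show "(\<integral>\<^sup>+\<omega>. (\<integral>\<^sup>+y. ennreal ((k s y * ?W s y \<omega>)\<^sup>2) * indicator {0..t} s \<partial>lborel) \<partial>M) = (\<integral>\<^sup>+y. (\<integral>\<^sup>+\<omega>. ennreal ((k s y * ?W s y \<omega>)\<^sup>2) * indicator {0..t} s \<partial>M) \<partial>lborel)"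
      by (rule P.Fubini')
  qed
  also have "\<dots> = (\<integral>\<^sup>+s. (\<integral>\<^sup>+y. ennreal ((k s y)\<^sup>2) * nsq M (w s y) \<partial>lborel) * indicator {0..t} s \<partial>lborel)"
  proof (intro nn_integral_cong)
    fix s :: real
    show "(\<integral>\<^sup>+y. (\<integral>\<^sup>+\<omega>. ennreal ((k s y * ?W s y \<omega>)\<^sup>2) * indicator {0..t} s \<partial>M) \<partial>lborel) = (\<integral>\<^sup>+y. ennreal ((k s y)\<^sup>2) * nsq M (w s y) \<partial>lborel) * indicator {0..t} s"
    proof (cases "s \<in> {0..t}")
      case True
      have "(\<integral>\<^sup>+\<omega>. ennreal ((k s y * ?W s y \<omega>)\<^sup>2) * indicator {0..t} s \<partial>M) = ennreal ((k s y)\<^sup>2) * nsq M (w s y)" for y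
        using True jointly_section'[OF w, of s y]
        by (simp add: nsq_def power_mult_distrib ennreal_mult nn_integral_cmult)
      then show ?thesis using True by simp
    qed simp
  qed
  finally show ?thesis .
qed

end

lemma measurable_wave_kernel[measurable]:
  assumes [measurable]: "f \<in> borel_measurable P" "g \<in> borel_measurable P"
  shows "(\<lambda>p. wave_kernel (f p) (g p)) \<in> borel_measurable P"
  unfolding wave_kernel_def by measurable

lemma wave_kernel_sq: "ennreal ((wave_kernel t x)\<^sup>2) = ennreal (1/4) * indicator {-t<..<t} x"
  by (auto simp: wave_kernel_def indicator_def power2_eq_square)

context levy_noise
begin

declare measurable_\<nu> [measurable del]

lemma mild_solutionD:
  assumes "mild_solution M \<nu> N \<kappa> u"
  shows "predictable M N u" "jointly M (\<lambda>s x \<omega>. indicator {0..} s * u s x \<omega>)"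
    "0 \<le> t \<Longrightarrow> has_walsh_integral M \<nu> N \<kappa> t (\<lambda>s y \<omega>. wave_kernel (t - s) (x - y) * u s y \<omega>) (\<lambda>\<omega>. u t x \<omega> - 1)"
  using assms predictable_jointly by (auto simp: mild_solution_def)

lemma measurable_mild_solution:
  assumes "mild_solution M \<nu> N \<kappa> u" "0 \<le> t"
  shows "u t x \<in> borel_measurable M"
  using jointly_section'[OF mild_solutionD(2)[OF assms(1)], of t x] assms(2) by simp

text \<open>The backward cone of a point of a cone lies in that cone, so the finiteness of the Walsh norm
  in the equation at the apex bounds the second moments in the whole cone.\<close>

lemma mild_solution_cone_bound:
  assumes u: "mild_solution M \<nu> N \<kappa> u" and T: "0 \<le> T"
  shows "\<exists>B. 0 \<le> B \<and> (\<forall>t x. 0 \<le> t \<longrightarrow> \<bar>x - x0\<bar> + t \<le> T \<longrightarrow> nsq M (u t x) \<le> ennreal B)"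
proof -
  let ?W = "walsh_norm_sq M \<kappa> T (\<lambda>s y \<omega>. wave_kernel (T - s) (x0 - y) * u s y \<omega>)"
  let ?B = "2 * (ennreal (4 * m2) * ?W) + 2"
  have fin: "?W < \<infinity>" by (rule has_walsh_integralD(3)[OF mild_solutionD(3)[OF u T]])
  have le: "nsq M (u t x) \<le> ?B" if t: "0 \<le> t" and cone: "\<bar>x - x0\<bar> + t \<le> T" for t x
  proof -
    have "nsq M (\<lambda>\<omega>. u t x \<omega> - 1) \<le> ennreal (4 * m2) * walsh_norm_sq M \<kappa> t (\<lambda>s y \<omega>. wave_kernel (t - s) (x - y) * u s y \<omega>)"
      by (rule walsh_integral_le[OF mild_solutionD(3)[OF u t] t])
    also have "walsh_norm_sq M \<kappa> t (\<lambda>s y \<omega>. wave_kernel (t - s) (x - y) * u s y \<omega>) \<le> ?W"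
    proof (rule walsh_norm_mono)
      fix s y \<omega>
      have "\<bar>wave_kernel (t - s) (x - y)\<bar> \<le> \<bar>wave_kernel (T - s) (x0 - y)\<bar>"
        using cone by (auto simp: wave_kernel_def)
      then show "\<bar>wave_kernel (t - s) (x - y) * u s y \<omega>\<bar> \<le> \<bar>wave_kernel (T - s) (x0 - y) * u s y \<omega>\<bar>"
        unfolding abs_mult by (rule mult_right_mono) simp
    qed (use cone in linarith)
    finally have 1: "nsq M (\<lambda>\<omega>. u t x \<omega> - 1) \<le> ennreal (4 * m2) * ?W" by (simp add: mult_left_mono)
    have "nsq M (u t x) = nsq M (\<lambda>\<omega>. (u t x \<omega> - 1) + 1)" by simp
    also have "\<dots> \<le> 2 * nsq M (\<lambda>\<omega>. u t x \<omega> - 1) + 2 * nsq M (\<lambda>\<omega>. 1)"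
      using measurable_mild_solution[OF u t] by (intro nsq_add_le) auto
    also have "nsq M (\<lambda>\<omega>. 1) = 1" by (simp add: nsq_def emeasure_space_1)
    also have "2 * nsq M (\<lambda>\<omega>. u t x \<omega> - 1) + 2 * 1 \<le> ?B" using 1 by (intro add_mono mult_left_mono) auto
    finally show ?thesis .
  qed
  have "?B < \<infinity>" using fin by (simp add: ennreal_mult_less_top)
  then obtain B where "?B = ennreal B" "0 \<le> B" by (cases ?B) auto
  then show ?thesis using le by auto
qed

text \<open>An iterated Gronwall argument for the second moment of the difference. Both solutions
  are bounded in the backward cone of \<open>(T, x0)\<close>, the equation for the difference never
  leaves that cone, and \<open>n\<close> iterations of the estimate leave a factor
  \<open>1 / n!\<close>.\<close>

lemma mild_solution_unique:
  assumes u: "mild_solution M \<nu> N \<kappa> u" and v: "mild_solution M \<nu> N \<kappa> v" and T: "0 \<le> T"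
  shows "AE \<omega> in M. u T x0 \<omega> = v T x0 \<omega>"
proof -
  define w where "w s y \<omega> = u s y \<omega> - v s y \<omega>" for s y \<omega>
  have jw: "jointly M (\<lambda>s y \<omega>. indicator {0..} s * w s y \<omega>)"
    using jointly_diff[OF mild_solutionD(2)[OF u] mild_solutionD(2)[OF v]] by (simp add: w_def algebra_simps)
  obtain Bu where Bu: "0 \<le> Bu" "\<And>t x. 0 \<le> t \<Longrightarrow> \<bar>x - x0\<bar> + t \<le> T \<Longrightarrow> nsq M (u t x) \<le> ennreal Bu"
    using mild_solution_cone_bound[OF u T, of x0] by blast
  obtain Bv where Bv: "0 \<le> Bv" "\<And>t x. 0 \<le> t \<Longrightarrow> \<bar>x - x0\<bar> + t \<le> T \<Longrightarrow> nsq M (v t x) \<le> ennreal Bv"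
    using mild_solution_cone_bound[OF v T, of x0] by blast
  define B where "B = 2 * Bu + 2 * Bv"
  have B: "0 \<le> B" using Bu Bv by (simp add: B_def)
  \<comment> \<open>The factors come from the bound on Walsh integrals, from the Schur test on an
    interval of radius at most \<open>T\<close>, and from the squared value \<open>1/4\<close> of
    the wave kernel.\<close>
  let ?K = "ennreal (4 * m2) * autoconv_mass (2 * T) * ennreal (1/4)"
  have "?K < \<infinity>" using autoconv_mass_finite[of "2 * T"] by (simp add: ennreal_mult_less_top)
  then obtain c where c: "?K = ennreal c" "0 \<le> c" by (cases ?K) auto
  have rec: "nsq M (w t x) \<le> ennreal c * (\<integral>\<^sup>+s. (\<integral>\<^sup>+y. indicator {-(t - s)<..<t - s} (x - y) * nsq M (w s y) \<partial>lborel) * indicator {0..t} s \<partial>lborel)"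
    if t: "0 \<le> t" "t \<le> T" for t x
  proof -
    let ?R = "\<integral>\<^sup>+s. (\<integral>\<^sup>+y. indicator {-(t - s)<..<t - s} (x - y) * nsq M (w s y) \<partial>lborel) * indicator {0..t} s \<partial>lborel"
    have m[measurable]: "(\<lambda>q. nsq M (w (fst q) (snd q)) * indicator {0..} (fst q)) \<in> borel_measurable (borel \<Otimes>\<^sub>M borel)"
    proof -
      have [measurable]: "(\<lambda>q. indicator {0..} (fst (fst q)) * w (fst (fst q)) (snd (fst q)) (snd q)) \<in> borel_measurable ((borel \<Otimes>\<^sub>M borel) \<Otimes>\<^sub>M M)"
        by (rule jointlyD[OF jw, where ?f1.0="\<lambda>q. snd q" and ?f2.0="\<lambda>q. fst (fst q)" and ?f3.0="\<lambda>q. snd (fst q)"]) measurable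
      have "(\<lambda>q. ennreal ((indicator {0..} (fst (fst q)) * w (fst (fst q)) (snd (fst q)) (snd q))\<^sup>2)) \<in> borel_measurable ((borel \<Otimes>\<^sub>M borel) \<Otimes>\<^sub>M M)" by measurable
      from borel_measurable_nn_integral_fst[OF this]
      have 1: "(\<lambda>q. nsq M (\<lambda>\<omega>. indicator {0..} (fst q) * w (fst q) (snd q) \<omega>)) \<in> borel_measurable (borel \<Otimes>\<^sub>M borel)"
        by (simp add: nsq_def)
      have "nsq M (\<lambda>\<omega>. indicator {0..} (fst q) * w (fst q) (snd q) \<omega>) = nsq M (w (fst q) (snd q)) * indicator {0..} (fst q)" for q
        by (simp add: indicator_def nsq_def)
      then show ?thesis using 1 by simp
    qed
    have W: "has_walsh_integral M \<nu> N \<kappa> t (\<lambda>s y \<omega>. wave_kernel (t - s) (x - y) * w s y \<omega>) (w t x)"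
      using has_walsh_integral_diff[OF mild_solutionD(3)[OF u t(1), of x] mild_solutionD(3)[OF v t(1), of x] t(1)]
      by (simp add: w_def[abs_def] algebra_simps)
    have "nsq M (w t x) \<le> ennreal (4 * m2) * walsh_norm_sq M \<kappa> t (\<lambda>s y \<omega>. wave_kernel (t - s) (x - y) * w s y \<omega>)"
      by (rule walsh_integral_le[OF W t(1)])
    also have "walsh_norm_sq M \<kappa> t (\<lambda>s y \<omega>. wave_kernel (t - s) (x - y) * w s y \<omega>)
      \<le> autoconv_mass (2 * t) * (\<integral>\<^sup>+s. (\<integral>\<^sup>+y. ennreal ((wave_kernel (t - s) (x - y))\<^sup>2) * nsq M (w s y) \<partial>lborel) * indicator {0..t} s \<partial>lborel)"
      by (rule walsh_norm_nsq_le[OF jw, where c=x]) (auto simp: wave_kernel_def split_beta')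
    also have "(\<integral>\<^sup>+s. (\<integral>\<^sup>+y. ennreal ((wave_kernel (t - s) (x - y))\<^sup>2) * nsq M (w s y) \<partial>lborel) * indicator {0..t} s \<partial>lborel)
      = (\<integral>\<^sup>+s. ennreal (1/4) * (\<integral>\<^sup>+y. indicator {-(t - s)<..<t - s} (x - y) * (nsq M (w s y) * indicator {0..} s) * indicator {0..t} s \<partial>lborel) \<partial>lborel)"
    proof (intro nn_integral_cong)
      fix s :: real
      have [measurable]: "(\<lambda>y. nsq M (w s y) * indicator {0..} s) \<in> borel_measurable borel"
        using measurable_compose[OF measurable_Pair1'[of s borel borel] m] by simp
      show "(\<integral>\<^sup>+y. ennreal ((wave_kernel (t - s) (x - y))\<^sup>2) * nsq M (w s y) \<partial>lborel) * indicator {0..t} s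
        = ennreal (1/4) * (\<integral>\<^sup>+y. indicator {-(t - s)<..<t - s} (x - y) * (nsq M (w s y) * indicator {0..} s) * indicator {0..t} s \<partial>lborel)"
      proof (cases "s \<in> {0..t}")
        case True
        have "(\<integral>\<^sup>+y. ennreal ((wave_kernel (t - s) (x - y))\<^sup>2) * nsq M (w s y) \<partial>lborel)
          = (\<integral>\<^sup>+y. ennreal (1/4) * (indicator {-(t - s)<..<t - s} (x - y) * (nsq M (w s y) * indicator {0..} s) * indicator {0..t} s) \<partial>lborel)"
          using True by (intro nn_integral_cong) (simp add: wave_kernel_sq mult.assoc)
        also have "\<dots> = ennreal (1/4) * (\<integral>\<^sup>+y. indicator {-(t - s)<..<t - s} (x - y) * (nsq M (w s y) * indicator {0..} s) * indicator {0..t} s \<partial>lborel)"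
          by (rule nn_integral_cmult) measurable
        finally show ?thesis using True by simp
      qed simp
    qed
    also have "\<dots> = ennreal (1/4) * (\<integral>\<^sup>+s. (\<integral>\<^sup>+y. indicator {-(t - s)<..<t - s} (x - y) * (nsq M (w s y) * indicator {0..} s) * indicator {0..t} s \<partial>lborel) \<partial>lborel)"
    proof (rule nn_integral_cmult)
      have [measurable]: "(\<lambda>q. indicator {-(t - fst q)<..<t - fst q} (x - snd q) :: ennreal) \<in> borel_measurable (borel \<Otimes>\<^sub>M borel)"
      proof -
        have "(\<lambda>q. indicator {-(t - fst q)<..<t - fst q} (x - snd q) :: ennreal) = indicator {q. -(t - fst q) < x - snd q \<and> x - snd q < t - fst q}"
          by (auto simp: fun_eq_iff indicator_def)
        then show ?thesis by (simp) measurable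
      qed
      have "(\<lambda>q. indicator {-(t - fst q)<..<t - fst q} (x - snd q) * (nsq M (w (fst q) (snd q)) * indicator {0..} (fst q)) * indicator {0..t} (fst q)) \<in> borel_measurable (borel \<Otimes>\<^sub>M lborel)"
        by measurable
      from lborel.borel_measurable_nn_integral_fst[OF this]
      show "(\<lambda>s. \<integral>\<^sup>+y. indicator {-(t - s)<..<t - s} (x - y) * (nsq M (w s y) * indicator {0..} s) * indicator {0..t} s \<partial>lborel) \<in> borel_measurable lborel"
        by simp
    qed
    also have "(\<integral>\<^sup>+s. (\<integral>\<^sup>+y. indicator {-(t - s)<..<t - s} (x - y) * (nsq M (w s y) * indicator {0..} s) * indicator {0..t} s \<partial>lborel) \<partial>lborel) = ?R"
      by (intro nn_integral_cong) (auto simp: indicator_def)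
    finally have "nsq M (w t x) \<le> ennreal (4 * m2) * (autoconv_mass (2 * t) * (ennreal (1/4) * ?R))"
      by (simp add: mult_left_mono)
    also have "\<dots> \<le> ennreal (4 * m2) * (autoconv_mass (2 * T) * (ennreal (1/4) * ?R))"
      using t by (intro mult_left_mono mult_right_mono autoconv_mass_mono) auto
    also have "\<dots> = ?K * ?R" by (simp only: mult.assoc)
    finally show ?thesis unfolding c(1) .
  qed
  \<comment> \<open>If \<open>(t, x)\<close> is in the cone, so is every \<open>(s, y)\<close> with
    \<open>\<bar>x - y\<bar> < t - s\<close>, and the induction hypothesis applies there. The
    section in \<open>y\<close> has length at most \<open>2 * T\<close>, and integrating
    \<open>s ^ n\<close> in time produces the next factorial.\<close>
  have iter: "nsq M (w t x) \<le> ennreal (B * (2 * T * c * t) ^ n / fact n)" if "0 \<le> t" "\<bar>x - x0\<bar> + t \<le> T" for n t x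
    using that
  proof (induction n arbitrary: t x)
    case 0
    have "nsq M (w t x) \<le> 2 * nsq M (u t x) + 2 * nsq M (v t x)"
      unfolding w_def[abs_def] using measurable_mild_solution[OF u 0(1)] measurable_mild_solution[OF v 0(1)]
      by (intro nsq_diff_le) auto
    also have "\<dots> \<le> 2 * ennreal Bu + 2 * ennreal Bv"
      using Bu(2)[OF 0] Bv(2)[OF 0] by (intro add_mono mult_left_mono) auto
    also have "\<dots> = ennreal B" using Bu Bv by (simp add: B_def ennreal_mult')
    finally show ?case by simp
  next
    case (Suc n)
    have tT: "t \<le> T" using Suc.prems by linarith
    let ?q = "2 * T * c"
    have q: "0 \<le> ?q" using T c(2) by simp
    have "(\<integral>\<^sup>+s. (\<integral>\<^sup>+y. indicator {-(t - s)<..<t - s} (x - y) * nsq M (w s y) \<partial>lborel) * indicator {0..t} s \<partial>lborel)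
      \<le> (\<integral>\<^sup>+s. ennreal (2 * T * (B * (?q * s) ^ n / fact n)) * indicator {0..t} s \<partial>lborel)"
    proof (rule nn_integral_mono)
      fix s :: real
      show "(\<integral>\<^sup>+y. indicator {-(t - s)<..<t - s} (x - y) * nsq M (w s y) \<partial>lborel) * indicator {0..t} s
        \<le> ennreal (2 * T * (B * (?q * s) ^ n / fact n)) * indicator {0..t} s"
      proof (cases "s \<in> {0..t}")
        case True
        have "(\<integral>\<^sup>+y. indicator {-(t - s)<..<t - s} (x - y) * nsq M (w s y) \<partial>lborel)
          \<le> (\<integral>\<^sup>+y. ennreal (B * (?q * s) ^ n / fact n) * indicator {x - T..x + T} y \<partial>lborel)"
        proof (rule nn_integral_mono)
          fix y
          show "indicator {-(t - s)<..<t - s} (x - y) * nsq M (w s y) \<le> ennreal (B * (?q * s) ^ n / fact n) * indicator {x - T..x + T} y"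
          proof (cases "x - y \<in> {-(t - s)<..<t - s}")
            case y: True
            then have "nsq M (w s y) \<le> ennreal (B * (?q * s) ^ n / fact n)"
              using True Suc.prems by (intro Suc.IH) auto
            moreover have "y \<in> {x - T..x + T}" using y True tT by auto
            ultimately show ?thesis using y by simp
          qed simp
        qed
        also have "\<dots> = ennreal (B * (?q * s) ^ n / fact n) * ennreal (2 * T)"
          using T by (simp add: nn_integral_cmult_indicator)
        also have "\<dots> = ennreal (2 * T * (B * (?q * s) ^ n / fact n))"
          using T by (simp add: ennreal_mult'[symmetric] mult.commute)
        finally show ?thesis using True by simp
      qed simp
    qed
    also have "\<dots> = ennreal (2 * T * B * ?q ^ n / fact n * (t ^ Suc n / real (Suc n)) - 2 * T * B * ?q ^ n / fact n * (0 ^ Suc n / real (Suc n)))"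
    proof (rule nn_integral_FTC_Icc[where F="\<lambda>s. 2 * T * B * ?q ^ n / fact n * (s ^ Suc n / real (Suc n))"])
      show "(\<lambda>s. 2 * T * (B * (?q * s) ^ n / fact n)) \<in> borel_measurable borel" by measurable
      fix s assume s: "s \<in> {0..t}"
      have "((\<lambda>s. 2 * T * B * ?q ^ n / fact n * (s ^ Suc n / real (Suc n))) has_real_derivative 2 * T * B * ?q ^ n / fact n * (real (Suc n) * s ^ n / real (Suc n))) (at s)"
        by (intro derivative_eq_intros | simp del: of_nat_Suc)+
      also have "2 * T * B * ?q ^ n / fact n * (real (Suc n) * s ^ n / real (Suc n)) = 2 * T * (B * (?q * s) ^ n / fact n)"
        by (simp add: power_mult_distrib del: of_nat_Suc)
      finally show "((\<lambda>s. 2 * T * B * ?q ^ n / fact n * (s ^ Suc n / real (Suc n))) has_real_derivative 2 * T * (B * (?q * s) ^ n / fact n)) (at s)" .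
      show "0 \<le> 2 * T * (B * (?q * s) ^ n / fact n)" using s T B q by simp
    qed (use Suc.prems in simp)
    finally have le: "(\<integral>\<^sup>+s. (\<integral>\<^sup>+y. indicator {-(t - s)<..<t - s} (x - y) * nsq M (w s y) \<partial>lborel) * indicator {0..t} s \<partial>lborel)
      \<le> ennreal (2 * T * B * ?q ^ n / fact n * (t ^ Suc n / real (Suc n)))" by simp
    have "nsq M (w t x) \<le> ennreal c * ennreal (2 * T * B * ?q ^ n / fact n * (t ^ Suc n / real (Suc n)))"
      by (rule order_trans[OF rec[OF Suc.prems(1) tT, of x] mult_left_mono[OF le]]) simp
    also have "\<dots> = ennreal (B * (?q * t) ^ Suc n / fact (Suc n))"
    proof -
      have "c * (2 * T * B * ?q ^ n / fact n * (t ^ Suc n / real (Suc n))) = B * (?q * t) ^ Suc n / fact (Suc n)"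
        by (simp add: power_mult_distrib field_simps del: of_nat_Suc)
      then show ?thesis using c(2) by (simp add: ennreal_mult'[symmetric] del: of_nat_Suc fact_Suc power_Suc)
    qed
    finally show ?case .
  qed
  have "(\<lambda>n. ennreal (B * (2 * T * c * T) ^ n / fact n)) \<longlonglongrightarrow> ennreal 0"
  proof (rule tendsto_ennrealI)
    have "summable (\<lambda>n. inverse (fact n) * (2 * T * c * T) ^ n)" by (rule summable_exp)
    then have "(\<lambda>n. inverse (fact n) * (2 * T * c * T) ^ n) \<longlonglongrightarrow> 0" by (rule summable_LIMSEQ_zero)
    from tendsto_mult_left[OF this, of B] show "(\<lambda>n. B * (2 * T * c * T) ^ n / fact n) \<longlonglongrightarrow> 0"
      by (simp add: divide_inverse mult_ac)
  qed
  then have "nsq M (w T x0) \<le> ennreal 0"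
    by (rule LIMSEQ_le_const) (use iter[of T x0] T in auto)
  then have "nsq M (w T x0) = 0" by simp
  moreover have "w T x0 \<in> borel_measurable M"
    unfolding w_def[abs_def] using measurable_mild_solution[OF u T] measurable_mild_solution[OF v T] by simp
  ultimately have "AE \<omega> in M. w T x0 \<omega> = 0" by (simp add: nsq_0_iff)
  then show ?thesis by eventually_elim (simp add: w_def)
qed

end

section \<open>Transfer between noises with the same law\<close>

type_synonym counts = "(real \<times> real \<times> real) set \<Rightarrow> ennreal"

text \<open>The predictable \<open>\<sigma>\<close>-algebra of the canonical noise, whose sample points are the counts of all
  measurable sets. No null sets are added, so that it does not depend on the law of the noise.\<close>

definition can_predictable :: "(real \<times> real \<times> real) measure \<Rightarrow> (counts \<times> real \<times> real) measure" where
  "can_predictable \<mu> = sigma (space (cnt_space (sets \<mu>)) \<times> {0..} \<times> UNIV)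
     {{(c, t, x) \<in> space (cnt_space (sets \<mu>)) \<times> {0..} \<times> UNIV. elementary_process (\<lambda>c. y (restrict c (boxes a))) a b A t x c \<in> D} | y a b A D.
        0 \<le> a \<and> a < b \<and> A \<in> sets borel \<and> bounded A \<and> y \<in> borel_measurable (cnt_space (boxes a)) \<and> D \<in> sets borel}"

lemma can_predictable_generator:
  "{{(c, t, x) \<in> space (cnt_space (sets \<mu>)) \<times> {0..} \<times> UNIV. elementary_process (\<lambda>c. y (restrict c (boxes a))) a b A t x c \<in> D} | y a b A D.
        0 \<le> a \<and> a < b \<and> A \<in> sets borel \<and> bounded A \<and> y \<in> borel_measurable (cnt_space (boxes a)) \<and> D \<in> sets borel}
    \<subseteq> Pow (space (cnt_space (sets \<mu>)) \<times> {0..} \<times> UNIV)"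
  by blast

lemma can_predictable_space: "space (can_predictable \<mu>) = space (cnt_space (sets \<mu>)) \<times> {0..} \<times> UNIV"
  unfolding can_predictable_def by (rule space_measure_of[OF can_predictable_generator])

context levy_measure
begin

abbreviation "Can \<equiv> cnt_space (sets (intensity \<nu>))"

lemma measurable_restrict_boxes:
  "y \<in> borel_measurable (cnt_space (boxes a)) \<Longrightarrow> (\<lambda>c. y (restrict c (boxes a))) \<in> borel_measurable Can"
  by (rule measurable_compose[OF measurable_restrict_subset[OF boxes_sets]])

lemma can_predictable_jointly:
  fixes g :: "counts \<times> real \<times> real \<Rightarrow> real"
  assumes "g \<in> borel_measurable (can_predictable (intensity \<nu>))"
  shows "jointly Can (\<lambda>s x c. indicator {0..} s * g (c, s, x))"
proof -
  let ?Q = "Can \<Otimes>\<^sub>M (borel \<Otimes>\<^sub>M borel) :: (counts \<times> real \<times> real) measure"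
  let ?S = "space Can \<times> {0..} \<times> (UNIV :: real set)"
  have S: "?S \<inter> space ?Q \<in> sets ?Q"
  proof -
    have "?S \<in> sets ?Q" by (intro pair_measureI) auto
    moreover have "?S \<subseteq> space ?Q" by (auto simp: space_pair_measure)
    ultimately show ?thesis by (simp add: Int_absorb2)
  qed
  have "(\<lambda>p. p) \<in> measurable (restrict_space ?Q ?S) (can_predictable (intensity \<nu>))"
    unfolding can_predictable_def
  proof (rule measurable_measure_of[OF can_predictable_generator])
    show "(\<lambda>p. p) \<in> space (restrict_space ?Q ?S) \<rightarrow> ?S" by (auto simp: space_restrict_space)
    fix E assume "E \<in> {{(c, t, x) \<in> ?S. elementary_process (\<lambda>c. y (restrict c (boxes a))) a b A t x c \<in> D} | y a b A D.
        0 \<le> a \<and> a < b \<and> A \<in> sets borel \<and> bounded A \<and> y \<in> borel_measurable (cnt_space (boxes a)) \<and> D \<in> sets borel}"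
    then obtain y a b A D where E: "E = {(c, t, x) \<in> ?S. elementary_process (\<lambda>c. y (restrict c (boxes a))) a b A t x c \<in> D}"
      and y: "y \<in> borel_measurable (cnt_space (boxes a))" and A[measurable]: "A \<in> sets borel" and D: "D \<in> sets borel" by blast
    note [measurable] = measurable_restrict_boxes[OF y]
    have "(\<lambda>p. y (restrict (fst p) (boxes a)) * indicator {a<..b} (fst (snd p)) * indicator A (snd (snd p))) \<in> borel_measurable ?Q" by measurable
    from measurable_sets[OF measurable_restrict_space1[OF this] D]
    have "(\<lambda>p. y (restrict (fst p) (boxes a)) * indicator {a<..b} (fst (snd p)) * indicator A (snd (snd p))) -` D \<inter> space (restrict_space ?Q ?S) \<in> sets (restrict_space ?Q ?S)" .
    also have "(\<lambda>p. y (restrict (fst p) (boxes a)) * indicator {a<..b} (fst (snd p)) * indicator A (snd (snd p))) -` D \<inter> space (restrict_space ?Q ?S)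
       = (\<lambda>p. p) -` E \<inter> space (restrict_space ?Q ?S)"
      by (auto simp: E space_restrict_space elementary_process_def space_pair_measure)
    finally show "(\<lambda>p. p) -` E \<inter> space (restrict_space ?Q ?S) \<in> sets (restrict_space ?Q ?S)" .
  qed
  from measurable_compose[OF this assms]
  have "g \<in> borel_measurable (restrict_space ?Q ?S)" by simp
  then have m: "(\<lambda>p. indicator ?S p *\<^sub>R g p) \<in> borel_measurable ?Q"
    using borel_measurable_restrict_space_iff[OF S] by blast
  show ?thesis
    unfolding jointly_def
    by (rule measurable_cong[THEN iffD1, OF _ m]) (auto simp: space_pair_measure indicator_def)
qed

end

context levy_noise
begin

abbreviation cntN :: "'w \<Rightarrow> counts" where
  "cntN \<equiv> cnt N (sets (intensity \<nu>))"

lemma measurable_cntN: "cntN \<in> measurable M Can"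
  by (rule measurable_cnt) simp

lemma restrict_cntN: "I \<subseteq> sets (intensity \<nu>) \<Longrightarrow> restrict (cntN \<omega>) I = cnt N I \<omega>"
  by (auto simp: cnt_def fun_eq_iff)

lemma cntN_space: "cntN \<omega> \<in> space Can"
  by (simp add: cnt_def space_PiM)

text \<open>One null event serves all \<open>t\<close> and \<open>x\<close>: exceptional sets are
  those with null projection to the sample space. A merely pointwise almost sure identity would not
  carry over to Walsh's norm by congruence.\<close>

lemma predictable_factor:
  assumes g: "predictable M N g"
  shows "\<exists>h\<in>borel_measurable (can_predictable (intensity \<nu>)).
    AE \<omega> in M. \<forall>t\<ge>0. \<forall>x. g t x \<omega> = h (cntN \<omega>, t, x)"
proof -
  let ?X = "space M \<times> {0..} \<times> (UNIV :: real set)"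
  let ?T = "\<lambda>(\<omega>, t, x). (cntN \<omega>, t, x)" and ?f = "\<lambda>(\<omega>, t, x). g t x \<omega>"
  let ?neg = "\<lambda>S. \<exists>Z\<in>null_sets M. fst ` S \<subseteq> Z"
  have "\<exists>h\<in>borel_measurable (can_predictable (intensity \<nu>)). ?neg {p\<in>?X. ?f p \<noteq> h (?T p)}"
  proof (rule factorization_AE[where Am="predictable_sigma M N" and neg="?neg" and f="?f"
      and G="{{(\<omega>, t, x) \<in> ?X. elementary_process Y a b A t x \<omega> \<in> C} | Y a b A C.
        elementary_data M N Y a b A \<and> C \<in> sets borel}"])
    show "space (predictable_sigma M N) = ?X" by (rule predictable_sigma_space)
    show "sets (predictable_sigma M N) = sigma_sets ?X {{(\<omega>, t, x) \<in> ?X. elementary_process Y a b A t x \<omega> \<in> C} | Y a b A C.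
        elementary_data M N Y a b A \<and> C \<in> sets borel}"
      unfolding predictable_sigma_def by (rule sets_measure_of[OF predictable_sigma_generator_subset])
    show "?T p \<in> space (can_predictable (intensity \<nu>))" if "p \<in> ?X" for p
      using that cntN_space by (auto simp: can_predictable_space)
    show "?neg {}" by auto
    show "?neg (\<Union>n. S n)" if S: "\<And>n. ?neg (S n)" for S :: "nat \<Rightarrow> ('w \<times> real \<times> real) set"
    proof -
      obtain Z where Z: "\<And>n. Z n \<in> null_sets M" "\<And>n. fst ` S n \<subseteq> Z n" using S by metis
      have "fst ` (\<Union>n. S n) \<subseteq> (\<Union>n. Z n)" unfolding image_UN using Z(2) by blast
      then show ?thesis using Z(1) by (intro bexI[of _ "\<Union>n. Z n"]) auto
    qed
    show "?neg S'" if "?neg S" "S' \<subseteq> S" for S S' using that by blast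
    show "?f \<in> borel_measurable (predictable_sigma M N)" using g unfolding predictable_def .
    fix E assume "E \<in> {{(\<omega>, t, x) \<in> ?X. elementary_process Y a b A t x \<omega> \<in> C} | Y a b A C.
        elementary_data M N Y a b A \<and> C \<in> sets borel}"
    then obtain Y a b A D where E: "E = {(\<omega>, t, x) \<in> ?X. elementary_process Y a b A t x \<omega> \<in> D}"
      and d: "elementary_data M N Y a b A" and D: "D \<in> sets borel" by blast
    obtain y where y: "y \<in> borel_measurable (cnt_space (boxes a))" "AE \<omega> in M. Y \<omega> = y (cnt N (boxes a) \<omega>)"
      using noise_filtration_factor[of Y a] d by (auto simp: elementary_data_def)
    obtain Z where Z: "{\<omega>\<in>space M. Y \<omega> \<noteq> y (cnt N (boxes a) \<omega>)} \<subseteq> Z" "Z \<in> null_sets M"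
      using y(2) by (auto elim: AE_E simp: null_sets_def)
    let ?B = "{(c, t, x) \<in> space Can \<times> {0..} \<times> UNIV. elementary_process (\<lambda>c. y (restrict c (boxes a))) a b A t x c \<in> D}"
    have d': "0 \<le> a" "a < b" "A \<in> sets borel" "bounded A" using d by (auto simp: elementary_data_def)
    have B: "?B \<in> sets (can_predictable (intensity \<nu>))"
      unfolding can_predictable_def sets_measure_of[OF can_predictable_generator]
      by (rule sigma_sets.Basic) (use d' D y(1) in blast)
    have "fst ` {p\<in>?X. (p \<in> E) \<noteq> (?T p \<in> ?B)} \<subseteq> Z"
    proof
      fix \<omega> assume "\<omega> \<in> fst ` {p\<in>?X. (p \<in> E) \<noteq> (?T p \<in> ?B)}"
      then obtain p where "\<omega> = fst p" and p': "p \<in> {p\<in>?X. (p \<in> E) \<noteq> (?T p \<in> ?B)}" by (rule imageE)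
      with CollectD[OF p'] have p: "p \<in> ?X" "\<omega> = fst p" "(p \<in> E) \<noteq> (?T p \<in> ?B)" by iprover+
      obtain t x where e: "p = (\<omega>, t, x)" using p(2) by (cases p) auto
      have \<omega>: "\<omega> \<in> space M" using p(1) e by auto
      have "Y \<omega> \<noteq> y (cnt N (boxes a) \<omega>)"
        using p(1,3) cntN_space[of \<omega>] unfolding e E
        by (auto simp: elementary_process_def restrict_cntN[OF boxes_sets])
      then show "\<omega> \<in> Z" using Z \<omega> by auto
    qed
    then show "\<exists>b\<in>sets (can_predictable (intensity \<nu>)). ?neg {p\<in>?X. (p \<in> E) \<noteq> (?T p \<in> b)}"
      using B Z(2) by blast
  qed
  then obtain h Z where h: "h \<in> borel_measurable (can_predictable (intensity \<nu>))" and Z: "Z \<in> null_sets M"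
    "fst ` {p\<in>?X. ?f p \<noteq> h (?T p)} \<subseteq> Z" by blast
  have "AE \<omega> in M. \<forall>t\<ge>0. \<forall>x. g t x \<omega> = h (cntN \<omega>, t, x)"
    using AE_not_in[OF Z(1)] AE_space
  proof eventually_elim
    case (elim \<omega>)
    show ?case
    proof (intro allI impI, rule ccontr)
      fix t x assume "0 \<le> (t::real)" "g t x \<omega> \<noteq> h (cntN \<omega>, t, x)"
      then have "(\<omega>, t, x) \<in> {p\<in>?X. ?f p \<noteq> h (?T p)}" using elim by auto
      then have "\<omega> \<in> fst ` {p\<in>?X. ?f p \<noteq> h (?T p)}" by (metis (no_types, lifting) fst_conv image_eqI)
      then show False using Z(2) elim by blast
    qed
  qed
  then show ?thesis using h by blast
qed

text \<open>The converse direction: a canonical predictable function can be evaluated along the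
  noise at hand, because each canonical generator pulls back to an elementary process of that
  noise.\<close>

lemma predictable_cntN:
  assumes h: "h \<in> borel_measurable (can_predictable (intensity \<nu>))"
  shows "predictable M N (\<lambda>t x \<omega>. h (cntN \<omega>, t, x))"
proof -
  let ?T = "\<lambda>(\<omega>, t, x). (cntN \<omega>, t, x)"
  have "?T \<in> measurable (predictable_sigma M N) (can_predictable (intensity \<nu>))"
    unfolding can_predictable_def
  proof (rule measurable_measure_of[OF can_predictable_generator])
    show "?T \<in> space (predictable_sigma M N) \<rightarrow> space Can \<times> {0..} \<times> UNIV"
      using cntN_space by (auto simp: predictable_sigma_space)
    fix E assume "E \<in> {{(c, t, x) \<in> space Can \<times> {0..} \<times> UNIV. elementary_process (\<lambda>c. y (restrict c (boxes a))) a b A t x c \<in> D} | y a b A D.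
        0 \<le> a \<and> a < b \<and> A \<in> sets borel \<and> bounded A \<and> y \<in> borel_measurable (cnt_space (boxes a)) \<and> D \<in> sets borel}"
    then obtain y a b A D where E: "E = {(c, t, x) \<in> space Can \<times> {0..} \<times> UNIV. elementary_process (\<lambda>c. y (restrict c (boxes a))) a b A t x c \<in> D}"
      and d: "0 \<le> a" "a < b" "A \<in> sets borel" "bounded A"
      and y: "y \<in> borel_measurable (cnt_space (boxes a))" and D: "D \<in> sets borel" by blast
    have e: "elementary_data M N (\<lambda>\<omega>. y (cnt N (boxes a) \<omega>)) a b A"
      using d measurable_noise_filtration_cnt[OF y] by (simp add: elementary_data_def)
    from measurable_sets[OF predictable_elementary[OF e, unfolded predictable_def] D]
    have "(\<lambda>(\<omega>, t, x). elementary_process (\<lambda>\<omega>. y (cnt N (boxes a) \<omega>)) a b A t x \<omega>) -` D \<inter> space (predictable_sigma M N) \<in> sets (predictable_sigma M N)" .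
    also have "(\<lambda>(\<omega>, t, x). elementary_process (\<lambda>\<omega>. y (cnt N (boxes a) \<omega>)) a b A t x \<omega>) -` D \<inter> space (predictable_sigma M N)
      = ?T -` E \<inter> space (predictable_sigma M N)"
      using cntN_space by (auto simp: E elementary_process_def restrict_cntN[OF boxes_sets] predictable_sigma_space)
    finally show "?T -` E \<inter> space (predictable_sigma M N) \<in> sets (predictable_sigma M N)" .
  qed
  from measurable_compose[OF this h] show ?thesis
    unfolding predictable_def split_beta' by simp
qed

lemma walsh_norm_distr:
  assumes g: "jointly Can g"
  shows "walsh_norm_sq M \<kappa> t (\<lambda>s x \<omega>. g s x (cntN \<omega>)) = walsh_norm_sq (distr M Can cntN) \<kappa> t g"
proof -
  have "walsh_norm_sq (distr M Can cntN) \<kappa> t g = (\<integral>\<^sup>+\<omega>. \<integral>\<^sup>+s. energy (\<lambda>x. g s x (cntN \<omega>)) * indicator {0..t} s \<partial>lborel \<partial>M)"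
    unfolding walsh_norm_energy
    by (rule nn_integral_distr[OF measurable_cntN]) (use measurable_inner_energy[OF g] in simp)
  then show ?thesis by (simp add: walsh_norm_energy)
qed

lemma nsq_cntN:
  assumes f: "f \<in> borel_measurable Can"
  shows "nsq M (\<lambda>\<omega>. f (cntN \<omega>)) = nsq (distr M Can cntN) f"
  using nsq_distr[OF measurable_cntN f] by simp

text \<open>The backward light cone is no product set, but it is the union over positive rationals
  \<open>q\<close> of the rectangles of times in \<open>(0,q]\<close> and points within
  \<open>t - q\<close> of \<open>x\<close>: given a point of the cone, choose \<open>q\<close>
  strictly between \<open>s\<close> and \<open>t - \<bar>x - y\<bar>\<close>. Needed when the
  equation is rebuilt for another noise.\<close>

lemma predictable_wave_kernel:
  assumes "0 \<le> t"
  shows "predictable M N (\<lambda>s y \<omega>. indicator {0<..t} s * wave_kernel (t - s) (x - y))"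
proof -
  define E where "E q = elementary_process (\<lambda>_::'w. 1) 0 q {x - (t - q)<..<x + (t - q)}" for q
  have E: "predictable M N (E q)" if "0 < q" for q
    unfolding E_def by (rule predictable_elementary) (use that in \<open>auto simp: elementary_data_def\<close>)
  let ?U = "(\<Union>q\<in>{q::rat. 0 < q}. (\<lambda>(\<omega>, s, y). E (of_rat q) s y \<omega>) -` {1} \<inter> space (predictable_sigma M N))"
  have "?U \<in> sets (predictable_sigma M N)"
  proof (rule sets.countable_UN'')
    fix q :: rat assume "q \<in> {q. 0 < q}"
    then show "(\<lambda>(\<omega>, s, y). E (of_rat q) s y \<omega>) -` {1} \<inter> space (predictable_sigma M N) \<in> sets (predictable_sigma M N)"
      using E[of "of_rat q"] by (intro measurable_sets[of _ _ borel]) (auto simp: predictable_def)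
  qed (auto intro: countable_subset)
  then have m: "(\<lambda>p. (1/2::real) * indicator ?U p) \<in> borel_measurable (predictable_sigma M N)"
    by (intro borel_measurable_times borel_measurable_const borel_measurable_indicator)
  have iff: "(\<omega>, s, y) \<in> ?U \<longleftrightarrow> 0 < s \<and> s \<le> t \<and> \<bar>x - y\<bar> < t - s" if "(\<omega>, s, y) \<in> space (predictable_sigma M N)" for \<omega> s y
  proof
    assume "(\<omega>, s, y) \<in> ?U"
    then obtain q :: rat where "E (of_rat q) s y \<omega> = 1" by auto
    then have "0 < s" "s \<le> of_rat q" "x - (t - of_rat q) < y" "y < x + (t - of_rat q)"
      by (auto simp: E_def elementary_process_def indicator_def split: split_of_bool_asm)
    then show "0 < s \<and> s \<le> t \<and> \<bar>x - y\<bar> < t - s" by linarith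
  next
    assume *: "0 < s \<and> s \<le> t \<and> \<bar>x - y\<bar> < t - s"
    then obtain q where q: "s < of_rat q" "of_rat q < t - \<bar>x - y\<bar>"
      using of_rat_dense[of s "t - \<bar>x - y\<bar>"] by auto
    then have "0 < q" using * by (metis less_trans zero_less_of_rat_iff)
    moreover have "E (of_rat q) s y \<omega> = 1"
      using * q by (auto simp: E_def elementary_process_def indicator_def)
    ultimately show "(\<omega>, s, y) \<in> ?U" using that by auto
  qed
  show ?thesis
    unfolding predictable_def
  proof (rule measurable_cong[THEN iffD1, OF _ m])
    fix p assume p: "p \<in> space (predictable_sigma M N)"
    obtain \<omega> s y where e: "p = (\<omega>, s, y)" by (cases p)
    show "(1/2) * indicator ?U p = (case p of (\<omega>, s, y) \<Rightarrow> indicator {0<..t} s * wave_kernel (t - s) (x - y))"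
      using iff[OF p[unfolded e]] by (auto simp: e wave_kernel_def indicator_def)
  qed
qed

end

section \<open>Simple processes and their integrals as functions of the counts\<close>

definition pull :: "('w \<Rightarrow> (real \<times> real \<times> real) measure) \<Rightarrow> counts simple_data \<Rightarrow> 'w simple_data" where
  "pull N qs = map (\<lambda>(y, a, b, A). (\<lambda>\<omega>. y (cnt N (boxes a) \<omega>), a, b, A)) qs"

text \<open>Boundedness is demanded on all arguments of \<open>y\<close>, not just on those attained
  by one noise, so that the data stay admissible when evaluated along another.\<close>

definition can_ok :: "counts simple_data \<Rightarrow> bool" where
  "can_ok qs \<longleftrightarrow> (\<forall>(y, a, b, A)\<in>set qs. 0 \<le> a \<and> a < b \<and> A \<in> sets borel \<and> bounded A \<and>
     y \<in> borel_measurable (cnt_space (boxes a)) \<and> bounded (range y))"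

context levy_noise
begin

lemma pull_ok: "can_ok qs \<Longrightarrow> simple_data_ok M N (pull N qs)"
proof -
  assume ok: "can_ok qs"
  have "bounded ((\<lambda>\<omega>. y (cnt N (boxes a) \<omega>)) ` space M)" if "bounded (range y)" for y :: "counts \<Rightarrow> real" and a
    by (rule bounded_subset[OF that]) auto
  note bd = this
  show ?thesis
    unfolding simple_data_ok_def
  proof (rule ballI, clarify)
    fix Y a b A assume "(Y, a, b, A) \<in> set (pull N qs)"
    then obtain y where y: "(y, a, b, A) \<in> set qs" "Y = (\<lambda>\<omega>. y (cnt N (boxes a) \<omega>))"
      by (auto simp: pull_def)
    from ok y(1) have "0 \<le> a" "a < b" "A \<in> sets borel" "bounded A"
      "y \<in> borel_measurable (cnt_space (boxes a))" "bounded (range y)"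
      unfolding can_ok_def by blast+
    then show "elementary_data M N Y a b A \<and> bounded (Y ` space M)"
      unfolding elementary_data_def y(2) using measurable_noise_filtration_cnt bd by blast
  qed
qed

lemma simple_data_pull:
  assumes "simple_data_ok M N ps"
  shows "\<exists>qs. can_ok qs \<and> (AE \<omega> in M. (\<forall>s x. simple_process ps s x \<omega> = simple_process (pull N qs) s x \<omega>) \<and>
     (\<forall>t. simple_walsh_integral M \<nu> N \<kappa> t ps \<omega> = simple_walsh_integral M \<nu> N \<kappa> t (pull N qs) \<omega>))"
  using assms
proof (induction ps)
  case Nil
  show ?case by (rule exI[of _ "[]"]) (simp add: can_ok_def pull_def)
next
  case (Cons p ps)
  obtain Y a b A where p: "p = (Y, a, b, A)" by (cases p)
  have d: "elementary_data M N Y a b A" and bd: "bounded (Y ` space M)" and ps: "simple_data_ok M N ps"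
    using Cons.prems by (auto simp: simple_data_ok_def p)
  obtain qs where qs: "can_ok qs" and eq: "AE \<omega> in M. (\<forall>s x. simple_process ps s x \<omega> = simple_process (pull N qs) s x \<omega>) \<and>
     (\<forall>t. simple_walsh_integral M \<nu> N \<kappa> t ps \<omega> = simple_walsh_integral M \<nu> N \<kappa> t (pull N qs) \<omega>)"
    using Cons.IH[OF ps] by blast
  obtain C where C: "\<And>\<omega>. \<omega> \<in> space M \<Longrightarrow> \<bar>Y \<omega>\<bar> \<le> C" using bd by (auto simp: bounded_iff)
  obtain y where y: "y \<in> borel_measurable (cnt_space (boxes a))" "AE \<omega> in M. Y \<omega> = y (cnt N (boxes a) \<omega>)"
    using noise_filtration_factor[of Y a] d by (auto simp: elementary_data_def)
  \<comment> \<open>The factor \<open>y\<close> agrees with the bounded \<open>Y\<close> almost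
    surely but may be unbounded elsewhere. Truncation at the bound of \<open>Y\<close> makes it
    bounded everywhere and keeps the identity.\<close>
  define z where "z c = max (- \<bar>C\<bar>) (min \<bar>C\<bar> (y c))" for c
  have zm: "z \<in> borel_measurable (cnt_space (boxes a))" unfolding z_def[abs_def] using y(1) by measurable
  have "bounded (range z)" by (rule boundedI[of _ "\<bar>C\<bar>"]) (auto simp: z_def)
  then have ok: "can_ok ((z, a, b, A) # qs)"
    using qs d zm by (auto simp: can_ok_def elementary_data_def)
  have Yz: "AE \<omega> in M. Y \<omega> = z (cnt N (boxes a) \<omega>)"
    using y(2) AE_space
  proof eventually_elim
    case (elim \<omega>)
    then show ?case using C[of \<omega>] by (auto simp: z_def)
  qed
  have "AE \<omega> in M. (\<forall>s x. simple_process (p # ps) s x \<omega> = simple_process (pull N ((z, a, b, A) # qs)) s x \<omega>) \<and>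
     (\<forall>t. simple_walsh_integral M \<nu> N \<kappa> t (p # ps) \<omega> = simple_walsh_integral M \<nu> N \<kappa> t (pull N ((z, a, b, A) # qs)) \<omega>)"
    using Yz eq
  proof eventually_elim
    case (elim \<omega>)
    then show ?case
      by (simp add: p pull_def simple_process_def simple_walsh_integral_def elementary_process_def)
  qed
  then show ?case using ok by blast
qed

text \<open>Each noise has its own chosen version of the integral. By uniqueness every such choice
  agrees almost surely with the one canonical functional.\<close>

lemma X_cnt:
  assumes A: "A \<in> sets borel" "bounded A"
  shows "\<exists>L\<in>borel_measurable Can. \<forall>N'. prm M (intensity \<nu>) N' \<longrightarrow>
    (AE \<omega> in M. levy_colored_noise M \<nu> N' \<kappa> t (indicator A) \<omega> = L (cnt N' (sets (intensity \<nu>)) \<omega>))"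
proof -
  have "prm M (intensity \<nu>) N" ..
  moreover have "nsq (intensity \<nu>) (tensor {0..t} (convolve (indicator A) \<kappa>)) < \<infinity>"
    using A by (intro nsq_tensor nsq_convolve_indicator) (auto simp: emeasure_lborel_Icc_eq intro!: measurable_convolve)
  moreover have "tensor {0..t} (convolve (indicator A) \<kappa>) \<in> borel_measurable (intensity \<nu>)"
    using A by (intro measurable_tensor measurable_convolve) auto
  ultimately obtain L where L: "L \<in> borel_measurable Can"
    "\<And>N'. prm M (intensity \<nu>) N' \<Longrightarrow> has_compensated_integral M N' (intensity \<nu>) (tensor {0..t} (convolve (indicator A) \<kappa>)) (\<lambda>\<omega>. L (cnt N' (sets (intensity \<nu>)) \<omega>))"
    using compensated_integral_exists[of M "intensity \<nu>" N "tensor {0..t} (convolve (indicator A) \<kappa>)"] by blast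
  show ?thesis
  proof (intro bexI[of _ L] allI impI L(1))
    fix N' assume N': "prm M (intensity \<nu>) N'"
    then interpret N': levy_noise M \<nu> N' \<kappa>
      by (intro levy_noise.intro levy_measure_axioms kernel_axioms)
    show "AE \<omega> in M. levy_colored_noise M \<nu> N' \<kappa> t (indicator A) \<omega> = L (cnt N' (sets (intensity \<nu>)) \<omega>)"
      by (rule N'.compensated_integral_unique[OF N'.has_compensated_integral_X[OF A] L(2)[OF N']])
  qed
qed

lemma pull_walsh:
  assumes "can_ok qs"
  shows "\<exists>L\<in>borel_measurable Can. \<forall>N'. prm M (intensity \<nu>) N' \<longrightarrow>
    (AE \<omega> in M. simple_walsh_integral M \<nu> N' \<kappa> t (pull N' qs) \<omega> = L (cnt N' (sets (intensity \<nu>)) \<omega>))"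
  using assms
proof (induction qs)
  case Nil
  show ?case by (intro bexI[of _ "\<lambda>_. 0"]) (auto simp: pull_def simple_walsh_integral_def)
next
  case (Cons q qs)
  obtain y a b A where q: "q = (y, a, b, A)" by (cases q)
  have d: "0 \<le> a" "a < b" "A \<in> sets borel" "bounded A" "y \<in> borel_measurable (cnt_space (boxes a))" and qs: "can_ok qs"
    using Cons.prems by (auto simp: can_ok_def q)
  obtain L where L[measurable]: "L \<in> borel_measurable Can" and L': "\<And>N'. prm M (intensity \<nu>) N' \<Longrightarrow>
    (AE \<omega> in M. simple_walsh_integral M \<nu> N' \<kappa> t (pull N' qs) \<omega> = L (cnt N' (sets (intensity \<nu>)) \<omega>))"
    using Cons.IH[OF qs] by blast
  obtain Lb where Lb[measurable]: "Lb \<in> borel_measurable Can" and Lb': "\<And>N'. prm M (intensity \<nu>) N' \<Longrightarrow>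
    (AE \<omega> in M. levy_colored_noise M \<nu> N' \<kappa> (min t b) (indicator A) \<omega> = Lb (cnt N' (sets (intensity \<nu>)) \<omega>))"
    using X_cnt[OF d(3,4)] by blast
  obtain La where La[measurable]: "La \<in> borel_measurable Can" and La': "\<And>N'. prm M (intensity \<nu>) N' \<Longrightarrow>
    (AE \<omega> in M. levy_colored_noise M \<nu> N' \<kappa> (min t a) (indicator A) \<omega> = La (cnt N' (sets (intensity \<nu>)) \<omega>))"
    using X_cnt[OF d(3,4)] by blast
  note [measurable] = measurable_restrict_boxes[OF d(5)]
  show ?case
  proof (intro bexI[of _ "\<lambda>c. y (restrict c (boxes a)) * (Lb c - La c) + L c"] allI impI)
    fix N' assume N': "prm M (intensity \<nu>) N'"
    then interpret N': levy_noise M \<nu> N' \<kappa>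
      by (intro levy_noise.intro levy_measure_axioms kernel_axioms)
    show "AE \<omega> in M. simple_walsh_integral M \<nu> N' \<kappa> t (pull N' (q # qs)) \<omega> =
      y (restrict (N'.cntN \<omega>) (boxes a)) * (Lb (N'.cntN \<omega>) - La (N'.cntN \<omega>)) + L (N'.cntN \<omega>)"
      using L'[OF N'] La'[OF N'] Lb'[OF N']
    proof eventually_elim
      case (elim \<omega>)
      then show ?case by (simp add: q pull_def simple_walsh_integral_def N'.restrict_cntN[OF boxes_sets])
    qed
  qed measurable
qed

text \<open>Here the identity holds at every sample point: simple processes involve counts only, and
  no chosen version of an integral.\<close>

lemma pull_process:
  assumes "can_ok qs"
  shows "\<exists>g. jointly Can g \<and> (\<forall>N'. \<forall>s x \<omega>. simple_process (pull N' qs) s x \<omega> = g s x (cnt N' (sets (intensity \<nu>)) (\<omega>::'w)))"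
  using assms
proof (induction qs)
  case Nil
  show ?case by (intro exI[of _ "\<lambda>_ _ _. 0"]) (simp add: pull_def simple_process_def jointly_iff)
next
  case (Cons q qs)
  obtain y a b A where q: "q = (y, a, b, A)" by (cases q)
  have d: "0 \<le> a" "a < b" "A \<in> sets borel" "bounded A" "y \<in> borel_measurable (cnt_space (boxes a))" and qs: "can_ok qs"
    using Cons.prems by (auto simp: can_ok_def q)
  obtain g where g: "jointly Can g" "\<And>N' s x \<omega>. simple_process (pull N' qs) s x \<omega> = g s x (cnt N' (sets (intensity \<nu>)) (\<omega>::'w))"
    using Cons.IH[OF qs] by blast
  note [measurable] = measurable_restrict_boxes[OF d(5)] d(3)
  have "jointly Can (\<lambda>s x c. y (restrict c (boxes a)) * indicator {a<..b} s * indicator A x)"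
    unfolding jointly_iff by measurable
  from jointly_add[OF this g(1)]
  have j: "jointly Can (\<lambda>s x c. y (restrict c (boxes a)) * indicator {a<..b} s * indicator A x + g s x c)" .
  have r: "restrict (cnt N' (sets (intensity \<nu>)) \<omega>) (boxes a) = cnt N' (boxes a) \<omega>" for N' and \<omega> :: 'w
    using boxes_sets[of a] by (auto simp: cnt_def fun_eq_iff)
  show ?case
    by (intro exI[of _ "\<lambda>s x c. y (restrict c (boxes a)) * indicator {a<..b} s * indicator A x + g s x c"] conjI j allI)
       (simp only: q pull_def simple_process_def list.map sum_list.Cons case_prod_conv elementary_process_def r
         g(2)[unfolded pull_def simple_process_def elementary_process_def])
qed

text \<open>Whether the approximations in the mild equation converge is decided by Walsh norms and
  second moments of functionals of the counts. These depend only on the law of the counts, so the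
  functional that solves the equation for \<open>N\<close> solves it for every noise with the same
  intensity.\<close>

lemma mild_solution_transfer:
  assumes u: "mild_solution M \<nu> N \<kappa> u"
  shows "\<exists>h. jointly Can (\<lambda>s x c. indicator {0..} s * h (c, s, x)) \<and>
    (AE \<omega> in M. \<forall>t\<ge>0. \<forall>x. u t x \<omega> = h (cntN \<omega>, t, x)) \<and>
    (\<forall>N'. prm M (intensity \<nu>) N' \<longrightarrow> mild_solution M \<nu> N' \<kappa> (\<lambda>t x \<omega>. h (cnt N' (sets (intensity \<nu>)) \<omega>, t, x)))"
proof -
  obtain h where h: "h \<in> borel_measurable (can_predictable (intensity \<nu>))"
    and uh: "AE \<omega> in M. \<forall>t\<ge>0. \<forall>x. u t x \<omega> = h (cntN \<omega>, t, x)"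
    using predictable_factor[OF mild_solutionD(1)[OF u]] by blast
  have jh: "jointly Can (\<lambda>s x c. indicator {0..} s * h (c, s, x))"
    by (rule can_predictable_jointly[OF h])
  have hm: "(\<lambda>c. h (c, t, x)) \<in> borel_measurable Can" if "0 \<le> t" for t x
    using jointly_section'[OF jh, of t x] that by simp
  have "mild_solution M \<nu> N' \<kappa> (\<lambda>t x \<omega>. h (cnt N' (sets (intensity \<nu>)) \<omega>, t, x))" if N': "prm M (intensity \<nu>) N'" for N'
  proof -
    interpret N': levy_noise M \<nu> N' \<kappa>
      using N' by (intro levy_noise.intro levy_measure_axioms kernel_axioms)
    let ?v = "\<lambda>t x \<omega>. h (N'.cntN \<omega>, t, x)"
    have law: "distr M Can cntN = distr M Can N'.cntN"
      by (rule distr_cnt_eq[OF prm_axioms N']) simp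
    have pv: "predictable M N' ?v" by (rule N'.predictable_cntN[OF h])
    show ?thesis
      unfolding mild_solution_def
    proof (intro conjI allI impI pv)
      fix t x :: real assume t: "0 \<le> t"
      let ?k = "\<lambda>s y. wave_kernel (t - s) (x - y)"
      let ?G = "\<lambda>s y c. ?k s y * (indicator {0..} s * h (c, s, y))"
      have jk: "jointly Can (\<lambda>s y c. ?k s y)" unfolding jointly_iff by measurable
      have jG: "jointly Can ?G" by (rule jointly_mult[OF jk jh])
      have W: "has_walsh_integral M \<nu> N \<kappa> t (\<lambda>s y \<omega>. ?k s y * u s y \<omega>) (\<lambda>\<omega>. u t x \<omega> - 1)"
        by (rule mild_solutionD(3)[OF u t])
      obtain ps where ps: "\<And>n::nat. simple_data_ok M N (ps n)"
        "(\<lambda>n. walsh_norm_sq M \<kappa> t (\<lambda>s y \<omega>. simple_process (ps n) s y \<omega> - ?k s y * u s y \<omega>)) \<longlonglongrightarrow> 0"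
        "(\<lambda>n. nsq M (\<lambda>\<omega>. simple_walsh_integral M \<nu> N \<kappa> t (ps n) \<omega> - (u t x \<omega> - 1))) \<longlonglongrightarrow> 0"
        using W unfolding has_walsh_integral_def nsq_def by blast
      have "\<forall>n. \<exists>qs. can_ok qs \<and> (AE \<omega> in M. (\<forall>s x. simple_process (ps n) s x \<omega> = simple_process (pull N qs) s x \<omega>) \<and>
         (\<forall>t. simple_walsh_integral M \<nu> N \<kappa> t (ps n) \<omega> = simple_walsh_integral M \<nu> N \<kappa> t (pull N qs) \<omega>))"
        using simple_data_pull[OF ps(1)] by blast
      from choice[OF this] obtain qs where qs: "\<And>n. can_ok (qs n)" and
        qs_eq: "\<And>n. AE \<omega> in M. (\<forall>s x. simple_process (ps n) s x \<omega> = simple_process (pull N (qs n)) s x \<omega>) \<and>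
         (\<forall>t. simple_walsh_integral M \<nu> N \<kappa> t (ps n) \<omega> = simple_walsh_integral M \<nu> N \<kappa> t (pull N (qs n)) \<omega>)"
        by blast
      have norm1: "walsh_norm_sq M \<kappa> t (\<lambda>s y \<omega>. ?k s y * ?v s y \<omega>) = walsh_norm_sq M \<kappa> t (\<lambda>s y \<omega>. ?k s y * u s y \<omega>)"
      proof -
        have "walsh_norm_sq M \<kappa> t (\<lambda>s y \<omega>. ?k s y * ?v s y \<omega>) = walsh_norm_sq M \<kappa> t (\<lambda>s y \<omega>. ?G s y (N'.cntN \<omega>))"
          by (rule walsh_norm_cong) auto
        also have "\<dots> = walsh_norm_sq M \<kappa> t (\<lambda>s y \<omega>. ?G s y (cntN \<omega>))"
          by (simp only: N'.walsh_norm_distr[OF jG] walsh_norm_distr[OF jG] law)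
        also have "\<dots> = walsh_norm_sq M \<kappa> t (\<lambda>s y \<omega>. ?k s y * u s y \<omega>)"
          by (rule walsh_norm_cong) (use uh in eventually_elim, auto)
        finally show ?thesis .
      qed
      \<comment> \<open>Three steps: exact on the side of \<open>N'\<close>, equality of the laws in
        the middle, almost sure identities on the side of \<open>N\<close>.\<close>
      have norm2: "walsh_norm_sq M \<kappa> t (\<lambda>s y \<omega>. simple_process (pull N' (qs n)) s y \<omega> - ?k s y * ?v s y \<omega>)
        = walsh_norm_sq M \<kappa> t (\<lambda>s y \<omega>. simple_process (ps n) s y \<omega> - ?k s y * u s y \<omega>)" for n
      proof -
        obtain g where g: "jointly Can g" "\<And>N' s x \<omega>. simple_process (pull N' (qs n)) s x \<omega> = g s x (cnt N' (sets (intensity \<nu>)) (\<omega>::'w))"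
          using pull_process[OF qs[of n]] by blast
        have j: "jointly Can (\<lambda>s y c. g s y c - ?G s y c)" by (rule jointly_diff[OF g(1) jG])
        have "walsh_norm_sq M \<kappa> t (\<lambda>s y \<omega>. simple_process (pull N' (qs n)) s y \<omega> - ?k s y * ?v s y \<omega>)
          = walsh_norm_sq M \<kappa> t (\<lambda>s y \<omega>. g s y (N'.cntN \<omega>) - ?G s y (N'.cntN \<omega>))"
          by (rule walsh_norm_cong) (auto simp: g(2))
        also have "\<dots> = walsh_norm_sq M \<kappa> t (\<lambda>s y \<omega>. g s y (cntN \<omega>) - ?G s y (cntN \<omega>))"
          by (simp only: N'.walsh_norm_distr[OF j] walsh_norm_distr[OF j] law)
        also have "\<dots> = walsh_norm_sq M \<kappa> t (\<lambda>s y \<omega>. simple_process (ps n) s y \<omega> - ?k s y * u s y \<omega>)"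
          by (rule walsh_norm_cong) (use uh qs_eq[of n] in eventually_elim, auto simp: g(2))
        finally show ?thesis .
      qed
      have norm3: "nsq M (\<lambda>\<omega>. simple_walsh_integral M \<nu> N' \<kappa> t (pull N' (qs n)) \<omega> - (?v t x \<omega> - 1))
        = nsq M (\<lambda>\<omega>. simple_walsh_integral M \<nu> N \<kappa> t (ps n) \<omega> - (u t x \<omega> - 1))" for n
      proof -
        obtain L where L[measurable]: "L \<in> borel_measurable Can" and L': "\<And>N'. prm M (intensity \<nu>) N' \<Longrightarrow>
            (AE \<omega> in M. simple_walsh_integral M \<nu> N' \<kappa> t (pull N' (qs n)) \<omega> = L (cnt N' (sets (intensity \<nu>)) \<omega>))"
          using pull_walsh[OF qs[of n]] by blast
        have m: "(\<lambda>c. L c - (h (c, t, x) - 1)) \<in> borel_measurable Can" using hm[OF t, of x] by measurable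
        have "nsq M (\<lambda>\<omega>. simple_walsh_integral M \<nu> N' \<kappa> t (pull N' (qs n)) \<omega> - (?v t x \<omega> - 1)) = nsq M (\<lambda>\<omega>. L (N'.cntN \<omega>) - (h (N'.cntN \<omega>, t, x) - 1))"
          by (rule nsq_cong_AE) (use L'[OF N'] in eventually_elim, simp)
        also have "\<dots> = nsq M (\<lambda>\<omega>. L (cntN \<omega>) - (h (cntN \<omega>, t, x) - 1))"
          by (simp only: N'.nsq_cntN[OF m] nsq_cntN[OF m] law)
        also have "\<dots> = nsq M (\<lambda>\<omega>. simple_walsh_integral M \<nu> N \<kappa> t (ps n) \<omega> - (u t x \<omega> - 1))"
          by (rule nsq_cong_AE) (use L'[OF prm_axioms] qs_eq[of n] uh in eventually_elim, use t in auto)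
        finally show ?thesis .
      qed
      show "has_walsh_integral M \<nu> N' \<kappa> t (\<lambda>s y \<omega>. ?k s y * ?v s y \<omega>) (\<lambda>\<omega>. ?v t x \<omega> - 1)"
        unfolding has_walsh_integral_def nsq_def[symmetric]
      proof (intro conjI exI[of _ "\<lambda>n. pull N' (qs n)"] allI)
        show "predictable M N' (\<lambda>s y \<omega>. indicator {0<..t} s * (?k s y * ?v s y \<omega>))"
          using N'.predictable_mult[OF N'.predictable_wave_kernel[OF t, of x] pv] by (simp add: mult.assoc)
        show "walsh_norm_sq M \<kappa> t (\<lambda>s y \<omega>. ?k s y * ?v s y \<omega>) < \<infinity>"
          unfolding norm1 by (rule has_walsh_integralD(3)[OF W])
        show "(\<lambda>\<omega>. ?v t x \<omega> - 1) \<in> borel_measurable M"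
          using measurable_compose[OF N'.measurable_cntN hm[OF t, of x]] by simp
        show "simple_data_ok M N' (pull N' (qs n))" for n by (rule N'.pull_ok[OF qs])
        show "(\<lambda>n. walsh_norm_sq M \<kappa> t (\<lambda>s y \<omega>. simple_process (pull N' (qs n)) s y \<omega> - ?k s y * ?v s y \<omega>)) \<longlonglongrightarrow> 0"
          unfolding norm2 by (rule ps(2))
        show "(\<lambda>n. nsq M (\<lambda>\<omega>. simple_walsh_integral M \<nu> N' \<kappa> t (pull N' (qs n)) \<omega> - (?v t x \<omega> - 1))) \<longlonglongrightarrow> 0"
          unfolding norm3 by (rule ps(3))
      qed
    qed
  qed
  then show ?thesis using jh uh by blast
qed

end

section \<open>Spatial shifts\<close>

text \<open>The sign is chosen so that the noise moved by \<open>shift h\<close> drives the field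
  seen from \<open>h\<close>, that is \<open>x \<mapsto> u t (x + h)\<close>.\<close>

definition shift :: "real \<Rightarrow> real \<times> real \<times> real \<Rightarrow> real \<times> real \<times> real" where
  "shift h = (\<lambda>(t, x, z). (t, x - h, z))"

lemma shift_inverse[simp]: "shift h (shift (- h) p) = p" "shift (- h) (shift h p) = p"
  by (cases p; simp add: shift_def)+

definition shift_noise :: "(real \<times> real \<times> real) measure \<Rightarrow> real \<Rightarrow> ('w \<Rightarrow> (real \<times> real \<times> real) measure) \<Rightarrow> 'w \<Rightarrow> (real \<times> real \<times> real) measure" where
  "shift_noise \<mu> h N \<omega> = distr (N \<omega>) \<mu> (shift h)"

definition shift_data :: "real \<Rightarrow> 'w simple_data \<Rightarrow> 'w simple_data" where
  "shift_data h ps = map (\<lambda>(Y, a, b, A). (Y, a, b, {x. x + h \<in> A})) ps"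

lemma borel_shift_set: "A \<in> sets borel \<Longrightarrow> {x::real. x + h \<in> A} \<in> sets borel"
  using measurable_sets[of "\<lambda>x::real. x + h" borel borel A] by (simp add: vimage_def)

lemma bounded_shift_set: "bounded A \<Longrightarrow> bounded {x::real. x + h \<in> A}"
proof -
  assume "bounded A"
  from bounded_translation[OF this, of "-h"] have "bounded ((+) (- h) ` A)" .
  moreover have "{x. x + h \<in> A} \<subseteq> (+) (- h) ` A"
  proof
    fix x assume "x \<in> {x. x + h \<in> A}"
    then show "x \<in> (+) (- h) ` A" by (intro image_eqI[of _ _ "x + h"]) auto
  qed
  ultimately show ?thesis by (rule bounded_subset)
qed

section \<open>Translation invariance of the intensity\<close>

context levy_measure
begin

abbreviation "\<mu> \<equiv> intensity \<nu>"

lemma measurable_shift: "shift h \<in> measurable \<mu> \<mu>"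
proof -
  have "(\<lambda>p. (fst p, fst (snd p) - h, snd (snd p))) \<in> measurable \<mu> (restrict_space lborel {0..} \<Otimes>\<^sub>M (lborel \<Otimes>\<^sub>M \<nu>))"
  proof (intro measurable_Pair)
    show "fst \<in> measurable \<mu> (restrict_space lborel {0..})" unfolding intensity_def by simp
    show "(\<lambda>p. fst (snd p) - h) \<in> measurable \<mu> lborel" by simp
    show "(\<lambda>p. snd (snd p)) \<in> measurable \<mu> \<nu>" by (rule measurable_compose[OF measurable_intensity_snd measurable_snd])
  qed
  then show ?thesis by (simp add: shift_def split_beta' intensity_def)
qed

lemma shift_space: "shift h p \<in> space \<mu> \<longleftrightarrow> p \<in> space \<mu>"
  by (cases p) (simp add: shift_def space_intensity)

text \<open>Written as an iterated integral over \<open>s\<close>, \<open>x\<close> and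
  \<open>z\<close>, the measure feels the shift only in the middle variable, where Lebesgue measure
  is invariant.\<close>

lemma distr_shift: "distr \<mu> \<mu> (shift h) = \<mu>"
proof (rule measure_eqI)
  fix D assume "D \<in> sets (distr \<mu> \<mu> (shift h))"
  then have D: "D \<in> sets \<mu>" by simp
  have pre: "shift h -` D \<inter> space \<mu> \<in> sets \<mu>" by (rule measurable_sets[OF measurable_shift D])
  have e: "emeasure \<mu> E = (\<integral>\<^sup>+s. \<integral>\<^sup>+x. \<integral>\<^sup>+z. indicator E (s, x, z) \<partial>\<nu> \<partial>lborel \<partial>restrict_space lborel {0..})" if E: "E \<in> sets \<mu>" for E
  proof -
    have m: "indicator E \<in> borel_measurable (restrict_space lborel {0..} \<Otimes>\<^sub>M (lborel \<Otimes>\<^sub>M \<nu>))"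
      using E unfolding intensity_def by simp
    have "emeasure \<mu> E = (\<integral>\<^sup>+p. indicator E p \<partial>\<mu>)" using E by simp
    also have "\<dots> = (\<integral>\<^sup>+s. \<integral>\<^sup>+q. indicator E (s, q) \<partial>(lborel \<Otimes>\<^sub>M \<nu>) \<partial>restrict_space lborel {0..})"
      unfolding intensity_def by (rule sigma_finite_measure.nn_integral_fst[OF sigma_finite_xz m, symmetric])
    also have "\<dots> = (\<integral>\<^sup>+s. \<integral>\<^sup>+x. \<integral>\<^sup>+z. indicator E (s, x, z) \<partial>\<nu> \<partial>lborel \<partial>restrict_space lborel {0..})"
    proof (rule nn_integral_cong)
      fix s assume "s \<in> space (restrict_space lborel {0::real..})"
      then have "(\<lambda>q. indicator E (s, q)) \<in> borel_measurable (lborel \<Otimes>\<^sub>M \<nu>)"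
        by (rule measurable_compose[OF measurable_Pair1' m])
      from \<nu>.nn_integral_fst[OF this]
      show "(\<integral>\<^sup>+q. indicator E (s, q) \<partial>(lborel \<Otimes>\<^sub>M \<nu>)) = (\<integral>\<^sup>+x. \<integral>\<^sup>+z. indicator E (s, x, z) \<partial>\<nu> \<partial>lborel)" by simp
    qed
    finally show ?thesis .
  qed
  have "emeasure (distr \<mu> \<mu> (shift h)) D = emeasure \<mu> (shift h -` D \<inter> space \<mu>)"
    by (rule emeasure_distr[OF measurable_shift D])
  also have "\<dots> = (\<integral>\<^sup>+s. \<integral>\<^sup>+x. \<integral>\<^sup>+z. indicator (shift h -` D \<inter> space \<mu>) (s, x, z) \<partial>\<nu> \<partial>lborel \<partial>restrict_space lborel {0..})"
    by (rule e[OF pre])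
  also have "\<dots> = (\<integral>\<^sup>+s. \<integral>\<^sup>+x. \<integral>\<^sup>+z. indicator D (s, x + - h, z) \<partial>\<nu> \<partial>lborel \<partial>restrict_space lborel {0..})"
    by (intro nn_integral_cong) (auto simp: indicator_def shift_def space_intensity space_\<nu> space_restrict_space)
  also have "\<dots> = (\<integral>\<^sup>+s. \<integral>\<^sup>+x. \<integral>\<^sup>+z. indicator D (s, x, z) \<partial>\<nu> \<partial>lborel \<partial>restrict_space lborel {0..})"
  proof (rule nn_integral_cong)
    fix s assume s: "s \<in> space (restrict_space lborel {0::real..})"
    have m: "indicator D \<in> borel_measurable (restrict_space lborel {0..} \<Otimes>\<^sub>M (lborel \<Otimes>\<^sub>M \<nu>))"
      using D unfolding intensity_def by simp
    have "(\<lambda>q. indicator D (s, q)) \<in> borel_measurable (lborel \<Otimes>\<^sub>M \<nu>)"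
      by (rule measurable_compose[OF measurable_Pair1'[OF s] m])
    from \<nu>.borel_measurable_nn_integral_fst[OF this]
    have "(\<lambda>x. \<integral>\<^sup>+z. indicator D (s, x, z) \<partial>\<nu>) \<in> borel_measurable borel" by simp
    from nn_integral_shift[OF this, of "- h"]
    show "(\<integral>\<^sup>+x. \<integral>\<^sup>+z. indicator D (s, x + - h, z) \<partial>\<nu> \<partial>lborel) = (\<integral>\<^sup>+x. \<integral>\<^sup>+z. indicator D (s, x, z) \<partial>\<nu> \<partial>lborel)" .
  qed
  also have "\<dots> = emeasure \<mu> D" by (rule e[OF D, symmetric])
  finally show "emeasure (distr \<mu> \<mu> (shift h)) D = emeasure \<mu> D" .
qed simp

lemma emeasure_shift: "D \<in> sets \<mu> \<Longrightarrow> emeasure \<mu> (shift h -` D \<inter> space \<mu>) = emeasure \<mu> D"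
  using emeasure_distr[OF measurable_shift, of D h] by (simp add: distr_shift)

end

section \<open>The shifted noise and the equation it drives\<close>

context levy_noise
begin

lemma measurable_shift_N: "\<omega> \<in> space M \<Longrightarrow> shift h \<in> measurable (N \<omega>) \<mu>"
  using measurable_shift measurable_cong_sets[OF sets_N refl] by blast

lemma emeasure_shift_noise:
  assumes "\<omega> \<in> space M" "D \<in> sets \<mu>"
  shows "emeasure (shift_noise \<mu> h N \<omega>) D = emeasure (N \<omega>) (shift h -` D \<inter> space \<mu>)"
  unfolding shift_noise_def using emeasure_distr[OF measurable_shift_N[OF assms(1)] assms(2)] space_N[OF assms(1)] by simp

text \<open>Counts of the shifted noise are counts of \<open>N\<close> on preimages, and preimages
  keep intensity and disjointness. Most of the proof reindexes independence from the preimages back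
  to the original sets.\<close>

lemma prm_shift_noise: "prm M \<mu> (shift_noise \<mu> h N)"
proof (intro prm.intro prm_axioms.intro)
  show "prob_space M" by (rule prob_space_axioms)
  let ?p = "\<lambda>D. shift h -` D \<inter> space \<mu>"
  have p: "?p D \<in> sets \<mu>" if "D \<in> sets \<mu>" for D by (rule measurable_sets[OF measurable_shift that])
  have meas: "(\<lambda>\<omega>. emeasure (shift_noise \<mu> h N \<omega>) D) \<in> borel_measurable M" if "D \<in> sets \<mu>" for D
    by (rule measurable_cong[THEN iffD2, OF _ measurable_N[OF p[OF that]]]) (rule emeasure_shift_noise[OF _ that])
  \<comment> \<open>The shift is a bijection of the space, so distinct sets have distinct preimages
    and the reindexing is faithful.\<close>
  have inj: "inj_on ?p (sets \<mu>)"
  proof (rule inj_onI)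
    fix D E assume DE: "D \<in> sets \<mu>" "E \<in> sets \<mu>" "?p D = ?p E"
    have "q \<in> D \<longleftrightarrow> q \<in> E" if "q \<in> space \<mu>" for q
    proof -
      have "shift (- h) q \<in> ?p D \<longleftrightarrow> shift (- h) q \<in> ?p E" using DE by simp
      then show ?thesis using that shift_space[of "-h" q] by simp
    qed
    then show "D = E" using DE sets.sets_into_space by blast
  qed
  show "poisson_random_measure M \<mu> (shift_noise \<mu> h N)"
    unfolding poisson_random_measure_def
  proof (intro conjI ballI allI impI)
    show "sets (shift_noise \<mu> h N \<omega>) = sets \<mu>" for \<omega> by (simp add: shift_noise_def)
    fix D assume D: "D \<in> sets \<mu>"
    show "(\<lambda>\<omega>. emeasure (shift_noise \<mu> h N \<omega>) D) \<in> borel_measurable M" by (rule meas[OF D])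
    {
      fix k :: nat assume fin: "emeasure \<mu> D < \<infinity>"
      have "{\<omega>\<in>space M. emeasure (shift_noise \<mu> h N \<omega>) D = of_nat k} = {\<omega>\<in>space M. emeasure (N \<omega>) (?p D) = of_nat k}"
        using emeasure_shift_noise[OF _ D] by auto
      moreover have "measure M {\<omega>\<in>space M. emeasure (N \<omega>) (?p D) = of_nat k} = pois (?p D) k"
        using fin emeasure_shift[OF D] by (intro prob_N p[OF D]) simp
      ultimately show "measure M {\<omega>\<in>space M. emeasure (shift_noise \<mu> h N \<omega>) D = of_nat k} = measure \<mu> D ^ k / fact k * exp (- measure \<mu> D)"
        by (simp add: pois_def measure_def emeasure_shift[OF D])
    }
    assume inf: "emeasure \<mu> D = \<infinity>"
    have "AE \<omega> in M. emeasure (N \<omega>) (?p D) = \<infinity>"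
      using inf emeasure_shift[OF D] by (intro N_infinite p[OF D]) simp
    then show "AE \<omega> in M. emeasure (shift_noise \<mu> h N \<omega>) D = \<infinity>"
      using AE_space by eventually_elim (simp add: emeasure_shift_noise D)
  next
    fix \<A> assume A: "\<A> \<subseteq> sets \<mu>" "finite \<A> \<and> disjoint \<A>"
    have "disjoint (?p ` \<A>)"
    proof (rule disjointI)
      fix a b assume "a \<in> ?p ` \<A>" "b \<in> ?p ` \<A>" "a \<noteq> b"
      then obtain D E where "D \<in> \<A>" "E \<in> \<A>" "a = ?p D" "b = ?p E" "D \<noteq> E" by blast
      moreover from this have "D \<inter> E = {}" using A(2) unfolding disjoint_def by blast
      ultimately show "a \<inter> b = {}" by blast
    qed
    moreover have "?p ` \<A> \<subseteq> sets \<mu>" "finite (?p ` \<A>)" using A p by auto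
    moreover have "\<forall>\<A>\<subseteq>sets \<mu>. finite \<A> \<and> disjoint \<A> \<longrightarrow> indep_vars (\<lambda>_. borel) (\<lambda>D \<omega>. emeasure (N \<omega>) D) \<A>"
      using prm unfolding poisson_random_measure_def by blast
    ultimately have iv: "indep_vars (\<lambda>_. borel) (\<lambda>D \<omega>. emeasure (N \<omega>) D) (?p ` \<A>)" by blast
    have "indep_vars (\<lambda>_. borel) (\<lambda>D \<omega>. emeasure (N \<omega>) (?p D)) \<A>"
    proof (cases "\<A> = {}")
      case True
      then show ?thesis by (simp add: indep_vars_def indep_sets_def)
    next
      case False
      have inj': "inj_on ?p \<A>" using inj A(1) by (rule inj_on_subset)
      show ?thesis
        unfolding indep_vars_def2
      proof (intro conjI ballI)
        fix D assume "D \<in> \<A>"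
        then show "(\<lambda>\<omega>. emeasure (N \<omega>) (?p D)) \<in> borel_measurable M" using A(1) p by (intro measurable_N) auto
      next
        let ?F = "\<lambda>D. {(\<lambda>\<omega>. emeasure (N \<omega>) D) -` B \<inter> space M | B. B \<in> sets borel}"
        have s: "indep_sets ?F (?p ` \<A>)" using iv unfolding indep_vars_def2 by blast
        show "indep_sets (\<lambda>D. ?F (?p D)) \<A>"
        proof (rule indep_setsI)
          show "?F (?p D) \<subseteq> events" if "D \<in> \<A>" for D
            using s that unfolding indep_sets_def by blast
          fix E J assume J: "J \<noteq> {}" "J \<subseteq> \<A>" "finite J" and E: "\<forall>j\<in>J. E j \<in> ?F (?p j)"
          \<comment> \<open>Events chosen for the original sets, carried over to their preimages
            along the inverse of the reindexing.\<close>
          define E' where "E' a = E (inv_into \<A> ?p a)" for a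
          have E': "E' (?p j) = E j" if "j \<in> J" for j
            unfolding E'_def using inv_into_f_f[OF inj', of j] that J by auto
          have "prob (\<Inter>a\<in>?p ` J. E' a) = (\<Prod>a\<in>?p ` J. prob (E' a))"
            using J E E' by (intro indep_setsD[OF s]) auto
          also have "(\<Inter>a\<in>?p ` J. E' a) = (\<Inter>j\<in>J. E j)" using E' by simp
          also have "(\<Prod>a\<in>?p ` J. prob (E' a)) = (\<Prod>j\<in>J. prob (E j))"
            using inj_on_subset[OF inj' J(2)] E' by (simp add: prod.reindex)
          finally show "prob (\<Inter>j\<in>J. E j) = (\<Prod>j\<in>J. prob (E j))" .
        qed
      qed
    qed
    moreover have "indep_vars (\<lambda>_. borel) (\<lambda>D \<omega>. emeasure (N \<omega>) (?p D)) \<A> = indep_vars (\<lambda>_. borel) (\<lambda>D \<omega>. emeasure (shift_noise \<mu> h N \<omega>) D) \<A>"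
    proof -
      have "(\<lambda>\<omega>. emeasure (shift_noise \<mu> h N \<omega>) D) -` B \<inter> space M = (\<lambda>\<omega>. emeasure (N \<omega>) (?p D)) -` B \<inter> space M" if "D \<in> \<A>" for D B
        using emeasure_shift_noise[of _ D h] that A(1) by auto
      then have "indep_sets (\<lambda>D. {(\<lambda>\<omega>. emeasure (N \<omega>) (?p D)) -` B \<inter> space M | B. B \<in> sets borel}) \<A> =
        indep_sets (\<lambda>D. {(\<lambda>\<omega>. emeasure (shift_noise \<mu> h N \<omega>) D) -` B \<inter> space M | B. B \<in> sets borel}) \<A>"
        by (intro indep_sets_cong refl) auto
      then show ?thesis
        unfolding indep_vars_def2 using meas p measurable_N A(1) by (auto simp: subset_iff)
    qed
    ultimately show "indep_vars (\<lambda>_. borel) (\<lambda>D \<omega>. emeasure (shift_noise \<mu> h N \<omega>) D) \<A>" by simp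
  qed
qed

abbreviation "Nh h \<equiv> shift_noise \<mu> h N"

lemma levy_noise_shift: "levy_noise M \<nu> (Nh h) \<kappa>"
  by (intro levy_noise.intro levy_measure_axioms kernel_axioms prm_shift_noise)

lemma emeasure_Nh_box:
  assumes "\<omega> \<in> space M" "{0..s} \<times> A \<times> B \<in> sets \<mu>"
  shows "emeasure (Nh h \<omega>) ({0..s} \<times> A \<times> B) = emeasure (N \<omega>) ({0..s} \<times> {x. x + - h \<in> A} \<times> B)"
proof -
  have "shift h -` ({0..s} \<times> A \<times> B) \<inter> space \<mu> = {0..s} \<times> {x. x + - h \<in> A} \<times> B"
    using sets.sets_into_space[OF assms(2)] by (cases "A = {}") (auto simp: shift_def space_intensity)
  then show ?thesis using emeasure_shift_noise[OF assms] by simp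
qed

text \<open>Translation permutes the bounded Borel sets of the line and leaves time alone, so both
  noises reveal the same events up to each time. Thus the coefficients of elementary data may be
  kept when the noise is shifted.\<close>

lemma noise_filtration_shift: "noise_filtration M (Nh h) a = noise_filtration M N a"
proof -
  let ?G = "\<lambda>N. {{\<omega>\<in>space M. emeasure (N \<omega>) ({0..s} \<times> A \<times> B) \<in> C} | s A B C.
         0 \<le> s \<and> s \<le> a \<and> A \<in> sets borel \<and> bounded A \<and>
         B \<in> sets borel_R0 \<and> bounded_R0 B \<and> C \<in> sets (borel :: ennreal measure)}"
  have box: "{0..s} \<times> A \<times> B \<in> sets \<mu>" if "A \<in> sets borel" "B \<in> sets borel_R0" for s A B
    using that by (intro sets_intensity_box) auto
  have "?G (Nh h) = ?G N"
  proof (intro equalityI subsetI)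
    fix E assume "E \<in> ?G (Nh h)"
    then obtain s A B C where E: "E = {\<omega>\<in>space M. emeasure (Nh h \<omega>) ({0..s} \<times> A \<times> B) \<in> C}"
      and c: "0 \<le> s" "s \<le> a" "A \<in> sets borel" "bounded A" "B \<in> sets borel_R0" "bounded_R0 B" "C \<in> sets borel" by blast
    have "E = {\<omega>\<in>space M. emeasure (N \<omega>) ({0..s} \<times> {x. x + - h \<in> A} \<times> B) \<in> C}"
      unfolding E using emeasure_Nh_box[OF _ box[OF c(3,5)]] by auto
    then show "E \<in> ?G N" using c borel_shift_set[OF c(3), of "-h"] bounded_shift_set[OF c(4), of "-h"] by blast
  next
    fix E assume "E \<in> ?G N"
    then obtain s A B C where E: "E = {\<omega>\<in>space M. emeasure (N \<omega>) ({0..s} \<times> A \<times> B) \<in> C}"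
      and c: "0 \<le> s" "s \<le> a" "A \<in> sets borel" "bounded A" "B \<in> sets borel_R0" "bounded_R0 B" "C \<in> sets borel" by blast
    have A': "{x. x + h \<in> A} \<in> sets borel" by (rule borel_shift_set[OF c(3)])
    have "E = {\<omega>\<in>space M. emeasure (Nh h \<omega>) ({0..s} \<times> {x. x + h \<in> A} \<times> B) \<in> C}"
      unfolding E using emeasure_Nh_box[OF _ box[OF A' c(5)]] by auto
    then show "E \<in> ?G (Nh h)" using c A' bounded_shift_set[OF c(4), of h] by blast
  qed
  then show ?thesis unfolding noise_filtration_def by simp
qed

lemma has_compensated_integral_shift:
  assumes "has_compensated_integral M N \<mu> (\<lambda>p. \<Phi> (shift h p)) I"
  shows "has_compensated_integral M (Nh h) \<mu> \<Phi> I"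
proof -
  obtain S where S: "\<And>n::nat. simple_function \<mu> (S n)" "\<And>n. integrable \<mu> (S n)"
    "(\<lambda>n. \<integral>\<^sup>+p. ennreal ((S n p - \<Phi> (shift h p))\<^sup>2) \<partial>\<mu>) \<longlonglongrightarrow> 0"
    "(\<lambda>n. \<integral>\<^sup>+\<omega>. ennreal ((compensated_integral N \<mu> (S n) \<omega> - I \<omega>)\<^sup>2) \<partial>M) \<longlonglongrightarrow> 0"
    and m: "(\<lambda>p. \<Phi> (shift h p)) \<in> borel_measurable \<mu>" "(\<integral>\<^sup>+p. ennreal ((\<Phi> (shift h p))\<^sup>2) \<partial>\<mu>) < \<infinity>" "I \<in> borel_measurable M"
    using assms unfolding has_compensated_integral_def by blast
  have Sm: "S n \<in> borel_measurable \<mu>" for n using S(2) by auto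
  have \<Phi>m: "\<Phi> \<in> borel_measurable \<mu>"
    using measurable_compose[OF measurable_shift[of "-h"] m(1)] by simp
  \<comment> \<open>Composing with the inverse shift turns approximants of the shifted integrand
    into approximants of \<open>\<Phi>\<close>, with the same pathwise integrals against the moved
    noise.\<close>
  define T where "T n p = S n (shift (- h) p)" for n p
  have Tm: "T n \<in> borel_measurable \<mu>" for n
    unfolding T_def[abs_def] by (rule measurable_compose[OF measurable_shift Sm])
  have TS: "T n (shift h p) = S n p" for n p by (simp add: T_def)
  show ?thesis
    unfolding has_compensated_integral_def
  proof (intro conjI exI[of _ T] allI \<Phi>m m(3))
    have nn: "(\<integral>\<^sup>+p. f p \<partial>\<mu>) = (\<integral>\<^sup>+p. f (shift h p) \<partial>\<mu>)" if "f \<in> borel_measurable \<mu>" for f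
      using nn_integral_distr[OF measurable_shift, of f h] that by (simp add: distr_shift)
    show "(\<integral>\<^sup>+p. ennreal ((\<Phi> p)\<^sup>2) \<partial>\<mu>) < \<infinity>"
      using m(2) \<Phi>m by (subst nn) auto
    show "simple_function \<mu> (T n)" for n
      unfolding T_def[abs_def] using simple_function_comp[OF measurable_shift[of "-h"] S(1)[of n]] by (simp add: comp_def)
    show "integrable \<mu> (T n)" for n
    proof -
      have "integrable (distr \<mu> \<mu> (shift h)) (T n)"
        by (subst integrable_distr_eq[OF measurable_shift Tm]) (simp add: TS S(2))
      then show ?thesis by (simp add: distr_shift)
    qed
    have "(\<integral>\<^sup>+p. ennreal ((T n p - \<Phi> p)\<^sup>2) \<partial>\<mu>) = (\<integral>\<^sup>+p. ennreal ((S n p - \<Phi> (shift h p))\<^sup>2) \<partial>\<mu>)" for n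
      using Tm[of n] \<Phi>m by (subst nn) (auto simp: TS)
    then show "(\<lambda>n. \<integral>\<^sup>+p. ennreal ((T n p - \<Phi> p)\<^sup>2) \<partial>\<mu>) \<longlonglongrightarrow> 0" using S(3) by simp
    have "compensated_integral (Nh h) \<mu> (T n) \<omega> = compensated_integral N \<mu> (S n) \<omega>" if \<omega>: "\<omega> \<in> space M" for n \<omega>
    proof -
      have "(\<integral>p. T n p \<partial>Nh h \<omega>) = (\<integral>p. S n p \<partial>N \<omega>)"
        unfolding shift_noise_def by (subst integral_distr[OF measurable_shift_N[OF \<omega>] Tm]) (simp add: TS)
      moreover have "(\<integral>p. T n p \<partial>\<mu>) = (\<integral>p. S n p \<partial>\<mu>)"
        using integral_distr[OF measurable_shift Tm, of h] by (simp add: distr_shift TS)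
      ultimately show ?thesis by (simp add: compensated_integral_def)
    qed
    then have "(\<integral>\<^sup>+\<omega>. ennreal ((compensated_integral (Nh h) \<mu> (T n) \<omega> - I \<omega>)\<^sup>2) \<partial>M) = (\<integral>\<^sup>+\<omega>. ennreal ((compensated_integral N \<mu> (S n) \<omega> - I \<omega>)\<^sup>2) \<partial>M)" for n
      by (intro nn_integral_cong) simp
    then show "(\<lambda>n. \<integral>\<^sup>+\<omega>. ennreal ((compensated_integral (Nh h) \<mu> (T n) \<omega> - I \<omega>)\<^sup>2) \<partial>M) \<longlonglongrightarrow> 0" using S(4) by simp
  qed
qed

text \<open>Both noises choose their version of the integral, so equality holds only almost surely.\<close>

lemma X_shift:
  assumes A: "A \<in> sets borel" "bounded A"
  shows "AE \<omega> in M. levy_colored_noise M \<nu> (Nh h) \<kappa> t (indicator {x. x + h \<in> A}) \<omega> = X t A \<omega>"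
proof -
  interpret Nh: levy_noise M \<nu> "Nh h" \<kappa> by (rule levy_noise_shift)
  \<comment> \<open>Convolution with \<open>\<kappa>\<close> commutes with translations.\<close>
  have conv: "convolve (indicator {x. x + h \<in> A}) \<kappa> (x - h) = convolve (indicator A) \<kappa> x" for x
    unfolding convolve_def by (intro Bochner_Integration.integral_cong refl) (auto simp: indicator_def algebra_simps)
  have "tensor {0..t} (convolve (indicator {x. x + h \<in> A}) \<kappa>) (shift h p) = tensor {0..t} (convolve (indicator A) \<kappa>) p" for p
    by (cases p) (simp add: tensor_def shift_def conv)
  then have "has_compensated_integral M N \<mu> (\<lambda>p. tensor {0..t} (convolve (indicator {x. x + h \<in> A}) \<kappa>) (shift h p)) (X t A)"
    using has_compensated_integral_X[OF A, of t] by simp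
  from has_compensated_integral_shift[OF this] Nh.has_compensated_integral_X[OF borel_shift_set[OF A(1)] bounded_shift_set[OF A(2)]]
  show ?thesis by (intro Nh.compensated_integral_unique) auto
qed

lemma elementary_data_shift:
  "elementary_data M N Y a b A \<Longrightarrow> elementary_data M (Nh h) Y a b {x. x + h \<in> A}"
  by (auto simp: elementary_data_def noise_filtration_shift borel_shift_set bounded_shift_set)

lemma shift_data_ok: "simple_data_ok M N ps \<Longrightarrow> simple_data_ok M (Nh h) (shift_data h ps)"
  using elementary_data_shift by (auto simp: simple_data_ok_def shift_data_def split_beta')

lemma simple_process_shift: "simple_process (shift_data h ps) s x \<omega> = simple_process ps s (x + h) \<omega>"
  by (induction ps) (auto simp: simple_process_def shift_data_def elementary_process_def indicator_def)

lemma simple_walsh_integral_shift: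
  assumes "simple_data_ok M N ps"
  shows "AE \<omega> in M. simple_walsh_integral M \<nu> (Nh h) \<kappa> t (shift_data h ps) \<omega> = simple_walsh_integral M \<nu> N \<kappa> t ps \<omega>"
  using assms
proof (induction ps)
  case Nil
  show ?case by (simp add: simple_walsh_integral_def shift_data_def)
next
  case (Cons p ps)
  obtain Y a b A where p: "p = (Y, a, b, A)" by (cases p)
  have A: "A \<in> sets borel" "bounded A" and ps: "simple_data_ok M N ps"
    using Cons.prems by (auto simp: simple_data_ok_def elementary_data_def p)
  show ?case
    using Cons.IH[OF ps] X_shift[OF A, of h "min t a"] X_shift[OF A, of h "min t b"]
    by eventually_elim (simp add: p simple_walsh_integral_def shift_data_def)
qed

lemma predictable_shift:
  assumes g: "predictable M N g"
  shows "predictable M (Nh h) (\<lambda>s x. g s (x + h))"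
proof -
  interpret Nh: levy_noise M \<nu> "Nh h" \<kappa> by (rule levy_noise_shift)
  let ?T = "\<lambda>(\<omega>, t, x). (\<omega>, t, x + h)"
  have "?T \<in> measurable (predictable_sigma M (Nh h)) (predictable_sigma M N)"
    unfolding predictable_sigma_def[of M N]
  proof (rule measurable_measure_of[OF predictable_sigma_generator_subset])
    show "?T \<in> space (predictable_sigma M (Nh h)) \<rightarrow> space M \<times> {0..} \<times> UNIV"
      by (auto simp: Nh.predictable_sigma_space)
    fix E assume "E \<in> {{(\<omega>, t, x) \<in> space M \<times> {0..} \<times> UNIV. elementary_process Y a b A t x \<omega> \<in> C} | Y a b A C.
        elementary_data M N Y a b A \<and> C \<in> sets borel}"
    then obtain Y a b A C where E: "E = {(\<omega>, t, x) \<in> space M \<times> {0..} \<times> UNIV. elementary_process Y a b A t x \<omega> \<in> C}"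
      and d: "elementary_data M N Y a b A" and C: "C \<in> sets borel" by blast
    from measurable_sets[OF Nh.predictable_elementary[OF elementary_data_shift[OF d], unfolded predictable_def] C]
    have "(\<lambda>(\<omega>, t, x). elementary_process Y a b {x. x + h \<in> A} t x \<omega>) -` C \<inter> space (predictable_sigma M (Nh h)) \<in> sets (predictable_sigma M (Nh h))" .
    also have "(\<lambda>(\<omega>, t, x). elementary_process Y a b {x. x + h \<in> A} t x \<omega>) -` C \<inter> space (predictable_sigma M (Nh h)) = ?T -` E \<inter> space (predictable_sigma M (Nh h))"
      by (auto simp: E Nh.predictable_sigma_space elementary_process_def indicator_def)
    finally show "?T -` E \<inter> space (predictable_sigma M (Nh h)) \<in> sets (predictable_sigma M (Nh h))" .
  qed
  from measurable_compose[OF this g[unfolded predictable_def]] show ?thesis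
    unfolding predictable_def split_beta' by simp
qed

lemma energy_shift:
  assumes [measurable]: "g \<in> borel_measurable borel"
  shows "energy (\<lambda>x. g (x + h)) = energy g"
proof -
  have "cv (\<lambda>x. g (x + h)) x = cv g (x + h)" for x
  proof -
    have "cv (\<lambda>x. g (x + h)) x = (\<integral>\<^sup>+y. ennreal \<bar>g (y + h)\<bar> * \<kappa> ((x + h) - (y + h)) \<partial>lborel)"
      by (simp add: cv_def)
    also have "\<dots> = cv g (x + h)"
      unfolding cv_def by (rule nn_integral_shift) measurable
    finally show ?thesis .
  qed
  then show ?thesis
    using nn_integral_shift[of "\<lambda>x. (cv g x)\<^sup>2" h] by (simp add: energy_cv)
qed

lemma walsh_norm_shift:
  assumes j: "jointly M (\<lambda>s x \<omega>. indicator {0<..t} s * g s x \<omega>)"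
  shows "walsh_norm_sq M \<kappa> t (\<lambda>s x. g s (x + h)) = walsh_norm_sq M \<kappa> t g"
proof -
  have "walsh_norm_sq M \<kappa> t (\<lambda>s x. g s (x + h)) = walsh_norm_sq M \<kappa> t (\<lambda>s x \<omega>. indicator {0<..t} s * g s (x + h) \<omega>)"
    by (rule walsh_norm_indicator)
  also have "\<dots> = walsh_norm_sq M \<kappa> t (\<lambda>s x \<omega>. indicator {0<..t} s * g s x \<omega>)"
    unfolding walsh_norm_energy
    by (intro nn_integral_cong) (simp add: energy_shift[OF jointly_section[OF j]])
  also have "\<dots> = walsh_norm_sq M \<kappa> t g" by (rule walsh_norm_indicator[symmetric])
  finally show ?thesis .
qed

lemma has_walsh_integral_shift:
  assumes g: "has_walsh_integral M \<nu> N \<kappa> t g I"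
  shows "has_walsh_integral M \<nu> (Nh h) \<kappa> t (\<lambda>s x. g s (x + h)) I"
proof -
  note gD = has_walsh_integralD[OF g]
  obtain ps where ps: "\<And>n::nat. simple_data_ok M N (ps n)"
    "(\<lambda>n. walsh_norm_sq M \<kappa> t (\<lambda>s x \<omega>. simple_process (ps n) s x \<omega> - g s x \<omega>)) \<longlonglongrightarrow> 0"
    "(\<lambda>n. nsq M (\<lambda>\<omega>. simple_walsh_integral M \<nu> N \<kappa> t (ps n) \<omega> - I \<omega>)) \<longlonglongrightarrow> 0"
    using g unfolding has_walsh_integral_def nsq_def by blast
  show ?thesis
    unfolding has_walsh_integral_def nsq_def[symmetric]
  proof (intro conjI exI[of _ "\<lambda>n. shift_data h (ps n)"] allI gD(4))
    show "predictable M (Nh h) (\<lambda>s x \<omega>. indicator {0<..t} s * g s (x + h) \<omega>)"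
      by (rule predictable_shift[OF gD(1)])
    show "walsh_norm_sq M \<kappa> t (\<lambda>s x. g s (x + h)) < \<infinity>"
      unfolding walsh_norm_shift[OF gD(2)] by (rule gD(3))
    show "simple_data_ok M (Nh h) (shift_data h (ps n))" for n by (rule shift_data_ok[OF ps(1)])
    have j: "jointly M (\<lambda>s x \<omega>. indicator {0<..t} s * (simple_process (ps n) s x \<omega> - g s x \<omega>))" for n
      unfolding right_diff_distrib by (intro jointly_diff jointly_indicator jointly_simple_process ps gD) simp
    show "(\<lambda>n. walsh_norm_sq M \<kappa> t (\<lambda>s x \<omega>. simple_process (shift_data h (ps n)) s x \<omega> - g s (x + h) \<omega>)) \<longlonglongrightarrow> 0"
      unfolding simple_process_shift using walsh_norm_shift[OF j] ps(2) by simp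
    have "nsq M (\<lambda>\<omega>. simple_walsh_integral M \<nu> (Nh h) \<kappa> t (shift_data h (ps n)) \<omega> - I \<omega>) = nsq M (\<lambda>\<omega>. simple_walsh_integral M \<nu> N \<kappa> t (ps n) \<omega> - I \<omega>)" for n
      by (rule nsq_cong_AE) (use simple_walsh_integral_shift[OF ps(1)] in eventually_elim, simp)
    then show "(\<lambda>n. nsq M (\<lambda>\<omega>. simple_walsh_integral M \<nu> (Nh h) \<kappa> t (shift_data h (ps n)) \<omega> - I \<omega>)) \<longlonglongrightarrow> 0"
      using ps(3) by simp
  qed
qed

text \<open>The wave kernel depends on \<open>x - y\<close> alone, so translating both variables by
  \<open>h\<close> leaves it unchanged.\<close>

lemma mild_solution_shift:
  assumes u: "mild_solution M \<nu> N \<kappa> u"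
  shows "mild_solution M \<nu> (Nh h) \<kappa> (\<lambda>t x. u t (x + h))"
  unfolding mild_solution_def
proof (intro conjI allI impI)
  show "predictable M (Nh h) (\<lambda>t x. u t (x + h))" by (rule predictable_shift[OF mild_solutionD(1)[OF u]])
  fix t x :: real assume "0 \<le> t"
  from has_walsh_integral_shift[OF mild_solutionD(3)[OF u this, of "x + h"], of h]
  show "has_walsh_integral M \<nu> (Nh h) \<kappa> t (\<lambda>s y \<omega>. wave_kernel (t - s) (x - y) * u s (y + h) \<omega>) (\<lambda>\<omega>. u t (x + h) \<omega> - 1)"
    by simp
qed

end

section \<open>Mixing and ergodicity\<close>

text \<open>The sets on which \<open>m n\<close> converges to \<open>l\<close> form a Dynkin class.
  Complements are harmless; for disjoint unions the limit is exchanged with the series by Tannery's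
  theorem, for which the summable majorant \<open>q\<close> is provided.\<close>

lemma dynkin_tendsto:
  fixes m :: "nat \<Rightarrow> 'a set \<Rightarrow> real"
  assumes G: "Int_stable G" "G \<subseteq> Pow \<Omega>"
    and basic: "\<And>a. a \<in> G \<Longrightarrow> (\<lambda>n. m n a) \<longlonglongrightarrow> l a"
    and space: "(\<lambda>n. m n \<Omega>) \<longlonglongrightarrow> l \<Omega>"
    and diff: "\<And>a n. a \<in> sigma_sets \<Omega> G \<Longrightarrow> m n (\<Omega> - a) = m n \<Omega> - m n a" "\<And>a. a \<in> sigma_sets \<Omega> G \<Longrightarrow> l (\<Omega> - a) = l \<Omega> - l a"
    and union: "\<And>A n. disjoint_family A \<Longrightarrow> range A \<subseteq> sigma_sets \<Omega> G \<Longrightarrow> (\<lambda>i. m n (A i)) sums m n (\<Union>i::nat. A i)"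
      "\<And>A. disjoint_family A \<Longrightarrow> range A \<subseteq> sigma_sets \<Omega> G \<Longrightarrow> (\<lambda>i. l (A i)) sums l (\<Union>i::nat. A i)"
      "\<And>A. disjoint_family A \<Longrightarrow> range A \<subseteq> sigma_sets \<Omega> G \<Longrightarrow> summable (\<lambda>i::nat. q (A i))"
    and bound: "\<And>a n. a \<in> sigma_sets \<Omega> G \<Longrightarrow> \<bar>m n a\<bar> \<le> q a"
    and a: "a \<in> sigma_sets \<Omega> G"
  shows "(\<lambda>n. m n a) \<longlonglongrightarrow> l a"
  using G a
proof (induction rule: sigma_sets_induct_disjoint)
  case (basic A)
  then show ?case by (rule assms(3))
next
  case empty
  have e: "\<Omega> \<in> sigma_sets \<Omega> G" by (rule sigma_sets_top)
  show ?case using diff(1)[OF e] diff(2)[OF e] by simp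
next
  case (compl A)
  then show ?case unfolding diff(1)[OF compl(1)] diff(2)[OF compl(1)] by (intro tendsto_diff space)
next
  case (union A)
  have Ai: "A i \<in> sigma_sets \<Omega> G" for i using union(2) by blast
  have "eventually (\<lambda>n. summable (\<lambda>k. norm (m n (A k)))) sequentially \<and> summable (\<lambda>k. norm (l (A k))) \<and>
     (\<lambda>n. \<Sum>k. m n (A k)) \<longlonglongrightarrow> (\<Sum>k. l (A k))"
    by (rule tannerys_theorem[where M="\<lambda>k. q (A k)"])
       (use union assms(9) bound[OF Ai] in \<open>auto intro!: always_eventually\<close>)
  then show ?case
    using assms(7)[OF union(1,2)] assms(8)[OF union(1,2)] by (simp add: sums_iff)
qed

text \<open>Two Dynkin arguments, in \<open>a\<close> for fixed \<open>b\<close> and then in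
  \<open>b\<close> for fixed \<open>a\<close>. The majorant is the probability of the varying event;
  in the second argument it does not depend on \<open>n\<close> because all \<open>Z n\<close> have
  the law of \<open>X\<close>.\<close>

lemma (in prob_space) mixing_extend:
  fixes Z :: "nat \<Rightarrow> 'a \<Rightarrow> 'c"
  assumes X: "X \<in> measurable M S" and Z: "\<And>n. Z n \<in> measurable M S"
    and law: "\<And>n b. b \<in> sets S \<Longrightarrow> prob (Z n -` b \<inter> space M) = prob (X -` b \<inter> space M)"
    and G: "Int_stable G" "G \<subseteq> Pow (space S)" "sets S = sigma_sets (space S) G"
    and mix: "\<And>a b. a \<in> G \<Longrightarrow> b \<in> G \<Longrightarrow> (\<lambda>n. prob (X -` a \<inter> Z n -` b \<inter> space M)) \<longlonglongrightarrow> prob (X -` a \<inter> space M) * prob (X -` b \<inter> space M)"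
    and ab: "a \<in> sets S" "b \<in> sets S"
  shows "(\<lambda>n. prob (X -` a \<inter> Z n -` b \<inter> space M)) \<longlonglongrightarrow> prob (X -` a \<inter> space M) * prob (X -` b \<inter> space M)"
proof -
  note XS = measurable_sets[OF X] and ZS = measurable_sets[OF Z]
  have XZ: "X -` a \<inter> Z n -` b \<inter> space M \<in> events" if "a \<in> sets S" "b \<in> sets S" for a b n
  proof -
    have "X -` a \<inter> Z n -` b \<inter> space M = (X -` a \<inter> space M) \<inter> (Z n -` b \<inter> space M)" by auto
    then show ?thesis using XS[OF that(1)] ZS[OF that(2)] by auto
  qed
  have GS: "a \<in> G \<Longrightarrow> a \<in> sets S" for a using G(3) by auto
  have sumsX: "(\<lambda>i. prob (X -` A i \<inter> space M)) sums prob (X -` (\<Union>i. A i) \<inter> space M)"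
    if A: "disjoint_family A" "range A \<subseteq> sets S" for A :: "nat \<Rightarrow> 'c set"
  proof -
    have "(\<lambda>i. prob (X -` A i \<inter> space M)) sums prob (\<Union>i. X -` A i \<inter> space M)"
      by (rule finite_measure_UNION) (use A XS in \<open>auto simp: disjoint_family_on_def\<close>)
    also have "(\<Union>i. X -` A i \<inter> space M) = X -` (\<Union>i. A i) \<inter> space M" by auto
    finally show ?thesis .
  qed
  have compX: "prob (X -` (space S - a) \<inter> space M) = 1 - prob (X -` a \<inter> space M)" if "a \<in> sets S" for a
  proof -
    have "X -` (space S - a) \<inter> space M = space M - (X -` a \<inter> space M)" using measurable_space[OF X] by auto
    then show ?thesis using prob_compl[OF XS[OF that]] by simp
  qed
  have spX: "X -` space S \<inter> space M = space M" using measurable_space[OF X] by auto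
  have spZ: "Z n -` space S \<inter> space M = space M" for n using measurable_space[OF Z] by auto
  have step1: "(\<lambda>n. prob (X -` a \<inter> Z n -` b \<inter> space M)) \<longlonglongrightarrow> prob (X -` a \<inter> space M) * prob (X -` b \<inter> space M)"
    if a: "a \<in> sets S" and b: "b \<in> G" for a b
  proof (rule dynkin_tendsto[where m="\<lambda>n a. prob (X -` a \<inter> Z n -` b \<inter> space M)" and l="\<lambda>a. prob (X -` a \<inter> space M) * prob (X -` b \<inter> space M)"
      and q="\<lambda>a. prob (X -` a \<inter> space M)", OF G(1,2), unfolded G(3)[symmetric]])
    note bS = GS[OF b]
    show "(\<lambda>n. prob (X -` a \<inter> Z n -` b \<inter> space M)) \<longlonglongrightarrow> prob (X -` a \<inter> space M) * prob (X -` b \<inter> space M)" if "a \<in> G" for a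
      by (rule mix[OF that b])
    have e: "X -` space S \<inter> Z n -` b \<inter> space M = Z n -` b \<inter> space M" for n using spX by auto
    show "(\<lambda>n. prob (X -` space S \<inter> Z n -` b \<inter> space M)) \<longlonglongrightarrow> prob (X -` space S \<inter> space M) * prob (X -` b \<inter> space M)"
      unfolding e spX law[OF bS] by (simp add: prob_space)
    show "prob (X -` (space S - a) \<inter> Z n -` b \<inter> space M) = prob (X -` space S \<inter> Z n -` b \<inter> space M) - prob (X -` a \<inter> Z n -` b \<inter> space M)" if a: "a \<in> sets S" for a n
    proof -
      have "X -` (space S - a) \<inter> Z n -` b \<inter> space M = (Z n -` b \<inter> space M) - (X -` a \<inter> Z n -` b \<inter> space M)"
        using measurable_space[OF X] by auto
      then show ?thesis unfolding e using XZ[OF a bS, of n] ZS[OF bS, of n] by (simp add: finite_measure_Diff Int_lower2 subset_iff)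
    qed
    show "prob (X -` (space S - a) \<inter> space M) * prob (X -` b \<inter> space M) = prob (X -` space S \<inter> space M) * prob (X -` b \<inter> space M) - prob (X -` a \<inter> space M) * prob (X -` b \<inter> space M)"
      if "a \<in> sets S" for a
      unfolding compX[OF that] spX by (simp add: prob_space algebra_simps)
    show "(\<lambda>i. prob (X -` A i \<inter> Z n -` b \<inter> space M)) sums prob (X -` (\<Union>i. A i) \<inter> Z n -` b \<inter> space M)"
      if A: "disjoint_family A" "range A \<subseteq> sets S" for A :: "nat \<Rightarrow> 'c set" and n
    proof -
      have "(\<lambda>i. prob (X -` A i \<inter> Z n -` b \<inter> space M)) sums prob (\<Union>i. X -` A i \<inter> Z n -` b \<inter> space M)"
        by (rule finite_measure_UNION) (use A XZ[OF _ bS] in \<open>auto simp: disjoint_family_on_def\<close>)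
      also have "(\<Union>i. X -` A i \<inter> Z n -` b \<inter> space M) = X -` (\<Union>i. A i) \<inter> Z n -` b \<inter> space M" by auto
      finally show ?thesis .
    qed
    show "(\<lambda>i. prob (X -` A i \<inter> space M) * prob (X -` b \<inter> space M)) sums (prob (X -` (\<Union>i. A i) \<inter> space M) * prob (X -` b \<inter> space M))"
      if A: "disjoint_family A" "range A \<subseteq> sets S" for A :: "nat \<Rightarrow> 'c set"
      by (rule sums_mult2[OF sumsX[OF A]])
    show "summable (\<lambda>i. prob (X -` A i \<inter> space M))" if A: "disjoint_family A" "range A \<subseteq> sets S" for A :: "nat \<Rightarrow> 'c set"
      using sumsX[OF A] by (rule sums_summable)
    show "\<bar>prob (X -` a \<inter> Z n -` b \<inter> space M)\<bar> \<le> prob (X -` a \<inter> space M)" if "a \<in> sets S" for a n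
      using XS[OF that] by (auto intro!: finite_measure_mono)
    show "a \<in> sets S" by fact
  qed
  show ?thesis
  proof (rule dynkin_tendsto[where m="\<lambda>n b. prob (X -` a \<inter> Z n -` b \<inter> space M)" and l="\<lambda>b. prob (X -` a \<inter> space M) * prob (X -` b \<inter> space M)"
      and q="\<lambda>b. prob (X -` b \<inter> space M)", OF G(1,2), unfolded G(3)[symmetric]])
    note aS = ab(1)
    show "(\<lambda>n. prob (X -` a \<inter> Z n -` b \<inter> space M)) \<longlonglongrightarrow> prob (X -` a \<inter> space M) * prob (X -` b \<inter> space M)" if "b \<in> G" for b
      by (rule step1[OF aS that])
    have e: "X -` a \<inter> Z n -` space S \<inter> space M = X -` a \<inter> space M" for n using spZ[of n] by auto
    show "(\<lambda>n. prob (X -` a \<inter> Z n -` space S \<inter> space M)) \<longlonglongrightarrow> prob (X -` a \<inter> space M) * prob (X -` space S \<inter> space M)"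
      unfolding e spX by (simp add: prob_space)
    show "prob (X -` a \<inter> Z n -` (space S - b) \<inter> space M) = prob (X -` a \<inter> Z n -` space S \<inter> space M) - prob (X -` a \<inter> Z n -` b \<inter> space M)" if b: "b \<in> sets S" for b n
    proof -
      have "X -` a \<inter> Z n -` (space S - b) \<inter> space M = (X -` a \<inter> space M) - (X -` a \<inter> Z n -` b \<inter> space M)"
        using measurable_space[OF Z] by auto
      then show ?thesis unfolding e using XZ[OF aS b, of n] XS[OF aS] by (simp add: finite_measure_Diff Int_lower2 subset_iff)
    qed
    show "prob (X -` a \<inter> space M) * prob (X -` (space S - b) \<inter> space M) = prob (X -` a \<inter> space M) * prob (X -` space S \<inter> space M) - prob (X -` a \<inter> space M) * prob (X -` b \<inter> space M)"
      if "b \<in> sets S" for b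
      unfolding compX[OF that] spX by (simp add: prob_space algebra_simps)
    show "(\<lambda>i. prob (X -` a \<inter> Z n -` A i \<inter> space M)) sums prob (X -` a \<inter> Z n -` (\<Union>i. A i) \<inter> space M)"
      if A: "disjoint_family A" "range A \<subseteq> sets S" for A :: "nat \<Rightarrow> 'c set" and n
    proof -
      have "(\<lambda>i. prob (X -` a \<inter> Z n -` A i \<inter> space M)) sums prob (\<Union>i. X -` a \<inter> Z n -` A i \<inter> space M)"
        by (rule finite_measure_UNION) (use A XZ[OF aS] in \<open>auto simp: disjoint_family_on_def\<close>)
      also have "(\<Union>i. X -` a \<inter> Z n -` A i \<inter> space M) = X -` a \<inter> Z n -` (\<Union>i. A i) \<inter> space M" by auto
      finally show ?thesis .
    qed
    show "(\<lambda>i. prob (X -` a \<inter> space M) * prob (X -` A i \<inter> space M)) sums (prob (X -` a \<inter> space M) * prob (X -` (\<Union>i. A i) \<inter> space M))"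
      if A: "disjoint_family A" "range A \<subseteq> sets S" for A :: "nat \<Rightarrow> 'c set"
      by (rule sums_mult[OF sumsX[OF A]])
    show "summable (\<lambda>i. prob (X -` A i \<inter> space M))" if A: "disjoint_family A" "range A \<subseteq> sets S" for A :: "nat \<Rightarrow> 'c set"
      using sumsX[OF A] by (rule sums_summable)
    show "\<bar>prob (X -` a \<inter> Z n -` b \<inter> space M)\<bar> \<le> prob (X -` b \<inter> space M)" if "b \<in> sets S" for b n
      unfolding law[OF that, symmetric, of n] using ZS[OF that] by (auto intro!: finite_measure_mono)
    show "b \<in> sets S" by fact
  qed
qed

text \<open>The null events for uncountably many \<open>x\<close> cannot be united. Yet each
  product-measurable set arises from coordinate events by countable operations, and induction over
  these collects countably many null events only.\<close>

lemma AE_PiM_mem_cong: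
  assumes eq: "\<And>x. AE \<omega> in M. f x \<omega> = g x \<omega>"
    and A: "A \<in> sets (\<Pi>\<^sub>M x\<in>(UNIV::real set). (borel :: real measure))"
  shows "AE \<omega> in M. (\<lambda>x. f x \<omega>) \<in> A \<longleftrightarrow> (\<lambda>x. g x \<omega>) \<in> A"
proof -
  have "A \<in> sigma_sets (\<Pi>\<^sub>E x\<in>UNIV. space borel) {{h\<in>\<Pi>\<^sub>E x\<in>UNIV. space (borel::real measure). h i \<in> B} | i B. i \<in> UNIV \<and> B \<in> sets borel}"
    using A unfolding sets_PiM_single .
  then show ?thesis
  proof induction
    case (Basic a)
    then obtain i B where a: "a = {h\<in>\<Pi>\<^sub>E x\<in>UNIV. space (borel::real measure). h i \<in> B}" by blast
    show ?case using eq[of i] by eventually_elim (simp add: a)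
  next
    case Empty
    show ?case by simp
  next
    case (Compl a)
    show ?case using Compl.IH by eventually_elim simp
  next
    case (Union a)
    then have "AE \<omega> in M. \<forall>n. (\<lambda>x. f x \<omega>) \<in> a n \<longleftrightarrow> (\<lambda>x. g x \<omega>) \<in> a n" by (simp add: AE_all_countable)
    then show ?case by eventually_elim auto
  qed
qed

section \<open>Mixing of the noise and ergodicity of the solution\<close>

context levy_noise
begin

lemma law_shift:
  assumes "I \<subseteq> sets \<mu>"
  shows "distr M (cnt_space I) (cnt (Nh h) I) = distr M (cnt_space I) (cnt N I)"
  by (rule distr_cnt_eq[OF prm_shift_noise prm_axioms assms])

lemma measurable_cnt_Nh: "I \<subseteq> sets \<mu> \<Longrightarrow> cnt (Nh h) I \<in> measurable M (cnt_space I)"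
  by (rule prm.measurable_cnt[OF prm_shift_noise])

text \<open>For cylinders over bounded boxes the product formula is not just a limit: it holds
  exactly as soon as the shift separates the boxes.\<close>

lemma cylinder_mixing:
  assumes J: "finite J1" "J1 \<subseteq> boxes t" "finite J2" "J2 \<subseteq> boxes t"
    and X: "\<And>i. i \<in> J1 \<Longrightarrow> X1 i \<in> sets (borel::ennreal measure)" "\<And>i. i \<in> J2 \<Longrightarrow> X2 i \<in> sets (borel::ennreal measure)"
  shows "(\<lambda>n. prob (cnt N (boxes t) -` prod_emb (boxes t) (\<lambda>_. borel) J1 (Pi\<^sub>E J1 X1) \<inter> cnt (Nh (real n)) (boxes t) -` prod_emb (boxes t) (\<lambda>_. borel) J2 (Pi\<^sub>E J2 X2) \<inter> space M))
    \<longlonglongrightarrow> prob (cnt N (boxes t) -` prod_emb (boxes t) (\<lambda>_. borel) J1 (Pi\<^sub>E J1 X1) \<inter> space M) * prob (cnt N (boxes t) -` prod_emb (boxes t) (\<lambda>_. borel) J2 (Pi\<^sub>E J2 X2) \<inter> space M)"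
proof (rule tendsto_eventually)
  have ex: "\<exists>r. \<forall>p\<in>D. \<bar>fst (snd p)\<bar> \<le> r" if "D \<in> boxes t" for D
    using that by (auto simp: boxes_def bounded_iff) blast
  have "\<forall>D\<in>J1 \<union> J2. \<exists>r. \<forall>p\<in>D. \<bar>fst (snd p)\<bar> \<le> r" using ex J by blast
  then obtain r where r: "\<And>D p. D \<in> J1 \<union> J2 \<Longrightarrow> p \<in> D \<Longrightarrow> \<bar>fst (snd p)\<bar> \<le> r D" by metis
  \<comment> \<open>A sum of absolute values is a common bound for finitely many boxes, also when
    there are none.\<close>
  define R where "R = (\<Sum>D\<in>J1 \<union> J2. \<bar>r D\<bar>)"
  have R: "\<bar>fst (snd p)\<bar> \<le> R" if "D \<in> J1 \<union> J2" "p \<in> D" for D p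
  proof -
    have "\<bar>r D\<bar> \<le> R" unfolding R_def using J that by (intro member_le_sum) auto
    then show ?thesis using r[OF that] by linarith
  qed
  have bs: "boxes t \<subseteq> sets \<mu>" by (rule boxes_sets)
  show "\<forall>\<^sub>F n in sequentially. prob (cnt N (boxes t) -` prod_emb (boxes t) (\<lambda>_. borel) J1 (Pi\<^sub>E J1 X1) \<inter> cnt (Nh (real n)) (boxes t) -` prod_emb (boxes t) (\<lambda>_. borel) J2 (Pi\<^sub>E J2 X2) \<inter> space M)
    = prob (cnt N (boxes t) -` prod_emb (boxes t) (\<lambda>_. borel) J1 (Pi\<^sub>E J1 X1) \<inter> space M) * prob (cnt N (boxes t) -` prod_emb (boxes t) (\<lambda>_. borel) J2 (Pi\<^sub>E J2 X2) \<inter> space M)"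
    \<comment> \<open>If \<open>n > 2 * R\<close>, then \<open>\<bar>x\<bar> \<le> R\<close> and
      \<open>\<bar>x - n\<bar> \<le> R\<close> exclude each other.\<close>
    using eventually_gt_at_top[of "nat \<lceil>2 * R\<rceil>"]
  proof eventually_elim
    case (elim n)
    then have n: "2 * R < real n" by linarith
    let ?p = "\<lambda>D. shift (real n) -` D \<inter> space \<mu>"
    have pm: "?p D \<in> sets \<mu>" if "D \<in> J2" for D using measurable_sets[OF measurable_shift] that J bs by blast
    have disj: "A \<inter> B = {}" if "A \<in> J1" "B \<in> ?p ` J2" for A B
    proof (rule ccontr)
      assume "A \<inter> B \<noteq> {}"
      then obtain q D where q: "q \<in> A" "shift (real n) q \<in> D" "D \<in> J2" using \<open>B \<in> ?p ` J2\<close> by blast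
      have "\<bar>fst (snd q)\<bar> \<le> R" using R[of A q] q that by auto
      moreover have "\<bar>fst (snd (shift (real n) q))\<bar> \<le> R" using R[of D] q by auto
      ultimately show False using n by (cases q) (auto simp: shift_def)
    qed
    have J1s: "J1 \<subseteq> sets \<mu>" using J bs by auto
    have J2s: "?p ` J2 \<subseteq> sets \<mu>" using pm by auto
    have ind: "indep_var (cnt_space J1) (cnt N J1) (cnt_space (?p ` J2)) (cnt N (?p ` J2))"
      by (rule indep_cnt[OF J1s J2s disj])
    let ?C1 = "Pi\<^sub>E J1 X1"
    let ?C2 = "{c\<in>space (cnt_space (?p ` J2)). \<forall>D\<in>J2. c (?p D) \<in> X2 D}"
    have C1: "?C1 \<in> sets (cnt_space J1)" using J X by (intro sets_PiM_I_finite) auto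
    have C2: "?C2 \<in> sets (cnt_space (?p ` J2))"
    proof (rule sets.sets_Collect_finite_All[OF _ J(3)])
      fix D assume "D \<in> J2"
      then have "(\<lambda>c. c (?p D)) \<in> borel_measurable (cnt_space (?p ` J2))" by (intro measurable_component_singleton) auto
      from measurable_sets[OF this X(2)[OF \<open>D \<in> J2\<close>]]
      show "{c\<in>space (cnt_space (?p ` J2)). c (?p D) \<in> X2 D} \<in> sets (cnt_space (?p ` J2))"
        by (simp add: vimage_def Int_def conj_commute)
    qed
    have E1: "cnt N (boxes t) \<omega> \<in> prod_emb (boxes t) (\<lambda>_. borel) J1 (Pi\<^sub>E J1 X1) \<longleftrightarrow> cnt N J1 \<omega> \<in> ?C1" for \<omega>
      unfolding cnt_mem_prod_emb[OF J(2)] by (auto simp: cnt_def PiE_iff)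
    have E2: "cnt (Nh (real n)) (boxes t) \<omega> \<in> prod_emb (boxes t) (\<lambda>_. borel) J2 (Pi\<^sub>E J2 X2) \<longleftrightarrow> cnt N (?p ` J2) \<omega> \<in> ?C2" if "\<omega> \<in> space M" for \<omega>
    proof -
      have "cnt (Nh (real n)) (boxes t) \<omega> \<in> prod_emb (boxes t) (\<lambda>_. borel) J2 (Pi\<^sub>E J2 X2) \<longleftrightarrow> (\<forall>D\<in>J2. emeasure (Nh (real n) \<omega>) D \<in> X2 D)"
        by (rule cnt_mem_prod_emb[OF J(4)])
      also have "\<dots> \<longleftrightarrow> (\<forall>D\<in>J2. emeasure (N \<omega>) (?p D) \<in> X2 D)"
      proof (intro ball_cong refl)
        fix D assume "D \<in> J2"
        then have "D \<in> sets \<mu>" using J bs by auto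
        from emeasure_shift_noise[OF \<open>\<omega> \<in> space M\<close> this]
        show "emeasure (Nh (real n) \<omega>) D \<in> X2 D \<longleftrightarrow> emeasure (N \<omega>) (?p D) \<in> X2 D" by simp
      qed
      also have "\<dots> \<longleftrightarrow> cnt N (?p ` J2) \<omega> \<in> ?C2" by (simp add: cnt_def space_PiM)
      finally show ?thesis .
    qed
    have "prob (cnt N (boxes t) -` prod_emb (boxes t) (\<lambda>_. borel) J1 (Pi\<^sub>E J1 X1) \<inter> cnt (Nh (real n)) (boxes t) -` prod_emb (boxes t) (\<lambda>_. borel) J2 (Pi\<^sub>E J2 X2) \<inter> space M)
      = prob ((\<lambda>\<omega>. (cnt N J1 \<omega>, cnt N (?p ` J2) \<omega>)) -` (?C1 \<times> ?C2) \<inter> space M)"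
      using E1 E2 by (intro arg_cong[where f=prob]) auto
    also have "\<dots> = prob (cnt N J1 -` ?C1 \<inter> space M) * prob (cnt N (?p ` J2) -` ?C2 \<inter> space M)"
      by (rule indep_varD[OF ind C1 C2])
    also have "cnt N J1 -` ?C1 \<inter> space M = cnt N (boxes t) -` prod_emb (boxes t) (\<lambda>_. borel) J1 (Pi\<^sub>E J1 X1) \<inter> space M"
      using E1 by auto
    also have "cnt N (?p ` J2) -` ?C2 \<inter> space M = cnt (Nh (real n)) (boxes t) -` prod_emb (boxes t) (\<lambda>_. borel) J2 (Pi\<^sub>E J2 X2) \<inter> space M"
      using E2 by auto
    also have "prob \<dots> = prob (cnt N (boxes t) -` prod_emb (boxes t) (\<lambda>_. borel) J2 (Pi\<^sub>E J2 X2) \<inter> space M)"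
    proof -
      have B: "prod_emb (boxes t) (\<lambda>_. borel) J2 (Pi\<^sub>E J2 X2) \<in> sets (cnt_space (boxes t))"
        using J X by (intro sets_PiM_I) auto
      show ?thesis
        using arg_cong[OF law_shift[OF bs, of "real n"], of "\<lambda>Q. measure Q (prod_emb (boxes t) (\<lambda>_. borel) J2 (Pi\<^sub>E J2 X2))"]
        by (simp add: measure_distr[OF measurable_cnt_Nh[OF bs] B] measure_distr[OF measurable_cnt[OF bs] B])
    qed
    finally show ?case .
  qed
qed

lemma noise_mixing:
  assumes "a \<in> sets (cnt_space (boxes t))" "b \<in> sets (cnt_space (boxes t))"
  shows "(\<lambda>n. prob (cnt N (boxes t) -` a \<inter> cnt (Nh (real n)) (boxes t) -` b \<inter> space M))
    \<longlonglongrightarrow> prob (cnt N (boxes t) -` a \<inter> space M) * prob (cnt N (boxes t) -` b \<inter> space M)"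
proof (rule mixing_extend[where G="prod_algebra (boxes t) (\<lambda>_. borel)" and S="cnt_space (boxes t)"])
  have bs: "boxes t \<subseteq> sets \<mu>" by (rule boxes_sets)
  show "cnt N (boxes t) \<in> measurable M (cnt_space (boxes t))" by (rule measurable_cnt[OF bs])
  show "cnt (Nh (real n)) (boxes t) \<in> measurable M (cnt_space (boxes t))" for n by (rule measurable_cnt_Nh[OF bs])
  show "prob (cnt (Nh (real n)) (boxes t) -` b \<inter> space M) = prob (cnt N (boxes t) -` b \<inter> space M)" if b: "b \<in> sets (cnt_space (boxes t))" for n b
    using arg_cong[OF law_shift[OF bs, of "real n"], of "\<lambda>Q. measure Q b"]
    by (simp add: measure_distr[OF measurable_cnt_Nh[OF bs] b] measure_distr[OF measurable_cnt[OF bs] b])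
  show "Int_stable (prod_algebra (boxes t) (\<lambda>_. borel))" by (rule Int_stable_prod_algebra)
  show "prod_algebra (boxes t) (\<lambda>_. borel) \<subseteq> Pow (space (cnt_space (boxes t)))"
    unfolding space_PiM by (rule prod_algebra_sets_into_space)
  show "sets (cnt_space (boxes t)) = sigma_sets (space (cnt_space (boxes t))) (prod_algebra (boxes t) (\<lambda>_. borel))"
    unfolding sets_PiM space_PiM ..
  fix a b assume a: "a \<in> prod_algebra (boxes t) (\<lambda>_. borel :: ennreal measure)" and b: "b \<in> prod_algebra (boxes t) (\<lambda>_. borel :: ennreal measure)"
  obtain J1 X1 where 1: "a = prod_emb (boxes t) (\<lambda>_. borel) J1 (Pi\<^sub>E J1 X1)" "finite J1" "J1 \<subseteq> boxes t" "\<And>i. i \<in> J1 \<Longrightarrow> X1 i \<in> sets (borel::ennreal measure)"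
    using a by (elim prod_algebraE) auto
  obtain J2 X2 where 2: "b = prod_emb (boxes t) (\<lambda>_. borel) J2 (Pi\<^sub>E J2 X2)" "finite J2" "J2 \<subseteq> boxes t" "\<And>i. i \<in> J2 \<Longrightarrow> X2 i \<in> sets (borel::ennreal measure)"
    using b by (elim prod_algebraE) auto
  show "(\<lambda>n. prob (cnt N (boxes t) -` a \<inter> cnt (Nh (real n)) (boxes t) -` b \<inter> space M))
    \<longlonglongrightarrow> prob (cnt N (boxes t) -` a \<inter> space M) * prob (cnt N (boxes t) -` b \<inter> space M)"
    unfolding 1(1) 2(1) by (rule cylinder_mixing[OF 1(2,3) 2(2,3) 1(4) 2(4)])
qed (rule assms)+

text \<open>Adaptedness: a generator that is active at time \<open>t\<close> has its coefficient
  measurable at a time \<open>a < t\<close>, an inactive one is constant. It allows the boxes up to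
  \<open>t\<close> as the only counts on which the solution at time \<open>t\<close>
  depends.\<close>

lemma predictable_section:
  assumes g: "predictable M N g" and t: "0 \<le> t"
  shows "g t x \<in> borel_measurable (noise_filtration M N t)"
proof -
  let ?T = "\<lambda>\<omega>. (\<omega>, t, x)"
  have "?T \<in> measurable (noise_filtration M N t) (predictable_sigma M N)"
    unfolding predictable_sigma_def
  proof (rule measurable_measure_of[OF predictable_sigma_generator_subset])
    show "?T \<in> space (noise_filtration M N t) \<rightarrow> space M \<times> {0..} \<times> UNIV" using t by auto
    fix E assume "E \<in> {{(\<omega>, t, x) \<in> space M \<times> {0..} \<times> UNIV. elementary_process Y a b A t x \<omega> \<in> C} | Y a b A C.
        elementary_data M N Y a b A \<and> C \<in> sets borel}"
    then obtain Y a b A C where E: "E = {(\<omega>, t, x) \<in> space M \<times> {0..} \<times> UNIV. elementary_process Y a b A t x \<omega> \<in> C}"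
      and d: "elementary_data M N Y a b A" and C: "C \<in> sets borel" by blast
    have "elementary_process Y a b A t x \<in> borel_measurable (noise_filtration M N t)"
    proof (cases "t \<in> {a<..b}")
      case True
      then have at: "a \<le> t" by simp
      have "Y \<in> borel_measurable (noise_filtration M N a)" using d unfolding elementary_data_def by blast
      then have "Y \<in> borel_measurable (noise_filtration M N t)" by (rule noise_filtration_mono[OF at])
      then show ?thesis unfolding elementary_process_def[abs_def]
        by (intro borel_measurable_times borel_measurable_const)
    next
      case False
      then show ?thesis by (simp add: elementary_process_def[abs_def])
    qed
    from measurable_sets[OF this C]
    show "?T -` E \<inter> space (noise_filtration M N t) \<in> sets (noise_filtration M N t)"
    proof (rule back_subst[of "\<lambda>D. D \<in> sets (noise_filtration M N t)"])
      show "elementary_process Y a b A t x -` C \<inter> space (noise_filtration M N t) = ?T -` E \<inter> space (noise_filtration M N t)"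
        using t by (auto simp: E)
    qed
  qed
  from measurable_compose[OF this g[unfolded predictable_def]] show ?thesis by simp
qed

text \<open>What matters is that \<open>y\<close> is the same for all shifts. The canonical solution
  evaluated on the shifted noise and the translated solution solve the same equation, so uniqueness
  identifies them. The relation between the canonical solution and \<open>y\<close> then moves from
  \<open>N\<close> to the shifted noise.\<close>

lemma mild_solution_shift_factor:
  assumes u: "mild_solution M \<nu> N \<kappa> u" and t: "0 \<le> t"
  shows "\<exists>y. (\<forall>x. y x \<in> borel_measurable (cnt_space (boxes t))) \<and>
    (\<forall>h x. AE \<omega> in M. u t (x + h) \<omega> = y x (cnt (Nh h) (boxes t) \<omega>)) \<and>
    (\<forall>x. AE \<omega> in M. u t x \<omega> = y x (cnt N (boxes t) \<omega>))"
proof -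
  obtain H where jH: "jointly Can (\<lambda>s x c. indicator {0..} s * H (c, s, x))"
    and uH: "AE \<omega> in M. \<forall>t\<ge>0. \<forall>x. u t x \<omega> = H (cntN \<omega>, t, x)"
    and HN: "\<And>N'. prm M \<mu> N' \<Longrightarrow> mild_solution M \<nu> N' \<kappa> (\<lambda>t x \<omega>. H (cnt N' (sets \<mu>) \<omega>, t, x))"
    using mild_solution_transfer[OF u] by blast
  have Hm: "(\<lambda>c. H (c, t, x)) \<in> borel_measurable Can" for x
    using jointly_section'[OF jH, of t x] t by simp
  have "\<forall>x. \<exists>y. y \<in> borel_measurable (cnt_space (boxes t)) \<and> (AE \<omega> in M. u t x \<omega> = y (cnt N (boxes t) \<omega>))"
    using noise_filtration_factor[OF predictable_section[OF mild_solutionD(1)[OF u] t]] by blast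
  from choice[OF this] obtain y where y: "\<And>x. y x \<in> borel_measurable (cnt_space (boxes t))" "\<And>x. AE \<omega> in M. u t x \<omega> = y x (cnt N (boxes t) \<omega>)"
    by blast
  have "AE \<omega> in M. u t (x + h) \<omega> = y x (cnt (Nh h) (boxes t) \<omega>)" for x h
  proof -
    interpret Nh: levy_noise M \<nu> "Nh h" \<kappa> by (rule levy_noise_shift)
    have 1: "AE \<omega> in M. u t (x + h) \<omega> = H (Nh.cntN \<omega>, t, x)"
      by (rule Nh.mild_solution_unique[OF mild_solution_shift[OF u] HN[OF prm_shift_noise] t])
    \<comment> \<open>The set where the two functionals agree is measurable, so that the almost sure
      identity becomes one about the law of the counts, which both noises share.\<close>
    have pm: "{c\<in>space Can. H (c, t, x) = y x (restrict c (boxes t))} \<in> sets Can"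
      using Hm measurable_restrict_boxes[OF y(1)] by (rule borel_measurable_eq)
    have "AE \<omega> in M. H (cntN \<omega>, t, x) = y x (restrict (cntN \<omega>) (boxes t))"
      using uH y(2)[of x] by eventually_elim (use t in \<open>simp add: restrict_cntN[OF boxes_sets]\<close>)
    then have "AE c in distr M Can cntN. H (c, t, x) = y x (restrict c (boxes t))"
      by (subst AE_distr_iff[OF measurable_cntN pm])
    also have "distr M Can cntN = distr M Can Nh.cntN"
      by (rule law_shift[symmetric]) simp
    finally have "AE \<omega> in M. H (Nh.cntN \<omega>, t, x) = y x (restrict (Nh.cntN \<omega>) (boxes t))"
      by (subst (asm) AE_distr_iff[OF Nh.measurable_cntN pm])
    with 1 show ?thesis
      by eventually_elim (simp add: Nh.restrict_cntN[OF boxes_sets])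
  qed
  then show ?thesis using y by blast
qed

text \<open>A finite-dimensional distribution, translated or not, is the image of the same law of
  counts under the same map; finitely many coordinates share one null event.\<close>

lemma mild_solution_stationary:
  assumes u: "mild_solution M \<nu> N \<kappa> u" and t: "0 \<le> t"
  shows "strictly_stationary M (u t)"
  unfolding strictly_stationary_def
proof (intro conjI allI impI)
  show um: "u t x \<in> borel_measurable M" for x by (rule measurable_mild_solution[OF u t])
  fix J :: "real set" and h assume "finite J"
  obtain y where y: "\<And>x. y x \<in> borel_measurable (cnt_space (boxes t))"
    "\<And>h x. AE \<omega> in M. u t (x + h) \<omega> = y x (cnt (Nh h) (boxes t) \<omega>)"
    "\<And>x. AE \<omega> in M. u t x \<omega> = y x (cnt N (boxes t) \<omega>)"
    using mild_solution_shift_factor[OF u t] by blast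
  have bs: "boxes t \<subseteq> sets \<mu>" by (rule boxes_sets)
  have F: "(\<lambda>c. \<lambda>x\<in>J. y x c) \<in> measurable (cnt_space (boxes t)) (\<Pi>\<^sub>M x\<in>J. borel)"
    using y(1) by (intro measurable_restrict) auto
  have g: "distr M (\<Pi>\<^sub>M x\<in>J. borel) (\<lambda>\<omega>. \<lambda>x\<in>J. f x \<omega>) = distr (distr M (cnt_space (boxes t)) c) (\<Pi>\<^sub>M x\<in>J. borel) (\<lambda>c. \<lambda>x\<in>J. y x c)"
    if f: "\<And>x. f x \<in> borel_measurable M" "\<And>x. AE \<omega> in M. f x \<omega> = y x (c \<omega>)" and c: "c \<in> measurable M (cnt_space (boxes t))" for f c
  proof -
    have "AE \<omega> in M. \<forall>x\<in>J. f x \<omega> = y x (c \<omega>)" using f(2) \<open>finite J\<close> by (intro AE_finite_allI) auto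
    then have "AE \<omega> in M. (\<lambda>x\<in>J. f x \<omega>) = (\<lambda>x\<in>J. y x (c \<omega>))"
      by eventually_elim (auto simp: fun_eq_iff)
    then have "distr M (\<Pi>\<^sub>M x\<in>J. borel) (\<lambda>\<omega>. \<lambda>x\<in>J. f x \<omega>) = distr M (\<Pi>\<^sub>M x\<in>J. borel) (\<lambda>\<omega>. \<lambda>x\<in>J. y x (c \<omega>))"
      using f(1) measurable_compose[OF c y(1)] by (intro distr_cong_AE refl measurable_restrict) auto
    also have "\<dots> = distr (distr M (cnt_space (boxes t)) c) (\<Pi>\<^sub>M x\<in>J. borel) (\<lambda>c. \<lambda>x\<in>J. y x c)"
      by (simp add: distr_distr[OF F c] comp_def)
    finally show ?thesis .
  qed
  show "distr M (\<Pi>\<^sub>M x\<in>J. borel) (\<lambda>\<omega>. \<lambda>x\<in>J. u t (x + h) \<omega>) = distr M (\<Pi>\<^sub>M x\<in>J. borel) (\<lambda>\<omega>. \<lambda>x\<in>J. u t x \<omega>)"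
    using g[of "\<lambda>x. u t (x + h)", OF um y(2) measurable_cnt_Nh[OF bs]] g[of "u t", OF um y(3) measurable_cnt[OF bs]]
    by (simp add: law_shift[OF bs])
qed

text \<open>An invariant event is, up to null sets, one event \<open>B\<close> for the counts of
  \<open>N\<close> and also for those of each shifted noise. Mixing of \<open>B\<close> with its
  shifts leaves a probability equal to its own square.\<close>

lemma mild_solution_ergodic:
  assumes u: "mild_solution M \<nu> N \<kappa> u" and t: "0 \<le> t"
  shows "ergodic_process M (u t)"
  unfolding ergodic_process_def
proof (intro conjI ballI impI mild_solution_stationary[OF u t])
  fix A assume A: "A \<in> sets (\<Pi>\<^sub>M x\<in>(UNIV::real set). (borel :: real measure))"
    and inv: "\<forall>h. AE \<omega> in M. (\<lambda>x. u t (x + h) \<omega>) \<in> A \<longleftrightarrow> (\<lambda>x. u t x \<omega>) \<in> A"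
  obtain y where y: "\<And>x. y x \<in> borel_measurable (cnt_space (boxes t))"
    "\<And>h x. AE \<omega> in M. u t (x + h) \<omega> = y x (cnt (Nh h) (boxes t) \<omega>)"
    "\<And>x. AE \<omega> in M. u t x \<omega> = y x (cnt N (boxes t) \<omega>)"
    using mild_solution_shift_factor[OF u t] by blast
  have bs: "boxes t \<subseteq> sets \<mu>" by (rule boxes_sets)
  let ?F = "\<lambda>c x. y x c"
  have "?F \<in> measurable (cnt_space (boxes t)) (\<Pi>\<^sub>M x\<in>(UNIV::real set). borel)"
    by (rule measurable_PiM_single') (use y(1) in auto)
  from measurable_sets[OF this A]
  have Fm: "?F -` A \<inter> space (cnt_space (boxes t)) \<in> sets (cnt_space (boxes t))" .
  define B where "B = ?F -` A \<inter> space (cnt_space (boxes t))"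
  have B: "B \<in> sets (cnt_space (boxes t))" using Fm by (simp add: B_def)
  have cs: "cnt N' (boxes t) \<omega> \<in> space (cnt_space (boxes t))" for N' and \<omega> :: 'w by (simp add: cnt_def space_PiM)
  let ?E = "{\<omega>\<in>space M. (\<lambda>x. u t x \<omega>) \<in> A}"
  have um: "u t x \<in> borel_measurable M" for x by (rule measurable_mild_solution[OF u t])
  have "(\<lambda>\<omega> x. u t x \<omega>) \<in> measurable M (\<Pi>\<^sub>M x\<in>(UNIV::real set). borel)"
    by (rule measurable_PiM_single') (use um in auto)
  from measurable_sets[OF this A] have E: "?E \<in> events" by (simp add: vimage_def Int_def conj_commute)
  have AE0: "AE \<omega> in M. (\<lambda>x. u t x \<omega>) \<in> A \<longleftrightarrow> cnt N (boxes t) \<omega> \<in> B"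
    using AE_PiM_mem_cong[OF y(3) A] by eventually_elim (simp add: B_def cs)
  have AEn: "AE \<omega> in M. (\<lambda>x. u t x \<omega>) \<in> A \<longleftrightarrow> cnt (Nh h) (boxes t) \<omega> \<in> B" for h
    using AE_PiM_mem_cong[where M=M and f="\<lambda>x. u t (x + h)" and g="\<lambda>x \<omega>. y x (cnt (Nh h) (boxes t) \<omega>)", OF y(2) A] inv[rule_format, of h] by eventually_elim (simp add: B_def cs)
  have cN: "cnt N (boxes t) -` B \<inter> space M \<in> events" by (rule measurable_sets[OF measurable_cnt[OF bs] B])
  have cNh: "cnt (Nh h) (boxes t) -` B \<inter> space M \<in> events" for h by (rule measurable_sets[OF measurable_cnt_Nh[OF bs] B])
  have p0: "prob (cnt N (boxes t) -` B \<inter> space M) = prob ?E"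
    by (rule finite_measure_eq_AE[OF _ cN E]) (use AE0 AE_space in eventually_elim, auto)
  have pn: "prob (cnt N (boxes t) -` B \<inter> cnt (Nh h) (boxes t) -` B \<inter> space M) = prob ?E" for h
  proof (rule finite_measure_eq_AE[OF _ _ E])
    have "cnt N (boxes t) -` B \<inter> cnt (Nh h) (boxes t) -` B \<inter> space M = (cnt N (boxes t) -` B \<inter> space M) \<inter> (cnt (Nh h) (boxes t) -` B \<inter> space M)" by auto
    then show "cnt N (boxes t) -` B \<inter> cnt (Nh h) (boxes t) -` B \<inter> space M \<in> events" using cN cNh[of h] by auto
    show "AE \<omega> in M. \<omega> \<in> cnt N (boxes t) -` B \<inter> cnt (Nh h) (boxes t) -` B \<inter> space M \<longleftrightarrow> \<omega> \<in> ?E"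
      using AE0 AEn[of h] AE_space by eventually_elim auto
  qed
  have "(\<lambda>n::nat. prob ?E) \<longlonglongrightarrow> prob ?E * prob ?E"
    using noise_mixing[OF B B] unfolding pn p0 .
  then have "prob ?E = prob ?E * prob ?E" by (simp add: LIMSEQ_const_iff)
  then show "prob ?E \<in> {0, 1}" by auto
qed

end

section \<open>A law of large numbers for random fields on the line\<close>

text \<open>The chord bound for a convex function on the unit interval. It will compare consecutive
  members of the sequence \<open>(k + 1) ^ p\<close>.\<close>

lemma power_one_plus_le:
  fixes x :: real
  assumes "0 \<le> x" "x \<le> 1"
  shows "(1 + x) ^ p \<le> 1 + (2 ^ p - 1) * x"
proof (induction p)
  case (Suc p)
  have "(1 + x) ^ Suc p \<le> (1 + x) * (1 + (2 ^ p - 1) * x)"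
    using Suc assms by (simp add: mult_left_mono)
  also have "\<dots> = 1 + 2 ^ p * x + (2 ^ p - 1) * (x * x)" by (simp add: algebra_simps)
  also have "\<dots> \<le> 1 + 2 ^ p * x + (2 ^ p - 1) * x"
    using assms by (intro add_left_mono mult_left_mono mult_left_le) auto
  also have "\<dots> = 1 + (2 ^ Suc p - 1) * x" by (simp add: algebra_simps)
  finally show ?case .
qed simp

text \<open>The law of large numbers separated from the equation. Only joint measurability, bounded
  second moments and the growth of the second moments of translated lattice sums are
  recorded.\<close>

locale random_field = prob_space M for M :: "'w measure" +
  fixes f :: "real \<Rightarrow> 'w \<Rightarrow> real" and B K b :: real
  assumes f_meas: "(\<lambda>(\<omega>, x). f x \<omega>) \<in> borel_measurable (M \<Otimes>\<^sub>M borel)"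
    and f_bound: "\<And>x. nsq M (f x) \<le> ennreal B"
    and sum_bound: "\<And>n \<theta>. 1 \<le> n \<Longrightarrow> 0 \<le> \<theta> \<Longrightarrow> \<theta> < 1 \<Longrightarrow>
      nsq M (\<lambda>\<omega>. \<Sum>j\<in>{- int n..<int n}. f (\<theta> + of_int j) \<omega>) \<le> ennreal (K * real n powr (1 + b))"
    and const_bounds: "0 \<le> B" "0 \<le> K" "0 \<le> b" "b < 1"
begin

lemma measurable_f[measurable (raw)]:
  assumes [measurable]: "g \<in> measurable P M" "h \<in> borel_measurable P"
  shows "(\<lambda>p. f (h p) (g p)) \<in> borel_measurable P"
proof -
  have "(\<lambda>p. (g p, h p)) \<in> measurable P (M \<Otimes>\<^sub>M borel)" by measurable
  from measurable_compose[OF this f_meas] show ?thesis by simp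
qed

lemma measurable_f_section: "\<omega> \<in> space M \<Longrightarrow> (\<lambda>x. f x \<omega>) \<in> borel_measurable borel"
  using measurable_f[of "\<lambda>_. \<omega>" borel "\<lambda>x. x"] by simp

lemma measurable_f_at: "f x \<in> borel_measurable M"
  using measurable_f[of "\<lambda>\<omega>. \<omega>" M "\<lambda>_. x"] by simp

text \<open>Extended-valued, so that it can be estimated before local integrability of the paths is
  known; the estimate then provides it.\<close>

definition absint :: "real set \<Rightarrow> 'w \<Rightarrow> ennreal" where
  "absint S \<omega> = (\<integral>\<^sup>+x. ennreal \<bar>f x \<omega>\<bar> * indicator S x \<partial>lborel)"

definition Sint :: "real \<Rightarrow> 'w \<Rightarrow> real" where
  "Sint R \<omega> = (LINT x:{-R..R}|lborel. f x \<omega>)"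

lemma measurable_absint: "S \<in> sets borel \<Longrightarrow> absint S \<in> borel_measurable M"
proof -
  assume [measurable]: "S \<in> sets borel"
  have "(\<lambda>p. ennreal \<bar>f (snd p) (fst p)\<bar> * indicator S (snd p)) \<in> borel_measurable (M \<Otimes>\<^sub>M lborel)" by measurable
  from lborel.borel_measurable_nn_integral_fst[OF this] show ?thesis unfolding absint_def[abs_def] by simp
qed

lemma measurable_Sint: "Sint R \<in> borel_measurable M"
proof -
  have "(\<lambda>p. indicator {-R..R} (snd p) *\<^sub>R f (snd p) (fst p)) \<in> borel_measurable (M \<Otimes>\<^sub>M lborel)" by measurable
  then have "(\<lambda>(\<omega>, x). indicator {-R..R} x *\<^sub>R f x \<omega>) \<in> borel_measurable (M \<Otimes>\<^sub>M lborel)" by (simp add: split_beta')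
  from lborel.borel_measurable_lebesgue_integral[OF this] show ?thesis
    unfolding Sint_def[abs_def] set_lebesgue_integral_def .
qed

text \<open>Cauchy-Schwarz costs one factor \<open>s\<close>; taking the expectation inside the
  integral costs another, together with the bound \<open>B\<close>.\<close>

lemma absint_square:
  assumes S: "S \<in> sets borel" and s: "emeasure lborel S = ennreal s" "0 \<le> s"
  shows "(\<integral>\<^sup>+\<omega>. (absint S \<omega>)\<^sup>2 \<partial>M) \<le> ennreal (s\<^sup>2 * B)"
proof -
  note [measurable] = S
  interpret P: pair_sigma_finite lborel M ..
  have "(\<integral>\<^sup>+\<omega>. (absint S \<omega>)\<^sup>2 \<partial>M) \<le> (\<integral>\<^sup>+\<omega>. (\<integral>\<^sup>+x. ennreal ((f x \<omega>)\<^sup>2) * indicator S x \<partial>lborel) * ennreal s \<partial>M)"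
  proof (rule nn_integral_mono)
    fix \<omega> assume \<omega>: "\<omega> \<in> space M"
    note [measurable] = measurable_f_section[OF \<omega>]
    have "(absint S \<omega>)\<^sup>2 = (\<integral>\<^sup>+x. (ennreal \<bar>f x \<omega>\<bar> * indicator S x) * indicator S x \<partial>lborel)\<^sup>2"
      unfolding absint_def by (intro arg_cong[where f="\<lambda>x. x\<^sup>2"] nn_integral_cong) (simp add: indicator_def)
    also have "\<dots> \<le> (\<integral>\<^sup>+x. (ennreal \<bar>f x \<omega>\<bar> * indicator S x)\<^sup>2 \<partial>lborel) * (\<integral>\<^sup>+x. (indicator S x)\<^sup>2 \<partial>lborel)"
      by (rule Cauchy_Schwarz_nn_integral) auto
    also have "(\<integral>\<^sup>+x. (indicator S x)\<^sup>2 \<partial>lborel) = (\<integral>\<^sup>+x. indicator S x \<partial>lborel)"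
      by (intro nn_integral_cong) (simp add: indicator_def)
    also have "\<dots> = ennreal s" using s by simp
    also have "(\<integral>\<^sup>+x. (ennreal \<bar>f x \<omega>\<bar> * indicator S x)\<^sup>2 \<partial>lborel) = (\<integral>\<^sup>+x. ennreal ((f x \<omega>)\<^sup>2) * indicator S x \<partial>lborel)"
      by (intro nn_integral_cong) (simp add: indicator_def ennreal_power)
    finally show "(absint S \<omega>)\<^sup>2 \<le> (\<integral>\<^sup>+x. ennreal ((f x \<omega>)\<^sup>2) * indicator S x \<partial>lborel) * ennreal s" .
  qed
  also have "\<dots> = (\<integral>\<^sup>+\<omega>. (\<integral>\<^sup>+x. ennreal ((f x \<omega>)\<^sup>2) * indicator S x \<partial>lborel) \<partial>M) * ennreal s"
  proof (rule nn_integral_multc)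
    have "(\<lambda>p. ennreal ((f (snd p) (fst p))\<^sup>2) * indicator S (snd p)) \<in> borel_measurable (M \<Otimes>\<^sub>M lborel)" by measurable
    from lborel.borel_measurable_nn_integral_fst[OF this]
    show "(\<lambda>\<omega>. \<integral>\<^sup>+x. ennreal ((f x \<omega>)\<^sup>2) * indicator S x \<partial>lborel) \<in> borel_measurable M" by simp
  qed
  also have "(\<integral>\<^sup>+\<omega>. (\<integral>\<^sup>+x. ennreal ((f x \<omega>)\<^sup>2) * indicator S x \<partial>lborel) \<partial>M) = (\<integral>\<^sup>+x. (\<integral>\<^sup>+\<omega>. ennreal ((f x \<omega>)\<^sup>2) * indicator S x \<partial>M) \<partial>lborel)"
  proof (rule P.Fubini')
    show "(\<lambda>(x, \<omega>). ennreal ((f x \<omega>)\<^sup>2) * indicator S x) \<in> borel_measurable (lborel \<Otimes>\<^sub>M M)"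
      unfolding split_beta' by measurable
  qed
  also have "\<dots> \<le> (\<integral>\<^sup>+x. ennreal B * indicator S x \<partial>lborel)"
  proof (rule nn_integral_mono)
    fix x
    have "(\<integral>\<^sup>+\<omega>. ennreal ((f x \<omega>)\<^sup>2) * indicator S x \<partial>M) = nsq M (f x) * indicator S x"
      unfolding nsq_def using measurable_f_at[of x] by (subst nn_integral_multc) auto
    then show "(\<integral>\<^sup>+\<omega>. ennreal ((f x \<omega>)\<^sup>2) * indicator S x \<partial>M) \<le> ennreal B * indicator S x"
      using f_bound[of x] by (simp add: mult_right_mono)
  qed
  also have "\<dots> = ennreal B * ennreal s" using s by (simp add: nn_integral_cmult_indicator)
  also have "ennreal B * ennreal s * ennreal s = ennreal (s\<^sup>2 * B)"
    using const_bounds s by (simp add: ennreal_mult[symmetric] power2_eq_square mult_ac)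
  finally show ?thesis by (simp add: mult_right_mono)
qed

text \<open>Integer radii keep the event measurable up to a countable intersection of almost sure
  events, and every bounded set is inside one of them.\<close>

definition good :: "'w \<Rightarrow> bool" where
  "good \<omega> \<longleftrightarrow> \<omega> \<in> space M \<and> (\<forall>m::nat. absint {- real m..real m} \<omega> < \<infinity>)"

lemma AE_good: "AE \<omega> in M. good \<omega>"
proof -
  have "AE \<omega> in M. absint {- real m..real m} \<omega> < \<infinity>" for m :: nat
  proof -
    have "(\<integral>\<^sup>+\<omega>. (absint {- real m..real m} \<omega>)\<^sup>2 \<partial>M) \<le> ennreal ((2 * real m)\<^sup>2 * B)"
      by (rule absint_square) (auto simp: emeasure_lborel_Icc_eq)
    then have "(\<integral>\<^sup>+\<omega>. (absint {- real m..real m} \<omega>)\<^sup>2 \<partial>M) \<noteq> \<infinity>" by (auto simp: top_unique)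
    then have "AE \<omega> in M. (absint {- real m..real m} \<omega>)\<^sup>2 \<noteq> \<infinity>"
      using measurable_absint by (intro nn_integral_PInf_AE) auto
    then show ?thesis by eventually_elim (simp add: top.not_eq_extremum[symmetric] power2_eq_square ennreal_mult_eq_top_iff)
  qed
  then have "AE \<omega> in M. \<forall>m::nat. absint {- real m..real m} \<omega> < \<infinity>" by (simp add: AE_all_countable)
  then show ?thesis using AE_space by eventually_elim (simp add: good_def)
qed

lemma good_absint:
  assumes "good \<omega>" "S \<subseteq> {-R..R}"
  shows "absint S \<omega> < \<infinity>"
proof -
  obtain m :: nat where m: "R \<le> real m" using real_arch_simple by blast
  have "absint S \<omega> \<le> absint {- real m..real m} \<omega>"
    unfolding absint_def using assms(2) m by (intro nn_integral_mono mult_left_mono) (auto simp: indicator_def)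
  then show ?thesis using assms(1) by (auto simp: good_def intro: le_less_trans)
qed

lemma good_integrable:
  assumes g: "good \<omega>" and S: "S \<subseteq> {-R..R}" "S \<in> sets borel"
  shows "integrable lborel (\<lambda>x. indicator S x * f x \<omega>)"
proof (rule integrableI_bounded)
  note [measurable] = S(2) measurable_f_section[of \<omega>]
  show "(\<lambda>x. indicator S x * f x \<omega>) \<in> borel_measurable lborel" using g by (simp add: good_def)
  have "(\<integral>\<^sup>+x. ennreal (norm (indicator S x * f x \<omega>)) \<partial>lborel) = absint S \<omega>"
    unfolding absint_def by (intro nn_integral_cong) (simp add: indicator_def)
  then show "(\<integral>\<^sup>+x. ennreal (norm (indicator S x * f x \<omega>)) \<partial>lborel) < \<infinity>" using good_absint[OF g S(1)] by simp
qed

lemma set_integrable_good: "good \<omega> \<Longrightarrow> set_integrable lborel {-R..R} (\<lambda>x. f x \<omega>)"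
  unfolding set_integrable_def using good_integrable[of \<omega> "{-R..R}" R] by simp

lemma Sint_gap:
  assumes g: "good \<omega>" and aR: "0 \<le> a" "a \<le> R"
  shows "ennreal \<bar>Sint R \<omega> - Sint a \<omega>\<bar> \<le> absint {x. a < \<bar>x\<bar> \<and> \<bar>x\<bar> \<le> R} \<omega>"
proof -
  let ?S = "{x. a < \<bar>x\<bar> \<and> \<bar>x\<bar> \<le> R}"
  have i: "integrable lborel (\<lambda>x. indicator ?S x * f x \<omega>)" by (rule good_integrable[OF g, where R=R]) auto
  have "Sint R \<omega> - Sint a \<omega> = (\<integral>x. indicator {-R..R} x * f x \<omega> - indicator {-a..a} x * f x \<omega> \<partial>lborel)"
    unfolding Sint_def set_lebesgue_integral_def
    using good_integrable[OF g, of "{-R..R}" R] good_integrable[OF g, of "{-a..a}" a] by simp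
  also have "\<dots> = (\<integral>x. indicator ?S x * f x \<omega> \<partial>lborel)"
    using aR by (intro Bochner_Integration.integral_cong refl) (auto simp: indicator_def)
  finally have "ennreal \<bar>Sint R \<omega> - Sint a \<omega>\<bar> \<le> (\<integral>\<^sup>+x. ennreal (norm (indicator ?S x * f x \<omega>)) \<partial>lborel)"
    using integral_norm_bound_ennreal[OF i] by simp
  also have "\<dots> = absint ?S \<omega>"
    unfolding absint_def by (intro nn_integral_cong) (simp add: indicator_def)
  finally show ?thesis .
qed

lemma gap_square:
  assumes "0 \<le> a" "a \<le> R"
  shows "(\<integral>\<^sup>+\<omega>. (absint {x. a < \<bar>x\<bar> \<and> \<bar>x\<bar> \<le> R} \<omega>)\<^sup>2 \<partial>M) \<le> ennreal ((2 * (R - a))\<^sup>2 * B)"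
proof (rule absint_square)
  have "{x. a < \<bar>x\<bar> \<and> \<bar>x\<bar> \<le> R} = {-R..<-a} \<union> {a<..R}" using assms by auto
  then have "emeasure lborel {x. a < \<bar>x\<bar> \<and> \<bar>x\<bar> \<le> R} = emeasure lborel {-R..<-a} + emeasure lborel {a<..R}"
    using assms by (simp only:) (rule plus_emeasure[symmetric], auto)
  also have "\<dots> = ennreal (2 * (R - a))"
    using assms by (simp flip: ennreal_plus)
  finally show "emeasure lborel {x. a < \<bar>x\<bar> \<and> \<bar>x\<bar> \<le> R} = ennreal (2 * (R - a))" .
qed (use assms in auto)

text \<open>The integral over \<open>[-n, n]\<close> is the average over \<theta> in the unit
  interval of the lattice sums. The square of an average is at most the average of the squares, here
  by Cauchy-Schwarz against the indicator of an interval of length one.\<close>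

lemma Sint_decomp:
  assumes g: "good \<omega>" and n: "1 \<le> n"
  shows "ennreal ((Sint (real n) \<omega>)\<^sup>2) \<le> (\<integral>\<^sup>+\<theta>. ennreal ((\<Sum>j\<in>{- int n..<int n}. f (\<theta> + of_int j) \<omega>)\<^sup>2) * indicator {0..<1} \<theta> \<partial>lborel)"
proof -
  let ?J = "{- int n..<int n}"
  let ?s = "\<lambda>\<theta>. \<Sum>j\<in>?J. f (\<theta> + of_int j) \<omega>"
  have [measurable]: "(\<lambda>x. f x \<omega>) \<in> borel_measurable borel" using g measurable_f_section by (simp add: good_def)
  have sub: "{real_of_int j..<real_of_int j + 1} \<subseteq> {- real n..real n}" if "j \<in> ?J" for j
  proof
    fix x assume x: "x \<in> {real_of_int j..<real_of_int j + 1}"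
    from that have "- int n \<le> j" "j + 1 \<le> int n" by auto
    then have "real_of_int (- int n) \<le> real_of_int j" "real_of_int (j + 1) \<le> real_of_int (int n)" by (simp_all only: of_int_le_iff)
    then show "x \<in> {- real n..real n}" using x by auto
  qed
  \<comment> \<open>Half-open unit intervals make this an exact partition: the only term that counts
    is that of the integer part of \<open>x\<close>. The endpoint \<open>n\<close> left out is
    null.\<close>
  have ind: "indicator {- real n..<real n} x = (\<Sum>j\<in>?J. indicator {real_of_int j..<real_of_int j + 1} x :: real)" for x
  proof -
    have eq: "indicator {real_of_int j..<real_of_int j + 1} x = (if j = \<lfloor>x\<rfloor> then 1 else 0 :: real)" for j
      by (simp add: indicator_def floor_eq_iff[symmetric] eq_commute)
    have mem: "x \<in> {- real n..<real n} \<longleftrightarrow> \<lfloor>x\<rfloor> \<in> ?J"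
      by (auto simp: le_floor_iff floor_less_iff)
    show ?thesis unfolding eq using mem by (simp add: indicator_def)
  qed
  have shift: "has_bochner_integral lborel (\<lambda>\<theta>. indicator {0..<1} \<theta> * f (\<theta> + of_int j) \<omega>) (\<integral>x. indicator {real_of_int j..<real_of_int j + 1} x * f x \<omega> \<partial>lborel)"
    if "j \<in> ?J" for j
  proof -
    have i: "integrable lborel (\<lambda>x. indicator {real_of_int j..<real_of_int j + 1} x * f x \<omega>)"
      by (rule good_integrable[OF g sub[OF that]]) simp
    have eq: "indicator {real_of_int j..<real_of_int j + 1} (of_int j + 1 * \<theta>) * f (of_int j + 1 * \<theta>) \<omega> = indicator {0..<1} \<theta> * f (\<theta> + of_int j) \<omega>" for \<theta>
      by (simp add: indicator_def add.commute)
    show ?thesis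
      using lborel_integrable_real_affine[OF i, of 1 "of_int j"] lborel_integral_real_affine[of 1 "\<lambda>x. indicator {real_of_int j..<real_of_int j + 1} x * f x \<omega>" "of_int j"]
      unfolding eq by (simp add: has_bochner_integral_iff)
  qed
  have "Sint (real n) \<omega> = (\<integral>x. indicator {- real n..<real n} x * f x \<omega> \<partial>lborel)"
    unfolding Sint_def set_lebesgue_integral_def
  proof (rule integral_cong_AE)
    have "AE x in lborel. x \<noteq> real n" by (rule AE_lborel_singleton)
    then show "AE x in lborel. indicator {- real n..real n} x *\<^sub>R f x \<omega> = indicator {- real n..<real n} x * f x \<omega>"
      by eventually_elim (auto simp: indicator_def)
  qed auto
  also have "\<dots> = (\<integral>x. (\<Sum>j\<in>?J. indicator {real_of_int j..<real_of_int j + 1} x * f x \<omega>) \<partial>lborel)"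
    by (simp only: ind sum_distrib_right)
  also have "\<dots> = (\<Sum>j\<in>?J. (\<integral>x. indicator {real_of_int j..<real_of_int j + 1} x * f x \<omega> \<partial>lborel))"
    by (rule Bochner_Integration.integral_sum) (rule good_integrable[OF g sub], auto)
  finally have S: "has_bochner_integral lborel (\<lambda>\<theta>. \<Sum>j\<in>?J. indicator {0..<1} \<theta> * f (\<theta> + of_int j) \<omega>) (Sint (real n) \<omega>)"
    using has_bochner_integral_sum[OF shift, of ?J] by simp
  then have S': "has_bochner_integral lborel (\<lambda>\<theta>. indicator {0..<1} \<theta> * ?s \<theta>) (Sint (real n) \<omega>)"
    by (simp add: sum_distrib_left)
  have "ennreal \<bar>Sint (real n) \<omega>\<bar> \<le> (\<integral>\<^sup>+\<theta>. ennreal \<bar>?s \<theta>\<bar> * indicator {0..<1} \<theta> * indicator {0..<1} \<theta> \<partial>lborel)"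
  proof -
    have "ennreal (norm (\<integral>\<theta>. indicator {0..<1} \<theta> * ?s \<theta> \<partial>lborel)) \<le> (\<integral>\<^sup>+\<theta>. ennreal (norm (indicator {0..<1} \<theta> * ?s \<theta>)) \<partial>lborel)"
      using S' by (intro integral_norm_bound_ennreal) (simp add: has_bochner_integral_iff)
    also have "\<dots> = (\<integral>\<^sup>+\<theta>. ennreal \<bar>?s \<theta>\<bar> * indicator {0..<1} \<theta> * indicator {0..<1} \<theta> \<partial>lborel)"
      by (intro nn_integral_cong) (simp add: indicator_def)
    finally show ?thesis using has_bochner_integral_integral_eq[OF S'] by simp
  qed
  then have "(ennreal \<bar>Sint (real n) \<omega>\<bar>)\<^sup>2 \<le> (\<integral>\<^sup>+\<theta>. ennreal \<bar>?s \<theta>\<bar> * indicator {0..<1} \<theta> * indicator {0..<1} \<theta> \<partial>lborel)\<^sup>2"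
    by (rule power_mono) simp
  also have "\<dots> \<le> (\<integral>\<^sup>+\<theta>. (ennreal \<bar>?s \<theta>\<bar> * indicator {0..<1} \<theta>)\<^sup>2 \<partial>lborel) * (\<integral>\<^sup>+\<theta>. (indicator {0..<1::real} \<theta>)\<^sup>2 \<partial>lborel)"
    by (rule Cauchy_Schwarz_nn_integral) measurable
  also have "(\<integral>\<^sup>+\<theta>. (indicator {0..<1::real} \<theta>)\<^sup>2 \<partial>lborel) = (\<integral>\<^sup>+\<theta>. indicator {0..<1::real} \<theta> \<partial>lborel)"
    by (intro nn_integral_cong) (simp add: indicator_def)
  also have "\<dots> = 1" by simp
  also have "(\<integral>\<^sup>+\<theta>. (ennreal \<bar>?s \<theta>\<bar> * indicator {0..<1} \<theta>)\<^sup>2 \<partial>lborel) = (\<integral>\<^sup>+\<theta>. ennreal ((?s \<theta>)\<^sup>2) * indicator {0..<1} \<theta> \<partial>lborel)"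
    by (intro nn_integral_cong) (simp add: indicator_def ennreal_power)
  finally show ?thesis by (simp add: ennreal_power)
qed

lemma nsq_Sint:
  assumes n: "1 \<le> n"
  shows "nsq M (Sint (real n)) \<le> ennreal (K * real n powr (1 + b))"
proof -
  let ?J = "{- int n..<int n}"
  interpret P: pair_sigma_finite lborel M ..
  have "nsq M (Sint (real n)) \<le> (\<integral>\<^sup>+\<omega>. (\<integral>\<^sup>+\<theta>. ennreal ((\<Sum>j\<in>?J. f (\<theta> + of_int j) \<omega>)\<^sup>2) * indicator {0..<1} \<theta> \<partial>lborel) \<partial>M)"
    unfolding nsq_def by (rule nn_integral_mono_AE) (use AE_good in eventually_elim, rule Sint_decomp[OF _ n])
  also have "\<dots> = (\<integral>\<^sup>+\<theta>. (\<integral>\<^sup>+\<omega>. ennreal ((\<Sum>j\<in>?J. f (\<theta> + of_int j) \<omega>)\<^sup>2) * indicator {0..<1} \<theta> \<partial>M) \<partial>lborel)"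
  proof (rule P.Fubini')
    show "(\<lambda>(\<theta>, \<omega>). ennreal ((\<Sum>j\<in>?J. f (\<theta> + of_int j) \<omega>)\<^sup>2) * indicator {0..<1} \<theta>) \<in> borel_measurable (lborel \<Otimes>\<^sub>M M)"
      unfolding split_beta' by measurable
  qed
  also have "\<dots> \<le> (\<integral>\<^sup>+\<theta>. ennreal (K * real n powr (1 + b)) * indicator {0..<1::real} \<theta> \<partial>lborel)"
  proof (rule nn_integral_mono)
    fix \<theta> :: real
    show "(\<integral>\<^sup>+\<omega>. ennreal ((\<Sum>j\<in>?J. f (\<theta> + of_int j) \<omega>)\<^sup>2) * indicator {0..<1} \<theta> \<partial>M) \<le> ennreal (K * real n powr (1 + b)) * indicator {0..<1} \<theta>"
      using sum_bound[OF n, of \<theta>] by (cases "\<theta> \<in> {0..<1}") (auto simp: nsq_def)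
  qed
  also have "\<dots> = ennreal (K * real n powr (1 + b))" by (simp add: nn_integral_cmult_indicator)
  finally show ?thesis .
qed

lemma nsq_Sint_real:
  assumes R: "1 \<le> R"
  shows "nsq M (Sint R) \<le> ennreal (2 * K * R powr (1 + b) + 8 * B)"
proof -
  \<comment> \<open>Rounding down to an integer radius leaves two intervals of total length at most
    \<open>2\<close>, whose contribution is bounded by \<open>4 * B\<close>.\<close>
  define n where "n = nat \<lfloor>R\<rfloor>"
  have n: "1 \<le> n" "real n \<le> R" "R - real n \<le> 1" using R unfolding n_def by linarith+
  have "nsq M (Sint R) \<le> (\<integral>\<^sup>+\<omega>. 2 * ennreal ((Sint (real n) \<omega>)\<^sup>2) + 2 * (absint {x. real n < \<bar>x\<bar> \<and> \<bar>x\<bar> \<le> R} \<omega>)\<^sup>2 \<partial>M)"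
    unfolding nsq_def
  proof (rule nn_integral_mono_AE, use AE_good in eventually_elim)
    fix \<omega> assume g: "good \<omega>"
    have "(ennreal \<bar>Sint R \<omega> - Sint (real n) \<omega>\<bar>)\<^sup>2 \<le> (absint {x. real n < \<bar>x\<bar> \<and> \<bar>x\<bar> \<le> R} \<omega>)\<^sup>2"
      by (rule power_mono[OF Sint_gap[OF g _ n(2)]]) auto
    then have 1: "ennreal ((Sint R \<omega> - Sint (real n) \<omega>)\<^sup>2) \<le> (absint {x. real n < \<bar>x\<bar> \<and> \<bar>x\<bar> \<le> R} \<omega>)\<^sup>2"
      by (simp add: ennreal_power)
    have "ennreal ((Sint R \<omega>)\<^sup>2) = ennreal ((Sint (real n) \<omega> + (Sint R \<omega> - Sint (real n) \<omega>))\<^sup>2)" by simp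
    also have "\<dots> \<le> 2 * ennreal ((Sint (real n) \<omega>)\<^sup>2) + 2 * ennreal ((Sint R \<omega> - Sint (real n) \<omega>)\<^sup>2)"
      by (rule ennreal_square_add_le)
    also have "\<dots> \<le> 2 * ennreal ((Sint (real n) \<omega>)\<^sup>2) + 2 * (absint {x. real n < \<bar>x\<bar> \<and> \<bar>x\<bar> \<le> R} \<omega>)\<^sup>2"
      by (intro add_left_mono mult_left_mono 1) simp
    finally show "ennreal ((Sint R \<omega>)\<^sup>2) \<le> 2 * ennreal ((Sint (real n) \<omega>)\<^sup>2) + 2 * (absint {x. real n < \<bar>x\<bar> \<and> \<bar>x\<bar> \<le> R} \<omega>)\<^sup>2" .
  qed
  also have "\<dots> = 2 * nsq M (Sint (real n)) + 2 * (\<integral>\<^sup>+\<omega>. (absint {x. real n < \<bar>x\<bar> \<and> \<bar>x\<bar> \<le> R} \<omega>)\<^sup>2 \<partial>M)"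
  proof -
    have [measurable]: "absint {x. real n < \<bar>x\<bar> \<and> \<bar>x\<bar> \<le> R} \<in> borel_measurable M" by (rule measurable_absint) measurable
    note [measurable] = measurable_Sint
    show ?thesis by (simp add: nsq_def nn_integral_add nn_integral_cmult)
  qed
  also have "\<dots> \<le> 2 * ennreal (K * R powr (1 + b)) + 2 * ennreal (4 * B)"
  proof (intro add_mono mult_left_mono)
    have "nsq M (Sint (real n)) \<le> ennreal (K * real n powr (1 + b))" by (rule nsq_Sint[OF n(1)])
    also have "\<dots> \<le> ennreal (K * R powr (1 + b))"
      using n const_bounds by (intro ennreal_leI mult_left_mono powr_mono2) auto
    finally show "nsq M (Sint (real n)) \<le> ennreal (K * R powr (1 + b))" .
    have "(\<integral>\<^sup>+\<omega>. (absint {x. real n < \<bar>x\<bar> \<and> \<bar>x\<bar> \<le> R} \<omega>)\<^sup>2 \<partial>M) \<le> ennreal ((2 * (R - real n))\<^sup>2 * B)"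
      by (rule gap_square) (use n in auto)
    also have "\<dots> \<le> ennreal (2\<^sup>2 * B)"
      using n const_bounds by (intro ennreal_leI mult_right_mono power_mono) auto
    finally show "(\<integral>\<^sup>+\<omega>. (absint {x. real n < \<bar>x\<bar> \<and> \<bar>x\<bar> \<le> R} \<omega>)\<^sup>2 \<partial>M) \<le> ennreal (4 * B)" by simp
  qed auto
  also have "\<dots> = ennreal (2 * K * R powr (1 + b) + 8 * B)"
    using const_bounds by (simp add: ennreal_mult' mult.assoc)
  finally show ?thesis .
qed

text \<open>After division by \<open>R^2\<close> the bound is a combination of
  \<open>R powr (b - 1)\<close> and \<open>R powr (- 2)\<close>, both of negative exponent because
  \<open>b < 1\<close>.\<close>

lemma mean_square_convergence:
  "tendsto_L2 M (\<lambda>R \<omega>. 1 / R * Sint R \<omega>) (\<lambda>\<omega>. 0) at_top"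
proof -
  have m: "(\<lambda>\<omega>. 1 / R * Sint R \<omega>) \<in> borel_measurable M" for R using measurable_Sint[of R] by simp
  have nb: "nsq M (\<lambda>\<omega>. 1 / R * Sint R \<omega>) \<le> ennreal (2 * K * R powr (b - 1) + 8 * B * R powr (- 2))" if R: "1 \<le> R" for R
  proof -
    have "nsq M (\<lambda>\<omega>. 1 / R * Sint R \<omega>) = ennreal ((1 / R)\<^sup>2) * nsq M (Sint R)" by (rule nsq_cmult[OF measurable_Sint])
    also have "\<dots> \<le> ennreal ((1 / R)\<^sup>2) * ennreal (2 * K * R powr (1 + b) + 8 * B)"
      by (intro mult_left_mono nsq_Sint_real R) simp
    also have "\<dots> = ennreal ((1 / R)\<^sup>2 * (2 * K * R powr (1 + b) + 8 * B))" by (simp add: ennreal_mult')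
    also have "(1 / R)\<^sup>2 * (2 * K * R powr (1 + b) + 8 * B) = 2 * K * R powr (b - 1) + 8 * B * R powr (- 2)"
    proof -
      have 2: "(1 / R)\<^sup>2 = R powr (- 2)" using R by (simp add: powr_minus power_divide divide_inverse power_inverse)
      have "R powr (- 2) * R powr (1 + b) = R powr (b - 1)" using R by (simp add: powr_add[symmetric])
      then show ?thesis unfolding 2 by (simp add: algebra_simps)
    qed
    finally show ?thesis .
  qed
  have fin: "nsq M (\<lambda>\<omega>. 1 / R * Sint R \<omega>) < \<infinity>" if "1 \<le> R" for R
    using nb[OF that] by (auto intro: le_less_trans)
  have lim: "((\<lambda>R. 2 * K * R powr (b - 1) + 8 * B * R powr (- 2)) \<longlongrightarrow> 0) at_top"
  proof -
    have "((\<lambda>R. 2 * K * R powr (b - 1) + 8 * B * R powr (- 2)) \<longlongrightarrow> 2 * K * 0 + 8 * B * 0) at_top"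
      using const_bounds by (intro tendsto_intros tendsto_neg_powr filterlim_ident) auto
    then show ?thesis by simp
  qed
  have conv: "((\<lambda>R. \<integral>\<omega>. (1 / R * Sint R \<omega>)\<^sup>2 \<partial>M) \<longlongrightarrow> 0) at_top"
  proof (rule tendsto_sandwich[OF _ _ tendsto_const lim])
    show "\<forall>\<^sub>F R in at_top. 0 \<le> (\<integral>\<omega>. (1 / R * Sint R \<omega>)\<^sup>2 \<partial>M)" by (rule always_eventually) simp
    show "\<forall>\<^sub>F R in at_top. (\<integral>\<omega>. (1 / R * Sint R \<omega>)\<^sup>2 \<partial>M) \<le> 2 * K * R powr (b - 1) + 8 * B * R powr (- 2)"
      using eventually_ge_at_top[of 1]
    proof eventually_elim
      case (elim R)
      have "ennreal (\<integral>\<omega>. (1 / R * Sint R \<omega>)\<^sup>2 \<partial>M) \<le> ennreal (2 * K * R powr (b - 1) + 8 * B * R powr (- 2))"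
        using nb[OF elim] nsq_eq_integral[OF m fin[OF elim]] by simp
      then show ?case using const_bounds by (subst (asm) ennreal_le_iff) auto
    qed
  qed
  show ?thesis
    unfolding tendsto_L2_def
  proof (intro conjI)
    show "\<forall>\<^sub>F R in at_top. (\<lambda>\<omega>. 1 / R * Sint R \<omega>) \<in> borel_measurable M \<and> integrable M (\<lambda>\<omega>. (1 / R * Sint R \<omega>)\<^sup>2)"
      using eventually_ge_at_top[of 1] by eventually_elim (use m fin integrable_square in blast)
  qed (use conv in auto)
qed

text \<open>Along \<open>(k + 1) ^ p\<close> with \<open>p (1 - b) \<ge> 2\<close> the second moments are summable, and the
  oscillation between consecutive members of this sequence has summable second moments for any \<open>p\<close>.\<close>

lemma almost_sure_convergence:
  "AE \<omega> in M. ((\<lambda>R. 1 / R * Sint R \<omega>) \<longlongrightarrow> 0) at_top"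
proof -
  obtain p :: nat where p: "2 / (1 - b) \<le> real p" using real_arch_simple by blast
  have p2: "2 \<le> real p * (1 - b)" using p const_bounds by (simp add: field_simps)
  \<comment> \<open>A positive exponent makes the sequence unbounded, so that every \<open>R\<close>
    falls between two of its members.\<close>
  have p0: "p \<noteq> 0" using p2 by (cases "p = 0") auto
  define r where "r k = (k + 1) ^ p" for k :: nat
  have r1: "1 \<le> r k" for k by (simp add: r_def)
  have r_mono: "r k \<le> r (Suc k)" for k by (simp add: r_def power_mono)
  define c where "c = (2::real) ^ p - 1"
  have gap: "real (r (Suc k)) - real (r k) \<le> real (r k) * (c / real (k + 1))" for k
  proof -
    have "real (r (Suc k)) = real (r k) * (1 + 1 / real (k + 1)) ^ p"
      by (simp add: r_def power_mult_distrib[symmetric] field_simps)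
    also have "\<dots> \<le> real (r k) * (1 + c * (1 / real (k + 1)))"
      unfolding c_def by (intro mult_left_mono power_one_plus_le) auto
    finally show ?thesis by (simp add: algebra_simps)
  qed
  let ?A = "\<lambda>k. {x. real (r k) < \<bar>x\<bar> \<and> \<bar>x\<bar> \<le> real (r (Suc k))}"
  \<comment> \<open>Both the value at a member of the sequence and the oscillation up to the next
    one, normalized by the same radius. The first has expectation at most
    \<open>K (k + 1)^-2\<close> by the choice of \<open>p\<close>, the second at most
    \<open>4 c^2 B (k + 1)^-2\<close> because the relative gap is at most
    \<open>c / (k + 1)\<close>.\<close>
  define e where "e k \<omega> = ennreal ((1 / real (r k))\<^sup>2) * (ennreal ((Sint (real (r k)) \<omega>)\<^sup>2) + (absint (?A k) \<omega>)\<^sup>2)" for k \<omega>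
  have em: "e k \<in> borel_measurable M" for k
  proof -
    have [measurable]: "absint (?A k) \<in> borel_measurable M" by (rule measurable_absint) measurable
    note [measurable] = measurable_Sint
    show ?thesis unfolding e_def[abs_def] by measurable
  qed
  have int_e: "(\<integral>\<^sup>+\<omega>. e k \<omega> \<partial>M) \<le> ennreal ((K + 4 * c\<^sup>2 * B) * (1 / (real (k + 1))\<^sup>2))" for k
  proof -
    have [measurable]: "absint (?A k) \<in> borel_measurable M" by (rule measurable_absint) measurable
    note [measurable] = measurable_Sint
    have "(\<integral>\<^sup>+\<omega>. e k \<omega> \<partial>M) = ennreal ((1 / real (r k))\<^sup>2) * (nsq M (Sint (real (r k))) + (\<integral>\<^sup>+\<omega>. (absint (?A k) \<omega>)\<^sup>2 \<partial>M))"
      unfolding e_def nsq_def by (simp add: nn_integral_cmult nn_integral_add)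
    also have "\<dots> \<le> ennreal ((1 / real (r k))\<^sup>2) * (ennreal (K * real (r k) powr (1 + b)) + ennreal ((2 * (real (r (Suc k)) - real (r k)))\<^sup>2 * B))"
      using r1[of k] r_mono[of k] by (intro mult_left_mono add_mono nsq_Sint gap_square) auto
    also have "\<dots> = ennreal ((1 / real (r k))\<^sup>2 * (K * real (r k) powr (1 + b) + (2 * (real (r (Suc k)) - real (r k)))\<^sup>2 * B))"
      using const_bounds by (subst ennreal_plus[symmetric]) (simp_all add: ennreal_mult'[symmetric] del: ennreal_plus)
    also have "\<dots> \<le> ennreal ((K + 4 * c\<^sup>2 * B) * (1 / (real (k + 1))\<^sup>2))"
    proof (rule ennreal_leI)
      let ?r = "real (r k)"
      have rp: "0 < ?r" using r1[of k] by simp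
      have "(1 / ?r)\<^sup>2 * (K * ?r powr (1 + b)) = K * ?r powr (b - 1)"
      proof -
        have "(1 / ?r)\<^sup>2 = ?r powr (- 2)" using rp by (simp add: powr_minus power_divide divide_inverse power_inverse)
        moreover have "?r powr (- 2) * ?r powr (1 + b) = ?r powr (b - 1)" by (simp add: powr_add[symmetric])
        ultimately show ?thesis by simp
      qed
      also have "?r powr (b - 1) = real (k + 1) powr (real p * (b - 1))"
        by (simp add: r_def powr_powr[symmetric] powr_realpow)
      also have "\<dots> \<le> real (k + 1) powr (- 2)"
        using p2 by (intro powr_mono) (auto simp: algebra_simps)
      also have "real (k + 1) powr (- 2) = 1 / (real (k + 1))\<^sup>2"
        by (simp add: powr_minus divide_inverse)
      finally have 1: "(1 / ?r)\<^sup>2 * (K * ?r powr (1 + b)) \<le> K * (1 / (real (k + 1))\<^sup>2)"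
        using const_bounds by (simp add: mult_left_mono)
      have "(2 * (real (r (Suc k)) - ?r))\<^sup>2 \<le> (2 * (?r * (c / real (k + 1))))\<^sup>2"
        using gap[of k] r_mono[of k] by (intro power_mono) auto
      then have "(1 / ?r)\<^sup>2 * ((2 * (real (r (Suc k)) - ?r))\<^sup>2 * B) \<le> (1 / ?r)\<^sup>2 * ((2 * (?r * (c / real (k + 1))))\<^sup>2 * B)"
        using const_bounds by (intro mult_left_mono mult_right_mono) auto
      also have "\<dots> = 4 * c\<^sup>2 * B * (1 / (real (k + 1))\<^sup>2)"
        using rp by (simp add: power_mult_distrib power_divide)
      finally have 2: "(1 / ?r)\<^sup>2 * ((2 * (real (r (Suc k)) - ?r))\<^sup>2 * B) \<le> 4 * c\<^sup>2 * B * (1 / (real (k + 1))\<^sup>2)" .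
      show "(1 / ?r)\<^sup>2 * (K * ?r powr (1 + b) + (2 * (real (r (Suc k)) - ?r))\<^sup>2 * B) \<le> (K + 4 * c\<^sup>2 * B) * (1 / (real (k + 1))\<^sup>2)"
        using 1 2 by (simp only: distrib_left distrib_right)
    qed
    finally show ?thesis .
  qed
  have "(\<integral>\<^sup>+\<omega>. (\<Sum>k. e k \<omega>) \<partial>M) = (\<Sum>k. \<integral>\<^sup>+\<omega>. e k \<omega> \<partial>M)" by (rule nn_integral_suminf[OF em])
  also have "\<dots> \<le> (\<Sum>k. ennreal ((K + 4 * c\<^sup>2 * B) * (1 / (real (k + 1))\<^sup>2)))"
    by (intro suminf_le summableI int_e)
  also have "\<dots> < \<infinity>"
  proof -
    have "summable (\<lambda>k. 1 / (real (k + 1))\<^sup>2)"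
    proof -
      have "summable (\<lambda>n. inverse (real n ^ 2))" by (rule inverse_power_summable) simp
      then have "summable (\<lambda>n. inverse ((real (Suc n)) ^ 2))" by (subst summable_Suc_iff)
      then show ?thesis by (simp add: inverse_eq_divide)
    qed
    then have s: "summable (\<lambda>k. (K + 4 * c\<^sup>2 * B) * (1 / (real (k + 1))\<^sup>2))" by (rule summable_mult)
    have "(\<Sum>k. ennreal ((K + 4 * c\<^sup>2 * B) * (1 / (real (k + 1))\<^sup>2))) = ennreal (\<Sum>k. (K + 4 * c\<^sup>2 * B) * (1 / (real (k + 1))\<^sup>2))"
      using const_bounds by (intro suminf_ennreal2 s) auto
    then show ?thesis by simp
  qed
  finally have "(\<integral>\<^sup>+\<omega>. (\<Sum>k. e k \<omega>) \<partial>M) \<noteq> \<infinity>" by simp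
  then have "AE \<omega> in M. (\<Sum>k. e k \<omega>) \<noteq> \<infinity>"
    using em by (intro nn_integral_PInf_AE borel_measurable_suminf) auto
  then show ?thesis
    using AE_good
  proof eventually_elim
    case (elim \<omega>)
    have g: "good \<omega>" by fact
    define G where "G k = enn2real (absint (?A k) \<omega>)" for k
    have Gfin: "absint (?A k) \<omega> = ennreal (G k)" for k
    proof -
      have "absint (?A k) \<omega> < \<infinity>" by (rule good_absint[OF g, where R="real (r (Suc k))"]) auto
      then show ?thesis by (simp add: G_def less_top)
    qed
    have G0: "0 \<le> G k" for k by (simp add: G_def)
    define q where "q k = ((Sint (real (r k)) \<omega>)\<^sup>2 + (G k)\<^sup>2) / (real (r k))\<^sup>2" for k
    have q0: "0 \<le> q k" for k by (simp add: q_def)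
    have eq: "e k \<omega> = ennreal (q k)" for k
      unfolding e_def Gfin q_def using G0
      by (simp add: ennreal_power ennreal_mult'[symmetric] power_divide flip: ennreal_plus)
    have "summable q"
      by (rule summable_suminf_not_top[OF q0]) (use elim in \<open>simp add: eq\<close>)
    then have "q \<longlonglongrightarrow> 0" by (rule summable_LIMSEQ_zero)
    then have sq: "(\<lambda>k. sqrt (2 * q k)) \<longlonglongrightarrow> 0"
      using tendsto_real_sqrt[OF tendsto_mult_left[of q 0 sequentially 2]] by simp
    \<comment> \<open>Back from squares to absolute values by
      \<open>(x + y)^2 \<le> 2 (x^2 + y^2)\<close>.\<close>
    have ek: "(\<bar>Sint (real (r k)) \<omega>\<bar> + G k) / real (r k) \<le> sqrt (2 * q k)" for k
    proof (rule real_le_rsqrt)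
      have "2 * \<bar>Sint (real (r k)) \<omega>\<bar> * G k \<le> \<bar>Sint (real (r k)) \<omega>\<bar>\<^sup>2 + (G k)\<^sup>2" by (rule sum_squares_bound)
      then have "(\<bar>Sint (real (r k)) \<omega>\<bar> + G k)\<^sup>2 \<le> 2 * ((Sint (real (r k)) \<omega>)\<^sup>2 + (G k)\<^sup>2)"
        by (simp add: power2_sum)
      then show "((\<bar>Sint (real (r k)) \<omega>\<bar> + G k) / real (r k))\<^sup>2 \<le> 2 * q k"
        unfolding q_def power_divide by (simp add: divide_right_mono)
    qed
    show ?case
    proof (rule tendstoI)
      fix \<epsilon> :: real assume \<epsilon>: "0 < \<epsilon>"
      from order_tendstoD(2)[OF sq this] obtain k0 where k0: "\<And>k. k0 \<le> k \<Longrightarrow> sqrt (2 * q k) < \<epsilon>"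
        by (auto simp: eventually_sequentially)
      show "\<forall>\<^sub>F R in at_top. dist (1 / R * Sint R \<omega>) 0 < \<epsilon>"
        using eventually_ge_at_top[of "real (r k0)"]
      proof eventually_elim
        case (elim R)
        have R1: "1 \<le> R" using elim r1[of k0] by linarith
        have ex: "\<exists>k. R < real (r (Suc k))"
        proof -
          obtain k :: nat where "R < real k" using reals_Archimedean2 by blast
          also have "real k \<le> real (r (Suc k))"
          proof -
            have "k + 2 \<le> (k + 2) ^ p" using p0 by (intro self_le_power) auto
            then have "k \<le> r (Suc k)" by (simp add: r_def)
            then show ?thesis by (simp only: of_nat_le_iff)
          qed
          finally show ?thesis by blast
        qed
        \<comment> \<open>The index of the block of the sequence that contains \<open>R\<close>.
          Since \<open>R\<close> is at least the left end \<open>r k\<close>, dividing by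
          \<open>r k\<close> instead of \<open>R\<close> only enlarges the quotient.\<close>
        define k where "k = (LEAST k. R < real (r (Suc k)))"
        have kR: "R < real (r (Suc k))" unfolding k_def by (rule LeastI_ex[OF ex])
        have Rk: "real (r k) \<le> R"
        proof (cases k)
          case 0 then show ?thesis using R1 by (simp add: r_def)
        next
          case (Suc k')
          then have "\<not> R < real (r (Suc k'))" using not_less_Least[of k' "\<lambda>k. R < real (r (Suc k))"] by (simp add: k_def)
          then show ?thesis using Suc by simp
        qed
        have "k0 \<le> k"
        proof (rule ccontr)
          assume "\<not> k0 \<le> k"
          then have "Suc k \<le> k0" by simp
          then have "r (Suc k) \<le> r k0" by (simp add: r_def power_mono)
          then show False using kR elim by linarith
        qed
        have "ennreal \<bar>Sint R \<omega> - Sint (real (r k)) \<omega>\<bar> \<le> absint {x. real (r k) < \<bar>x\<bar> \<and> \<bar>x\<bar> \<le> R} \<omega>"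
          by (rule Sint_gap[OF g _ Rk]) simp
        also have "\<dots> \<le> absint (?A k) \<omega>"
          unfolding absint_def using kR by (intro nn_integral_mono mult_left_mono) (auto simp: indicator_def)
        finally have "\<bar>Sint R \<omega> - Sint (real (r k)) \<omega>\<bar> \<le> G k"
          unfolding Gfin using G0 by (subst (asm) ennreal_le_iff) auto
        then have "\<bar>Sint R \<omega>\<bar> \<le> \<bar>Sint (real (r k)) \<omega>\<bar> + G k" by linarith
        then have "\<bar>Sint R \<omega>\<bar> / R \<le> (\<bar>Sint (real (r k)) \<omega>\<bar> + G k) / real (r k)"
          using Rk r1[of k] G0[of k] by (intro frac_le) auto
        also have "\<dots> < \<epsilon>" using ek[of k] k0[OF \<open>k0 \<le> k\<close>] by linarith
        finally show ?case using R1 by (simp add: abs_mult)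
      qed
    qed
  qed
qed

end

section \<open>Growth of the spatial averages\<close>

text \<open>A point \<open>y\<close> is reached from at most \<open>2 t + 2\<close> lattice points,
  each contributing \<open>1/2\<close>. The bound is free of \<open>n\<close>, which is what keeps
  the second moment of the lattice sum nearly linear.\<close>

lemma sum_wave_kernel_bounds:
  assumes "\<tau> \<le> t" "0 \<le> t"
  shows "0 \<le> (\<Sum>j\<in>{- int n..<int n}. wave_kernel \<tau> (\<theta> + of_int j - y))"
    "(\<Sum>j\<in>{- int n..<int n}. wave_kernel \<tau> (\<theta> + of_int j - y)) \<le> t + 1"
proof -
  show "0 \<le> (\<Sum>j\<in>{- int n..<int n}. wave_kernel \<tau> (\<theta> + of_int j - y))"
    by (intro sum_nonneg) (simp add: wave_kernel_def)
  \<comment> \<open>The integers strictly between \<open>y - \<theta> - t\<close> and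
    \<open>y - \<theta> + t\<close>; strictness explains the added one at the lower end and the open
    upper end.\<close>
  let ?S = "{\<lfloor>y - \<theta> - t\<rfloor> + 1..<\<lceil>y - \<theta> + t\<rceil>}"
  have mem: "j \<in> ?S" if "\<bar>\<theta> + of_int j - y\<bar> < \<tau>" for j
  proof -
    have "y - \<theta> - t < of_int j" "of_int j < y - \<theta> + t" using that assms by linarith+
    then show ?thesis by (simp add: floor_less_iff less_ceiling_iff add1_zle_eq)
  qed
  have "(\<Sum>j\<in>{- int n..<int n}. wave_kernel \<tau> (\<theta> + of_int j - y)) = (\<Sum>j\<in>{- int n..<int n} \<inter> ?S. wave_kernel \<tau> (\<theta> + of_int j - y))"
    by (rule sum.mono_neutral_right) (use mem in \<open>auto simp: wave_kernel_def split: if_splits\<close>)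
  also have "\<dots> \<le> (\<Sum>j\<in>?S. wave_kernel \<tau> (\<theta> + of_int j - y))"
    by (rule sum_mono2) (auto simp: wave_kernel_def)
  also have "\<dots> \<le> (\<Sum>j\<in>?S. 1 / 2)" by (rule sum_mono) (simp add: wave_kernel_def)
  also have "\<dots> = real (card ?S) / 2" by simp
  also have "real (card ?S) \<le> 2 * t + 2"
  proof -
    have "\<lceil>y - \<theta> + t\<rceil> - (\<lfloor>y - \<theta> - t\<rfloor> + 1) \<le> 2 * t + 2" by linarith
    then show ?thesis using assms by (cases "0 \<le> \<lceil>y - \<theta> + t\<rceil> - (\<lfloor>y - \<theta> - t\<rfloor> + 1)") auto
  qed
  finally show "(\<Sum>j\<in>{- int n..<int n}. wave_kernel \<tau> (\<theta> + of_int j - y)) \<le> t + 1" by simp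
qed

section \<open>Second moments of lattice sums of the solution\<close>

context levy_noise
begin

text \<open>The value at \<open>x\<close> is the functional for the origin, evaluated on the noise
  shifted by \<open>x\<close>.\<close>

lemma mild_solution_nsq_const:
  assumes u: "mild_solution M \<nu> N \<kappa> u" and t: "0 \<le> t"
  shows "nsq M (u t x) = nsq M (u t 0)"
proof -
  obtain y where y: "\<And>x. y x \<in> borel_measurable (cnt_space (boxes t))"
    "\<And>h x. AE \<omega> in M. u t (x + h) \<omega> = y x (cnt (Nh h) (boxes t) \<omega>)"
    "\<And>x. AE \<omega> in M. u t x \<omega> = y x (cnt N (boxes t) \<omega>)"
    using mild_solution_shift_factor[OF u t] by blast
  have "nsq M (u t x) = nsq M (\<lambda>\<omega>. y 0 (cnt (Nh x) (boxes t) \<omega>))" using y(2)[of 0 x] by (intro nsq_cong_AE) simp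
  also have "\<dots> = nsq (distr M (cnt_space (boxes t)) (cnt (Nh x) (boxes t))) (y 0)"
    by (rule nsq_distr[symmetric, OF measurable_cnt_Nh[OF boxes_sets] y(1)])
  also have "\<dots> = nsq (distr M (cnt_space (boxes t)) (cnt N (boxes t))) (y 0)" by (simp only: law_shift[OF boxes_sets])
  also have "\<dots> = nsq M (\<lambda>\<omega>. y 0 (cnt N (boxes t) \<omega>))"
    by (rule nsq_distr[OF measurable_cnt[OF boxes_sets] y(1)])
  also have "\<dots> = nsq M (u t 0)" using y(3)[of 0] by (intro nsq_cong_AE) auto
  finally show ?thesis .
qed

text \<open>The cone with apex \<open>(t, 0)\<close> contains all points \<open>(s, 0)\<close> up to
  time \<open>t\<close>. The bound there becomes uniform in space because second moments do not
  depend on \<open>x\<close>.\<close>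

lemma mild_solution_nsq_bound:
  assumes u: "mild_solution M \<nu> N \<kappa> u" and t: "0 \<le> t"
  shows "\<exists>B\<ge>0. \<forall>s x. 0 \<le> s \<longrightarrow> s \<le> t \<longrightarrow> nsq M (u s x) \<le> ennreal B"
proof -
  obtain B where "0 \<le> B" "\<And>s x. 0 \<le> s \<Longrightarrow> \<bar>x - 0\<bar> + s \<le> t \<Longrightarrow> nsq M (u s x) \<le> ennreal B"
    using mild_solution_cone_bound[OF u t, of 0] by blast
  then have "nsq M (u s x) \<le> ennreal B" if "0 \<le> s" "s \<le> t" for s x
    using that mild_solution_nsq_const[OF u that(1), of x] by simp
  then show ?thesis using \<open>0 \<le> B\<close> by blast
qed

text \<open>By linearity the lattice sum is one Walsh integral with the summed kernel. That kernel
  is bounded by \<open>t + 1\<close> and vanishes outside an interval of radius \<open>r\<close>, so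
  the estimate grows like \<open>r\<close> times the mass of \<open>autoconv \<kappa>\<close> on
  \<open>[-2 r, 2 r]\<close>.\<close>

lemma mild_solution_sum_bound:
  fixes n :: nat
  assumes u: "mild_solution M \<nu> N \<kappa> u" and t: "0 \<le> t" and B: "0 \<le> B"
    and bound: "\<And>s x. 0 \<le> s \<Longrightarrow> s \<le> t \<Longrightarrow> nsq M (u s x) \<le> ennreal B"
    and \<theta>: "0 \<le> \<theta>" "\<theta> < 1"
  defines "r \<equiv> real n + 1 + t"
  shows "nsq M (\<lambda>\<omega>. \<Sum>j\<in>{- int n..<int n}. u t (\<theta> + of_int j) \<omega> - 1)
    \<le> ennreal (4 * m2) * (autoconv_mass (2 * r) * ennreal ((t + 1)\<^sup>2 * B * (2 * r) * t))"
proof -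
  let ?J = "{- int n..<int n}"
  define k where "k s y = (\<Sum>j\<in>?J. wave_kernel (t - s) (\<theta> + of_int j - y))" for s y
  have r0: "0 \<le> r" using t by (simp add: r_def)
  have km: "(\<lambda>(s, y). k s y) \<in> borel_measurable (borel \<Otimes>\<^sub>M borel)" unfolding k_def split_beta' by measurable
  \<comment> \<open>Lattice points satisfy \<open>\<bar>\<theta> + j\<bar> \<le> n + 1\<close>, and
    waves travel a distance less than \<open>t\<close>; this is the choice of
    \<open>r\<close>.\<close>
  have supp: "k s y = 0" if "0 \<le> s" "r < \<bar>y - 0\<bar>" for s y
    unfolding k_def
  proof (rule sum.neutral, rule ballI)
    fix j assume "j \<in> ?J"
    then have "- int n \<le> j" "j \<le> int n" by auto
    then have "real_of_int (- int n) \<le> real_of_int j" "real_of_int j \<le> real_of_int (int n)" by (simp_all only: of_int_le_iff)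
    then show "wave_kernel (t - s) (\<theta> + of_int j - y) = 0"
      using that \<theta> by (auto simp: wave_kernel_def r_def)
  qed
  have k2: "(k s y)\<^sup>2 \<le> (t + 1)\<^sup>2 * indicator {-r..r} y" if s: "0 \<le> s" for s y
  proof (cases "y \<in> {-r..r}")
    case True
    have "(k s y)\<^sup>2 \<le> (t + 1)\<^sup>2"
      unfolding k_def using s by (intro power_mono sum_wave_kernel_bounds[OF _ t]) auto
    then show ?thesis using True by simp
  next
    case False
    then show ?thesis using supp[OF s, of y] by auto
  qed
  have w: "has_walsh_integral M \<nu> N \<kappa> t (\<lambda>s y \<omega>. k s y * u s y \<omega>) (\<lambda>\<omega>. \<Sum>j\<in>?J. u t (\<theta> + of_int j) \<omega> - 1)"
    using has_walsh_integral_sum[of ?J t "\<lambda>j s y \<omega>. wave_kernel (t - s) (\<theta> + of_int j - y) * u s y \<omega>" "\<lambda>j \<omega>. u t (\<theta> + of_int j) \<omega> - 1"]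
      mild_solutionD(3)[OF u t] t by (simp add: k_def sum_distrib_right)
  have "nsq M (\<lambda>\<omega>. \<Sum>j\<in>?J. u t (\<theta> + of_int j) \<omega> - 1) \<le> ennreal (4 * m2) * walsh_norm_sq M \<kappa> t (\<lambda>s y \<omega>. k s y * u s y \<omega>)"
    by (rule walsh_integral_le[OF w t])
  also have "\<dots> \<le> ennreal (4 * m2) * (autoconv_mass (2 * r) * (\<integral>\<^sup>+s. (\<integral>\<^sup>+y. ennreal ((k s y)\<^sup>2) * nsq M (u s y) \<partial>lborel) * indicator {0..t} s \<partial>lborel))"
    by (intro mult_left_mono walsh_norm_nsq_le[OF mild_solutionD(2)[OF u] km, where c=0] supp) auto
  also have "(\<integral>\<^sup>+s. (\<integral>\<^sup>+y. ennreal ((k s y)\<^sup>2) * nsq M (u s y) \<partial>lborel) * indicator {0..t} s \<partial>lborel)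
    \<le> (\<integral>\<^sup>+s. ennreal ((t + 1)\<^sup>2 * B * (2 * r)) * indicator {0..t} s \<partial>lborel)"
  proof (rule nn_integral_mono)
    fix s :: real
    have "(\<integral>\<^sup>+y. ennreal ((k s y)\<^sup>2) * nsq M (u s y) \<partial>lborel) \<le> (\<integral>\<^sup>+y. ennreal ((t + 1)\<^sup>2 * B) * indicator {-r..r} y \<partial>lborel)"
      if s: "s \<in> {0..t}"
    proof (rule nn_integral_mono)
      fix y
      have "ennreal ((k s y)\<^sup>2) * nsq M (u s y) \<le> ennreal ((t + 1)\<^sup>2 * indicator {-r..r} y) * ennreal B"
        using s k2[of s y] bound[of s y] by (intro mult_mono ennreal_leI) auto
      also have "\<dots> = ennreal ((t + 1)\<^sup>2 * B) * indicator {-r..r} y"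
        using B by (simp add: indicator_def ennreal_mult')
      finally show "ennreal ((k s y)\<^sup>2) * nsq M (u s y) \<le> ennreal ((t + 1)\<^sup>2 * B) * indicator {-r..r} y" .
    qed
    also have "(\<integral>\<^sup>+y. ennreal ((t + 1)\<^sup>2 * B) * indicator {-r..r} y \<partial>lborel) = ennreal ((t + 1)\<^sup>2 * B) * ennreal (2 * r)"
      using r0 by (simp add: nn_integral_cmult_indicator)
    also have "\<dots> = ennreal ((t + 1)\<^sup>2 * B * (2 * r))" using B by (intro ennreal_mult'[symmetric]) simp
    finally show "(\<integral>\<^sup>+y. ennreal ((k s y)\<^sup>2) * nsq M (u s y) \<partial>lborel) * indicator {0..t} s \<le> ennreal ((t + 1)\<^sup>2 * B * (2 * r)) * indicator {0..t} s"
      by (cases "s \<in> {0..t}") auto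
  qed
  also have "(\<integral>\<^sup>+s. ennreal ((t + 1)\<^sup>2 * B * (2 * r)) * indicator {0..t} s \<partial>lborel) = ennreal ((t + 1)\<^sup>2 * B * (2 * r)) * ennreal t"
    using t by (simp add: nn_integral_cmult_indicator)
  also have "\<dots> = ennreal ((t + 1)\<^sup>2 * B * (2 * r) * t)"
    using B r0 by (intro ennreal_mult'[symmetric]) simp
  finally show ?thesis by (simp add: mult_left_mono)
qed

lemma mild_solution_random_field:
  assumes u: "mild_solution M \<nu> N \<kappa> u" and t: "0 \<le> t"
    and b: "0 \<le> b" "b < 1" "0 \<le> C" "\<And>r. 1 \<le> r \<Longrightarrow> autoconv_mass r \<le> ennreal (C * r powr b)"
  shows "\<exists>B K. random_field M (\<lambda>x \<omega>. u t x \<omega> - 1) B K b"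
proof -
  obtain B where B: "0 \<le> B" "\<And>s x. 0 \<le> s \<Longrightarrow> s \<le> t \<Longrightarrow> nsq M (u s x) \<le> ennreal B"
    using mild_solution_nsq_bound[OF u t] by blast
  \<comment> \<open>For \<open>n \<ge> 1\<close> the width \<open>2 (n + 1 + t)\<close> is at most
    \<open>a * n\<close>. Substituting this in the bound for lattice sums leaves
    \<open>K * n powr (1 + b)\<close>: one power of \<open>n\<close> from the length, the power
    \<open>b\<close> from the kernel mass.\<close>
  define a where "a = 2 * (2 + t)"
  define K where "K = 4 * m2 * (C * a powr b * ((t + 1)\<^sup>2 * B * a * t))"
  have a: "0 < a" using t by (simp add: a_def)
  have "random_field M (\<lambda>x \<omega>. u t x \<omega> - 1) (2 * B + 2) K b"
  proof
    have "(\<lambda>p. indicator {0..} t * u t (snd p) (fst p)) \<in> borel_measurable (M \<Otimes>\<^sub>M borel)"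
      by (rule jointlyD[OF mild_solutionD(2)[OF u], of fst _ "\<lambda>_. t" snd]) auto
    then show "(\<lambda>(\<omega>, x). u t x \<omega> - 1) \<in> borel_measurable (M \<Otimes>\<^sub>M borel)" using t by (simp add: split_beta')
  next
    fix x
    have "nsq M (\<lambda>\<omega>. u t x \<omega> - 1) \<le> 2 * nsq M (u t x) + 2 * nsq M (\<lambda>_. 1)"
      using nsq_diff_le[of "u t x" M "\<lambda>_. 1"] measurable_mild_solution[OF u t] by simp
    also have "\<dots> \<le> 2 * ennreal B + 2 * 1"
      using B(2)[OF t order_refl, of x] by (intro add_mono mult_left_mono) (auto simp: nsq_def emeasure_space_1)
    also have "\<dots> = ennreal (2 * B + 2)" using B(1) by (simp add: ennreal_mult')
    finally show "nsq M (\<lambda>\<omega>. u t x \<omega> - 1) \<le> ennreal (2 * B + 2)" .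
  next
    fix n :: nat and \<theta> :: real assume n: "1 \<le> n" and \<theta>: "0 \<le> \<theta>" "\<theta> < 1"
    let ?r = "2 * (real n + 1 + t)"
    have ra: "1 \<le> ?r" "?r \<le> a * real n"
    proof -
      have n1: "1 \<le> real n" using n by simp
      then show "1 \<le> ?r" using t by (simp add: algebra_simps)
      have "t * 1 \<le> t * real n" using n1 t by (intro mult_left_mono)
      then show "?r \<le> a * real n" using n1 by (simp add: a_def algebra_simps)
    qed
    have "nsq M (\<lambda>\<omega>. \<Sum>j\<in>{- int n..<int n}. u t (\<theta> + of_int j) \<omega> - 1)
      \<le> ennreal (4 * m2) * (autoconv_mass ?r * ennreal ((t + 1)\<^sup>2 * B * ?r * t))"
      by (rule mild_solution_sum_bound[OF u t B \<theta>])
    also have "\<dots> \<le> ennreal (4 * m2) * (ennreal (C * ?r powr b) * ennreal ((t + 1)\<^sup>2 * B * ?r * t))"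
      by (intro mult_left_mono mult_right_mono b(4) ra) auto
    also have "\<dots> = ennreal (4 * m2 * ((C * ?r powr b) * ((t + 1)\<^sup>2 * B * ?r * t)))"
      using m2_nonneg b(3) by (simp add: ennreal_mult')
    also have "\<dots> \<le> ennreal (4 * m2 * ((C * (a * real n) powr b) * ((t + 1)\<^sup>2 * B * (a * real n) * t)))"
    proof -
      have 1: "C * ?r powr b \<le> C * (a * real n) powr b" using b ra by (intro mult_left_mono powr_mono2) auto
      have 2: "(t + 1)\<^sup>2 * B * ?r * t \<le> (t + 1)\<^sup>2 * B * (a * real n) * t"
        using B(1) t ra by (intro mult_right_mono mult_left_mono) auto
      have 3: "0 \<le> C * (a * real n) powr b" "0 \<le> (t + 1)\<^sup>2 * B * ?r * t" using b B(1) t by auto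
      show ?thesis
        by (rule ennreal_leI[OF mult_left_mono[OF mult_mono[OF 1 2 3]]]) (use m2_nonneg in simp)
    qed
    also have "4 * m2 * ((C * (a * real n) powr b) * ((t + 1)\<^sup>2 * B * (a * real n) * t)) = K * real n powr (1 + b)"
      using n a by (simp add: K_def powr_mult powr_add)
    finally show "nsq M (\<lambda>\<omega>. \<Sum>j\<in>{- int n..<int n}. u t (\<theta> + of_int j) \<omega> - 1) \<le> ennreal (K * real n powr (1 + b))" .
  next
    show "0 \<le> 2 * B + 2" "0 \<le> K" "0 \<le> b" "b < 1" using B(1) m2_nonneg b t a by (auto simp: K_def)
  qed
  then show ?thesis by blast
qed

end

theorem theorem1p3:
  fixes M :: "'w measure" and \<nu> :: "real measure"
    and N :: "'w \<Rightarrow> (real \<times> real \<times> real) measure"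
    and \<kappa> :: "real \<Rightarrow> ennreal"
    and u :: "real \<Rightarrow> real \<Rightarrow> 'w \<Rightarrow> real" and t :: real
  assumes "prob_space M" and "complete_measure M"
    and "sets \<nu> = sets borel_R0"
    and "(\<integral>\<^sup>+z. ennreal (\<bar>z\<bar>\<^sup>2) \<partial>\<nu>) < \<infinity>"
    and "poisson_random_measure M (intensity \<nu>) N"
    and "assumption_A \<kappa>" and "assumption_B \<kappa>"
    and "mild_solution M \<nu> N \<kappa> u"
    and "t > 0"
  shows "ergodic_process M (u t) \<and>
    (AE \<omega> in M. \<forall>R>0. set_integrable lborel {-R..R} (\<lambda>x. u t x \<omega> - 1)) \<and>
    (AE \<omega> in M. ((\<lambda>R. 1 / R * spatial_integral u t R \<omega>) \<longlongrightarrow> 0) at_top) \<and>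
    tendsto_L2 M (\<lambda>R \<omega>. 1 / R * spatial_integral u t R \<omega>) (\<lambda>\<omega>. 0) at_top"
proof -
  note u = assms(8)
  have t: "0 \<le> t" using assms(9) by simp
  interpret levy_noise M \<nu> N \<kappa>
    by (intro levy_noise.intro levy_measure.intro kernel_assumption_A prm.intro prm_axioms.intro assms)
  obtain C b where b: "0 \<le> b" "b < 1" "0 \<le> C" "\<And>r. 1 \<le> r \<Longrightarrow> autoconv_mass r \<le> ennreal (C * r powr b)"
    using autoconv_mass_growth[OF assms(6,7)] by blast
  obtain B K where "random_field M (\<lambda>x \<omega>. u t x \<omega> - 1) B K b"
    using mild_solution_random_field[OF u t b] by blast
  then interpret F: random_field M "\<lambda>x \<omega>. u t x \<omega> - 1" B K b .
  have S: "spatial_integral u t = F.Sint" by (intro ext) (simp add: spatial_integral_def F.Sint_def)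
  \<comment> \<open>The event \<open>good\<close> settles integrability on all integer radii at
    once, hence a single null event works for every \<open>R\<close>.\<close>
  have "AE \<omega> in M. \<forall>R>0. set_integrable lborel {-R..R} (\<lambda>x. u t x \<omega> - 1)"
    using F.AE_good by eventually_elim (auto intro: F.set_integrable_good)
  then show ?thesis
    unfolding S using mild_solution_ergodic[OF u t] F.almost_sure_convergence F.mean_square_convergence by blast
qed

end
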